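(* Let $\nu\ge0$. Let $u^\nu\in L^3(\mathbb{T}^d\times(0,T))$ be a weak solution to the incompressible Navier--Stokes equations on $\mathbb{T}^d\times(0,T)$ with viscosity $\nu$ (Euler equations if $\nu=0$), and let $D^\nu$ be the associated Duchon--Robert distribution. If $\nu>0$, assume additionally $u^\nu\in L^2(0,T;H^1(\mathbb{T}^d))$. For $\ell>0$ let the subscript $\ell$ denote mollification in the space variable at scale $\ell$, and set $$E^{\ell,\nu}=\frac{|u^\nu-u^\nu_\ell|^2}{2},\qquad Q^{\ell,\nu}=\Big(\frac{|u^\nu-u^\nu_\ell|^2}{2}+(q^\nu-q^\nu_\ell)\Big)(u^\nu-u^\nu_\ell),$$ $$R^{\ell,\nu}=u^\nu_\ell\otimes u^\nu_\ell-(u^\nu\otimes u^\nu)_\ell,\qquad C^{\ell,\nu}=(u^\nu-u^\nu_\ell)\cdot\operatorname{div}R^{\ell,\nu}+(u^\nu-u^\nu_\ell)\otimes(u^\nu-u^\nu_\ell):\nabla u^\nu_\ell .$$ Denote $\mathcal{E}^\nu=D^\nu+\nu|\nabla u^\nu|^2$. Then, for any $\ell>0$, $$-\mathcal{E}^\nu=(\partial_t+u^\nu_\ell\cdot\nabla-\nu\Delta)E^{\ell,\nu}+\operatorname{div}Q^{\ell,\nu}+C^{\ell,\nu}+\nu|\nabla u^\nu_\ell|^2-2\nu\,\nabla u^\nu:\nabla u^\nu_\ell$$ in the sense of distributions on $\mathbb{T}^d\times(0,T)$.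
   Context: Navier--Stokes equations on $\mathbb{T}^d\times(0,T)$: $\partial_t u^\nu+\operatorname{div}(u^\nu\otimes u^\nu)+\nabla q^\nu=\nu\Delta u^\nu$, $\operatorname{div}u^\nu=0$, understood in the sense of distributions; the pressure $q^\nu$ is the unique zero-spatial-mean solution of $-\Delta q^\nu=\operatorname{div}\operatorname{div}(u^\nu\otimes u^\nu)$. The Duchon--Robert distribution $D^\nu$ is defined by $$(\partial_t-\nu\Delta)\frac{|u^\nu|^2}{2}+\operatorname{div}\Big(\Big(\frac{|u^\nu|^2}{2}+q^\nu\Big)u^\nu\Big)+\nu|\nabla u^\nu|^2=-D^\nu$$ in the sense of distributions on $\mathbb{T}^d\times(0,T)$; when $\nu=0$ all terms multiplied by $\nu$ are absent. Space mollification: $f_\ell=f*_x\rho_\ell$ with $\rho_\ell(x)=\ell^{-d}\rho(x/\ell)$ and $\rho$ a standard (smooth, non-negative, even, compactly supported, integral one) Friedrichs mollifier on $\mathbb{R}^d$. $A:B=\sum_{i,j}A_{ij}B_{ij}$. Since $u^\nu_\ell$ is divergence-free, $u^\nu_\ell\cdot\nabla E^{\ell,\nu}$ is understood as $\operatorname{div}(u^\nu_\ell E^{\ell,\nu})$. *)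

theory Defs
  imports "HOL-Analysis.Analysis"
begin

text \<open>
  The torus is \<open>\<real>\<^sup>d / \<int>\<^sup>d\<close>, with \<open>d = CARD('d)\<close>. A function on space-time is a total function of
  \<open>(t, x)\<close> that is 1-periodic in each component of \<open>x\<close>; its values for \<open>t\<close> outside \<open>(0, T)\<close> are
  irrelevant. Integrals over the torus are integrals over the unit cube.
\<close>

definition space_periodic :: "(real \<times> (real ^ 'd) \<Rightarrow> 'b) \<Rightarrow> bool" where
  "space_periodic f \<longleftrightarrow> (\<forall>t x i. f (t, x + axis i 1) = f (t, x))"

abbreviation unit_cube :: "(real ^ 'd) set" where
  "unit_cube \<equiv> cbox 0 1"

definition cylinder :: "real \<Rightarrow> (real \<times> (real ^ 'd)) set" where
  "cylinder T = {0<..<T} \<times> unit_cube"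

text \<open>Classes in \<open>L\<^sup>p\<close> are given by a Borel representative (every class has one).\<close>

definition in_Lp :: "real \<Rightarrow> real \<Rightarrow> (real \<times> (real ^ 'd) \<Rightarrow> 'b::euclidean_space) \<Rightarrow> bool" where
  "in_Lp T p f \<longleftrightarrow> f \<in> borel_measurable borel \<and> space_periodic f \<and>
     set_integrable lborel (cylinder T) (\<lambda>z. norm (f z) powr p)"


subsection \<open>Smooth functions and test functions\<close>

primrec Ck :: "nat \<Rightarrow> ('a::euclidean_space \<Rightarrow> 'b::real_normed_vector) \<Rightarrow> bool" where
  "Ck 0 f \<longleftrightarrow> continuous_on UNIV f"
| "Ck (Suc n) f \<longleftrightarrow> (\<forall>x. f differentiable (at x)) \<and>
     (\<forall>v. Ck n (\<lambda>x. frechet_derivative f (at x) v))"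

definition smooth :: "('a::euclidean_space \<Rightarrow> 'b::real_normed_vector) \<Rightarrow> bool" where
  "smooth f \<longleftrightarrow> (\<forall>n. Ck n f)"

definition test_fun :: "real \<Rightarrow> (real \<times> (real ^ 'd) \<Rightarrow> real) \<Rightarrow> bool" where
  "test_fun T \<phi> \<longleftrightarrow> smooth \<phi> \<and> space_periodic \<phi> \<and>
     (\<exists>a b. 0 < a \<and> b < T \<and> (\<forall>t x. t \<notin> {a..b} \<longrightarrow> \<phi> (t, x) = 0))"

definition pd_t :: "(real \<times> (real ^ 'd) \<Rightarrow> real) \<Rightarrow> real \<times> (real ^ 'd) \<Rightarrow> real" where
  "pd_t \<phi> z = frechet_derivative \<phi> (at z) (1, 0)"

definition pd_x :: "'d \<Rightarrow> (real \<times> (real ^ 'd) \<Rightarrow> real) \<Rightarrow> real \<times> (real ^ 'd) \<Rightarrow> real" where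
  "pd_x i \<phi> z = frechet_derivative \<phi> (at z) (0, axis i 1)"


subsection \<open>Distributions on \<open>(0, T) \<times> \<T>\<^sup>d\<close>\<close>

text \<open>
  All distributions below are obtained from locally integrable functions by differentiation,
  so continuity on test functions is automatic and is not recorded in the type.
\<close>

type_synonym 'd distrib = "(real \<times> (real ^ 'd) \<Rightarrow> real) \<Rightarrow> real"

text \<open>
  The completed measure is used here because pointwise derivatives of mollified functions are
  only meaningful for almost every \<open>t\<close>, hence only almost everywhere equal to a Borel function.
\<close>

definition reg :: "real \<Rightarrow> (real \<times> (real ^ 'd) \<Rightarrow> real) \<Rightarrow> 'd::finite distrib" where
  "reg T f \<phi> = (LINT z:cylinder T|lebesgue. f z * \<phi> z)"

definition D_t :: "'d::finite distrib \<Rightarrow> 'd::finite distrib" where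
  "D_t \<Lambda> \<phi> = - \<Lambda> (pd_t \<phi>)"

definition D_x :: "'d \<Rightarrow> 'd::finite distrib \<Rightarrow> 'd::finite distrib" where
  "D_x i \<Lambda> \<phi> = - \<Lambda> (pd_x i \<phi>)"

definition D_laplace :: "'d::finite distrib \<Rightarrow> 'd::finite distrib" where
  "D_laplace \<Lambda> \<phi> = (\<Sum>i\<in>UNIV. D_x i (D_x i \<Lambda>) \<phi>)"

definition D_div :: "real \<Rightarrow> (real \<times> (real ^ 'd) \<Rightarrow> real ^ 'd) \<Rightarrow> 'd::finite distrib" where
  "D_div T F \<phi> = (\<Sum>i\<in>UNIV. D_x i (reg T (\<lambda>z. F z $ i)) \<phi>)"


subsection \<open>Weak solutions, pressure and the Duchon--Robert distribution\<close>

definition tensor :: "real ^ 'd \<Rightarrow> real ^ 'd \<Rightarrow> real ^ 'd ^ 'd"  (infixl \<open>\<otimes>\<^sub>v\<close> 75) where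
  "a \<otimes>\<^sub>v b = (\<chi> i j. a $ i * b $ j)"

text \<open>
  The solution \<open>q\<close> of \<open>- \<Delta> q = div div (u \<otimes> u)\<close> is sought in \<open>L\<^bsup>3/2\<^esup>\<close>, the natural class for
  \<open>u \<in> L\<^sup>3\<close>, in which the products with \<open>u\<close> below are integrable; among functions with zero
  spatial mean it is unique.
\<close>

definition pressure :: "real \<Rightarrow> (real \<times> (real ^ 'd) \<Rightarrow> real ^ 'd) \<Rightarrow> (real \<times> (real ^ 'd) \<Rightarrow> real) \<Rightarrow> bool"
  where
  "pressure T u q \<longleftrightarrow> in_Lp T (3/2) q \<and>
     (AE t in lborel. t \<in> {0<..<T} \<longrightarrow> (LINT x:unit_cube|lborel. q (t, x)) = 0) \<and>
     (\<forall>\<phi>. test_fun T \<phi> \<longrightarrow>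
        - D_laplace (reg T q) \<phi> =
        (\<Sum>i\<in>UNIV. \<Sum>j\<in>UNIV. D_x i (D_x j (reg T (\<lambda>z. (u z \<otimes>\<^sub>v u z) $ i $ j))) \<phi>))"

definition weak_solution ::
  "real \<Rightarrow> real \<Rightarrow> (real \<times> (real ^ 'd) \<Rightarrow> real ^ 'd) \<Rightarrow> (real \<times> (real ^ 'd) \<Rightarrow> real) \<Rightarrow> bool" where
  "weak_solution T \<nu> u q \<longleftrightarrow> (\<forall>\<phi>. test_fun T \<phi> \<longrightarrow>
     (\<forall>i. D_t (reg T (\<lambda>z. u z $ i)) \<phi> + D_div T (\<lambda>z. (u z \<otimes>\<^sub>v u z) $ i) \<phi> + D_x i (reg T q) \<phi>
          = \<nu> * D_laplace (reg T (\<lambda>z. u z $ i)) \<phi>) \<and>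
     D_div T u \<phi> = 0)"

text \<open>
  \<open>u \<in> L\<^sup>2(0, T; H\<^sup>1)\<close> with weak spatial gradient \<open>G\<close>, where \<open>G $ i $ j\<close> is the \<open>j\<close>-th derivative of
  the \<open>i\<close>-th component, the convention of \<^const>\<open>jacobian\<close>.
\<close>

definition in_L2_H1 ::
  "real \<Rightarrow> (real \<times> (real ^ 'd) \<Rightarrow> real ^ 'd) \<Rightarrow> (real \<times> (real ^ 'd) \<Rightarrow> real ^ 'd ^ 'd) \<Rightarrow> bool" where
  "in_L2_H1 T u G \<longleftrightarrow> in_Lp T 2 u \<and> in_Lp T 2 G \<and>
     (AE t in lborel. t \<in> {0<..<T} \<longrightarrow>
        (\<forall>\<psi>::real ^ 'd \<Rightarrow> real. smooth \<psi> \<and> (\<forall>x i. \<psi> (x + axis i 1) = \<psi> x) \<longrightarrow>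
           (\<forall>i j. (LINT x:unit_cube|lborel. u (t, x) $ i * frechet_derivative \<psi> (at x) (axis j 1)) =
                  - (LINT x:unit_cube|lborel. G (t, x) $ i $ j * \<psi> x))))"

text \<open>
  On \<open>real ^ 'd ^ 'd\<close> the library's inner product is \<open>A : B\<close> and its norm is the Frobenius norm.
  When \<open>\<nu> = 0\<close> the argument \<open>G\<close> plays no role.
\<close>

definition duchon_robert ::
  "real \<Rightarrow> real \<Rightarrow> (real \<times> (real ^ 'd) \<Rightarrow> real ^ 'd) \<Rightarrow> (real \<times> (real ^ 'd) \<Rightarrow> real)
    \<Rightarrow> (real \<times> (real ^ 'd) \<Rightarrow> real ^ 'd ^ 'd) \<Rightarrow> 'd::finite distrib" where
  "duchon_robert T \<nu> u q G \<phi> =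
     - (D_t (reg T (\<lambda>z. (norm (u z))\<^sup>2 / 2)) \<phi> - \<nu> * D_laplace (reg T (\<lambda>z. (norm (u z))\<^sup>2 / 2)) \<phi>
        + D_div T (\<lambda>z. ((norm (u z))\<^sup>2 / 2 + q z) *\<^sub>R u z) \<phi>
        + \<nu> * reg T (\<lambda>z. (norm (G z))\<^sup>2) \<phi>)"

definition total_dissipation ::
  "real \<Rightarrow> real \<Rightarrow> (real \<times> (real ^ 'd) \<Rightarrow> real ^ 'd) \<Rightarrow> (real \<times> (real ^ 'd) \<Rightarrow> real)
    \<Rightarrow> (real \<times> (real ^ 'd) \<Rightarrow> real ^ 'd ^ 'd) \<Rightarrow> 'd::finite distrib" where
  "total_dissipation T \<nu> u q G \<phi> =
     duchon_robert T \<nu> u q G \<phi> + \<nu> * reg T (\<lambda>z. (norm (G z))\<^sup>2) \<phi>"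


subsection \<open>Space mollification and the quantities built from it\<close>

definition mollifier :: "(real ^ 'd \<Rightarrow> real) \<Rightarrow> bool" where
  "mollifier \<rho> \<longleftrightarrow> smooth \<rho> \<and> (\<forall>x. 0 \<le> \<rho> x) \<and> (\<forall>x. \<rho> (- x) = \<rho> x) \<and>
     bounded {x. \<rho> x \<noteq> 0} \<and> (LINT x|lborel. \<rho> x) = 1"

definition mollify ::
  "(real ^ 'd \<Rightarrow> real) \<Rightarrow> real \<Rightarrow> (real \<times> (real ^ 'd) \<Rightarrow> 'b::euclidean_space) \<Rightarrow> real \<times> (real ^ 'd) \<Rightarrow> 'b"
  where
  "mollify \<rho> l f = (\<lambda>(t, x). LINT y|lborel. (\<rho> (y /\<^sub>R l) / l ^ CARD('d)) *\<^sub>R f (t, x - y))"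

definition grad_x :: "(real \<times> (real ^ 'd) \<Rightarrow> real ^ 'd) \<Rightarrow> real \<times> (real ^ 'd) \<Rightarrow> real ^ 'd ^ 'd" where
  "grad_x v = (\<lambda>(t, x). jacobian (\<lambda>y. v (t, y)) (at x))"

definition div_x :: "(real \<times> (real ^ 'd) \<Rightarrow> real ^ 'd ^ 'd) \<Rightarrow> real \<times> (real ^ 'd) \<Rightarrow> real ^ 'd" where
  "div_x A z = (\<chi> i. trace (grad_x (\<lambda>z. A z $ i) z))"

definition E_fluct ::
  "(real ^ 'd \<Rightarrow> real) \<Rightarrow> real \<Rightarrow> (real \<times> (real ^ 'd) \<Rightarrow> real ^ 'd) \<Rightarrow> real \<times> (real ^ 'd) \<Rightarrow> real" where
  "E_fluct \<rho> l u z = (norm (u z - mollify \<rho> l u z))\<^sup>2 / 2"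

definition Q_flux ::
  "(real ^ 'd \<Rightarrow> real) \<Rightarrow> real \<Rightarrow> (real \<times> (real ^ 'd) \<Rightarrow> real ^ 'd) \<Rightarrow> (real \<times> (real ^ 'd) \<Rightarrow> real)
    \<Rightarrow> real \<times> (real ^ 'd) \<Rightarrow> real ^ 'd" where
  "Q_flux \<rho> l u q z =
     ((norm (u z - mollify \<rho> l u z))\<^sup>2 / 2 + (q z - mollify \<rho> l q z)) *\<^sub>R (u z - mollify \<rho> l u z)"

definition R_stress ::
  "(real ^ 'd \<Rightarrow> real) \<Rightarrow> real \<Rightarrow> (real \<times> (real ^ 'd) \<Rightarrow> real ^ 'd) \<Rightarrow> real \<times> (real ^ 'd) \<Rightarrow> real ^ 'd ^ 'd"
  where
  "R_stress \<rho> l u z =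
     mollify \<rho> l u z \<otimes>\<^sub>v mollify \<rho> l u z - mollify \<rho> l (\<lambda>z. u z \<otimes>\<^sub>v u z) z"

definition C_comm ::
  "(real ^ 'd \<Rightarrow> real) \<Rightarrow> real \<Rightarrow> (real \<times> (real ^ 'd) \<Rightarrow> real ^ 'd) \<Rightarrow> real \<times> (real ^ 'd) \<Rightarrow> real" where
  "C_comm \<rho> l u z =
     (u z - mollify \<rho> l u z) \<bullet> div_x (R_stress \<rho> l u) z
     + ((u z - mollify \<rho> l u z) \<otimes>\<^sub>v (u z - mollify \<rho> l u z)) \<bullet> grad_x (mollify \<rho> l u) z"

end

(*
  Let k be the periodised kernel of the mollification, so that u_l = k * u.  Testing the equation
  for u with phi u_l is not permitted, because u_l is not smooth in time.  Instead the equation at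
  (t, x) and the equation at (s, y) are multiplied with u(s, y) and u(t, x) and tested with k(x - y)
  phi(t, x) eta_n(t - s), where eta_n is an approximate identity in time: the derivatives of eta_n
  cancel, and as n tends to infinity only t = s survives.  This gives the balance of u . u_l;
  testing with k(z - x) k(z - y) phi(t, z) eta_n(t - s) and integrating over z gives that of
  |u_l|^2.  The constraint div u = 0 holds at almost every fixed time, so it may be tested with
  functions that are not smooth in time.  The asserted identity is then a linear combination of
  these balances and of integrations by parts in space, because |u - u_l|^2 = |u|^2 - 2 u . u_l +
  |u_l|^2 and the terms in |u|^2 are the definition of D.
*)
theory Submission
  imports Defs "HOL-Probability.Probability_Measure"
begin

subsection \<open>Calculus of smooth functions\<close>

text \<open>Each component of \<open>u\<close> solves a scalar equation with flux
  \<open>u i * u j\<close>, plus \<open>q\<close> on the diagonal. The two-point argument is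
  therefore carried out for a scalar \<open>a\<close> in L^3 with fluxes in L^(3/2), and components
  are summed only in the final theorem. The obstacle is the limit in n: the products pair L^(3/2)
  with L^3, and neither factor is continuous. A bound uniform in n allows the L^3 factor to be
  replaced by a bounded continuous one, for which the approximate identity in time converges
  pointwise; Young's inequality with a free scale stands in for Hoelder's inequality there. The bump
  in time is the mollifier itself, restricted to a line that meets its support and normalised.
  Mollified functions are known to be differentiable in space only at times whose slices are
  integrable, so they are compared with convolutions on the torus almost everywhere.\<close>

lemma Ck_SucD: "Ck (Suc n) f \<Longrightarrow> Ck n f"
proof (induction n arbitrary: f)
  case 0
  then show ?case
    by (auto intro!: continuous_at_imp_continuous_on differentiable_imp_continuous_within)
next
  case (Suc n)
  then show ?case by (metis Ck.simps(2))
qed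

lemma smooth_differentiable: "smooth f \<Longrightarrow> f differentiable (at x)"
  unfolding smooth_def by (metis Ck.simps(2))

lemma smooth_dird: "smooth f \<Longrightarrow> smooth (\<lambda>x. frechet_derivative f (at x) v)"
  unfolding smooth_def by (metis Ck.simps(2))

lemma smooth_has_derivative:
  "smooth f \<Longrightarrow> (f has_derivative frechet_derivative f (at x)) (at x)"
  using frechet_derivative_works smooth_differentiable by blast

lemma smooth_continuous_on: "smooth f \<Longrightarrow> continuous_on A f"
  unfolding smooth_def using Ck.simps(1) continuous_on_subset by blast

lemma smooth_borel_measurable: "smooth f \<Longrightarrow> f \<in> borel_measurable borel"
  by (intro borel_measurable_continuous_onI smooth_continuous_on)

lemma Ck_const: "Ck n (\<lambda>x. c)"
  by (induction n arbitrary: c) (auto)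

lemma frechet_derivative_add_apply:
  assumes "f differentiable (at x)" "g differentiable (at x)"
  shows "frechet_derivative (\<lambda>x. f x + g x) (at x) v
      = frechet_derivative f (at x) v + frechet_derivative g (at x) v"
proof -
  have "((\<lambda>x. f x + g x) has_derivative
      (\<lambda>v. frechet_derivative f (at x) v + frechet_derivative g (at x) v)) (at x)"
    using assms has_derivative_add frechet_derivative_works by blast
  from frechet_derivative_at[OF this] show ?thesis by metis
qed

lemma Ck_add: "Ck n f \<Longrightarrow> Ck n g \<Longrightarrow> Ck n (\<lambda>x. f x + g x)"
proof (induction n arbitrary: f g)
  case (Suc n)
  have "frechet_derivative (\<lambda>x. f x + g x) (at x) v
      = frechet_derivative f (at x) v + frechet_derivative g (at x) v" for x v
    using Suc.prems by (simp add: frechet_derivative_add_apply)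
  then show ?case using Suc by (simp add: differentiable_add)
qed (auto intro: continuous_on_add)

lemma frechet_derivative_mult_apply:
  fixes f g :: "'a::real_normed_vector \<Rightarrow> real"
  assumes "f differentiable (at x)" "g differentiable (at x)"
  shows "frechet_derivative (\<lambda>x. f x * g x) (at x) v
      = f x * frechet_derivative g (at x) v + frechet_derivative f (at x) v * g x"
proof -
  have "((\<lambda>x. f x * g x) has_derivative
      (\<lambda>v. f x * frechet_derivative g (at x) v + frechet_derivative f (at x) v * g x)) (at x)"
    using assms has_derivative_mult frechet_derivative_works by blast
  from frechet_derivative_at[OF this] show ?thesis by metis
qed

text \<open>The product rule leaves undifferentiated factors next to derivatives, so the induction
  also uses that regularity of order \<open>Suc n\<close> implies that of order
  \<open>n\<close>.\<close>

lemma Ck_mult: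
  fixes f g :: "'a::euclidean_space \<Rightarrow> real"
  shows "Ck n f \<Longrightarrow> Ck n g \<Longrightarrow> Ck n (\<lambda>x. f x * g x)"
proof (induction n arbitrary: f g)
  case (Suc n)
  have "frechet_derivative (\<lambda>x. f x * g x) (at x) v
      = f x * frechet_derivative g (at x) v + frechet_derivative f (at x) v * g x" for x v
    using Suc.prems by (simp add: frechet_derivative_mult_apply)
  moreover have "Ck n f" "Ck n g"
    using Suc.prems by (blast intro: Ck_SucD)+
  ultimately show ?case using Suc.prems
    by (simp add: Ck_add Suc.IH differentiable_mult)
qed (auto intro: continuous_on_mult)

lemma frechet_derivative_affine_apply:
  assumes "f differentiable (at (A x + c))" "bounded_linear A"
  shows "frechet_derivative (\<lambda>x. f (A x + c)) (at x) v = frechet_derivative f (at (A x + c)) (A v)"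
proof -
  have "((\<lambda>x. A x + c) has_derivative A) (at x)"
    using assms(2) by (auto intro!: derivative_eq_intros bounded_linear_imp_has_derivative)
  moreover have "(f has_derivative frechet_derivative f (at (A x + c))) (at (A x + c))"
    using assms(1) frechet_derivative_works by blast
  ultimately have "((\<lambda>x. f (A x + c)) has_derivative
      (\<lambda>v. frechet_derivative f (at (A x + c)) (A v))) (at x)"
    by (rule has_derivative_compose)
  from frechet_derivative_at[OF this] show ?thesis by metis
qed

text \<open>The compositions of kernels and test functions below are affine. Their derivatives are
  again compositions with the same affine map, in the fixed direction \<open>A v\<close>, so the
  induction closes without a chain rule of higher order.\<close>

lemma Ck_affine:
  assumes "bounded_linear A"
  shows "Ck n f \<Longrightarrow> Ck n (\<lambda>x. f (A x + c))"
proof (induction n arbitrary: f)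
  case 0
  have "continuous_on UNIV (\<lambda>x. A x + c)"
    using assms by (intro continuous_intros linear_continuous_on)
  with 0 show ?case
    using continuous_on_compose2[of UNIV f UNIV "\<lambda>x. A x + c"] by simp
next
  case (Suc n)
  have "((\<lambda>x. A x + c) has_derivative A) (at x)" for x
    using assms by (auto intro!: derivative_eq_intros bounded_linear_imp_has_derivative)
  then have "(\<lambda>x. f (A x + c)) differentiable (at x)" for x
    using Suc.prems has_derivative_compose[of "\<lambda>x. A x + c" A x UNIV f]
    unfolding differentiable_def Ck.simps by blast
  moreover have "Ck n (\<lambda>x. frechet_derivative f (at (A x + c)) (A v))" for v
    using Suc.prems Suc.IH[of "\<lambda>x. frechet_derivative f (at x) (A v)"] by simp
  ultimately show ?case using Suc.prems
    by (simp add: frechet_derivative_affine_apply[OF _ assms])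
qed

lemma smooth_const: "smooth (\<lambda>x. c)"
  by (simp add: smooth_def Ck_const)

lemma smooth_mult:
  fixes f g :: "'a::euclidean_space \<Rightarrow> real"
  shows "smooth f \<Longrightarrow> smooth g \<Longrightarrow> smooth (\<lambda>x. f x * g x)"
  by (simp add: smooth_def Ck_mult)

lemma smooth_affine: "smooth f \<Longrightarrow> bounded_linear A \<Longrightarrow> smooth (\<lambda>x. f (A x + c))"
  by (simp add: smooth_def Ck_affine)

lemma dird_mult:
  fixes f g :: "'a::euclidean_space \<Rightarrow> real"
  shows "smooth f \<Longrightarrow> smooth g \<Longrightarrow> frechet_derivative (\<lambda>x. f x * g x) (at x) v
      = f x * frechet_derivative g (at x) v + frechet_derivative f (at x) v * g x"
  by (simp add: frechet_derivative_mult_apply smooth_differentiable)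

lemma dird_affine:
  "smooth f \<Longrightarrow> bounded_linear A \<Longrightarrow>
    frechet_derivative (\<lambda>x. f (A x + c)) (at x) v = frechet_derivative f (at (A x + c)) (A v)"
  by (simp add: frechet_derivative_affine_apply smooth_differentiable)

lemma linear_frechet_derivative_smooth: "smooth f \<Longrightarrow> linear (frechet_derivative f (at x))"
  by (simp add: linear_frechet_derivative smooth_differentiable)

lemma mollifierD:
  assumes "mollifier \<rho>"
  shows "smooth \<rho>" "0 \<le> \<rho> x" "\<rho> (- x) = \<rho> x" "bounded {x. \<rho> x \<noteq> 0}" "(LINT x|lborel. \<rho> x) = 1"
  using assms unfolding mollifier_def by (elim conjE; simp only:)+

text \<open>A mollifier has integral one and hence is non-zero at some \<open>x0\<close>. Its
  restriction to a line through \<open>x0\<close> is smooth, non-negative, compactly supported and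
  not identically zero; dividing by its integral gives the bump.\<close>

lemma smooth_bump_ex:
  assumes "mollifier (\<rho> :: real ^ 'd \<Rightarrow> real)"
  obtains \<eta> :: "real \<Rightarrow> real" and R where "smooth \<eta>" "\<And>r. 0 \<le> \<eta> r" "0 < R"
    "\<And>r. R \<le> \<bar>r\<bar> \<Longrightarrow> \<eta> r = 0" "integrable lborel \<eta>" "(LINT r|lborel. \<eta> r) = 1"
proof -
  have sm: "smooth \<rho>" and nn: "\<And>x. 0 \<le> \<rho> x" and bd: "bounded {x. \<rho> x \<noteq> 0}"
    and one: "(LINT x|lborel. \<rho> x) = 1"
    using mollifierD[OF assms] by (simp_all only:)
  obtain x0 where x0: "\<rho> x0 \<noteq> 0"
  proof -
    have "\<rho> \<noteq> (\<lambda>x. 0)" using one by auto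
    then show ?thesis using that by auto
  qed
  obtain B where B: "\<And>x. \<rho> x \<noteq> 0 \<Longrightarrow> norm x \<le> B" "0 < B"
    using bd by (auto simp: bounded_pos)
  define e :: "real ^ 'd" where "e = axis undefined 1"
  define h where "h = (\<lambda>r::real. \<rho> (r *\<^sub>R e + x0))"
  \<comment> \<open>Where \<open>h r\<close> is non-zero, \<open>norm (r *\<^sub>R e + x0)\<close>
    is at most \<open>B\<close>, so the modulus of \<open>r\<close> is at most
    \<open>B + norm x0\<close>. The added 1 makes this strict, so that \<open>h\<close> vanishes at
    distance exactly \<open>R\<close> as well.\<close>
  define R where "R = B + norm x0 + 1"
  have bl: "bounded_linear (\<lambda>r::real. r *\<^sub>R e)"
    by (rule bounded_linear_scaleR_left)
  have smh: "smooth h" unfolding h_def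
    using smooth_affine[OF sm bl] .
  have R0: "0 < R" using B(2) by (simp add: R_def add_pos_nonneg)
  have supp: "h r = 0" if "R \<le> \<bar>r\<bar>" for r
  proof (rule ccontr)
    assume "h r \<noteq> 0"
    then have "norm (r *\<^sub>R e + x0) \<le> B" using B(1) by (simp add: h_def)
    moreover have "norm (r *\<^sub>R e) \<le> norm (r *\<^sub>R e + x0) + norm x0"
      by (metis add_diff_cancel_right' norm_triangle_ineq4)
    moreover have "norm (r *\<^sub>R e) = \<bar>r\<bar>" by (simp add: e_def norm_axis_1)
    ultimately show False using that unfolding R_def by linarith
  qed
  have ch: "continuous_on UNIV h" by (rule smooth_continuous_on[OF smh])
  have inth: "integrable lborel h"
  proof -
    have "set_integrable lborel {-R..R} h"
      using ch borel_integrable_atLeastAtMost' continuous_on_subset by blast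
    moreover have "(\<lambda>r. indicator {-R..R} r *\<^sub>R h r) = h"
    proof
      fix r show "indicator {-R..R} r *\<^sub>R h r = h r"
        using supp[of r] by (cases "R \<le> \<bar>r\<bar>") (simp_all add: indicator_def, linarith)
    qed
    ultimately show ?thesis by (simp only: set_integrable_def)
  qed
  define c where "c = (LINT r|lborel. h r)"
  have c: "0 < c"
  proof -
    \<comment> \<open>A non-negative function with integral 0 vanishes almost everywhere. By
      continuity the set where \<open>h\<close> is non-zero is open, and an open negligible set is
      empty; but it contains 0.\<close>
    have "c \<noteq> 0"
    proof
      assume "c = 0"
      then have "AE r in lborel. h r = 0"
        using integral_nonneg_eq_0_iff_AE[OF inth] nn by (simp add: c_def h_def)
      moreover have "open {r. h r \<noteq> 0}"
        using ch by (simp add: open_Collect_neq continuous_on_const)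
      moreover from calculation(2) have "{r. h r \<noteq> 0} \<in> sets lborel"
        by (simp add: borel_open)
      ultimately have "{r. h r \<noteq> 0} \<in> null_sets lborel"
        by (simp add: AE_iff_null_sets)
      then have "negligible {r. h r \<noteq> 0}"
        by (simp add: negligible_iff_null_sets null_sets_completionI)
      with \<open>open {r. h r \<noteq> 0}\<close> have "{r. h r \<noteq> 0} = {}"
        using open_not_negligible by blast
      moreover have "h 0 \<noteq> 0" using x0 by (simp add: h_def)
      ultimately show False by blast
    qed
    moreover have "0 \<le> c" unfolding c_def using nn by (simp add: h_def)
    ultimately show ?thesis by simp
  qed
  show ?thesis
  proof (rule that[of "\<lambda>r. (1 / c) * h r" R])
    show "smooth (\<lambda>r. (1 / c) * h r)" by (intro smooth_mult smooth_const smh)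
    show "(LINT r|lborel. 1 / c * h r) = 1" using c inth by (simp flip: c_def)
  qed (use c nn R0 supp inth in \<open>auto simp: h_def\<close>)
qed

subsection \<open>The torus and periodic functions\<close>

text \<open>No quotient is formed: functions on the torus stay periodic functions on
  \<open>real ^ 'd\<close>, and the measure is carried by one period. It is a probability
  measure.\<close>

definition torus :: "(real ^ 'd) measure" where
  "torus = density lborel (indicator unit_cube)"

definition int_vec :: "(real ^ 'd) set" where
  "int_vec = {k. \<forall>i. k $ i \<in> \<int>}"

text \<open>A fundamental domain of the lattice: each point has exactly one translate in it, whereas
  the closed cube counts points of its faces several times.\<close>

definition half_cube :: "(real ^ 'd) set" where
  "half_cube = {x. \<forall>i. 0 \<le> x $ i \<and> x $ i < 1}"

definition vec_floor :: "real ^ 'd \<Rightarrow> real ^ 'd" where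
  "vec_floor x = (\<chi> i. of_int \<lfloor>x $ i\<rfloor>)"

definition periodic :: "(real ^ 'd \<Rightarrow> 'b) \<Rightarrow> bool" where
  "periodic f \<longleftrightarrow> (\<forall>x i. f (x + axis i 1) = f x)"

lemma vec_floor_int_vec: "vec_floor x \<in> int_vec"
  by (simp add: vec_floor_def int_vec_def)

lemma diff_vec_floor_half_cube: "x - vec_floor x \<in> half_cube"
  by (simp add: half_cube_def vec_floor_def) linarith

lemma half_cube_diff_int_vec_iff:
  assumes "k \<in> int_vec" shows "x - k \<in> half_cube \<longleftrightarrow> k = vec_floor x"
proof
  assume *: "x - k \<in> half_cube"
  show "k = vec_floor x"
  proof (rule vec_eq_iff[THEN iffD2, rule_format])
    fix i
    obtain m where m: "k $ i = of_int m" using assms by (auto simp: int_vec_def elim: Ints_cases)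
    have "0 \<le> x $ i - k $ i" "x $ i - k $ i < 1" using * by (auto simp: half_cube_def)
    then have "\<lfloor>x $ i\<rfloor> = m" unfolding m by linarith
    then show "k $ i = vec_floor x $ i" by (simp add: vec_floor_def m)
  qed
qed (simp add: diff_vec_floor_half_cube)

lemma int_vec_uminus: "k \<in> int_vec \<Longrightarrow> - k \<in> int_vec"
  and int_vec_add: "k \<in> int_vec \<Longrightarrow> m \<in> int_vec \<Longrightarrow> k + m \<in> int_vec"
  by (auto simp: int_vec_def)

lemma axis_int_vec: "axis i 1 \<in> int_vec"
  by (auto simp: int_vec_def axis_def)

lemma finite_int_vec_bounded: "finite {k::real ^ 'd. k \<in> int_vec \<and> norm k \<le> B}"
proof -
  define S where "S = {r::real. r \<in> \<int> \<and> \<bar>r\<bar> \<le> B}"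
  have "finite S" unfolding S_def using finite_abs_int_segment .
  then have "finite (PiE (UNIV::'d set) (\<lambda>_. S))" by (intro finite_PiE) auto
  moreover have "{k::real ^ 'd. k \<in> int_vec \<and> norm k \<le> B} \<subseteq> vec_lambda ` (PiE UNIV (\<lambda>_. S))"
  proof
    fix k :: "real ^ 'd" assume k: "k \<in> {k. k \<in> int_vec \<and> norm k \<le> B}"
    have "\<bar>k $ i\<bar> \<le> B" for i
      using component_le_norm_cart[of k i] k by simp
    then have "vec_nth k \<in> PiE UNIV (\<lambda>_. S)" using k by (auto simp: S_def int_vec_def)
    moreover have "k = vec_lambda (vec_nth k)" by simp
    ultimately show "k \<in> vec_lambda ` (PiE UNIV (\<lambda>_. S))" by blast
  qed
  ultimately show ?thesis by (rule finite_surj)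
qed

lemma norm_half_cube_le: "x \<in> half_cube \<Longrightarrow> norm (x :: real ^ 'd) \<le> CARD('d)"
proof -
  assume "x \<in> half_cube"
  then have "\<bar>x $ i\<bar> \<le> 1" for i by (auto simp: half_cube_def less_imp_le)
  then have "(\<Sum>i\<in>UNIV. \<bar>x $ i\<bar>) \<le> (\<Sum>i\<in>(UNIV::'d set). 1)" by (intro sum_mono)
  then show ?thesis using norm_le_l1_cart[of x] by simp
qed

text \<open>Along a single axis, natural multiples are reached by induction and negative ones by
  moving back; a lattice vector is a finite sum of such moves.\<close>

lemma periodic_int_vec:
  assumes "periodic f" "k \<in> int_vec" shows "f (x + k) = f x"
proof -
  have nat: "f (x + real n *\<^sub>R axis i 1) = f x" for n x i
  proof (induction n)
    case (Suc n)
    have *: "x + real (Suc n) *\<^sub>R axis i 1 = (x + real n *\<^sub>R axis i 1) + axis i 1"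
      by (simp add: scaleR_left_distrib add_ac)
    have "f ((x + real n *\<^sub>R axis i 1) + axis i 1) = f (x + real n *\<^sub>R axis i 1)"
      by (rule assms(1)[unfolded periodic_def, rule_format])
    then show ?case unfolding * by (rule trans) (rule Suc)
  qed simp
  have int: "f (x + r *\<^sub>R axis i 1) = f x" if "r \<in> \<int>" for r x i
  proof -
    from that obtain m where m: "r = of_int m" by (rule Ints_cases)
    show ?thesis
    proof (cases "0 \<le> m")
      case True
      then show ?thesis using nat[of x "nat m" i] m by simp
    next
      case False
      then show ?thesis using nat[of "x + r *\<^sub>R axis i 1" "nat (- m)" i] m by simp
    qed
  qed
  have "f (x + (\<Sum>i\<in>S. (k $ i) *\<^sub>R axis i 1)) = f x" if "finite S" for S x
    using that
  proof (induction S arbitrary: x rule: finite_induct)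
    case (insert i S)
    have *: "x + (\<Sum>i\<in>insert i S. (k $ i) *\<^sub>R axis i 1)
        = (x + (k $ i) *\<^sub>R axis i 1) + (\<Sum>i\<in>S. (k $ i) *\<^sub>R axis i 1)"
      using insert.hyps by (simp add: add_ac)
    show ?case unfolding * insert.IH using int assms(2) by (simp add: int_vec_def)
  qed simp
  from this[of UNIV x] show ?thesis
    using basis_expansion[of k] by (simp add: scalar_mult_eq_scaleR)
qed

lemma half_cube_measurable [measurable]: "half_cube \<in> sets borel"
  unfolding half_cube_def by measurable

lemma AE_half_cube: "AE x in lborel. x \<in> unit_cube \<longleftrightarrow> x \<in> half_cube"
proof -
  have "cbox (0::real ^ 'd) 1 - box 0 1 \<in> null_sets lborel"
    using negligible_frontier_interval[of "0::real ^ 'd" 1]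
    by (simp add: negligible_iff_null_sets null_sets_completion_iff)
  then have *: "AE x in lborel. x \<notin> cbox (0::real ^ 'd) 1 - box 0 1"
    by (rule AE_not_in)
  moreover have "box (0::real ^ 'd) 1 \<subseteq> half_cube" "half_cube \<subseteq> cbox (0::real ^ 'd) 1"
    by (auto simp: half_cube_def mem_box_cart less_imp_le)
  ultimately have "x \<notin> cbox (0::real ^ 'd) 1 - box 0 1 \<longrightarrow> (x \<in> unit_cube \<longleftrightarrow> x \<in> half_cube)" for x
    by blast
  with * show ?thesis using AE_mp by fastforce
qed

lemma sets_torus [measurable_cong]: "sets torus = sets borel"
  by (simp add: torus_def)

lemma space_torus [simp]: "space torus = UNIV"
  by (simp add: torus_def)

lemma prob_space_torus: "prob_space (torus :: (real ^ 'd) measure)"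
proof
  show "emeasure (torus :: (real ^ 'd) measure) (space torus) = 1"
    by (simp add: torus_def emeasure_density emeasure_lborel_cbox_eq Basis_vec_def inner_axis
        prod.neutral ball_Un image_iff)
qed

lemma torus_alt: "torus = density lborel (indicator half_cube)"
  unfolding torus_def
  by (rule density_cong) (use AE_half_cube in \<open>auto elim!: AE_mp simp: indicator_def\<close>)

lemma integrable_torus_iff:
  fixes f :: "real ^ 'd \<Rightarrow> real"
  assumes [measurable]: "f \<in> borel_measurable borel"
  shows "integrable torus f \<longleftrightarrow> integrable lborel (\<lambda>x. indicator half_cube x * f x)"
proof -
  have "torus = density lborel (\<lambda>x::real ^ 'd. ennreal (indicator half_cube x))"
    by (simp add: torus_alt ennreal_indicator)
  from integrable_density[of f lborel "indicator half_cube"] show ?thesis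
    unfolding \<open>torus = _\<close> by simp
qed

lemma integral_torus_eq:
  fixes f :: "real ^ 'd \<Rightarrow> real"
  assumes [measurable]: "f \<in> borel_measurable borel"
  shows "integral\<^sup>L torus f = (LINT x|lborel. indicator half_cube x * f x)"
proof -
  have "torus = density lborel (\<lambda>x::real ^ 'd. ennreal (indicator half_cube x))"
    by (simp add: torus_alt ennreal_indicator)
  from integral_density[of f lborel "indicator half_cube"] show ?thesis
    unfolding \<open>torus = _\<close> by simp
qed

lemma integrable_lborel_translate:
  fixes f :: "'a::euclidean_space \<Rightarrow> real"
  assumes "f \<in> borel_measurable borel"
  shows "integrable lborel (\<lambda>x. f (c + x)) \<longleftrightarrow> integrable lborel f"
  using integrable_distr_eq[of "(+) c" lborel borel f] assms by (simp add: lborel_distr_plus)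

lemma integral_lborel_translate:
  fixes f :: "'a::euclidean_space \<Rightarrow> real"
  assumes "f \<in> borel_measurable borel"
  shows "(LINT x|lborel. f (c + x)) = integral\<^sup>L lborel f"
  using integral_distr[of "(+) c" lborel borel f] assms by (simp add: lborel_distr_plus)

text \<open>The lattice translates of \<open>half_cube\<close> tile the space, so an integral over
  the space is a sum of integrals over the torus. The finite set \<open>F\<close> contains every
  translate on which \<open>g\<close> does not vanish.\<close>

lemma torus_unfold:
  fixes g :: "real ^ 'd \<Rightarrow> real"
  assumes [measurable]: "g \<in> borel_measurable borel"
    and F: "finite F" "F \<subseteq> int_vec"
    and supp: "\<And>x k. x \<in> half_cube \<Longrightarrow> k \<in> int_vec \<Longrightarrow> k \<notin> F \<Longrightarrow> g (x + k) = 0"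
    and int: "\<And>k. k \<in> F \<Longrightarrow> integrable torus (\<lambda>x. g (x + k))"
  shows "integrable lborel g"
    and "integral\<^sup>L lborel g = (\<Sum>k\<in>F. (LINT x|torus. g (x + k)))"
proof -
  have eq: "g x = (\<Sum>k\<in>F. indicator half_cube (x - k) * g x)" for x
  proof (cases "vec_floor x \<in> F")
    case True
    have "(\<Sum>k\<in>F. indicator half_cube (x - k) * g x)
        = (\<Sum>k\<in>F. if k = vec_floor x then g x else 0)"
      using F(2) by (intro sum.cong) (auto simp: indicator_def half_cube_diff_int_vec_iff subset_iff)
    then show ?thesis using True F(1) by (simp add: sum.delta')
  next
    case False
    then have "g ((x - vec_floor x) + vec_floor x) = 0"
      by (intro supp diff_vec_floor_half_cube vec_floor_int_vec)
    then show ?thesis by simp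
  qed
  have summand: "integrable lborel (\<lambda>x. indicator half_cube (x - k) * g x)"
    "(LINT x|lborel. indicator half_cube (x - k) * g x) = (LINT x|torus. g (x + k))"
    if "k \<in> F" for k
  proof -
    have "integrable lborel (\<lambda>x. indicator half_cube x * g (x + k))"
      using int[OF that] by (simp add: integrable_torus_iff)
    then show "integrable lborel (\<lambda>x. indicator half_cube (x - k) * g x)"
      using integrable_lborel_translate[of "\<lambda>x. indicator half_cube (x - k) * g x" k]
      by (simp add: add.commute)
    show "(LINT x|lborel. indicator half_cube (x - k) * g x) = (LINT x|torus. g (x + k))"
      using integral_lborel_translate[of "\<lambda>x. indicator half_cube (x - k) * g x" k]
      by (simp add: add.commute integral_torus_eq)
  qed
  have "integrable lborel (\<lambda>x. \<Sum>k\<in>F. indicator half_cube (x - k) * g x)"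
    using summand(1) by (intro Bochner_Integration.integrable_sum)
  then show "integrable lborel g" using eq by simp
  have "integral\<^sup>L lborel g = (LINT x|lborel. (\<Sum>k\<in>F. indicator half_cube (x - k) * g x))"
    using eq by simp
  also have "\<dots> = (\<Sum>k\<in>F. (LINT x|torus. g (x + k)))"
    using summand by (subst Bochner_Integration.integral_sum) auto
  finally show "integral\<^sup>L lborel g = (\<Sum>k\<in>F. (LINT x|torus. g (x + k)))" .
qed

text \<open>The translated cube is cut along the lattice and its pieces are moved back into
  \<open>half_cube\<close>, where they fit together exactly once. Periodicity leaves the values of
  \<open>f\<close> unchanged under these moves.\<close>

lemma torus_translate:
  fixes f :: "real ^ 'd \<Rightarrow> real"
  assumes [measurable]: "f \<in> borel_measurable borel" and per: "periodic f"
    and int: "integrable torus f"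
  shows "integral\<^sup>L torus (\<lambda>x. f (x + h)) = integral\<^sup>L torus f"
proof -
  \<comment> \<open>If \<open>x\<close> and \<open>x - h + k\<close> both lie in
    \<open>half_cube\<close>, whose points have norm at most the dimension, the triangle inequality
    bounds \<open>norm k\<close> by this number.\<close>
  define F :: "(real ^ 'd) set" where
    "F = {k. k \<in> int_vec \<and> norm k \<le> CARD('d) + CARD('d) + norm h}"
  have F: "finite F" "F \<subseteq> int_vec" unfolding F_def using finite_int_vec_bounded by auto
  define g where "g x = indicator half_cube (x - h) * f x" for x
  have gk: "g (x + k) = indicator half_cube (x - h + k) * f x" if "k \<in> int_vec" for x k
    using periodic_int_vec[OF per that] unfolding g_def by (metis diff_add_eq)
  have inF: "k \<in> F" if "x \<in> half_cube" "x - h + k \<in> half_cube" "k \<in> int_vec" for x k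
  proof -
    have "norm k = norm ((x - h + k) - x + h)" by simp
    also have "\<dots> \<le> norm (x - h + k) + norm x + norm h"
      by (metis add_mono_thms_linordered_semiring(3) norm_triangle_ineq norm_triangle_ineq4 order_trans)
    also have "\<dots> \<le> CARD('d) + CARD('d) + norm h"
      using norm_half_cube_le[OF that(1)] norm_half_cube_le[OF that(2)] by simp
    finally show ?thesis using that(3) by (simp add: F_def)
  qed
  have meas [measurable]: "g \<in> borel_measurable borel" unfolding g_def by measurable
  have intk: "integrable torus (\<lambda>x. g (x + k))" if "k \<in> F" for k
  proof -
    have "(\<lambda>x. g (x + k)) = (\<lambda>x. indicator half_cube (x - h + k) * f x)"
      using gk F(2) that by auto
    moreover have "integrable torus (\<lambda>x. indicator half_cube (x - h + k) * f x)"
      using int by (rule Bochner_Integration.integrable_bound) (auto simp: indicator_def)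
    ultimately show ?thesis by simp
  qed
  have supp: "g (x + k) = 0" if "x \<in> half_cube" "k \<in> int_vec" "k \<notin> F" for x k
    using inF[of x k] that by (auto simp: gk indicator_def)
  have sum1: "(\<Sum>k\<in>F. g (x + k)) = f x" if "x \<in> half_cube" for x
  proof -
    \<comment> \<open>The only lattice vector that brings \<open>x - h\<close> back into the
      fundamental domain, hence the only index that contributes to the sum.\<close>
    define k0 where "k0 = - vec_floor (x - h)"
    have k0: "k0 \<in> int_vec" by (simp add: k0_def int_vec_uminus vec_floor_int_vec)
    have *: "x - h + k \<in> half_cube \<longleftrightarrow> k = k0" if "k \<in> int_vec" for k
      using half_cube_diff_int_vec_iff[OF int_vec_uminus[OF that], of "x - h"]
      unfolding k0_def by (metis add.inverse_inverse diff_minus_eq_add)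
    have "k0 \<in> F" using inF[OF that _ k0] *[OF k0] by simp
    have "(\<Sum>k\<in>F. g (x + k)) = (\<Sum>k\<in>F. if k = k0 then f x else 0)"
      using F(2) * by (intro sum.cong) (auto simp: gk indicator_def subset_iff)
    then show ?thesis using \<open>k0 \<in> F\<close> F(1) by simp
  qed
  have "integral\<^sup>L torus (\<lambda>x. f (x + h)) = (LINT x|lborel. g (h + x))"
    by (simp add: integral_torus_eq g_def add.commute)
  also have "\<dots> = integral\<^sup>L lborel g" by (rule integral_lborel_translate) measurable
  also have "\<dots> = (\<Sum>k\<in>F. (LINT x|torus. g (x + k)))"
    by (rule torus_unfold(2)[OF _ F supp intk]) auto
  also have "\<dots> = (LINT x|torus. (\<Sum>k\<in>F. g (x + k)))"
    by (rule Bochner_Integration.integral_sum[symmetric]) (use intk in auto)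
  also have "\<dots> = integral\<^sup>L torus f"
    by (simp add: integral_torus_eq) (intro Bochner_Integration.integral_cong, auto simp: indicator_def sum1)
  finally show ?thesis .
qed

lemma periodic_continuous_bounded:
  fixes g :: "real ^ 'd \<Rightarrow> real"
  assumes "periodic g" "continuous_on UNIV g"
  obtains M where "\<And>x. \<bar>g x\<bar> \<le> M"
proof -
  have "compact (g ` cbox 0 1)"
    by (rule compact_continuous_image[OF continuous_on_subset[OF assms(2)]]) auto
  then obtain M where M: "\<And>x. x \<in> cbox 0 1 \<Longrightarrow> \<bar>g x\<bar> \<le> M"
    using compact_imp_bounded[of "g ` cbox 0 1"] unfolding bounded_iff by auto
  have "\<bar>g x\<bar> \<le> M" for x
  proof -
    have "x - vec_floor x \<in> cbox 0 1"
      using diff_vec_floor_half_cube[of x] by (auto simp: half_cube_def mem_box_cart less_imp_le)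
    moreover have "g (x - vec_floor x) = g x"
      using periodic_int_vec[OF assms(1) vec_floor_int_vec, of "x - vec_floor x" x] by simp
    ultimately show ?thesis using M by metis
  qed
  then show ?thesis by (rule that)
qed

lemma integrable_torus_bounded:
  fixes g :: "real ^ 'd \<Rightarrow> real"
  assumes "g \<in> borel_measurable borel" "\<And>x. \<bar>g x\<bar> \<le> M"
  shows "integrable torus g"
proof -
  interpret prob_space torus by (rule prob_space_torus)
  show ?thesis
    by (rule integrable_const_bound[of _ M]) (use assms in \<open>simp_all add: measurable_cong_sets[OF sets_torus refl]\<close>)
qed

text \<open>By translation invariance each difference quotient has integral zero. The mean value
  theorem bounds the quotients by the supremum of \<open>g\<close>, and dominated convergence
  transfers the zero to their limit.\<close>

lemma torus_integral_partial_zero: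
  fixes f g :: "real ^ 'd \<Rightarrow> real"
  assumes per: "periodic f" and cf: "continuous_on UNIV f" and cg: "continuous_on UNIV g"
    and der: "\<And>x. ((\<lambda>r. f (x + r *\<^sub>R axis i 1)) has_real_derivative g x) (at 0)"
  shows "integral\<^sup>L torus g = 0"
proof -
  have [measurable]: "f \<in> borel_measurable borel" "g \<in> borel_measurable borel"
    by (rule borel_measurable_continuous_onI[OF cf], rule borel_measurable_continuous_onI[OF cg])
  \<comment> \<open>Periodicity passes to the derivative; together with continuity it gives the
    bound \<open>M\<close> that dominates the difference quotients.\<close>
  have "periodic g" unfolding periodic_def
  proof (intro allI)
    fix x j
    have "(\<lambda>r. f (x + axis j 1 + r *\<^sub>R axis i 1)) = (\<lambda>r. f (x + r *\<^sub>R axis i 1))"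
    proof
      fix r :: real
      have "x + axis j 1 + r *\<^sub>R axis i 1 = (x + r *\<^sub>R axis i 1) + axis j 1" by simp
      then show "f (x + axis j 1 + r *\<^sub>R axis i 1) = f (x + r *\<^sub>R axis i 1)"
        using per by (simp only: periodic_def)
    qed
    then show "g (x + axis j 1) = g x" using der DERIV_unique by metis
  qed
  then obtain M where M: "\<And>x. \<bar>g x\<bar> \<le> M" using periodic_continuous_bounded cg by blast
  obtain Mf where Mf: "\<And>x. \<bar>f x\<bar> \<le> Mf" using periodic_continuous_bounded per cf by blast
  have der': "((\<lambda>r. f (x + r *\<^sub>R axis i 1)) has_real_derivative g (x + s *\<^sub>R axis i 1)) (at s)" for x s
    using der[of "x + s *\<^sub>R axis i 1"] DERIV_shift[of "\<lambda>r. f (x + r *\<^sub>R axis i 1)" "g (x + s *\<^sub>R axis i 1)" 0 s]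
    by (simp add: scaleR_left_distrib add_ac)
  define e where "e n = 1 / real (Suc n)" for n
  have e: "e n > 0" "e \<longlonglongrightarrow> 0" for n
    unfolding e_def using LIMSEQ_inverse_real_of_nat by (auto simp: inverse_eq_divide)
  define D where "D n x = (f (x + e n *\<^sub>R axis i 1) - f x) / e n" for n x
  have "(\<lambda>n. integral\<^sup>L torus (D n)) \<longlonglongrightarrow> integral\<^sup>L torus g"
  proof (rule integral_dominated_convergence)
    show "integrable torus (\<lambda>_::real ^ 'd. M)"
      by (rule integrable_torus_bounded[of _ "\<bar>M\<bar>"]) auto
    show "AE x in torus. (\<lambda>n. D n x) \<longlonglongrightarrow> g x"
    proof (intro AE_I2)
      fix x
      have "((\<lambda>h. (f (x + h *\<^sub>R axis i 1) - f x) / h) \<longlongrightarrow> g x) (at 0)"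
        using der[of x] by (simp add: DERIV_def)
      moreover have "filterlim e (at 0) sequentially"
        unfolding filterlim_at using e(2) e(1) by (auto simp: less_imp_neq[symmetric])
      ultimately show "(\<lambda>n. D n x) \<longlonglongrightarrow> g x"
        unfolding D_def by (rule filterlim_compose)
    qed
    show "AE x in torus. norm (D n x) \<le> M" for n
    proof (intro AE_I2)
      fix x
      obtain \<xi> where "f (x + e n *\<^sub>R axis i 1) - f (x + 0 *\<^sub>R axis i 1) = (e n - 0) * g (x + \<xi> *\<^sub>R axis i 1)"
        using MVT2[of 0 "e n" "\<lambda>r. f (x + r *\<^sub>R axis i 1)" "\<lambda>s. g (x + s *\<^sub>R axis i 1)"] e(1) der' by blast
      then have "D n x = g (x + \<xi> *\<^sub>R axis i 1)" using e(1)[of n] by (simp add: D_def)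
      then show "norm (D n x) \<le> M" using M by simp
    qed
    show "D n \<in> borel_measurable torus" for n unfolding D_def by measurable
  qed measurable
  moreover have "integral\<^sup>L torus (D n) = 0" for n
  proof -
    have "integrable torus (\<lambda>x. f (x + e n *\<^sub>R axis i 1))" "integrable torus f"
      using Mf by (auto intro!: integrable_torus_bounded)
    then have "integral\<^sup>L torus (D n)
        = (integral\<^sup>L torus (\<lambda>x. f (x + e n *\<^sub>R axis i 1)) - integral\<^sup>L torus f) / e n"
      unfolding D_def by simp
    also have "\<dots> = 0" using torus_translate[OF _ per \<open>integrable torus f\<close>] by simp
    finally show ?thesis .
  qed
  ultimately show ?thesis using LIMSEQ_unique by (metis (no_types, lifting) LIMSEQ_const_iff ext)
qed

subsection \<open>Periodisation\<close>

text \<open>The sum over all lattice translates. Restricting it to the non-zero terms makes the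
  index set finite at each point as soon as \<open>g\<close> has bounded support.\<close>

definition periodize :: "(real ^ 'd \<Rightarrow> real) \<Rightarrow> real ^ 'd \<Rightarrow> real" where
  "periodize g x = (\<Sum>k | k \<in> int_vec \<and> g (x + k) \<noteq> 0. g (x + k))"

lemma periodize_eq_sum:
  assumes "finite F" "F \<subseteq> int_vec" "\<And>k. k \<in> int_vec \<Longrightarrow> k \<notin> F \<Longrightarrow> g (x + k) = 0"
  shows "periodize g x = (\<Sum>k\<in>F. g (x + k))"
  unfolding periodize_def
  by (rule sum.mono_neutral_left) (use assms in auto)

text \<open>The index set depends on the bound \<open>N\<close> only and not on \<open>x\<close>.
  Near a given point the periodisation is thus one fixed finite sum, which can be differentiated
  term by term.\<close>

lemma periodize_eq_sum_ball:
  fixes g :: "real ^ 'd \<Rightarrow> real"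
  assumes supp: "\<And>x. B < norm x \<Longrightarrow> g x = 0" and "norm x \<le> N"
  shows "periodize g x = (\<Sum>k | k \<in> int_vec \<and> norm k \<le> B + N. g (x + k))"
proof (rule periodize_eq_sum)
  fix k :: "real ^ 'd" assume "k \<in> int_vec" "k \<notin> {k \<in> int_vec. norm k \<le> B + N}"
  then have "B + N < norm k" by simp
  moreover have "norm k \<le> norm (x + k) + norm x"
    using norm_triangle_ineq4[of "x + k" x] by simp
  ultimately show "g (x + k) = 0" using assms(2) by (intro supp) linarith
qed (auto simp: finite_int_vec_bounded)

lemma periodic_periodize:
  fixes g :: "real ^ 'd \<Rightarrow> real"
  shows "periodic (periodize g)"
  unfolding periodic_def
proof (intro allI)
  fix x :: "real ^ 'd" and i
  have *: "x + axis i 1 + (k - axis i 1) = x + k" "x + axis i 1 + k = x + (axis i 1 + k)" for k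
    by (simp_all add: algebra_simps)
  show "periodize g (x + axis i 1) = periodize g x"
    unfolding periodize_def
    by (rule sum.reindex_bij_witness[where i = "\<lambda>k. k - axis i 1" and j = "\<lambda>k. axis i 1 + k"])
      (use int_vec_add[OF int_vec_uminus[OF axis_int_vec[of i]]] int_vec_add[OF axis_int_vec[of i]]
        in \<open>simp_all add: * add.commute[of "- axis i 1"]\<close>)
qed

lemma frechet_derivative_zero_outside:
  assumes "\<And>x. B < norm x \<Longrightarrow> g x = 0" and "B < norm x"
  shows "frechet_derivative g (at x) v = 0"
proof -
  have "open {x. B < norm x}" by (intro open_Collect_less continuous_intros)
  moreover have "((\<lambda>x. 0) has_derivative (\<lambda>x. 0)) (at x)" by simp
  ultimately have "(g has_derivative (\<lambda>x. 0)) (at x)"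
    using assms by (intro has_derivative_transform_within_open[where f = "\<lambda>x. 0" and g = g]) auto
  from frechet_derivative_at[OF this] show ?thesis by metis
qed

lemma has_derivative_periodize:
  fixes g :: "real ^ 'd \<Rightarrow> real"
  assumes diff: "\<And>x. g differentiable (at x)" and supp: "\<And>x. B < norm x \<Longrightarrow> g x = 0"
  shows "(periodize g has_derivative
    (\<lambda>v. periodize (\<lambda>y. frechet_derivative g (at y) v) x)) (at x)"
proof -
  define F :: "(real ^ 'd) set" where "F = {k. k \<in> int_vec \<and> norm k \<le> B + (norm x + 1)}"
  have eq: "periodize g y = (\<Sum>k\<in>F. g (y + k))" if "norm y < norm x + 1" for y
    using periodize_eq_sum_ball[of B g y "norm x + 1", OF supp] that by (simp add: F_def)
  have eq': "periodize (\<lambda>y. frechet_derivative g (at y) v) x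
      = (\<Sum>k\<in>F. frechet_derivative g (at (x + k)) v)" for v
    using periodize_eq_sum_ball[of B "\<lambda>y. frechet_derivative g (at y) v" x "norm x + 1",
        OF frechet_derivative_zero_outside[OF supp]] by (simp add: F_def)
  have "((\<lambda>y. g (y + k)) has_derivative frechet_derivative g (at (x + k))) (at x)" for k
    using has_derivative_compose[of "\<lambda>y. y + k" "\<lambda>v. v" x UNIV g "frechet_derivative g (at (x + k))"]
      diff[of "x + k"] frechet_derivative_works[of g "at (x + k)"]
      has_derivative_add_const[OF has_derivative_ident, of k "at x"] by simp
  then have "((\<lambda>y. \<Sum>k\<in>F. g (y + k)) has_derivative
      (\<lambda>v. \<Sum>k\<in>F. frechet_derivative g (at (x + k)) v)) (at x)"
    by (rule has_derivative_sum)
  then have "(periodize g has_derivative (\<lambda>v. \<Sum>k\<in>F. frechet_derivative g (at (x + k)) v)) (at x)"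
  proof (rule has_derivative_transform_within_open[where s = "{y. norm y < norm x + 1}"])
    show "open {y. norm y < norm x + 1}" by (intro open_Collect_less continuous_intros)
  qed (simp_all add: eq)
  then show ?thesis unfolding eq' .
qed

lemma differentiable_periodize:
  fixes g :: "real ^ 'd \<Rightarrow> real"
  assumes "\<And>x. g differentiable (at x)" "\<And>x. B < norm x \<Longrightarrow> g x = 0"
  shows "periodize g differentiable (at x)"
  unfolding differentiable_def by (rule exI, rule has_derivative_periodize[OF assms])

text \<open>One order of regularity beyond the conclusion is assumed, because continuity in the base
  case is inferred from differentiability. For smooth functions nothing is lost.\<close>

lemma Ck_periodize:
  assumes "Ck n g" "Ck (Suc n) g" "\<And>x. B < norm x \<Longrightarrow> g x = 0"
  shows "Ck n (periodize g)"
  using assms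
proof (induction n arbitrary: g)
  case 0
  have diff: "g differentiable (at x)" for x using 0(2) by simp
  have "periodize g differentiable (at x)" for x
    by (rule differentiable_periodize[OF diff 0(3)])
  then show ?case
    by (simp add: continuous_at_imp_continuous_on differentiable_imp_continuous_within)
next
  case (Suc n)
  have diff: "g differentiable (at x)" for x using Suc.prems(2) by simp

  have "Ck n (periodize (\<lambda>y. frechet_derivative g (at y) v))" for v
  proof (rule Suc.IH)
    show "Ck n (\<lambda>y. frechet_derivative g (at y) v)" using Suc.prems(1) by simp
    show "Ck (Suc n) (\<lambda>y. frechet_derivative g (at y) v)"
      using Suc.prems(2) Ck.simps(2) by blast
    show "frechet_derivative g (at x) v = 0" if "B < norm x" for x
      by (rule frechet_derivative_zero_outside[OF Suc.prems(3) that])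
  qed
  moreover have "(\<lambda>x. frechet_derivative (periodize g) (at x) v)
      = periodize (\<lambda>y. frechet_derivative g (at y) v)" for v
    using fun_cong[OF frechet_derivative_at[OF has_derivative_periodize[OF diff Suc.prems(3)]]]
    by (intro ext) (rule sym)
  moreover have "periodize g differentiable (at x)" for x
    by (rule differentiable_periodize[OF diff Suc.prems(3)])
  ultimately show ?case by simp
qed

lemma smooth_periodize:
  assumes "smooth g" "\<And>x. B < norm x \<Longrightarrow> g x = 0"
  shows "smooth (periodize g)"
  unfolding smooth_def
proof
  fix n show "Ck n (periodize g)"
    by (rule Ck_periodize[OF _ _ assms(2)]) (use assms(1) in \<open>simp_all only: smooth_def\<close>)
qed

section \<open>Convolution with a periodic function as an integral over the torus\<close>

lemma lborel_reflect: "lborel = distr lborel borel (\<lambda>y::'a::euclidean_space. x - y)"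
  using lborel_affine[of "-1" x] by (simp add: density_1)

lemma integrable_lborel_reflect:
  fixes h :: "'a::euclidean_space \<Rightarrow> real"
  assumes "h \<in> borel_measurable borel"
  shows "integrable lborel (\<lambda>y. h (x - y)) \<longleftrightarrow> integrable lborel h"
  using integrable_distr_eq[of "\<lambda>y. x - y" lborel borel h] assms
  by (simp flip: lborel_reflect)

lemma integral_lborel_reflect:
  fixes h :: "'a::euclidean_space \<Rightarrow> real"
  assumes "h \<in> borel_measurable borel"
  shows "(LINT y|lborel. h (x - y)) = integral\<^sup>L lborel h"
  using integral_distr[of "\<lambda>y. x - y" lborel borel h] assms
  by (simp flip: lborel_reflect)

lemma integrable_bounded_mult:
  fixes g f :: "'a \<Rightarrow> real"
  assumes "integrable M f" "g \<in> borel_measurable M" "\<And>x. \<bar>g x\<bar> \<le> C"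
  shows "integrable M (\<lambda>x. g x * f x)"
proof (rule Bochner_Integration.integrable_bound)
  show "integrable M (\<lambda>x. C * f x)" using assms(1) by simp
  show "AE x in M. norm (g x * f x) \<le> norm (C * f x)"
  proof (rule AE_I2)
    fix x
    have "\<bar>g x\<bar> \<le> \<bar>C\<bar>" using assms(3)[of x] by linarith
    then show "norm (g x * f x) \<le> norm (C * f x)" by (simp add: abs_mult mult_right_mono)
  qed
qed (use assms in simp)

lemma compact_support_bounded:
  fixes g :: "'a::euclidean_space \<Rightarrow> real"
  assumes "continuous_on UNIV g" "\<And>x. B < norm x \<Longrightarrow> g x = 0"
  obtains C where "\<And>x. \<bar>g x\<bar> \<le> C"
proof -
  have "compact (g ` cball 0 B)"
    by (rule compact_continuous_image[OF continuous_on_subset[OF assms(1)]]) auto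
  then obtain C where C: "\<forall>x\<in>cball 0 B. \<bar>g x\<bar> \<le> C"
    using compact_imp_bounded[of "g ` cball 0 B"] unfolding bounded_iff by auto
  show ?thesis
  proof (rule that[of "max C 0"])
    fix x show "\<bar>g x\<bar> \<le> max C 0"
      using C assms(2)[of x] by (cases "norm x \<le> B") (auto simp: le_max_iff_disj)
  qed
qed

text \<open>After the reflection of \<open>y\<close> into \<open>x - y\<close> the integrand is
  \<open>g (x - y) * f y\<close>. Cutting the space along the lattice, periodicity removes the
  translations from \<open>f\<close>, and they accumulate on the kernel, which becomes its
  periodisation.\<close>

lemma convolution_unfold:
  fixes g f :: "real ^ 'd \<Rightarrow> real"
  assumes sg: "smooth g" and supp: "\<And>x. B < norm x \<Longrightarrow> g x = 0"
    and [measurable]: "f \<in> borel_measurable borel" and per: "periodic f" and int: "integrable torus f"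
  shows "integrable lborel (\<lambda>y. g y * f (x - y))"
    and "(LINT y|lborel. g y * f (x - y)) = (LINT y|torus. periodize g (x - y) * f y)"
proof -
  have [measurable]: "g \<in> borel_measurable borel" "periodize g \<in> borel_measurable borel"
    by (rule smooth_borel_measurable[OF sg],
        rule smooth_borel_measurable[OF smooth_periodize[OF sg supp]])
  obtain C where C: "\<And>x. \<bar>g x\<bar> \<le> C"
    using compact_support_bounded[OF smooth_continuous_on[OF sg] supp] by blast
  define h where "h y = g (x - y) * f y" for y
  have [measurable]: "h \<in> borel_measurable borel" unfolding h_def by measurable
  \<comment> \<open>For \<open>y\<close> in \<open>half_cube\<close> and \<open>norm k\<close> above
    this number, \<open>x - y - k\<close> has norm above \<open>B\<close> and so lies outside the
    support of \<open>g\<close>.\<close>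
  define N where "N = B + norm x + CARD('d)"
  define F :: "(real ^ 'd) set" where "F = {k. k \<in> int_vec \<and> norm k \<le> N}"
  have F: "finite F" "F \<subseteq> int_vec" unfolding F_def using finite_int_vec_bounded by auto
  have hk: "h (y + k) = g (x - y - k) * f y" if "k \<in> int_vec" for y k
    using periodic_int_vec[OF per that] by (simp add: h_def diff_diff_eq)
  have zero: "g (x - y - k) = 0" if "y \<in> half_cube" "k \<in> int_vec" "k \<notin> F" for y k
  proof (rule supp)
    have "N < norm k" using that by (simp add: F_def)
    moreover have "norm k \<le> norm (x - y - k) + norm x + norm y"
      using norm_triangle_ineq4[of "x - y" "x - y - k"] norm_triangle_ineq4[of x y] by simp
    ultimately show "B < norm (x - y - k)"
      using norm_half_cube_le[OF that(1)] by (simp add: N_def)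
  qed
  have ik: "integrable torus (\<lambda>y. h (y + k))" if "k \<in> F" for k
  proof -
    have "integrable torus (\<lambda>y. g (x - y - k) * f y)"
      by (rule integrable_bounded_mult[OF int _ C]) measurable
    then show ?thesis using hk F(2) that by auto
  qed
  have supp_h: "h (y + k) = 0" if "y \<in> half_cube" "k \<in> int_vec" "k \<notin> F" for y k
    using zero[OF that] hk[OF that(2)] by simp
  note unf = torus_unfold[OF \<open>h \<in> borel_measurable borel\<close> F supp_h ik]
  have gh: "(\<lambda>y. g y * f (x - y)) = (\<lambda>y. h (x - y))" by (simp add: h_def)
  show "integrable lborel (\<lambda>y. g y * f (x - y))"
    unfolding gh using unf(1) by (simp add: integrable_lborel_reflect)
  have sum_eq: "(\<Sum>k\<in>F. h (y + k)) = periodize g (x - y) * f y" if "y \<in> half_cube" for y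
  proof -
    \<comment> \<open>The periodisation adds lattice vectors where the unfolding has subtracted
      them, so the index set is reflected.\<close>
    have "periodize g (x - y) = (\<Sum>k\<in>uminus ` F. g (x - y + k))"
    proof (rule periodize_eq_sum)
      show "finite (uminus ` F)" "uminus ` F \<subseteq> int_vec"
        using F by (auto intro: int_vec_uminus)
      fix k assume k: "k \<in> int_vec" "k \<notin> uminus ` F"
      then have "- k \<notin> F" by force
      then show "g (x - y + k) = 0" using zero[OF that int_vec_uminus[OF k(1)]] by simp
    qed
    also have "\<dots> = (\<Sum>k\<in>F. g (x - y - k))"
      by (subst sum.reindex) (auto simp: inj_on_def)
    finally have "periodize g (x - y) * f y = (\<Sum>k\<in>F. g (x - y - k) * f y)"
      by (simp add: sum_distrib_right)
    also have "\<dots> = (\<Sum>k\<in>F. h (y + k))"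
      using hk F(2) by (intro sum.cong) auto
    finally show ?thesis by simp
  qed

  have "(LINT y|lborel. g y * f (x - y)) = integral\<^sup>L lborel h"
    unfolding gh by (rule integral_lborel_reflect) measurable
  also have "\<dots> = (\<Sum>k\<in>F. (LINT y|torus. h (y + k)))" by (rule unf(2))
  also have "\<dots> = (LINT y|torus. (\<Sum>k\<in>F. h (y + k)))"
    by (rule Bochner_Integration.integral_sum[symmetric]) (rule ik)
  also have "\<dots> = (LINT y|torus. periodize g (x - y) * f y)"
  proof (rule Bochner_Integration.integral_cong_AE)

    show "(\<lambda>y. periodize g (x - y) * f y) \<in> borel_measurable torus" by measurable
    have "AE y in torus. y \<in> half_cube"
      unfolding torus_alt by (subst AE_density) (auto simp: indicator_def)
    then show "AE y in torus. (\<Sum>k\<in>F. h (y + k)) = periodize g (x - y) * f y"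
      by (rule AE_mp) (rule AE_I2, use sum_eq in blast)
  qed measurable
  finally show "(LINT y|lborel. g y * f (x - y)) = (LINT y|torus. periodize g (x - y) * f y)" .
qed

subsection \<open>Measures on the space-time slab\<close>

definition time_measure :: "real \<Rightarrow> real measure" where
  "time_measure T = density lborel (indicator {0<..<T})"

definition slab :: "real \<Rightarrow> (real \<times> (real ^ 'd)) measure" where
  "slab T = time_measure T \<Otimes>\<^sub>M torus"

lemma sets_time_measure [measurable_cong]: "sets (time_measure T) = sets borel"
  by (simp add: time_measure_def)

lemma space_time_measure [simp]: "space (time_measure T) = UNIV"
  by (simp add: time_measure_def)

lemma sets_slab [measurable_cong]: "sets (slab T) = sets (borel \<Otimes>\<^sub>M borel)"
  unfolding slab_def by (intro sets_pair_measure_cong sets_time_measure sets_torus)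

lemma space_slab [simp]: "space (slab T) = UNIV"
  by (simp add: slab_def space_pair_measure)

lemma finite_time_measure: "finite_measure (time_measure T)"
proof
  show "emeasure (time_measure T) (space (time_measure T)) \<noteq> \<infinity>"
    by (cases "0 \<le> T") (simp_all add: time_measure_def emeasure_density)
qed

global_interpretation time: finite_measure "time_measure T" for T
  by (rule finite_time_measure)

global_interpretation torus: prob_space "torus :: (real ^ 'd) measure"
  by (rule prob_space_torus)

global_interpretation tt: pair_sigma_finite "time_measure T" "torus :: (real ^ 'd) measure" for T ..

text \<open>The product form is the one to which Fubini's theorem applies; the density form is the
  one that occurs in \<open>in_Lp\<close> and \<open>reg\<close>.\<close>

lemma slab_eq_density: "slab T = density lborel (indicator (cylinder T))"
proof -
  have "sigma_finite_measure (density lborel (indicator (unit_cube :: (real ^ 'd) set)))"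
    using torus.sigma_finite_measure_axioms unfolding torus_def .
  then have "slab T = density (lborel \<Otimes>\<^sub>M lborel) (\<lambda>(t, x). indicator {0<..<T} t * indicator unit_cube x)"
    unfolding slab_def time_measure_def torus_def
    by (intro pair_measure_density) (auto simp: sigma_finite_lborel)
  also have "(\<lambda>(t, x::real ^ 'd). indicator {0<..<T} t * indicator unit_cube x)
      = (indicator (cylinder T) :: _ \<Rightarrow> ennreal)"
    by (auto simp: cylinder_def indicator_def)
  finally show ?thesis by (simp add: lborel_prod)
qed

lemma finite_slab: "finite_measure (slab T :: (real \<times> (real ^ 'd)) measure)"
proof
  have "emeasure (slab T :: (real \<times> (real ^ 'd)) measure) (UNIV \<times> UNIV)
      = emeasure (time_measure T) UNIV * emeasure (torus :: (real ^ 'd) measure) UNIV"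
    unfolding slab_def by (intro torus.emeasure_pair_measure_Times) auto
  also have "\<dots> \<noteq> \<infinity>"
    using time.emeasure_finite[of T UNIV] torus.emeasure_finite[of UNIV]
    by (simp add: ennreal_mult_eq_top_iff)
  finally show "emeasure (slab T :: (real \<times> (real ^ 'd)) measure) (space (slab T)) \<noteq> \<infinity>" by simp
qed

global_interpretation slab: finite_measure "slab T :: (real \<times> (real ^ 'd)) measure" for T
  by (rule finite_slab)

global_interpretation st: pair_sigma_finite "slab T :: (real \<times> (real ^ 'd)) measure"
  "torus :: (real ^ 'd) measure" for T ..

global_interpretation ss: pair_sigma_finite "slab T :: (real \<times> (real ^ 'd)) measure"
  "slab T :: (real \<times> (real ^ 'd)) measure" for T ..

lemma cylinder_measurable [measurable]: "cylinder T \<in> sets borel"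
  unfolding cylinder_def by (intro borel_Times) auto

lemma set_integrable_slab_iff:
  fixes f :: "real \<times> (real ^ 'd) \<Rightarrow> real"
  assumes "f \<in> borel_measurable borel"
  shows "set_integrable lborel (cylinder T) f \<longleftrightarrow> integrable (slab T) f"
  using integrable_density[of f lborel "indicator (cylinder T)"] assms
  unfolding slab_eq_density set_integrable_def by (simp add: ennreal_indicator)

lemma AE_time_measure_iff: "(AE t in time_measure T. P t) \<longleftrightarrow> (AE t in lborel. t \<in> {0<..<T} \<longrightarrow> P t)"
  unfolding time_measure_def by (subst AE_density) (auto simp: indicator_def)

text \<open>Mollification acts on one time slice at a time, so its exceptional sets are sets of
  times; here they become null sets of the slab.\<close>

lemma AE_slab_I:
  assumes "AE t in time_measure T. P t"
  shows "AE z in slab T. P (fst z)"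
proof -
  from assms obtain N where N: "{t. \<not> P t} \<subseteq> N" "N \<in> sets (time_measure T)" "emeasure (time_measure T) N = 0"
    by (auto elim!: AE_E)
  have "emeasure (slab T) (N \<times> (UNIV :: (real ^ 'd) set)) = 0"
    using torus.emeasure_pair_measure_Times[OF N(2), of UNIV] N(3) by (simp add: slab_def)
  moreover have "N \<times> (UNIV :: (real ^ 'd) set) \<in> sets (slab T)"
    unfolding slab_def using N(2) by (intro pair_measureI) (auto simp: sets_torus)
  ultimately show ?thesis
    using N(1) by (intro AE_I[where N = "N \<times> UNIV"]) auto
qed

subsection \<open>Convolution on the torus\<close>

definition conv :: "(real ^ 'd \<Rightarrow> real) \<Rightarrow> (real \<times> (real ^ 'd) \<Rightarrow> real) \<Rightarrow> real \<times> (real ^ 'd) \<Rightarrow> real" where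
  "conv k f z = (LINT y|torus. k (snd z - y) * f (fst z, y))"

definition smooth_periodic :: "(real ^ 'd \<Rightarrow> real) \<Rightarrow> bool" where
  "smooth_periodic k \<longleftrightarrow> smooth k \<and> periodic k"

abbreviation partial :: "'d \<Rightarrow> (real ^ 'd \<Rightarrow> real) \<Rightarrow> real ^ 'd \<Rightarrow> real" where
  "partial i k \<equiv> \<lambda>x. frechet_derivative k (at x) (axis i 1)"

lemma periodic_dird:
  assumes "periodic k" "\<And>x. k differentiable (at x)"
  shows "periodic (\<lambda>x. frechet_derivative k (at x) v)"
  unfolding periodic_def
proof (intro allI)
  fix x i
  have "frechet_derivative (\<lambda>x. k (x + axis i 1)) (at x) v = frechet_derivative k (at (x + axis i 1)) v"
    using frechet_derivative_affine_apply[OF assms(2) bounded_linear_ident, where x = x and c = "axis i 1" and v = v]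
    by simp
  moreover have "(\<lambda>x. k (x + axis i 1)) = k" using assms(1) by (auto simp: periodic_def)
  ultimately show "frechet_derivative k (at (x + axis i 1)) v = frechet_derivative k (at x) v" by simp
qed

lemma smooth_periodic_dird:
  "smooth_periodic k \<Longrightarrow> smooth_periodic (\<lambda>x. frechet_derivative k (at x) v)"
  unfolding smooth_periodic_def by (blast intro: smooth_dird periodic_dird smooth_differentiable)

lemma smooth_periodic_bounded:
  assumes "smooth_periodic k"
  obtains C where "\<And>x. \<bar>k x\<bar> \<le> C"
  using periodic_continuous_bounded[of k] assms smooth_continuous_on smooth_periodic_def by metis

lemma smooth_periodic_measurable [measurable_dest]: "smooth_periodic k \<Longrightarrow> k \<in> borel_measurable borel"
  by (simp add: smooth_periodic_def smooth_borel_measurable)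

text \<open>Periodicity bounds the partial derivatives, and \<open>L\<close> is the sum of these
  bounds. Linearity extends the bound from the axes to all directions, and the mean value inequality
  gives the Lipschitz estimate.\<close>

lemma smooth_periodic_lipschitz:
  assumes "smooth_periodic (k :: real ^ 'd \<Rightarrow> real)"
  obtains L where "\<And>x v. \<bar>frechet_derivative k (at x) v\<bar> \<le> L * norm v" "\<And>x y. \<bar>k x - k y\<bar> \<le> L * norm (x - y)"
proof -
  have sm: "smooth k" using assms by (simp add: smooth_periodic_def)
  have "\<forall>i. \<exists>C. \<forall>x. \<bar>partial i k x\<bar> \<le> C"
    using smooth_periodic_bounded[OF smooth_periodic_dird[OF assms]] by metis
  then obtain C where C: "\<And>i x. \<bar>partial i k x\<bar> \<le> C i" by metis
  define L where "L = (\<Sum>i\<in>UNIV. C i)"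
  have der: "\<bar>frechet_derivative k (at x) v\<bar> \<le> L * norm v" for x v
  proof -
    have "frechet_derivative k (at x) v = frechet_derivative k (at x) (\<Sum>i\<in>UNIV. v $ i *\<^sub>R axis i 1)"
      using basis_expansion[of v] by (simp add: scalar_mult_eq_scaleR)
    also have "\<dots> = (\<Sum>i\<in>UNIV. v $ i * partial i k x)"
      using linear_frechet_derivative_smooth[OF sm, of x] by (simp add: linear_sum linear_scale)
    also have "\<bar>\<dots>\<bar> \<le> (\<Sum>i\<in>UNIV. norm v * C i)"
    proof (rule order_trans[OF sum_abs], rule sum_mono)
      fix i show "\<bar>v $ i * partial i k x\<bar> \<le> norm v * C i"
        unfolding abs_mult by (rule mult_mono[OF component_le_norm_cart C]) auto
    qed
    finally show ?thesis by (simp add: L_def sum_distrib_left mult.commute)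
  qed
  have lip: "\<bar>k x - k y\<bar> \<le> L * norm (x - y)" for x y
  proof -
    have "norm (k x - k y) \<le> L * norm (x - y)"
    proof (rule differentiable_bound[of UNIV k "\<lambda>x. frechet_derivative k (at x)"])
      show "onorm (frechet_derivative k (at x)) \<le> L" for x
        by (rule onorm_le) (use der in simp)
    qed (use smooth_has_derivative[OF sm] in auto)
    then show ?thesis by simp
  qed
  show ?thesis by (rule that[OF der lip])
qed

lemma integrable_conv_integrand:
  assumes "smooth_periodic k" "integrable torus (\<lambda>y. f (t, y))"
  shows "integrable torus (\<lambda>y. k (x - y) * f (t, y))"
proof -
  obtain C where C: "\<And>x. \<bar>k x\<bar> \<le> C" using smooth_periodic_bounded[OF assms(1)] by blast
  have [measurable]: "k \<in> borel_measurable borel" using assms(1) by measurable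
  show ?thesis
    by (rule integrable_bounded_mult[OF assms(2) _ C]) measurable
qed

text \<open>Differentiation under the integral sign: the remainder of the kernel divided by
  \<open>norm h\<close> is bounded by \<open>2 * L\<close> uniformly in \<open>y\<close> and tends
  to 0 pointwise, while the slice of \<open>f\<close> is merely integrable.\<close>

lemma has_derivative_conv:
  fixes k :: "real ^ 'd \<Rightarrow> real"
  assumes sp: "smooth_periodic k" and int: "integrable torus (\<lambda>y. f (t, y))"
  shows "((\<lambda>x. conv k f (t, x)) has_derivative
    (\<lambda>v. conv (\<lambda>x. frechet_derivative k (at x) v) f (t, x))) (at x)"
proof -
  have sm: "smooth k" using sp by (simp add: smooth_periodic_def)
  have [measurable]: "k \<in> borel_measurable borel" using sp by measurable
  have [measurable]: "(\<lambda>x. frechet_derivative k (at x) v) \<in> borel_measurable borel" for v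
    using smooth_periodic_dird[OF sp, of v] by measurable
  have [measurable]: "(\<lambda>y. f (t, y)) \<in> borel_measurable torus" using int by measurable
  note ic = integrable_conv_integrand[OF sp int]
    and id = integrable_conv_integrand[OF smooth_periodic_dird[OF sp] int]
  obtain L where L: "\<And>x v. \<bar>frechet_derivative k (at x) v\<bar> \<le> L * norm v"
    "\<And>x y. \<bar>k x - k y\<bar> \<le> L * norm (x - y)" using smooth_periodic_lipschitz[OF sp] by blast
  have lin: "linear (frechet_derivative k (at y))" for y
    by (rule linear_frechet_derivative_smooth[OF sm])
  have "linear (\<lambda>v. conv (\<lambda>x. frechet_derivative k (at x) v) f (t, x))"
  proof (rule linearI)
    fix v w show "conv (\<lambda>x. frechet_derivative k (at x) (v + w)) f (t, x)
      = conv (\<lambda>x. frechet_derivative k (at x) v) f (t, x) + conv (\<lambda>x. frechet_derivative k (at x) w) f (t, x)"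
      using id[of x v] id[of x w] by (simp add: conv_def linear_add[OF lin] ring_distribs)
  next
    fix r v show "conv (\<lambda>x. frechet_derivative k (at x) (r *\<^sub>R v)) f (t, x)
      = r *\<^sub>R conv (\<lambda>x. frechet_derivative k (at x) v) f (t, x)"
      by (simp add: conv_def linear_scale[OF lin] mult.assoc)
  qed
  then have bl: "bounded_linear (\<lambda>v. conv (\<lambda>x. frechet_derivative k (at x) v) f (t, x))"
    by (simp add: linear_conv_bounded_linear)
  \<comment> \<open>For \<open>h = 0\<close> the division yields 0, and both sides of
    \<open>rem\<close> are then 0, so that identity needs no exception.\<close>
  define q where "q h y = (k (x + h - y) - k (x - y) - frechet_derivative k (at (x - y)) h) / norm h" for h y
  have rem: "norm (conv k f (t, x + h) - conv k f (t, x) - conv (\<lambda>x. frechet_derivative k (at x) h) f (t, x)) / norm h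
      = \<bar>LINT y|torus. q h y * f (t, y)\<bar>" for h
  proof -
    have "conv k f (t, x + h) - conv k f (t, x) - conv (\<lambda>x. frechet_derivative k (at x) h) f (t, x)
      = (LINT y|torus. (k (x + h - y) - k (x - y) - frechet_derivative k (at (x - y)) h) * f (t, y))"
      using ic[of "x + h"] ic[of x] id[of x h] by (simp add: conv_def left_diff_distrib)
    also have "\<dots> = (LINT y|torus. norm h * (q h y * f (t, y)))"
      by (cases "h = 0") (simp_all add: q_def linear_0[OF lin])
    finally have "conv k f (t, x + h) - conv k f (t, x) - conv (\<lambda>x. frechet_derivative k (at x) h) f (t, x)
      = norm h * (LINT y|torus. q h y * f (t, y))"
      by simp
    then show ?thesis by (cases "h = 0") (simp_all add: abs_mult q_def)
  qed
  have "(\<lambda>h. \<bar>LINT y|torus. q h y * f (t, y)\<bar>) \<midarrow>0\<rightarrow> 0"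
    unfolding tendsto_at_iff_sequentially comp_def
  proof (intro allI impI)
    fix X :: "nat \<Rightarrow> real ^ 'd"
    assume X: "\<forall>i. X i \<in> UNIV - {0}" "X \<longlonglongrightarrow> 0"
    have "(\<lambda>n. LINT y|torus. q (X n) y * f (t, y)) \<longlonglongrightarrow> (LINT y|(torus :: (real ^ 'd) measure). 0)"
    proof (rule integral_dominated_convergence)
      show "integrable torus (\<lambda>y. 2 * L * \<bar>f (t, y)\<bar>)" using int by simp
      show "AE y in torus. (\<lambda>n. q (X n) y * f (t, y)) \<longlonglongrightarrow> 0"
      proof (rule AE_I2)
        fix y
        have "(\<lambda>h. norm (k ((x - y) + h) - k (x - y) - frechet_derivative k (at (x - y)) h) / norm h) \<midarrow>0\<rightarrow> 0"
          using smooth_has_derivative[OF sm, of "x - y"] unfolding has_derivative_at by blast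
        then have "(\<lambda>h. norm (q h y)) \<midarrow>0\<rightarrow> 0" by (simp add: q_def add_diff_eq diff_add_eq)
        then have "(\<lambda>h. q h y) \<midarrow>0\<rightarrow> 0" by (rule tendsto_norm_zero_cancel)
        then have "(\<lambda>n. q (X n) y) \<longlonglongrightarrow> 0"
          using X unfolding tendsto_at_iff_sequentially comp_def by blast
        then show "(\<lambda>n. q (X n) y * f (t, y)) \<longlonglongrightarrow> 0" by (rule tendsto_mult_left_zero)
      qed
      show "AE y in torus. norm (q (X n) y * f (t, y)) \<le> 2 * L * \<bar>f (t, y)\<bar>" for n
      proof (rule AE_I2)
        fix y
        have "norm (X n) > 0" using X(1) by simp
        moreover have "\<bar>k (x + X n - y) - k (x - y) - frechet_derivative k (at (x - y)) (X n)\<bar> \<le> 2 * L * norm (X n)"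
          using L(1)[of "x - y" "X n"] L(2)[of "x + X n - y" "x - y"] by simp
        ultimately have "\<bar>q (X n) y\<bar> \<le> 2 * L" by (simp add: q_def abs_divide divide_le_eq)
        then show "norm (q (X n) y * f (t, y)) \<le> 2 * L * \<bar>f (t, y)\<bar>"
          by (simp add: abs_mult mult_right_mono)
      qed
      show "(\<lambda>y. q (X n) y * f (t, y)) \<in> borel_measurable torus" for n
        unfolding q_def by measurable
    qed measurable
    then show "(\<lambda>n. \<bar>LINT y|torus. q (X n) y * f (t, y)\<bar>) \<longlonglongrightarrow> 0"
      by (intro tendsto_rabs_zero) simp
  qed
  then show ?thesis unfolding has_derivative_at rem using bl by simp
qed

subsection \<open>Lebesgue classes on the slab\<close>

text \<open>The scalar counterpart of \<open>in_Lp\<close>. Periodicity is not part of it, since an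
  integral over the slab sees a single period.\<close>

definition Lp :: "real \<Rightarrow> real \<Rightarrow> (real \<times> (real ^ 'd) \<Rightarrow> real) \<Rightarrow> bool" where
  "Lp T p f \<longleftrightarrow> f \<in> borel_measurable (borel \<Otimes>\<^sub>M borel) \<and> integrable (slab T) (\<lambda>z. \<bar>f z\<bar> powr p)"

lemma Lp_measurable [measurable_dest]: "Lp T p f \<Longrightarrow> f \<in> borel_measurable (borel \<Otimes>\<^sub>M borel)"
  by (simp add: Lp_def)

lemma Lp_integrable_powr: "Lp T p f \<Longrightarrow> integrable (slab T) (\<lambda>z. \<bar>f z\<bar> powr p)"
  by (simp add: Lp_def)

lemma Lp_dominated:
  assumes [measurable]: "f \<in> borel_measurable (borel \<Otimes>\<^sub>M borel)" and "integrable (slab T) g"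
    and le: "\<And>z. \<bar>f z\<bar> powr p \<le> g z"
  shows "Lp T p f"
  unfolding Lp_def
proof (intro conjI assms(1))
  show "integrable (slab T) (\<lambda>z. \<bar>f z\<bar> powr p)"
  proof (rule Bochner_Integration.integrable_bound[OF assms(2)])
    have "\<bar>f z\<bar> powr p \<le> \<bar>g z\<bar>" for z using le[of z] by linarith
    then show "AE z in slab T. norm (\<bar>f z\<bar> powr p) \<le> norm (g z)" by simp
  qed measurable
qed

lemma Lp_mult_bounded:
  assumes "Lp T p f" and [measurable]: "g \<in> borel_measurable (borel \<Otimes>\<^sub>M borel)"
    and "\<And>z. \<bar>g z\<bar> \<le> C" and "0 \<le> p"
  shows "Lp T p (\<lambda>z. g z * f z)"
proof (rule Lp_dominated)
  show "(\<lambda>z. g z * f z) \<in> borel_measurable (borel \<Otimes>\<^sub>M borel)"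
    using assms(1) by measurable
  show "integrable (slab T) (\<lambda>z. C powr p * \<bar>f z\<bar> powr p)"
    using Lp_integrable_powr[OF assms(1)] by simp
  fix z
  have "\<bar>g z\<bar> powr p \<le> C powr p" using assms(3,4) by (intro powr_mono2) auto
  then show "\<bar>g z * f z\<bar> powr p \<le> C powr p * \<bar>f z\<bar> powr p"
    by (simp add: abs_mult powr_mult mult_right_mono)
qed

lemma Lp_cmult: "Lp T p f \<Longrightarrow> 0 \<le> p \<Longrightarrow> Lp T p (\<lambda>z. c * f z)"
  by (rule Lp_mult_bounded[where C = "\<bar>c\<bar>"]) auto

lemma Lp_add:
  assumes "Lp T p f" "Lp T p g" "0 \<le> p"
  shows "Lp T p (\<lambda>z. f z + g z)"
proof (rule Lp_dominated)
  have [measurable]: "f \<in> borel_measurable (borel \<Otimes>\<^sub>M borel)" "g \<in> borel_measurable (borel \<Otimes>\<^sub>M borel)"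
    using assms by measurable
  show "(\<lambda>z. f z + g z) \<in> borel_measurable (borel \<Otimes>\<^sub>M borel)" by measurable
  show "integrable (slab T) (\<lambda>z. 2 powr p * (\<bar>f z\<bar> powr p + \<bar>g z\<bar> powr p))"
    using Lp_integrable_powr[OF assms(1)] Lp_integrable_powr[OF assms(2)] by simp
  fix z
  define m where "m = max \<bar>f z\<bar> \<bar>g z\<bar>"
  have "\<bar>f z + g z\<bar> powr p \<le> (2 * m) powr p"
    using assms(3) by (intro powr_mono2) (auto simp: m_def)
  also have "\<dots> = 2 powr p * m powr p" by (simp add: powr_mult m_def)
  also have "m powr p \<le> \<bar>f z\<bar> powr p + \<bar>g z\<bar> powr p" by (auto simp: m_def max_def)
  finally show "\<bar>f z + g z\<bar> powr p \<le> 2 powr p * (\<bar>f z\<bar> powr p + \<bar>g z\<bar> powr p)" by simp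
qed

lemma Lp_uminus: "Lp T p f \<Longrightarrow> Lp T p (\<lambda>z. - f z)"
  unfolding Lp_def by (auto intro: borel_measurable_uminus)

lemma Lp_zero: "Lp T p (\<lambda>z. 0)"
  unfolding Lp_def by auto

lemma Lp_diff: "Lp T p f \<Longrightarrow> Lp T p g \<Longrightarrow> 0 \<le> p \<Longrightarrow> Lp T p (\<lambda>z. f z - g z)"
  using Lp_add[of T p f "\<lambda>z. - g z"] Lp_uminus[of T p g] by simp

lemma Lp_sum: "(\<And>i. i \<in> I \<Longrightarrow> Lp T p (f i)) \<Longrightarrow> 0 \<le> p \<Longrightarrow> Lp T p (\<lambda>z. \<Sum>i\<in>I. f i z)"
proof (induction I rule: infinite_finite_induct)
  case (insert i I)
  then show ?case by (simp add: Lp_add)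
qed (auto simp: Lp_zero)

text \<open>The slab has finite measure: where the modulus of \<open>f\<close> is at most 1, the
  constant 1 dominates, and elsewhere the higher power does.\<close>

lemma Lp_mono:
  assumes "Lp T p f" "p' \<le> p" "0 \<le> p'"
  shows "Lp T p' f"
proof (rule Lp_dominated[where g = "\<lambda>z. 1 + \<bar>f z\<bar> powr p"])
  show "f \<in> borel_measurable (borel \<Otimes>\<^sub>M borel)" using assms(1) by measurable
  show "integrable (slab T) (\<lambda>z. 1 + \<bar>f z\<bar> powr p)"
    using Lp_integrable_powr[OF assms(1)] by simp
  fix z
  show "\<bar>f z\<bar> powr p' \<le> 1 + \<bar>f z\<bar> powr p"
  proof (cases "\<bar>f z\<bar> \<le> 1")
    case True
    then have "\<bar>f z\<bar> powr p' \<le> 1 powr p'" using assms(3) by (intro powr_mono2) auto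
    then show ?thesis by (simp add: add_increasing2)
  next
    case False
    then have "\<bar>f z\<bar> powr p' \<le> \<bar>f z\<bar> powr p" using assms(2) by (intro powr_mono) auto
    then show ?thesis by simp
  qed
qed

lemma Lp_3_imp: "Lp T 3 f \<Longrightarrow> Lp T (3/2) f"
  by (rule Lp_mono) auto

lemma Lp_imp_integrable:
  assumes "Lp T p f" "1 \<le> p" shows "integrable (slab T) f"
proof -
  have "Lp T 1 f" using assms by (rule Lp_mono) auto
  then have "integrable (slab T) (\<lambda>z. \<bar>f z\<bar>)" by (simp add: Lp_def powr_one_gt_zero_iff)
  moreover have "f \<in> borel_measurable (slab T)" using assms(1) by measurable
  ultimately show ?thesis using integrable_norm_iff[of f "slab T"] by simp
qed

text \<open>Either \<open>b\<close> is at most the square root of \<open>a\<close>, and the product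
  is at most the first summand, or \<open>a\<close> is below the square of \<open>b\<close>, and the
  product is at most the second.\<close>

lemma young_32_3:
  fixes a b :: real assumes "0 \<le> a" "0 \<le> b"
  shows "a * b \<le> a powr (3/2) + b powr 3"
proof (cases "b \<le> a powr (1/2)")
  case True
  have "a * b \<le> a * a powr (1/2)" using True assms by (intro mult_left_mono)
  also have "\<dots> = a powr (3/2)"
    using powr_add[of a 1 "1/2"] assms(1) by (cases "a = 0") (simp_all add: powr_one)
  finally show ?thesis by (simp add: add_increasing2)
next
  case False
  then have "(a powr (1/2)) powr 2 \<le> b powr 2" by (intro powr_mono2) auto
  then have "a \<le> b powr 2" using assms(1) by (simp add: powr_powr)
  then have "a * b \<le> b powr 2 * b" using assms(2) by (intro mult_right_mono)
  also have "\<dots> = b powr 3"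
    using powr_add[of b 2 1] assms(2) by (cases "b = 0") (simp_all add: powr_one)
  finally show ?thesis by (simp add: add_increasing)
qed

lemma integrable_Lp_32_3:
  assumes "Lp T (3/2) f" "Lp T 3 g"
  shows "integrable (slab T) (\<lambda>z. f z * g z)"
proof (rule Bochner_Integration.integrable_bound)
  show "integrable (slab T) (\<lambda>z. \<bar>f z\<bar> powr (3/2) + \<bar>g z\<bar> powr 3)"
    by (intro Bochner_Integration.integrable_add Lp_integrable_powr assms)
  show "AE z in slab T. norm (f z * g z) \<le> norm (\<bar>f z\<bar> powr (3/2) + \<bar>g z\<bar> powr 3)"
    using young_32_3 by (intro AE_I2) (simp add: abs_mult)
  show "(\<lambda>z. f z * g z) \<in> borel_measurable (slab T)" using assms by measurable
qed

lemma Lp_3_mult: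
  assumes "Lp T 3 f" "Lp T 3 g"
  shows "Lp T (3/2) (\<lambda>z. f z * g z)"
proof (rule Lp_dominated)
  show "(\<lambda>z. f z * g z) \<in> borel_measurable (borel \<Otimes>\<^sub>M borel)" using assms by measurable
  show "integrable (slab T) (\<lambda>z. \<bar>f z\<bar> powr 3 + \<bar>g z\<bar> powr 3)"
    by (intro Bochner_Integration.integrable_add Lp_integrable_powr assms)
  fix z
  define m where "m = max \<bar>f z\<bar> \<bar>g z\<bar>"
  have "\<bar>f z * g z\<bar> powr (3/2) \<le> (m * m) powr (3/2)"
    unfolding abs_mult by (intro powr_mono2 mult_mono) (auto simp: m_def)
  also have "\<dots> = m powr 3"
    using powr_add[of m "3/2" "3/2"] powr_mult[of m m "3/2"] by (simp add: m_def del: powr_numeral)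
  also have "\<dots> \<le> \<bar>f z\<bar> powr 3 + \<bar>g z\<bar> powr 3" by (auto simp: m_def max_def)
  finally show "\<bar>f z * g z\<bar> powr (3/2) \<le> \<bar>f z\<bar> powr 3 + \<bar>g z\<bar> powr 3" .
qed

lemma Lp_slice_integrable:
  assumes "Lp T p f" "1 \<le> p"
  shows "AE t in time_measure T. integrable torus (\<lambda>y. f (t, y))"
  using Lp_imp_integrable[OF assms] unfolding slab_def by (rule tt.AE_integrable_fst')

lemma integrable_slab_fst:
  fixes g :: "real \<Rightarrow> real"
  assumes "integrable (time_measure T) g"
  shows "integrable (slab T) (\<lambda>z. g (fst z))"
  unfolding slab_def
proof (rule tt.Fubini_integrable)
  have [measurable]: "g \<in> borel_measurable (time_measure T)" using assms by measurable
  show "(\<lambda>z. g (fst z)) \<in> borel_measurable (time_measure T \<Otimes>\<^sub>M torus)" by measurable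
qed (use assms in \<open>simp_all add: torus.prob_space[simplified]\<close>)

lemma conv_measurable:
  assumes [measurable]: "k \<in> borel_measurable borel" "f \<in> borel_measurable (borel \<Otimes>\<^sub>M borel)"
  shows "conv k f \<in> borel_measurable (borel \<Otimes>\<^sub>M borel)"
  unfolding conv_def by measurable

text \<open>The kernel is bounded, so the convolution at time \<open>t\<close> is at most a constant
  times the mean of the modulus of \<open>f\<close> over the slice. Jensen's inequality on the
  probability space \<open>torus\<close> bounds the power of this mean by the mean of the powers,
  which is integrable in time.\<close>

lemma Lp_conv:
  assumes k: "smooth_periodic k" and f: "Lp T p f" and p: "1 \<le> p"
  shows "Lp T p (conv k f)"
proof -
  have [measurable]: "k \<in> borel_measurable borel" "f \<in> borel_measurable (borel \<Otimes>\<^sub>M borel)"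
    using k f by measurable
  have meas [measurable]: "conv k f \<in> borel_measurable (borel \<Otimes>\<^sub>M borel)"
    by (rule conv_measurable) measurable
  obtain C where C: "\<And>x. \<bar>k x\<bar> \<le> C" using smooth_periodic_bounded[OF k] by blast
  have C0: "0 \<le> C" using C[of 0] by linarith
  \<comment> \<open>Adding 1 keeps the averaged function in the open half-line of positive numbers,
    on which Jensen's inequality is applied.\<close>
  have L1: "Lp T p (\<lambda>z. 1 + \<bar>f z\<bar>)"
  proof (rule Lp_add)
    show "Lp T p (\<lambda>z. 1)" unfolding Lp_def by simp
    show "Lp T p (\<lambda>z. \<bar>f z\<bar>)" using f unfolding Lp_def by simp
  qed (use p in simp)
  define g where "g t = (LINT y|torus. (1 + \<bar>f (t, y)\<bar>) powr p)" for t
  have intp: "integrable (slab T) (\<lambda>z. (1 + \<bar>f z\<bar>) powr p)"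
    using Lp_integrable_powr[OF L1] by (simp add: abs_of_nonneg add_nonneg_nonneg)
  have int_g: "integrable (slab T) (\<lambda>z. C powr p * g (fst z))"
    using integrable_slab_fst[OF tt.integrable_fst'[OF intp[unfolded slab_def]]]
    unfolding g_def by (intro integrable_mult_right) simp
  have AEp: "AE t in time_measure T. integrable torus (\<lambda>y. (1 + \<bar>f (t, y)\<bar>) powr p)"
    using tt.AE_integrable_fst'[OF intp[unfolded slab_def]] by simp
  have bound: "\<bar>conv k f (t, x)\<bar> powr p \<le> C powr p * g t"
    if i1: "integrable torus (\<lambda>y. f (t, y))"
      and ip: "integrable torus (\<lambda>y. (1 + \<bar>f (t, y)\<bar>) powr p)" for t x
  proof -
    have i1': "integrable torus (\<lambda>y. 1 + \<bar>f (t, y)\<bar>)" using i1 by simp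
    have ik: "integrable torus (\<lambda>y. k (x - y) * f (t, y))"
      by (rule integrable_conv_integrand[OF k i1])
    have "\<bar>conv k f (t, x)\<bar> \<le> (LINT y|torus. \<bar>k (x - y) * f (t, y)\<bar>)"
      unfolding conv_def using integral_abs_bound by simp
    also have "\<dots> \<le> (LINT y|torus. C * (1 + \<bar>f (t, y)\<bar>))"
    proof (rule integral_mono)
      show "integrable torus (\<lambda>y. \<bar>k (x - y) * f (t, y)\<bar>)" using ik by simp
      show "integrable torus (\<lambda>y. C * (1 + \<bar>f (t, y)\<bar>))" using i1' by simp
      show "\<bar>k (x - y) * f (t, y)\<bar> \<le> C * (1 + \<bar>f (t, y)\<bar>)" for y
        unfolding abs_mult using C C0 by (intro mult_mono) auto
    qed
    also have "\<dots> = C * (LINT y|torus. 1 + \<bar>f (t, y)\<bar>)" by simp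
    finally have "\<bar>conv k f (t, x)\<bar> powr p \<le> (C * (LINT y|torus. 1 + \<bar>f (t, y)\<bar>)) powr p"
      using p by (intro powr_mono2) auto
    also have "\<dots> = C powr p * (LINT y|torus. 1 + \<bar>f (t, y)\<bar>) powr p"
      by (rule powr_mult)
    also have "(LINT y|torus. 1 + \<bar>f (t, y)\<bar>) powr p \<le> g t"
      unfolding g_def
      by (rule torus.jensens_inequality[OF i1' _ _ ip powr_convex[OF p], where a = 0]) (auto intro: add_pos_nonneg)
    finally show ?thesis by (simp add: mult_left_mono)
  qed
  have AE1: "AE t in time_measure T. \<forall>x. \<bar>conv k f (t, x)\<bar> powr p \<le> C powr p * g t"
    using Lp_slice_integrable[OF f p] AEp by eventually_elim (blast intro: bound)
  show ?thesis
    unfolding Lp_def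
  proof (intro conjI meas Bochner_Integration.integrable_bound[OF int_g])
    have "AE z in slab T. \<forall>x. \<bar>conv k f (fst z, x)\<bar> powr p \<le> C powr p * g (fst z)"
      using AE_slab_I[OF AE1] .
    then show "AE z in slab T. norm (\<bar>conv k f z\<bar> powr p) \<le> norm (C powr p * g (fst z))"
    proof eventually_elim
      case (elim z)
      then have "\<bar>conv k f z\<bar> powr p \<le> C powr p * g (fst z)" by (metis prod.collapse)
      then show ?case by simp
    qed
  qed measurable
qed

subsection \<open>Mollification as convolution on the torus\<close>

definition kernel :: "(real ^ 'd \<Rightarrow> real) \<Rightarrow> real \<Rightarrow> real ^ 'd \<Rightarrow> real" where
  "kernel \<rho> l = periodize (\<lambda>y. \<rho> (y /\<^sub>R l) / l ^ CARD('d))"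

lemma scaled_mollifier:
  fixes \<rho> :: "real ^ 'd \<Rightarrow> real"
  assumes "mollifier \<rho>" "0 < l"
  shows "smooth (\<lambda>y. \<rho> (y /\<^sub>R l) / l ^ CARD('d))"
    and "\<exists>B. \<forall>y. B < norm y \<longrightarrow> \<rho> (y /\<^sub>R l) / l ^ CARD('d) = 0"
proof -
  have "smooth (\<lambda>y. \<rho> (y /\<^sub>R l + 0))"
    by (rule smooth_affine[OF mollifierD(1)[OF assms(1)] bounded_linear_scaleR_right])
  then have "smooth (\<lambda>y. (1 / l ^ CARD('d)) * \<rho> (y /\<^sub>R l))"
    by (intro smooth_mult smooth_const) simp
  then show "smooth (\<lambda>y. \<rho> (y /\<^sub>R l) / l ^ CARD('d))" by simp
  obtain B where B: "\<And>x. \<rho> x \<noteq> 0 \<Longrightarrow> norm x \<le> B"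
    using mollifierD(4)[OF assms(1)] unfolding bounded_iff by auto
  have "\<rho> (y /\<^sub>R l) = 0" if "l * B < norm y" for y
  proof (rule ccontr)
    assume "\<rho> (y /\<^sub>R l) \<noteq> 0"
    then have "norm (y /\<^sub>R l) \<le> B" by (rule B)
    then show False using that assms(2) by (simp add: field_simps)
  qed
  then show "\<exists>B. \<forall>y. B < norm y \<longrightarrow> \<rho> (y /\<^sub>R l) / l ^ CARD('d) = 0"
    by (intro exI[of _ "l * B"]) simp
qed

lemma smooth_periodic_kernel:
  assumes "mollifier \<rho>" "0 < l"
  shows "smooth_periodic (kernel \<rho> l)"
proof -
  obtain B where "\<And>y. B < norm y \<Longrightarrow> \<rho> (y /\<^sub>R l) / l ^ CARD('a) = 0"
    using scaled_mollifier(2)[OF assms] by blast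
  then show ?thesis
    unfolding smooth_periodic_def kernel_def
    using smooth_periodize[OF scaled_mollifier(1)[OF assms]] periodic_periodize by blast
qed

text \<open>The functional \<open>L\<close> reduces vector- and matrix-valued mollification to
  scalar convolution: it is the identity for the pressure, a coordinate for \<open>u\<close> and an
  entry for the tensor product.\<close>

lemma mollify_eq_conv:
  fixes f :: "real \<times> (real ^ 'd) \<Rightarrow> 'b::euclidean_space"
  assumes \<rho>: "mollifier \<rho>" "0 < l"
    and f: "f \<in> borel_measurable borel" "space_periodic f"
    and int: "integrable torus (\<lambda>y. f (t, y))"
    and L: "bounded_linear L"
  shows "L (mollify \<rho> l f (t, x)) = conv (kernel \<rho> l) (\<lambda>z. L (f z)) (t, x)"
proof -
  define g where "g y = \<rho> (y /\<^sub>R l) / l ^ CARD('d)" for y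
  have sg: "smooth g" unfolding g_def using scaled_mollifier(1)[OF \<rho>] .
  obtain B where supp: "\<And>y. B < norm y \<Longrightarrow> g y = 0"
    using scaled_mollifier(2)[OF \<rho>] unfolding g_def by blast
  have g0: "0 \<le> g y" for y using mollifierD(2)[OF \<rho>(1)] \<rho>(2) by (simp add: g_def)
  have [measurable]: "g \<in> borel_measurable borel" by (rule smooth_borel_measurable[OF sg])
  have ft [measurable]: "(\<lambda>y. f (t, y)) \<in> borel_measurable borel"
    using measurable_compose[OF _ f(1), of "\<lambda>y. (t, y)" borel] by (simp add: borel_measurable_Pair)
  have per: "periodic (\<lambda>y. f (t, y))" using f(2) by (simp add: space_periodic_def periodic_def)
  have per_n: "periodic (\<lambda>y. norm (f (t, y)))" and per_L: "periodic (\<lambda>y. L (f (t, y)))"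
    using per by (simp_all add: periodic_def)
  have [measurable]: "L \<in> borel_measurable borel"
    using L by (intro borel_measurable_continuous_onI linear_continuous_on)
  have "integrable lborel (\<lambda>y. g y * norm (f (t, x - y)))"
    by (rule convolution_unfold(1)[OF sg supp _ per_n]) (use int in auto)
  then have "integrable lborel (\<lambda>y. norm (g y *\<^sub>R f (t, x - y)))"
    using g0 by simp
  then have int': "integrable lborel (\<lambda>y. g y *\<^sub>R f (t, x - y))"
    by (subst (asm) integrable_norm_iff) auto
  have "L (mollify \<rho> l f (t, x)) = L (LINT y|lborel. g y *\<^sub>R f (t, x - y))"
    by (simp add: mollify_def g_def)
  also have "\<dots> = (LINT y|lborel. L (g y *\<^sub>R f (t, x - y)))"
    by (rule integral_bounded_linear[OF L int', symmetric])
  also have "\<dots> = (LINT y|lborel. g y * L (f (t, x - y)))"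
    using L by (simp add: linear_simps bounded_linear.linear linear_scale)
  also have "\<dots> = (LINT y|torus. periodize g (x - y) * L (f (t, y)))"
    by (rule convolution_unfold(2)[OF sg supp _ per_L])
      (use integrable_bounded_linear[OF L int] in auto)
  also have "periodize g = kernel \<rho> l" unfolding kernel_def g_def ..
  finally show ?thesis by (simp add: conv_def)
qed

lemma in_Lp_imp_Lp:
  assumes "in_Lp T p f" and [measurable]: "L \<in> borel_measurable borel"
    and "\<And>x. \<bar>L x\<bar> \<le> norm x" and "0 \<le> p"
  shows "Lp T p (\<lambda>z. L (f z))"
proof (rule Lp_dominated)
  have [measurable]: "f \<in> borel_measurable (borel \<Otimes>\<^sub>M borel)"
    using assms(1) by (simp add: in_Lp_def borel_prod)
  have "(\<lambda>z. norm (f z) powr p) \<in> borel_measurable borel"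
    using assms(1) by (auto simp: in_Lp_def)
  then show "integrable (slab T) (\<lambda>z. norm (f z) powr p)"
    using assms(1) set_integrable_slab_iff[of "\<lambda>z. norm (f z) powr p" T] by (simp add: in_Lp_def)
  show "(\<lambda>z. L (f z)) \<in> borel_measurable (borel \<Otimes>\<^sub>M borel)" by measurable
  show "\<bar>L (f z)\<bar> powr p \<le> norm (f z) powr p" for z
    using assms(3,4) by (intro powr_mono2) auto
qed

lemma borel_measurable_slice:
  fixes f :: "real \<times> (real ^ 'd) \<Rightarrow> 'b::euclidean_space"
  assumes "f \<in> borel_measurable borel" shows "(\<lambda>y. f (t, y)) \<in> borel_measurable torus"
proof -
  have "(\<lambda>y :: real ^ 'd. (t, y)) \<in> borel_measurable borel"
    by (rule borel_measurable_Pair) auto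
  from measurable_compose[OF this assms] show ?thesis
    by (simp add: measurable_cong_sets[OF sets_torus refl])
qed

lemma in_Lp_slice_integrable:
  fixes f :: "real \<times> (real ^ 'd) \<Rightarrow> 'b::euclidean_space"
  assumes "in_Lp T p f" "1 \<le> p"
  shows "AE t in time_measure T. integrable torus (\<lambda>y. f (t, y))"
proof -
  have f: "f \<in> borel_measurable borel" using assms(1) by (simp add: in_Lp_def)
  have "Lp T p (\<lambda>z. norm (f z))"
    by (rule in_Lp_imp_Lp[OF assms(1)]) (use assms(2) in auto)
  from Lp_slice_integrable[OF this assms(2)] show ?thesis
    by eventually_elim (simp add: integrable_norm_iff[OF borel_measurable_slice[OF f]])
qed

lemma Lp_component: "in_Lp T p u \<Longrightarrow> 0 \<le> p \<Longrightarrow> Lp T p (\<lambda>z. u z $ i)"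
  by (rule in_Lp_imp_Lp) (auto simp: component_le_norm_cart
      intro: borel_measurable_continuous_onI continuous_on_component)

lemma tensor_component: "(a \<otimes>\<^sub>v b) $ i $ j = a $ i * b $ j"
  by (simp add: tensor_def)

lemma continuous_on_tensor: "continuous_on UNIV (\<lambda>a :: real ^ 'd. a \<otimes>\<^sub>v a)"
  unfolding tensor_def by (intro continuous_on_vec_lambda continuous_intros)

lemma norm_le_sum_entries: "norm (A :: real ^ 'd ^ 'e) \<le> (\<Sum>i\<in>UNIV. \<Sum>j\<in>UNIV. \<bar>A $ i $ j\<bar>)"
proof -
  have "norm A \<le> (\<Sum>i\<in>UNIV. norm (A $ i))" unfolding norm_vec_def by (rule L2_set_le_sum) simp
  also have "\<dots> \<le> (\<Sum>i\<in>UNIV. \<Sum>j\<in>UNIV. \<bar>A $ i $ j\<bar>)" by (intro sum_mono norm_le_l1_cart)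
  finally show ?thesis .
qed

text \<open>The mollified tensor is a matrix-valued integral, which is 0 by default at
  non-integrable slices; only integrability of the whole matrix lets its entries be identified with
  convolutions of products. The entries are products of two functions in L^3.\<close>

lemma tensor_slice_integrable:
  assumes u: "in_Lp T 3 u"
  shows "AE t in time_measure T. integrable torus (\<lambda>y. u (t, y) \<otimes>\<^sub>v u (t, y))"
proof -
  have "Lp T (3/2) (\<lambda>z. \<bar>u z $ i * u z $ j\<bar>)" for i j
    using Lp_3_mult[OF Lp_component[OF u, of i] Lp_component[OF u, of j]]
    unfolding Lp_def by (auto simp only: abs_idempotent intro: borel_measurable_abs)
  then have "Lp T (3/2) (\<lambda>z. \<Sum>i\<in>UNIV. \<Sum>j\<in>UNIV. \<bar>u z $ i * u z $ j\<bar>)"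
    by (intro Lp_sum) auto
  from Lp_slice_integrable[OF this] have
    "AE t in time_measure T. integrable torus (\<lambda>y. \<Sum>i\<in>UNIV. \<Sum>j\<in>UNIV. \<bar>u (t, y) $ i * u (t, y) $ j\<bar>)"
    by simp
  then show ?thesis
  proof eventually_elim
    case (elim t)
    show ?case
    proof (rule Bochner_Integration.integrable_bound[OF elim])
      have "u \<in> borel_measurable borel" using u by (simp add: in_Lp_def)
      then have "(\<lambda>z. u z \<otimes>\<^sub>v u z) \<in> borel_measurable borel"
        by (rule measurable_compose) (rule borel_measurable_continuous_onI[OF continuous_on_tensor])
      then show "(\<lambda>y. u (t, y) \<otimes>\<^sub>v u (t, y)) \<in> borel_measurable torus"
        by (rule borel_measurable_slice)
      show "AE y in torus. norm (u (t, y) \<otimes>\<^sub>v u (t, y))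
          \<le> norm (\<Sum>i\<in>UNIV. \<Sum>j\<in>UNIV. \<bar>u (t, y) $ i * u (t, y) $ j\<bar>)"
      proof (rule AE_I2)
        fix y
        have "norm (u (t, y) \<otimes>\<^sub>v u (t, y)) \<le> (\<Sum>i\<in>UNIV. \<Sum>j\<in>UNIV. \<bar>u (t, y) $ i * u (t, y) $ j\<bar>)"
          using norm_le_sum_entries[of "u (t, y) \<otimes>\<^sub>v u (t, y)"] by (simp add: tensor_def)
        then show "norm (u (t, y) \<otimes>\<^sub>v u (t, y)) \<le> norm (\<Sum>i\<in>UNIV. \<Sum>j\<in>UNIV. \<bar>u (t, y) $ i * u (t, y) $ j\<bar>)"
          unfolding real_norm_def by linarith
      qed
    qed
  qed
qed

lemma grad_x_component:
  fixes v :: "real \<times> (real ^ 'd) \<Rightarrow> real ^ 'd"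
  assumes "\<And>i. ((\<lambda>y. v (t, y) $ i) has_derivative D i) (at x)"
  shows "grad_x v (t, x) $ i $ j = D i (axis j 1)"
proof -
  have "((\<lambda>y. v (t, y)) has_derivative (\<lambda>h. \<chi> i. D i h)) (at x)"
    unfolding has_derivative_componentwise_within[of "\<lambda>y. v (t, y)"]
    using assms by (auto simp: Basis_vec_def inner_axis)
  from frechet_derivative_at[OF this, symmetric] show ?thesis
    by (simp add: grad_x_def jacobian_def matrix_def)
qed

lemma AE_mollify_scalar:
  assumes "mollifier \<rho>" "0 < l" "in_Lp T p q" "1 \<le> p"
  shows "AE z in slab T. mollify \<rho> l q z = conv (kernel \<rho> l) q z"
proof -
  have "AE t in time_measure T. \<forall>x. mollify \<rho> l q (t, x) = conv (kernel \<rho> l) q (t, x)"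
    using in_Lp_slice_integrable[OF assms(3,4)]
  proof eventually_elim
    case (elim t)
    show ?case
      using mollify_eq_conv[OF assms(1,2) _ _ elim bounded_linear_ident] assms(3)
      by (simp add: in_Lp_def)
  qed
  from AE_slab_I[OF this] show ?thesis by eventually_elim (metis prod.collapse)
qed

text \<open>At a time where the slices of \<open>u\<close> and of its tensor square are integrable,
  all three statements hold at every \<open>x\<close>; the last one is the product rule. The
  divergence of the mollified field is kept in it, because the constraint is brought in only
  later.\<close>

lemma AE_mollify_vector:
  fixes u :: "real \<times> (real ^ 'd) \<Rightarrow> real ^ 'd"
  assumes \<rho>: "mollifier \<rho>" "0 < l" and u: "in_Lp T 3 u"
  defines "k \<equiv> kernel \<rho> l"
  shows "AE z in slab T.
    (\<forall>i. mollify \<rho> l u z $ i = conv k (\<lambda>z. u z $ i) z) \<and>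
    (\<forall>i j. grad_x (mollify \<rho> l u) z $ i $ j = conv (partial j k) (\<lambda>z. u z $ i) z) \<and>
    (\<forall>i. div_x (R_stress \<rho> l u) z $ i = (\<Sum>j\<in>UNIV.
      conv k (\<lambda>z. u z $ i) z * conv (partial j k) (\<lambda>z. u z $ j) z
      + conv (partial j k) (\<lambda>z. u z $ i) z * conv k (\<lambda>z. u z $ j) z
      - conv (partial j k) (\<lambda>z. u z $ i * u z $ j) z))"
proof -
  have k: "smooth_periodic k" unfolding k_def by (rule smooth_periodic_kernel[OF \<rho>])
  have mu: "u \<in> borel_measurable borel" "space_periodic u" using u by (simp_all add: in_Lp_def)
  have muu: "(\<lambda>z. u z \<otimes>\<^sub>v u z) \<in> borel_measurable borel" "space_periodic (\<lambda>z. u z \<otimes>\<^sub>v u z)"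
    using mu measurable_compose[OF mu(1) borel_measurable_continuous_onI[OF continuous_on_tensor]]
    by (simp_all add: space_periodic_def)
  have "AE t in time_measure T. \<forall>x.
    (\<forall>i. mollify \<rho> l u (t, x) $ i = conv k (\<lambda>z. u z $ i) (t, x)) \<and>
    (\<forall>i j. grad_x (mollify \<rho> l u) (t, x) $ i $ j = conv (partial j k) (\<lambda>z. u z $ i) (t, x)) \<and>
    (\<forall>i. div_x (R_stress \<rho> l u) (t, x) $ i = (\<Sum>j\<in>UNIV.
      conv k (\<lambda>z. u z $ i) (t, x) * conv (partial j k) (\<lambda>z. u z $ j) (t, x)
      + conv (partial j k) (\<lambda>z. u z $ i) (t, x) * conv k (\<lambda>z. u z $ j) (t, x)
      - conv (partial j k) (\<lambda>z. u z $ i * u z $ j) (t, x)))"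
    using in_Lp_slice_integrable[OF u, simplified] tensor_slice_integrable[OF u]
  proof eventually_elim
    case (elim t)
    have int: "integrable torus (\<lambda>y. u (t, y))" using elim(1) by simp
    have int_i: "integrable torus (\<lambda>y. u (t, y) $ i)" for i
      by (rule integrable_bounded_linear[OF bounded_linear_vec_nth int])
    have int_ij: "integrable torus (\<lambda>y. u (t, y) $ i * u (t, y) $ j)" for i j
      using integrable_bounded_linear[OF bounded_linear_vec_nth[of j]
          integrable_bounded_linear[OF bounded_linear_vec_nth[of i] elim(2)]]
      by (simp add: tensor_def)
    have m: "mollify \<rho> l u (t, x) $ i = conv k (\<lambda>z. u z $ i) (t, x)" for i x
      unfolding k_def by (rule mollify_eq_conv[OF \<rho> mu int bounded_linear_vec_nth])
    have mm: "mollify \<rho> l (\<lambda>z. u z \<otimes>\<^sub>v u z) (t, x) $ i $ j = conv k (\<lambda>z. u z $ i * u z $ j) (t, x)" for i j x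
      using mollify_eq_conv[OF \<rho> muu elim(2)
          bounded_linear_compose[OF bounded_linear_vec_nth[of j] bounded_linear_vec_nth[of i]]]
      by (simp add: k_def tensor_def)
    note d = has_derivative_conv[OF k int_i] and dd = has_derivative_conv[where f = "\<lambda>z. u z $ a * u z $ b" for a b, OF k int_ij]
    have g: "grad_x (mollify \<rho> l u) (t, x) $ i $ j = conv (partial j k) (\<lambda>z. u z $ i) (t, x)" for i j x
      by (rule grad_x_component) (unfold m, rule d)
    have r: "div_x (R_stress \<rho> l u) (t, x) $ i = (\<Sum>j\<in>UNIV.
      conv k (\<lambda>z. u z $ i) (t, x) * conv (partial j k) (\<lambda>z. u z $ j) (t, x)
      + conv (partial j k) (\<lambda>z. u z $ i) (t, x) * conv k (\<lambda>z. u z $ j) (t, x)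
      - conv (partial j k) (\<lambda>z. u z $ i * u z $ j) (t, x))" for i x
    proof -
      have R: "R_stress \<rho> l u (t, y) $ i $ j = conv k (\<lambda>z. u z $ i) (t, y) * conv k (\<lambda>z. u z $ j) (t, y)
          - conv k (\<lambda>z. u z $ i * u z $ j) (t, y)" for y j
        by (simp add: R_stress_def mm m tensor_component)
      have "grad_x (\<lambda>z. R_stress \<rho> l u z $ i) (t, x) $ j $ j =
          conv k (\<lambda>z. u z $ i) (t, x) * conv (partial j k) (\<lambda>z. u z $ j) (t, x)
          + conv (partial j k) (\<lambda>z. u z $ i) (t, x) * conv k (\<lambda>z. u z $ j) (t, x)
          - conv (partial j k) (\<lambda>z. u z $ i * u z $ j) (t, x)" for j
        by (rule grad_x_component) (unfold R, rule has_derivative_diff[OF has_derivative_mult[OF d d] dd])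
      then show ?thesis by (simp add: div_x_def trace_def)
    qed
    show ?case using m g r by blast
  qed
  from AE_slab_I[OF this] show ?thesis
  proof eventually_elim
    case (elim z)
    then show ?case by (cases z) simp
  qed
qed

section \<open>Distributions given by functions as integrals over the slab\<close>

lemma borel_measurable_completion_AE:
  fixes f g :: "'a \<Rightarrow> real"
  assumes "AE z in M. f z = g z" and g: "g \<in> borel_measurable M"
  shows "f \<in> borel_measurable (completion M)"
proof (rule measurableI)
  fix A :: "real set" assume A: "A \<in> sets borel"
  obtain N where N: "{z \<in> space M. f z \<noteq> g z} \<subseteq> N" "N \<in> null_sets M"
    using assms(1) by (auto elim!: AE_E simp: null_sets_def)
  have eq: "f -` A \<inter> space M = (g -` A \<inter> space M - N) \<union> (f -` A \<inter> space M \<inter> N)"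
    using N(1) by auto
  have 1: "g -` A \<inter> space M - N \<in> sets (completion M)"
    using measurable_sets[OF g A] N(2) by auto
  have 2: "f -` A \<inter> space M \<inter> N \<in> sets (completion M)"
    using null_sets_completion_subset[of "f -` A \<inter> space M \<inter> N" N M] null_sets_completionI[OF N(2)]
    by auto
  show "f -` A \<inter> space (completion M) \<in> sets (completion M)"
    unfolding space_completion by (subst eq) (rule sets.Un[OF 1 2])
qed auto

text \<open>Inside \<open>reg\<close> a function built from pointwise derivatives may be replaced by
  a Borel function equal to it almost everywhere; for the latter the completed measure and
  \<open>lborel\<close> give the same integral.\<close>

lemma reg_eq:
  assumes "AE z in slab T. f z = g z"
    and g: "g \<in> borel_measurable (borel \<Otimes>\<^sub>M borel)" and \<phi>: "\<phi> \<in> borel_measurable borel"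
  shows "reg T f \<phi> = (LINT z|slab T. g z * \<phi> z)"
proof -
  have [measurable]: "g \<in> borel_measurable borel" "\<phi> \<in> borel_measurable borel"
    using g \<phi> by (simp_all add: borel_prod)
  have AE: "AE z in lborel. indicator (cylinder T) z *\<^sub>R (f z * \<phi> z) = indicator (cylinder T) z *\<^sub>R (g z * \<phi> z)"
    using assms(1) unfolding slab_eq_density by (subst (asm) AE_density) (auto elim!: AE_mp simp: indicator_def)
  have "reg T f \<phi> = (LINT z|lebesgue. indicator (cylinder T) z *\<^sub>R (f z * \<phi> z))"
    by (simp add: reg_def set_lebesgue_integral_def)
  also have "\<dots> = (LINT z|lebesgue. indicator (cylinder T) z *\<^sub>R (g z * \<phi> z))"
    by (rule integral_cong_AE[OF borel_measurable_completion_AE[OF AE] _ AE_completion[OF AE]])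
      (auto intro!: measurable_completion)
  also have "\<dots> = (LINT z|lborel. indicator (cylinder T) z *\<^sub>R (g z * \<phi> z))"
    by (rule integral_completion) measurable
  also have "\<dots> = (LINT z|slab T. g z * \<phi> z)"
    using integral_density[of "\<lambda>z. g z * \<phi> z" lborel "indicator (cylinder T)"]
    unfolding slab_eq_density by (simp add: ennreal_indicator)
  finally show ?thesis .
qed

subsection \<open>Iterated integrals\<close>

lemma measure_torus_UNIV [simp]: "measure (torus :: (real ^ 'd) measure) UNIV = 1"
  using prob_space.prob_space[OF prob_space_torus] by simp

lemma integrable_pair_fst:
  fixes g :: "'a \<Rightarrow> real"
  assumes "sigma_finite_measure M1" "finite_measure M2" "integrable M1 g"
  shows "integrable (M1 \<Otimes>\<^sub>M M2) (\<lambda>p. g (fst p))"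
proof -
  interpret M1: sigma_finite_measure M1 by fact
  interpret M2: finite_measure M2 by fact
  interpret pair_sigma_finite M1 M2 ..
  show ?thesis
  proof (rule Fubini_integrable)
    have [measurable]: "g \<in> borel_measurable M1" using assms(3) by measurable
    show "(\<lambda>p. g (fst p)) \<in> borel_measurable (M1 \<Otimes>\<^sub>M M2)" by measurable
  qed (use assms(3) in simp_all)
qed

lemma integrable_pair_mult:
  fixes f :: "'a \<Rightarrow> real" and g :: "'b \<Rightarrow> real"
  assumes "sigma_finite_measure M1" "sigma_finite_measure M2" "integrable M1 f" "integrable M2 g"
  shows "integrable (M1 \<Otimes>\<^sub>M M2) (\<lambda>p. f (fst p) * g (snd p))"
proof -
  interpret M1: sigma_finite_measure M1 by fact
  interpret M2: sigma_finite_measure M2 by fact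
  interpret pair_sigma_finite M1 M2 ..
  show ?thesis
  proof (rule Fubini_integrable)
    have [measurable]: "f \<in> borel_measurable M1" "g \<in> borel_measurable M2" using assms by measurable
    show "(\<lambda>p. f (fst p) * g (snd p)) \<in> borel_measurable (M1 \<Otimes>\<^sub>M M2)" by measurable
  qed (use assms(3,4) in \<open>simp_all add: abs_mult\<close>)
qed

definition swap_space :: "(real \<times> (real ^ 'd)) \<times> (real ^ 'd) \<Rightarrow> (real \<times> (real ^ 'd)) \<times> (real ^ 'd)" where
  "swap_space p = ((fst (fst p), snd p), snd (fst p))"

lemma swap_space_measurable [measurable]:
  "swap_space \<in> (slab T \<Otimes>\<^sub>M torus) \<rightarrow>\<^sub>M (slab T \<Otimes>\<^sub>M torus)"
  unfolding swap_space_def by measurable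

global_interpretation tor2: pair_sigma_finite "torus :: (real ^ 'd) measure" "torus :: (real ^ 'd) measure" ..

text \<open>Integrating over the time last reduces the invariance to Tonelli's theorem in the two
  space variables, since both points share the time.\<close>

lemma distr_swap_space:
  "distr (slab T \<Otimes>\<^sub>M torus) (slab T \<Otimes>\<^sub>M torus) swap_space
    = (slab T \<Otimes>\<^sub>M torus :: ((real \<times> (real ^ 'd)) \<times> (real ^ 'd)) measure)"
proof (rule measure_eqI)
  fix A :: "((real \<times> (real ^ 'd)) \<times> (real ^ 'd)) set"
  assume "A \<in> sets (distr (slab T \<Otimes>\<^sub>M torus) (slab T \<Otimes>\<^sub>M torus) swap_space)"
  then have [measurable]: "A \<in> sets (slab T \<Otimes>\<^sub>M torus)" by simp
  have iter: "(\<integral>\<^sup>+p. f p \<partial>(slab T \<Otimes>\<^sub>M torus)) = (\<integral>\<^sup>+t. \<integral>\<^sup>+x. \<integral>\<^sup>+y. f ((t, x), y) \<partial>torus \<partial>torus \<partial>time_measure T)"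
    if [measurable]: "f \<in> borel_measurable (slab T \<Otimes>\<^sub>M torus)" for f :: "(real \<times> (real ^ 'd)) \<times> (real ^ 'd) \<Rightarrow> ennreal"
  proof -
    have "(\<integral>\<^sup>+p. f p \<partial>(slab T \<Otimes>\<^sub>M torus)) = (\<integral>\<^sup>+z. \<integral>\<^sup>+y. f (z, y) \<partial>torus \<partial>slab T)"
      by (rule torus.nn_integral_fst[symmetric]) measurable
    also have "\<dots> = (\<integral>\<^sup>+t. \<integral>\<^sup>+x. \<integral>\<^sup>+y. f ((t, x), y) \<partial>torus \<partial>torus \<partial>time_measure T)"
      unfolding slab_def by (rule torus.nn_integral_fst[symmetric]) (simp flip: slab_def)
    finally show ?thesis .
  qed
  have "emeasure (distr (slab T \<Otimes>\<^sub>M torus) (slab T \<Otimes>\<^sub>M torus) swap_space) A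
      = (\<integral>\<^sup>+p. indicator A (swap_space p) \<partial>(slab T \<Otimes>\<^sub>M torus))"
    by (simp add: nn_integral_distr flip: nn_integral_indicator)
  also have "\<dots> = (\<integral>\<^sup>+t. \<integral>\<^sup>+x. \<integral>\<^sup>+y. indicator A ((t, y), x) \<partial>torus \<partial>torus \<partial>time_measure T)"
    by (subst iter) (measurable, simp add: swap_space_def)
  also have "\<dots> = (\<integral>\<^sup>+t. \<integral>\<^sup>+x. \<integral>\<^sup>+y. indicator A ((t, x), y) \<partial>torus \<partial>torus \<partial>time_measure T)"
  proof (rule nn_integral_cong)
    fix t
    have "(\<lambda>(x, y). indicator A ((t, x), y) :: ennreal) \<in> borel_measurable (torus \<Otimes>\<^sub>M torus)"
      by measurable
    then show "(\<integral>\<^sup>+x. \<integral>\<^sup>+y. indicator A ((t, y), x) \<partial>torus \<partial>torus) = (\<integral>\<^sup>+x. \<integral>\<^sup>+y. indicator A ((t, x), y) \<partial>torus \<partial>torus)"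
      by (rule tor2.Fubini')
  qed
  also have "\<dots> = (\<integral>\<^sup>+p. indicator A p \<partial>(slab T \<Otimes>\<^sub>M torus))"
    by (rule iter[symmetric]) measurable
  finally show "emeasure (distr (slab T \<Otimes>\<^sub>M torus) (slab T \<Otimes>\<^sub>M torus) swap_space) A
      = emeasure (slab T \<Otimes>\<^sub>M torus) A" by simp
qed simp

lemma integrable_swap_space:
  fixes f :: "_ \<Rightarrow> real"
  assumes "integrable (slab T \<Otimes>\<^sub>M torus) f"
  shows "integrable (slab T \<Otimes>\<^sub>M torus) (\<lambda>p. f (swap_space p))"
proof -
  have "f \<in> borel_measurable (slab T \<Otimes>\<^sub>M torus)" using assms by measurable
  from integrable_distr_eq[OF swap_space_measurable this] assms show ?thesis
    by (simp add: distr_swap_space)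
qed

lemma integral_swap_space:
  fixes f :: "_ \<Rightarrow> real"
  assumes "f \<in> borel_measurable (slab T \<Otimes>\<^sub>M torus)"
  shows "(\<integral>p. f (swap_space p) \<partial>(slab T \<Otimes>\<^sub>M torus)) = integral\<^sup>L (slab T \<Otimes>\<^sub>M torus) f"
  using integral_distr[OF swap_space_measurable assms] by (simp add: distr_swap_space)

lemma sigma_finite_slab: "sigma_finite_measure (slab T)"
  by (rule slab.sigma_finite_measure_axioms)

text \<open>Young's inequality separates the factors. The cube of \<open>a\<close> at the second
  point is integrable because exchanging the two space points preserves the measure.\<close>

lemma integrable_two_point:
  fixes a b :: "real \<times> (real ^ 'd) \<Rightarrow> real"
  assumes "Lp T (3/2) b" "Lp T 3 a"
  shows "integrable (slab T \<Otimes>\<^sub>M torus) (\<lambda>(z, y). b z * a (fst z, y))"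
proof (rule Bochner_Integration.integrable_bound)
  have [measurable]: "b \<in> borel_measurable (borel \<Otimes>\<^sub>M borel)" "a \<in> borel_measurable (borel \<Otimes>\<^sub>M borel)"
    using assms by measurable
  have 1: "integrable (slab T \<Otimes>\<^sub>M torus) (\<lambda>p. \<bar>b (fst p)\<bar> powr (3/2))"
    by (rule integrable_pair_fst[OF sigma_finite_slab torus.finite_measure_axioms Lp_integrable_powr[OF assms(1)]])
  have 2: "integrable (slab T \<Otimes>\<^sub>M (torus :: (real ^ 'd) measure)) (\<lambda>p :: (real \<times> (real ^ 'd)) \<times> (real ^ 'd). \<bar>a (fst (fst p), snd p)\<bar> powr 3)"
    using integrable_swap_space[OF integrable_pair_fst[OF sigma_finite_slab torus.finite_measure_axioms Lp_integrable_powr[OF assms(2)]]]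
    by (simp only: swap_space_def fst_conv snd_conv)
  show "integrable (slab T \<Otimes>\<^sub>M torus) (\<lambda>p. \<bar>b (fst p)\<bar> powr (3/2) + \<bar>a (fst (fst p), snd p)\<bar> powr 3)"
    by (rule Bochner_Integration.integrable_add[OF 1 2])
  show "AE p in slab T \<Otimes>\<^sub>M torus. norm (case p of (z, y) \<Rightarrow> b z * a (fst z, y))
      \<le> norm (\<bar>b (fst p)\<bar> powr (3/2) + \<bar>a (fst (fst p), snd p)\<bar> powr 3)"
  proof (rule AE_I2)
    fix p
    have "\<bar>b (fst p)\<bar> * \<bar>a (fst (fst p), snd p)\<bar> \<le> \<bar>b (fst p)\<bar> powr (3/2) + \<bar>a (fst (fst p), snd p)\<bar> powr 3"
      by (rule young_32_3) auto
    then show "norm (case p of (z, y) \<Rightarrow> b z * a (fst z, y))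
      \<le> norm (\<bar>b (fst p)\<bar> powr (3/2) + \<bar>a (fst (fst p), snd p)\<bar> powr 3)"
      by (simp add: case_prod_beta abs_mult del: powr_numeral)
  qed
  show "(\<lambda>(z, y). b z * a (fst z, y)) \<in> borel_measurable (slab T \<Otimes>\<^sub>M torus)"
    by measurable
qed

subsection \<open>Approximation by continuous functions\<close>

definition clamp_at :: "real \<Rightarrow> real \<Rightarrow> real" where
  "clamp_at M r = max (- M) (min M r)"

lemma continuous_on_clamp_at: "continuous_on A f \<Longrightarrow> continuous_on A (\<lambda>x. clamp_at M (f x))"
  unfolding clamp_at_def by (intro continuous_intros)

lemma clamp_at_measurable [measurable]: "clamp_at M \<in> borel_measurable borel"
  unfolding clamp_at_def by measurable

lemma abs_clamp_at: "0 \<le> M \<Longrightarrow> \<bar>clamp_at M r\<bar> \<le> M"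
  unfolding clamp_at_def by auto

lemma clamp_at_eq: "\<bar>r\<bar> \<le> M \<Longrightarrow> clamp_at M r = r"
  unfolding clamp_at_def by auto

lemma abs_diff_clamp_at: "0 \<le> M \<Longrightarrow> \<bar>r - clamp_at M r\<bar> \<le> \<bar>r\<bar>"
  unfolding clamp_at_def by (auto simp: max_def min_def)

lemma AE_slab_lborel: "AE z in lborel. P z \<Longrightarrow> AE z in slab T. P z"
  unfolding slab_eq_density by (subst AE_density) (auto elim: AE_mp)

text \<open>A measurable function is a limit almost everywhere of continuous functions. Clamping
  them to the range of \<open>f\<close> keeps continuity and provides a constant bound, so dominated
  convergence on the finite slab gives convergence in L^3.\<close>

lemma continuous_approx_bounded:
  fixes f :: "real \<times> (real ^ 'd) \<Rightarrow> real"
  assumes f: "f \<in> borel_measurable borel" and M: "0 \<le> M" "\<And>z. \<bar>f z\<bar> \<le> M" and e: "0 < e"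
  shows "\<exists>g. continuous_on UNIV g \<and> (\<forall>z. \<bar>g z\<bar> \<le> M) \<and> (LINT z|slab T. \<bar>f z - g z\<bar> ^ 3) < e"
proof -
  have "f \<in> borel_measurable (lebesgue_on UNIV)"
    using f by (simp add: lebesgue_on_UNIV_eq measurable_completion)
  then have "f measurable_on UNIV" by (simp add: measurable_on_iff_borel_measurable)
  then obtain N g where N: "negligible N" and g: "\<And>n. continuous_on UNIV (g n)"
    and lim: "\<And>z. z \<notin> N \<Longrightarrow> (\<lambda>n. g n z) \<longlonglongrightarrow> f z"
    unfolding measurable_on_def by auto
  define h where "h n z = clamp_at M (g n z)" for n z
  have ch: "continuous_on UNIV (h n)" for n unfolding h_def by (rule continuous_on_clamp_at[OF g])
  have [measurable]: "h n \<in> borel_measurable (borel \<Otimes>\<^sub>M borel)" for n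
    using borel_measurable_continuous_onI[OF ch] by (simp add: borel_prod)
  have [measurable]: "f \<in> borel_measurable (borel \<Otimes>\<^sub>M borel)" using f by (simp add: borel_prod)
  have "AE z in lebesgue. z \<notin> N" using N by (intro AE_not_in) (simp add: negligible_iff_null_sets)
  then have AE_N: "AE z in slab T. z \<notin> N" by (intro AE_slab_lborel) (simp add: AE_completion_iff)
  have "(\<lambda>n. LINT z|slab T. \<bar>f z - h n z\<bar> ^ 3) \<longlonglongrightarrow> (LINT z|(slab T :: (real \<times> (real ^ 'd)) measure). 0)"
  proof (rule integral_dominated_convergence)
    show "integrable (slab T) (\<lambda>z :: real \<times> (real ^ 'd). (2 * M) ^ 3)" by simp
    show "AE z in slab T. (\<lambda>n. \<bar>f z - h n z\<bar> ^ 3) \<longlonglongrightarrow> 0"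
      using AE_N
    proof eventually_elim
      case (elim z)
      have "(\<lambda>n. clamp_at M (g n z)) \<longlonglongrightarrow> clamp_at M (f z)"
        unfolding clamp_at_def by (intro tendsto_intros lim elim)
      then have "(\<lambda>n. h n z) \<longlonglongrightarrow> f z" using M(2)[of z] by (simp add: h_def clamp_at_eq)
      then have "(\<lambda>n. \<bar>f z - h n z\<bar> ^ 3) \<longlonglongrightarrow> \<bar>f z - f z\<bar> ^ 3" by (intro tendsto_intros)
      then show ?case by simp
    qed
    show "AE z in slab T. norm (\<bar>f z - h n z\<bar> ^ 3) \<le> (2 * M) ^ 3" for n
    proof (rule AE_I2)
      fix z
      have "\<bar>f z - h n z\<bar> \<le> 2 * M" using M(2)[of z] abs_clamp_at[OF M(1), of "g n z"] by (simp add: h_def)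
      then have "\<bar>f z - h n z\<bar> ^ 3 \<le> (2 * M) ^ 3" by (intro power_mono) auto
      then show "norm (\<bar>f z - h n z\<bar> ^ 3) \<le> (2 * M) ^ 3" by simp
    qed
  qed measurable
  then have "(\<lambda>n. LINT z|slab T. \<bar>f z - h n z\<bar> ^ 3) \<longlonglongrightarrow> 0" by simp
  from order_tendstoD(2)[OF this e] obtain n where "(LINT z|slab T. \<bar>f z - h n z\<bar> ^ 3) < e"
    by (auto simp: eventually_sequentially)
  then show ?thesis using ch abs_clamp_at[OF M(1)] by (intro exI[of _ "h n"]) (auto simp: h_def)
qed

text \<open>Truncation at a large height reduces the claim to bounded functions. Boundedness of
  \<open>g\<close> is part of the conclusion because the approximate identity is applied to bounded
  continuous functions.\<close>

lemma continuous_approx_L3: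
  fixes f :: "real \<times> (real ^ 'd) \<Rightarrow> real"
  assumes f: "Lp T 3 f" and e: "0 < e"
  shows "\<exists>g C. continuous_on UNIV g \<and> (\<forall>z. \<bar>g z\<bar> \<le> C) \<and> (LINT z|slab T. \<bar>f z - g z\<bar> ^ 3) < e"
proof -
  have [measurable]: "f \<in> borel_measurable (borel \<Otimes>\<^sub>M borel)" using f by measurable
  have int3: "integrable (slab T) (\<lambda>z. \<bar>f z\<bar> ^ 3)" using Lp_integrable_powr[OF f] by simp
  define h where "h n z = clamp_at (real n) (f z)" for n z
  have [measurable]: "h n \<in> borel_measurable (borel \<Otimes>\<^sub>M borel)" for n unfolding h_def by measurable
  have dom: "\<bar>f z - h n z\<bar> ^ 3 \<le> \<bar>f z\<bar> ^ 3" for n z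
    unfolding h_def by (intro power_mono abs_diff_clamp_at) auto
  have "(\<lambda>n. LINT z|slab T. \<bar>f z - h n z\<bar> ^ 3) \<longlonglongrightarrow> (LINT z|(slab T :: (real \<times> (real ^ 'd)) measure). 0)"
  proof (rule integral_dominated_convergence[OF _ _ int3])
    show "AE z in slab T. (\<lambda>n. \<bar>f z - h n z\<bar> ^ 3) \<longlonglongrightarrow> 0"
    proof (rule AE_I2)
      fix z
      obtain m where "\<bar>f z\<bar> \<le> real m" using real_arch_simple by blast
      then have "\<forall>n\<ge>m. \<bar>f z - h n z\<bar> ^ 3 = 0" by (auto simp: h_def clamp_at_eq)
      then show "(\<lambda>n. \<bar>f z - h n z\<bar> ^ 3) \<longlonglongrightarrow> 0"
        by (intro tendsto_eventually) (auto simp: eventually_sequentially)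
    qed
  qed (use dom in auto)
  then have "(\<lambda>n. LINT z|slab T. \<bar>f z - h n z\<bar> ^ 3) \<longlonglongrightarrow> 0" by simp
  \<comment> \<open>The factor 8 is the cube of 2, from the cube of a sum of two terms; each of the
    two errors receives half of the rest.\<close>
  from order_tendstoD(2)[OF this, of "e / 8 / 2"] e
  obtain n where n: "(LINT z|slab T. \<bar>f z - h n z\<bar> ^ 3) < e / 8 / 2"
    by (auto simp: eventually_sequentially)
  have "h n \<in> borel_measurable borel" using \<open>h n \<in> _\<close> by (simp add: borel_prod)
  then obtain g where g: "continuous_on UNIV g" "\<And>z. \<bar>g z\<bar> \<le> real n"
    "(LINT z|slab T. \<bar>h n z - g z\<bar> ^ 3) < e / 8 / 2"
    using continuous_approx_bounded[of "h n" "real n" "e / 8 / 2" T] e abs_clamp_at[of "real n"]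
    by (auto simp: h_def)
  have [measurable]: "g \<in> borel_measurable (borel \<Otimes>\<^sub>M borel)"
    using borel_measurable_continuous_onI[OF g(1)] by (simp add: borel_prod)
  have i1: "integrable (slab T) (\<lambda>z. \<bar>f z - h n z\<bar> ^ 3)"
    by (rule Bochner_Integration.integrable_bound[OF int3]) (use dom in auto)
  have i2: "integrable (slab T) (\<lambda>z. \<bar>h n z - g z\<bar> ^ 3)"
  proof (rule slab.integrable_const_bound[where B = "(2 * real n) ^ 3"])
    show "AE z in slab T. norm (\<bar>h n z - g z\<bar> ^ 3) \<le> (2 * real n) ^ 3"
    proof (rule AE_I2)
      fix z
      have "\<bar>h n z - g z\<bar> \<le> 2 * real n" using g(2)[of z] abs_clamp_at[of "real n" "f z"] by (simp add: h_def)
      then have "\<bar>h n z - g z\<bar> ^ 3 \<le> (2 * real n) ^ 3" by (intro power_mono) auto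
      then show "norm (\<bar>h n z - g z\<bar> ^ 3) \<le> (2 * real n) ^ 3" by simp
    qed
  qed measurable
  have cube: "\<bar>f z - g z\<bar> ^ 3 \<le> 8 * (\<bar>f z - h n z\<bar> ^ 3 + \<bar>h n z - g z\<bar> ^ 3)" for z
  proof -
    define m where "m = max \<bar>f z - h n z\<bar> \<bar>h n z - g z\<bar>"
    have "\<bar>f z - h n z\<bar> \<le> m" "\<bar>h n z - g z\<bar> \<le> m" by (simp_all add: m_def)
    then have "\<bar>f z - g z\<bar> \<le> 2 * m" by linarith
    then have "\<bar>f z - g z\<bar> ^ 3 \<le> (2 * m) ^ 3" by (intro power_mono) auto
    also have "\<dots> = 8 * m ^ 3" by (simp add: power_mult_distrib)
    also have "m ^ 3 \<le> \<bar>f z - h n z\<bar> ^ 3 + \<bar>h n z - g z\<bar> ^ 3" by (auto simp: m_def max_def)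
    finally show ?thesis by simp
  qed
  have "(LINT z|slab T. \<bar>f z - g z\<bar> ^ 3) \<le> (LINT z|slab T. 8 * (\<bar>f z - h n z\<bar> ^ 3 + \<bar>h n z - g z\<bar> ^ 3))"
  proof (rule integral_mono)
    show "integrable (slab T) (\<lambda>z. 8 * (\<bar>f z - h n z\<bar> ^ 3 + \<bar>h n z - g z\<bar> ^ 3))" using i1 i2 by simp
    then show "integrable (slab T) (\<lambda>z. \<bar>f z - g z\<bar> ^ 3)"
      by (rule Bochner_Integration.integrable_bound) (use cube in \<open>auto intro: order_trans[OF _ abs_ge_self]\<close>)
  qed (use cube in auto)
  also have "\<dots> < e" using n g(3) i1 i2 by simp
  finally show ?thesis using g(1,2) by blast
qed

subsection \<open>Approximate identities in time\<close>

abbreviation slab2 :: "real \<Rightarrow> ((real \<times> (real ^ 'd)) \<times> (real \<times> (real ^ 'd))) measure" where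
  "slab2 T \<equiv> slab T \<Otimes>\<^sub>M slab T"

abbreviation slabt :: "real \<Rightarrow> ((real \<times> (real ^ 'd)) \<times> (real ^ 'd)) measure" where
  "slabt T \<equiv> slab T \<Otimes>\<^sub>M torus"

text \<open>The bump need not be even. Exchanging the two times therefore passes to the reversed
  bump, which is another instance of the locale.\<close>

locale time_bump =
  fixes \<eta> :: "real \<Rightarrow> real" and R :: real
  assumes smooth_eta: "smooth \<eta>" and eta_nonneg: "0 \<le> \<eta> r" and R_pos: "0 < R"
    and eta_supp: "R \<le> \<bar>r\<bar> \<Longrightarrow> \<eta> r = 0" and eta_integrable: "integrable lborel \<eta>"
    and eta_integral: "(LINT r|lborel. \<eta> r) = 1"
begin

definition etan :: "nat \<Rightarrow> real \<Rightarrow> real" where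
  "etan n r = real (Suc n) * \<eta> (real (Suc n) * r)"

lemma eta_measurable [measurable]: "\<eta> \<in> borel_measurable borel"
  by (rule smooth_borel_measurable[OF smooth_eta])

lemma etan_measurable [measurable]: "etan n \<in> borel_measurable borel"
  unfolding etan_def by measurable

lemma etan_nonneg: "0 \<le> etan n r"
  unfolding etan_def using eta_nonneg by simp

lemma etan_supp: "R \<le> real (Suc n) * \<bar>r\<bar> \<Longrightarrow> etan n r = 0"
  unfolding etan_def using eta_supp[of "real (Suc n) * r"] by (simp add: abs_mult)

lemma smooth_etan: "smooth (etan n)"
proof -
  have "smooth (\<lambda>r. \<eta> (real (Suc n) * r + 0))"
    by (rule smooth_affine[OF smooth_eta bounded_linear_mult_right])
  then show ?thesis unfolding etan_def using smooth_mult[OF smooth_const] by simp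
qed

lemma eta_bounded: obtains C where "\<And>r. \<bar>\<eta> r\<bar> \<le> C"
  using compact_support_bounded[of \<eta> R] smooth_continuous_on[OF smooth_eta] eta_supp
  by (metis less_imp_le real_norm_def)

lemma etan_bounded: obtains C where "\<And>r. \<bar>etan n r\<bar> \<le> C"
proof -
  obtain C where "\<And>r. \<bar>\<eta> r\<bar> \<le> C" using eta_bounded by blast
  then have "\<bar>etan n r\<bar> \<le> real (Suc n) * C" for r
    unfolding etan_def abs_mult by (intro mult_mono) auto
  then show ?thesis by (rule that)
qed

lemma etan_integrable_integral:
  shows "integrable lborel (\<lambda>s. etan n (t - s))" "(LINT s|lborel. etan n (t - s)) = 1"
    and "integrable lborel (etan n)" "(LINT s|lborel. etan n s) = 1"
proof -
  have 1: "integrable lborel (etan n)"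
    using lborel_integrable_real_affine[OF eta_integrable, of "real (Suc n)" 0] unfolding etan_def by simp
  have 2: "(LINT s|lborel. etan n s) = 1"
    using lborel_integral_real_affine[of "real (Suc n)" \<eta> 0] eta_integral unfolding etan_def by simp
  show "integrable lborel (etan n)" "(LINT s|lborel. etan n s) = 1" by fact+
  show "integrable lborel (\<lambda>s. etan n (t - s))" "(LINT s|lborel. etan n (t - s)) = 1"
    using 1 2 by (simp_all add: integrable_lborel_reflect integral_lborel_reflect)
qed

lemma integral_time_measure_eq:
  fixes f :: "real \<Rightarrow> real"
  assumes "f \<in> borel_measurable borel"
  shows "integral\<^sup>L (time_measure T) f = (LINT s|lborel. indicator {0<..<T} s * f s)"
  using integral_density[of f lborel "indicator {0<..<T}"] assms
  unfolding time_measure_def by (simp add: ennreal_indicator)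

text \<open>Only an inequality: for \<open>t\<close> near the ends of the time interval, part of the
  bump lies outside and its mass is lost.\<close>

lemma etan_time_le:
  shows "(LINT s|time_measure T. etan n (t - s)) \<le> 1" and "(LINT s|time_measure T. etan n (s - t)) \<le> 1"
proof -
  have 1: "integrable lborel (\<lambda>s. etan n (t - s))" "integrable lborel (\<lambda>s. etan n (s - t))"
    using etan_integrable_integral(1,3) integrable_lborel_translate[of "etan n" "- t"] by auto
  have 2: "(LINT s|lborel. etan n (t - s)) = 1" "(LINT s|lborel. etan n (s - t)) = 1"
    using etan_integrable_integral(2,4) integral_lborel_translate[of "etan n" "- t"] by auto
  have "(LINT s|time_measure T. etan n (t - s)) \<le> (LINT s|lborel. etan n (t - s))"
    unfolding integral_time_measure_eq[of "\<lambda>s. etan n (t - s)", simplified]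
    by (rule integral_mono_AE[OF _ 1(1)])
      (auto intro!: Bochner_Integration.integrable_bound[OF 1(1)] simp: indicator_def etan_nonneg)
  then show "(LINT s|time_measure T. etan n (t - s)) \<le> 1" using 2 by simp
  have "(LINT s|time_measure T. etan n (s - t)) \<le> (LINT s|lborel. etan n (s - t))"
    unfolding integral_time_measure_eq[of "\<lambda>s. etan n (s - t)", simplified]
    by (rule integral_mono_AE[OF _ 1(2)])
      (auto intro!: Bochner_Integration.integrable_bound[OF 1(2)] simp: indicator_def etan_nonneg)
  then show "(LINT s|time_measure T. etan n (s - t)) \<le> 1" using 2 by simp
qed

text \<open>Rescaling turns the integral into a mean of values of \<open>F\<close> at points tending
  to \<open>t\<close>. As \<open>t\<close> is an interior time, the cut-off at the ends of the
  interval is eventually invisible.\<close>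

lemma etan_approx:
  assumes f: "continuous_on UNIV f" and t: "t \<in> {0<..<T}" and M: "\<And>s. \<bar>f s\<bar> \<le> M"
  shows "(\<lambda>n. LINT s|time_measure T. f s * etan n (t - s)) \<longlonglongrightarrow> f t"
proof -
  have [measurable]: "f \<in> borel_measurable borel" by (rule borel_measurable_continuous_onI[OF f])
  define F where "F s = indicator {0<..<T} s * f s" for s
  have [measurable]: "F \<in> borel_measurable borel" unfolding F_def by measurable
  have eq: "(LINT s|time_measure T. f s * etan n (t - s)) = (LINT r|lborel. F (t - r / real (Suc n)) * \<eta> r)" for n
  proof -
    have "(LINT s|time_measure T. f s * etan n (t - s)) = (LINT s|lborel. F s * etan n (t - s))"
      by (simp add: integral_time_measure_eq F_def mult.assoc)
    also have "\<dots> = \<bar>- 1 / real (Suc n)\<bar> *\<^sub>R (LINT r|lborel. F (t + (- 1 / real (Suc n)) * r) * etan n (t - (t + (- 1 / real (Suc n)) * r)))"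
      by (rule lborel_integral_real_affine) simp
    also have "\<dots> = (LINT r|lborel. F (t - r / real (Suc n)) * \<eta> r)"
      by (simp add: etan_def mult.left_commute[of _ "real (Suc n)"] del: of_nat_Suc)
    finally show ?thesis .
  qed
  have "(\<lambda>n. LINT r|lborel. F (t - r / real (Suc n)) * \<eta> r) \<longlonglongrightarrow> (LINT r|lborel. f t * \<eta> r)"
  proof (rule integral_dominated_convergence)
    show "integrable lborel (\<lambda>r. M * \<eta> r)" using eta_integrable by simp
    show "AE r in lborel. norm (F (t - r / real (Suc n)) * \<eta> r) \<le> M * \<eta> r" for n
    proof (rule AE_I2)
      fix r
      have "0 \<le> M" using M[of 0] by linarith
      then have "\<bar>F (t - r / real (Suc n))\<bar> \<le> M" using M by (simp add: F_def indicator_def)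
      then show "norm (F (t - r / real (Suc n)) * \<eta> r) \<le> M * \<eta> r"
        using eta_nonneg[of r] by (simp add: abs_mult mult_right_mono)
    qed
    show "AE r in lborel. (\<lambda>n. F (t - r / real (Suc n)) * \<eta> r) \<longlonglongrightarrow> f t * \<eta> r"
    proof (rule AE_I2)
      fix r
      have "(\<lambda>n. t - r * inverse (real (Suc n))) \<longlonglongrightarrow> t - r * 0"
        by (intro tendsto_intros LIMSEQ_inverse_real_of_nat)
      then have lim: "(\<lambda>n. t - r / real (Suc n)) \<longlonglongrightarrow> t" by (simp add: divide_inverse)
      have "eventually (\<lambda>n. t - r / real (Suc n) \<in> {0<..<T}) sequentially"
        by (rule topological_tendstoD[OF lim _ t]) simp
      then have "eventually (\<lambda>n. f (t - r / real (Suc n)) = F (t - r / real (Suc n))) sequentially"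
        by eventually_elim (simp add: F_def)
      moreover have "(\<lambda>n. f (t - r / real (Suc n))) \<longlonglongrightarrow> f t"
        by (rule continuous_on_tendsto_compose[OF f lim]) auto
      ultimately have "(\<lambda>n. F (t - r / real (Suc n))) \<longlonglongrightarrow> f t"
        by (rule Lim_transform_eventually[rotated])
      then show "(\<lambda>n. F (t - r / real (Suc n)) * \<eta> r) \<longlonglongrightarrow> f t * \<eta> r" by (intro tendsto_intros)
    qed
  qed measurable
  then show ?thesis by (simp add: eq eta_integral)
qed

lemma integral_slab_fst:
  fixes h :: "real \<Rightarrow> real"
  assumes "integrable (time_measure T) h"
  shows "(LINT w|(slab T :: (real \<times> (real ^ 'd)) measure). h (fst w)) = integral\<^sup>L (time_measure T) h"
proof -
  have "(LINT w|(slab T :: (real \<times> (real ^ 'd)) measure). h (fst w))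
      = (LINT t|time_measure T. (LINT x|(torus :: (real ^ 'd) measure). h t))"
    unfolding slab_def using tt.integral_fst'[OF integrable_slab_fst[OF assms, unfolded slab_def], symmetric]
    by (simp only: fst_conv)
  then show ?thesis by simp
qed

lemma integrable_time_etan:
  "integrable (time_measure T) (\<lambda>s. etan n (t - s))" "integrable (time_measure T) (\<lambda>s. etan n (s - t))"
proof -
  obtain C where C: "\<And>r. \<bar>etan n r\<bar> \<le> C" using etan_bounded by blast
  show "integrable (time_measure T) (\<lambda>s. etan n (t - s))" "integrable (time_measure T) (\<lambda>s. etan n (s - t))"
    by (rule time.integrable_const_bound[where B = C]; use C in simp)+
qed

text \<open>Integrating out the other point costs a factor of at most 1: the bump has mass at most 1
  over the time interval and the torus has measure 1. Hence a bound independent of \<open>n\<close>,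
  although \<open>etan n\<close> itself is unbounded in \<open>n\<close>.\<close>

lemma weighted_etan_fst:
  fixes A :: "real \<times> (real ^ 'd) \<Rightarrow> real"
  assumes A: "integrable (slab T) A" "\<And>z. 0 \<le> A z"
  shows "integrable (slab2 T) (\<lambda>p. A (fst p) * etan n (fst (fst p) - fst (snd p)))"
    and "(LINT p|slab2 T. A (fst p) * etan n (fst (fst p) - fst (snd p))) \<le> integral\<^sup>L (slab T) A"
proof -
  obtain C where C: "\<And>r. \<bar>etan n r\<bar> \<le> C" using etan_bounded by blast
  have "integrable (slab2 T) (\<lambda>p. etan n (fst (fst p) - fst (snd p)) * A (fst p))"
    by (rule integrable_bounded_mult[OF integrable_pair_fst[OF sigma_finite_slab slab.finite_measure_axioms A(1)] _ C])
      measurable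
  then show int: "integrable (slab2 T) (\<lambda>p. A (fst p) * etan n (fst (fst p) - fst (snd p)))"
    by (simp add: mult.commute)
  have "(LINT p|slab2 T. A (fst p) * etan n (fst (fst p) - fst (snd p)))
      = (LINT z|slab T. A z * (LINT w|(slab T :: (real \<times> (real ^ 'd)) measure). etan n (fst z - fst w)))"
    using ss.integral_fst'[OF int] by simp
  also have "\<dots> = (LINT z|slab T. A z * (LINT s|time_measure T. etan n (fst z - s)))"
    by (simp add: integral_slab_fst[OF integrable_time_etan(1)])
  also have "\<dots> \<le> integral\<^sup>L (slab T) A"
  proof (rule integral_mono)
    have "integrable (slab T) (\<lambda>z. LINT w|(slab T :: (real \<times> (real ^ 'd)) measure). A z * etan n (fst z - fst w))"
      using ss.integrable_fst'[OF int] by simp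
    then show "integrable (slab T) (\<lambda>z. A z * (LINT s|time_measure T. etan n (fst z - s)))"
      by (simp add: integral_slab_fst[OF integrable_time_etan(1)])
    show "A z * (LINT s|time_measure T. etan n (fst z - s)) \<le> A z" for z
      using mult_left_mono[OF etan_time_le(1)[where T = T and n = n and t = "fst z"] A(2)[of z]] by simp
  qed (rule A(1))
  finally show "(LINT p|slab2 T. A (fst p) * etan n (fst (fst p) - fst (snd p))) \<le> integral\<^sup>L (slab T) A" .
qed

lemma weighted_etan_snd:
  fixes A :: "real \<times> (real ^ 'd) \<Rightarrow> real"
  assumes A: "integrable (slab T) A" "\<And>z. 0 \<le> A z"
  shows "integrable (slab2 T) (\<lambda>p. A (snd p) * etan n (fst (fst p) - fst (snd p)))"
    and "(LINT p|slab2 T. A (snd p) * etan n (fst (fst p) - fst (snd p))) \<le> integral\<^sup>L (slab T) A"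
proof -
  obtain C where C: "\<And>r. \<bar>etan n r\<bar> \<le> C" using etan_bounded by blast
  have "integrable (slab2 T) (\<lambda>p. A (snd p))"
    using ss.integrable_product_swap[OF integrable_pair_fst[OF sigma_finite_slab slab.finite_measure_axioms A(1)]]
    by (simp add: split_def)
  then have "integrable (slab2 T) (\<lambda>p. etan n (fst (fst p) - fst (snd p)) * A (snd p))"
    by (rule integrable_bounded_mult[OF _ _ C]) measurable
  then show int: "integrable (slab2 T) (\<lambda>p. A (snd p) * etan n (fst (fst p) - fst (snd p)))"
    by (simp add: mult.commute)
  have int': "integrable (slab2 T) (\<lambda>(z, w). A w * etan n (fst z - fst w))"
    using int by (simp add: split_def)
  have "(LINT p|slab2 T. A (snd p) * etan n (fst (fst p) - fst (snd p)))
      = (LINT w|slab T. A w * (LINT z|(slab T :: (real \<times> (real ^ 'd)) measure). etan n (fst z - fst w)))"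
    using ss.integral_snd[OF int'] by (simp add: split_def)
  also have "\<dots> = (LINT w|slab T. A w * (LINT s|time_measure T. etan n (s - fst w)))"
    by (simp add: integral_slab_fst[OF integrable_time_etan(2)])
  also have "\<dots> \<le> integral\<^sup>L (slab T) A"
  proof (rule integral_mono)
    have "integrable (slab T) (\<lambda>w. LINT z|(slab T :: (real \<times> (real ^ 'd)) measure). A w * etan n (fst z - fst w))"
      using ss.integrable_snd[OF int'] by simp
    then show "integrable (slab T) (\<lambda>w. A w * (LINT s|time_measure T. etan n (s - fst w)))"
      by (simp add: integral_slab_fst[OF integrable_time_etan(2)])
    show "A w * (LINT s|time_measure T. etan n (s - fst w)) \<le> A w" for w
      using mult_left_mono[OF etan_time_le(2)[where T = T and n = n and t = "fst w"] A(2)[of w]] by simp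
  qed (rule A(1))
  finally show "(LINT p|slab2 T. A (snd p) * etan n (fst (fst p) - fst (snd p))) \<le> integral\<^sup>L (slab T) A" .
qed

section \<open>Limits of integrals over two times\<close>

lemma two_time_integrable:
  fixes a b :: "real \<times> (real ^ 'd) \<Rightarrow> real"
  assumes b: "integrable (slab T) b" and a: "integrable (slab T) a"
    and [measurable]: "\<kappa> \<in> borel_measurable ((borel \<Otimes>\<^sub>M borel) \<Otimes>\<^sub>M (borel \<Otimes>\<^sub>M borel))"
    and M: "\<And>p. \<bar>\<kappa> p\<bar> \<le> M"
  shows "integrable (slab2 T) (\<lambda>p. b (fst p) * a (snd p) * \<kappa> p)"
proof -
  have "integrable (slab2 T) (\<lambda>p. \<kappa> p * (b (fst p) * a (snd p)))"
    by (rule integrable_bounded_mult[OF integrable_pair_mult[OF sigma_finite_slab sigma_finite_slab b a] _ M])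
      measurable
  then show ?thesis by (simp add: mult.commute)
qed

lemma two_time_etan_integrable:
  fixes a b :: "real \<times> (real ^ 'd) \<Rightarrow> real"
  assumes b: "integrable (slab T) b" and a: "integrable (slab T) a"
    and [measurable]: "\<kappa> \<in> borel_measurable ((borel \<Otimes>\<^sub>M borel) \<Otimes>\<^sub>M (borel \<Otimes>\<^sub>M borel))"
    and M: "\<And>p. \<bar>\<kappa> p\<bar> \<le> M"
  shows "integrable (slab2 T) (\<lambda>p. b (fst p) * a (snd p) * \<kappa> p * etan n (fst (fst p) - fst (snd p)))"
proof -
  obtain C where C: "\<And>r. \<bar>etan n r\<bar> \<le> C" using etan_bounded by blast
  have "integrable (slab2 T) (\<lambda>p. etan n (fst (fst p) - fst (snd p)) * (b (fst p) * a (snd p) * \<kappa> p))"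
    by (rule integrable_bounded_mult[OF two_time_integrable[OF b a _ M] _ C]) measurable
  then show ?thesis by (simp add: mult.commute)
qed

text \<open>Young's inequality at scale \<open>\<delta>\<close> bounds the product by a function of
  the first point plus a function of the second, and each is then integrated against the bump with
  loss at most 1. A small \<open>\<delta>\<close> makes the first term small, after which an
  \<open>a\<close> small in L^3 makes the second one small, for all \<open>n\<close> at
  once.\<close>

lemma two_time_bound:
  fixes a b :: "real \<times> (real ^ 'd) \<Rightarrow> real"
  assumes b: "Lp T (3/2) b" and a: "Lp T 3 a"
    and \<kappa> [measurable]: "\<kappa> \<in> borel_measurable ((borel \<Otimes>\<^sub>M borel) \<Otimes>\<^sub>M (borel \<Otimes>\<^sub>M borel))"
    and M: "\<And>p. \<bar>\<kappa> p\<bar> \<le> M" and \<delta>: "0 < \<delta>"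
  shows "\<bar>LINT p|slab2 T. b (fst p) * a (snd p) * \<kappa> p * etan n (fst (fst p) - fst (snd p))\<bar>
    \<le> M * (\<delta> powr (3/2) * (LINT z|slab T. \<bar>b z\<bar> powr (3/2)) + (LINT z|slab T. \<bar>a z\<bar> ^ 3) / \<delta> ^ 3)"
proof -
  define A where "A z = \<delta> powr (3/2) * \<bar>b z\<bar> powr (3/2)" for z
  define B where "B z = \<bar>a z\<bar> ^ 3 / \<delta> ^ 3" for z
  have iA: "integrable (slab T) A" unfolding A_def using Lp_integrable_powr[OF b] by (intro integrable_mult_right) simp
  have iB: "integrable (slab T) B" unfolding B_def using Lp_integrable_powr[OF a] by simp
  have A0: "0 \<le> A z" and B0: "0 \<le> B z" for z unfolding A_def B_def using \<delta> by auto
  have M0: "0 \<le> M" using M[of undefined] by linarith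
  note wA = weighted_etan_fst[OF iA A0] and wB = weighted_etan_snd[OF iB B0]
  have ab: "\<bar>b z\<bar> * \<bar>a w\<bar> \<le> A z + B w" for z w
  proof -
    have "\<bar>b z\<bar> * \<bar>a w\<bar> = (\<delta> * \<bar>b z\<bar>) * (\<bar>a w\<bar> / \<delta>)" using \<delta> by simp
    also have "\<dots> \<le> (\<delta> * \<bar>b z\<bar>) powr (3/2) + (\<bar>a w\<bar> / \<delta>) powr 3"
      using \<delta> by (intro young_32_3) auto
    also have "\<dots> = A z + B w" using \<delta> by (simp add: A_def B_def powr_mult power_divide)
    finally show ?thesis .
  qed
  have int: "integrable (slab2 T) (\<lambda>p. b (fst p) * a (snd p) * \<kappa> p * etan n (fst (fst p) - fst (snd p)))"
    by (rule two_time_etan_integrable[OF Lp_imp_integrable[OF b] Lp_imp_integrable[OF a] \<kappa> M]) auto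
  have intW: "integrable (slab2 T) (\<lambda>p. M * (A (fst p) * etan n (fst (fst p) - fst (snd p))
      + B (snd p) * etan n (fst (fst p) - fst (snd p))))"
    using wA(1) wB(1) by simp
  have "\<bar>LINT p|slab2 T. b (fst p) * a (snd p) * \<kappa> p * etan n (fst (fst p) - fst (snd p))\<bar>
    \<le> (LINT p|slab2 T. \<bar>b (fst p) * a (snd p) * \<kappa> p * etan n (fst (fst p) - fst (snd p))\<bar>)"
    by (rule integral_abs_bound)
  also have "\<dots> \<le> (LINT p|slab2 T. M * (A (fst p) * etan n (fst (fst p) - fst (snd p))
      + B (snd p) * etan n (fst (fst p) - fst (snd p))))"
  proof (rule integral_mono[OF _ intW])
    show "integrable (slab2 T) (\<lambda>p. \<bar>b (fst p) * a (snd p) * \<kappa> p * etan n (fst (fst p) - fst (snd p))\<bar>)"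
      using int by simp
    fix p :: "(real \<times> (real ^ 'd)) \<times> (real \<times> (real ^ 'd))"
    let ?e = "etan n (fst (fst p) - fst (snd p))"
    have "\<bar>b (fst p) * a (snd p) * \<kappa> p * ?e\<bar> = (\<bar>b (fst p)\<bar> * \<bar>a (snd p)\<bar>) * \<bar>\<kappa> p\<bar> * ?e"
      using etan_nonneg by (simp add: abs_mult)
    also have "\<dots> \<le> (A (fst p) + B (snd p)) * M * ?e"
      using ab[of "fst p" "snd p"] M[of p] A0 B0 etan_nonneg by (intro mult_right_mono mult_mono) auto
    also have "\<dots> = M * (A (fst p) * ?e + B (snd p) * ?e)" by (simp add: algebra_simps)
    finally show "\<bar>b (fst p) * a (snd p) * \<kappa> p * ?e\<bar> \<le> M * (A (fst p) * ?e + B (snd p) * ?e)" .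
  qed
  also have "\<dots> = M * ((LINT p|slab2 T. A (fst p) * etan n (fst (fst p) - fst (snd p)))
      + (LINT p|slab2 T. B (snd p) * etan n (fst (fst p) - fst (snd p))))"
    using wA(1) wB(1) by simp
  also have "\<dots> \<le> M * (integral\<^sup>L (slab T) A + integral\<^sup>L (slab T) B)"
    using wA(2) wB(2) M0 by (intro mult_left_mono add_mono)
  also have "\<dots> = M * (\<delta> powr (3/2) * (LINT z|slab T. \<bar>b z\<bar> powr (3/2)) + (LINT z|slab T. \<bar>a z\<bar> ^ 3) / \<delta> ^ 3)"
    unfolding A_def B_def by simp
  finally show ?thesis .
qed

text \<open>The expected limit obeys the same bound as the approximations, so that the same
  remainder is negligible on both sides of the limit.\<close>

lemma diagonal_bound:
  fixes a b :: "real \<times> (real ^ 'd) \<Rightarrow> real"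
  assumes b: "Lp T (3/2) b" and a: "Lp T 3 a"
    and [measurable]: "\<kappa> \<in> borel_measurable ((borel \<Otimes>\<^sub>M borel) \<Otimes>\<^sub>M borel)"
    and M: "\<And>p. \<bar>\<kappa> p\<bar> \<le> M" and \<delta>: "0 < \<delta>"
  shows "integrable (slabt T) (\<lambda>p. b (fst p) * a (fst (fst p), snd p) * \<kappa> p)"
    and "\<bar>LINT p|slabt T. b (fst p) * a (fst (fst p), snd p) * \<kappa> p\<bar>
    \<le> M * (\<delta> powr (3/2) * (LINT z|slab T. \<bar>b z\<bar> powr (3/2)) + (LINT z|slab T. \<bar>a z\<bar> ^ 3) / \<delta> ^ 3)"
proof -
  define A where "A z = \<delta> powr (3/2) * \<bar>b z\<bar> powr (3/2)" for z
  define B where "B z = \<bar>a z\<bar> ^ 3 / \<delta> ^ 3" for z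
  have iA: "integrable (slab T) A" unfolding A_def using Lp_integrable_powr[OF b] by (intro integrable_mult_right) simp
  have iB: "integrable (slab T) B" unfolding B_def using Lp_integrable_powr[OF a] by simp
  have A0: "0 \<le> A z" and B0: "0 \<le> B z" for z unfolding A_def B_def using \<delta> by auto
  have M0: "0 \<le> M" using M[of undefined] by linarith
  have jA: "integrable (slabt T) (\<lambda>p. A (fst p))"
    by (rule integrable_pair_fst[OF sigma_finite_slab torus.finite_measure_axioms iA])
  have jB': "integrable (slabt T) (\<lambda>p. B (fst p))"
    by (rule integrable_pair_fst[OF sigma_finite_slab torus.finite_measure_axioms iB])
  have jB: "integrable (slabt T) (\<lambda>p. B (fst (fst p), snd p))"
    using integrable_swap_space[OF jB'] by (simp only: swap_space_def fst_conv snd_conv)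
  have vA: "(LINT p|slabt T. A (fst p)) = integral\<^sup>L (slab T) A"
    using st.integral_fst'[OF jA] by simp
  have "(LINT p|slabt T. B (fst (fst p), snd p)) = (LINT p|slabt T. B (fst p))"
    using integral_swap_space[OF borel_measurable_integrable[OF jB']] by (simp only: swap_space_def fst_conv snd_conv)
  also have "\<dots> = integral\<^sup>L (slab T) B" using st.integral_fst'[OF jB'] by simp
  finally have vB: "(LINT p|slabt T. B (fst (fst p), snd p)) = integral\<^sup>L (slab T) B" .
  have ab: "\<bar>b z\<bar> * \<bar>a w\<bar> \<le> A z + B w" for z w
  proof -
    have "\<bar>b z\<bar> * \<bar>a w\<bar> = (\<delta> * \<bar>b z\<bar>) * (\<bar>a w\<bar> / \<delta>)" using \<delta> by simp
    also have "\<dots> \<le> (\<delta> * \<bar>b z\<bar>) powr (3/2) + (\<bar>a w\<bar> / \<delta>) powr 3"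
      using \<delta> by (intro young_32_3) auto
    also have "\<dots> = A z + B w" using \<delta> by (simp add: A_def B_def powr_mult power_divide)
    finally show ?thesis .
  qed
  have "integrable (slabt T) (\<lambda>p. b (fst p) * a (fst (fst p), snd p))"
    using integrable_two_point[OF b a] by (simp add: split_def)
  then have "integrable (slabt T) (\<lambda>p. \<kappa> p * (b (fst p) * a (fst (fst p), snd p)))"
    by (rule integrable_bounded_mult[OF _ _ M]) measurable
  then show int: "integrable (slabt T) (\<lambda>p. b (fst p) * a (fst (fst p), snd p) * \<kappa> p)"
    by (simp add: mult.commute)
  have intW: "integrable (slabt T) (\<lambda>p. M * (A (fst p) + B (fst (fst p), snd p)))"
    using jA jB by simp
  have "\<bar>LINT p|slabt T. b (fst p) * a (fst (fst p), snd p) * \<kappa> p\<bar>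
    \<le> (LINT p|slabt T. \<bar>b (fst p) * a (fst (fst p), snd p) * \<kappa> p\<bar>)"
    by (rule integral_abs_bound)
  also have "\<dots> \<le> (LINT p|slabt T. M * (A (fst p) + B (fst (fst p), snd p)))"
  proof (rule integral_mono[OF _ intW])
    show "integrable (slabt T) (\<lambda>p. \<bar>b (fst p) * a (fst (fst p), snd p) * \<kappa> p\<bar>)" using int by simp
    fix p :: "(real \<times> (real ^ 'd)) \<times> (real ^ 'd)"
    have "(\<bar>b (fst p)\<bar> * \<bar>a (fst (fst p), snd p)\<bar>) * \<bar>\<kappa> p\<bar> \<le> (A (fst p) + B (fst (fst p), snd p)) * M"
      using M[of p] A0 B0 ab by (intro mult_mono) auto
    then show "\<bar>b (fst p) * a (fst (fst p), snd p) * \<kappa> p\<bar> \<le> M * (A (fst p) + B (fst (fst p), snd p))"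
      by (simp add: abs_mult mult.commute)
  qed
  also have "\<dots> = M * (integral\<^sup>L (slab T) A + integral\<^sup>L (slab T) B)"
    using jA jB by (simp add: vA vB)
  also have "\<dots> = M * (\<delta> powr (3/2) * (LINT z|slab T. \<bar>b z\<bar> powr (3/2)) + (LINT z|slab T. \<bar>a z\<bar> ^ 3) / \<delta> ^ 3)"
    unfolding A_def B_def by simp
  finally show "\<bar>LINT p|slabt T. b (fst p) * a (fst (fst p), snd p) * \<kappa> p\<bar>
    \<le> M * (\<delta> powr (3/2) * (LINT z|slab T. \<bar>b z\<bar> powr (3/2)) + (LINT z|slab T. \<bar>a z\<bar> ^ 3) / \<delta> ^ 3)" .
qed

text \<open>At fixed \<open>z\<close> and \<open>y\<close> the function of the second time is
  bounded and continuous, so the approximate identity converges pointwise. The integrable function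
  \<open>C * M * \<bar>b z\<bar>\<close> then dominates the remaining integral.\<close>

lemma two_time_limit_continuous:
  fixes b g :: "real \<times> (real ^ 'd) \<Rightarrow> real"
  assumes b: "Lp T (3/2) b" and g: "continuous_on UNIV g" "\<And>z. \<bar>g z\<bar> \<le> C"
    and \<kappa>: "continuous_on UNIV \<kappa>" and M: "\<And>p. \<bar>\<kappa> p\<bar> \<le> M"
  shows "(\<lambda>n. LINT p|slab2 T. b (fst p) * g (snd p) * \<kappa> p * etan n (fst (fst p) - fst (snd p)))
    \<longlonglongrightarrow> (LINT p|slabt T. b (fst p) * g (fst (fst p), snd p) * \<kappa> (fst p, (fst (fst p), snd p)))"
proof -
  have [measurable]: "b \<in> borel_measurable (borel \<Otimes>\<^sub>M borel)" using b by measurable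
  have [measurable]: "g \<in> borel_measurable (borel \<Otimes>\<^sub>M borel)"
    "\<kappa> \<in> borel_measurable ((borel \<Otimes>\<^sub>M borel) \<Otimes>\<^sub>M (borel \<Otimes>\<^sub>M borel))"
    using borel_measurable_continuous_onI[OF g(1)] borel_measurable_continuous_onI[OF \<kappa>]
    by (simp_all add: borel_prod)
  have C0: "0 \<le> C" using g(2)[of undefined] by linarith
  have M0: "0 \<le> M" using M[of undefined] by linarith
  have ib: "integrable (slab T) b" by (rule Lp_imp_integrable[OF b]) simp
  have ig: "integrable (slab T) g"
    by (rule slab.integrable_const_bound[where B = C]) (use g(2) in auto)
  define h where "h z w = g w * \<kappa> (z, w)" for z w
  have h_bound: "\<bar>h z w\<bar> \<le> C * M" for z w
    unfolding h_def abs_mult using g(2) M C0 by (intro mult_mono) auto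
  have h_meas [measurable]: "(\<lambda>(z, w). h z w) \<in> borel_measurable ((borel \<Otimes>\<^sub>M borel) \<Otimes>\<^sub>M (borel \<Otimes>\<^sub>M borel))"
    unfolding h_def by measurable
  have cont_h: "continuous_on UNIV (h z)" for z
  proof -
    have "continuous_on UNIV (\<lambda>w. \<kappa> (z, w))"
      by (rule continuous_on_compose2[OF \<kappa>]) (auto intro!: continuous_intros)
    then show ?thesis unfolding h_def by (intro continuous_on_mult g(1))
  qed
  have cont_hs: "continuous_on UNIV (\<lambda>s. h z (s, y))" for z y
    by (rule continuous_on_compose2[OF cont_h]) (auto intro!: continuous_intros)
  have [measurable]: "h z \<in> borel_measurable (borel \<Otimes>\<^sub>M borel)" for z
    using borel_measurable_continuous_onI[OF cont_h] by (simp add: borel_prod)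
  have [measurable]: "(\<lambda>s. h z (s, y)) \<in> borel_measurable borel" for z y
    by (rule borel_measurable_continuous_onI[OF cont_hs])
  \<comment> \<open>Only the second time is averaged; the second space point stays a variable of
    integration and becomes the torus variable of the limit.\<close>
  define F where "F n z y = (LINT s|time_measure T. h z (s, y) * etan n (fst z - s))" for n z y
  have F_meas [measurable]: "(\<lambda>p. F n (fst p) (snd p)) \<in> borel_measurable ((borel \<Otimes>\<^sub>M borel) \<Otimes>\<^sub>M borel)" for n
    unfolding F_def by measurable
  have int_s: "integrable (time_measure T) (\<lambda>s. h z (s, y) * etan n (fst z - s))" for n z y
    by (rule integrable_bounded_mult[OF integrable_time_etan(1) _ h_bound]) measurable
  have F_bound: "\<bar>F n z y\<bar> \<le> C * M" for n z y
  proof -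
    have "\<bar>F n z y\<bar> \<le> (LINT s|time_measure T. \<bar>h z (s, y) * etan n (fst z - s)\<bar>)"
      unfolding F_def by (rule integral_abs_bound)
    also have "\<dots> \<le> (LINT s|time_measure T. C * M * etan n (fst z - s))"
    proof (rule integral_mono)
      show "integrable (time_measure T) (\<lambda>s. \<bar>h z (s, y) * etan n (fst z - s)\<bar>)" using int_s by simp
      show "integrable (time_measure T) (\<lambda>s. C * M * etan n (fst z - s))" using integrable_time_etan(1) by simp
      show "\<bar>h z (s, y) * etan n (fst z - s)\<bar> \<le> C * M * etan n (fst z - s)" for s
        unfolding abs_mult using h_bound etan_nonneg by (simp add: mult_right_mono)
    qed
    also have "\<dots> = C * M * (LINT s|time_measure T. etan n (fst z - s))" by simp
    also have "\<dots> \<le> C * M * 1" using C0 M0 by (intro mult_left_mono etan_time_le) auto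
    finally show ?thesis by simp
  qed
  have int_bF: "integrable (slabt T) (\<lambda>p. b (fst p) * F n (fst p) (snd p))" for n
  proof -
    have "integrable (slabt T) (\<lambda>p. F n (fst p) (snd p) * b (fst p))"
      by (rule integrable_bounded_mult[OF integrable_pair_fst[OF sigma_finite_slab torus.finite_measure_axioms ib] _ F_bound])
        measurable
    then show ?thesis by (simp add: mult.commute)
  qed
  have J: "(LINT p|slab2 T. b (fst p) * g (snd p) * \<kappa> p * etan n (fst (fst p) - fst (snd p)))
      = (LINT p|slabt T. b (fst p) * F n (fst p) (snd p))" for n
  proof -
    have inner: "(LINT w|slab T. h z w * etan n (fst z - fst w)) = (LINT y|torus. F n z y)" for z
    proof -
      have "integrable (slab T) (\<lambda>w. h z w * etan n (fst z - fst w))"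
        by (rule integrable_bounded_mult[OF integrable_slab_fst[OF integrable_time_etan(1)] _ h_bound]) measurable
      then have "integrable (time_measure T \<Otimes>\<^sub>M torus) (\<lambda>(s, y). h z (s, y) * etan n (fst z - s))"
        by (simp add: slab_def split_def)
      from tt.integral_snd[OF this] show ?thesis by (simp add: F_def slab_def split_def)
    qed
    have int2: "integrable (slab2 T) (\<lambda>p. b (fst p) * g (snd p) * \<kappa> p * etan n (fst (fst p) - fst (snd p)))"
      by (rule two_time_etan_integrable[OF ib ig _ M]) measurable
    have "(LINT p|slab2 T. b (fst p) * g (snd p) * \<kappa> p * etan n (fst (fst p) - fst (snd p)))
        = (LINT z|slab T. (LINT w|slab T. b z * (h z w * etan n (fst z - fst w))))"
      using ss.integral_fst'[OF int2] by (simp add: h_def mult.assoc)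
    also have "\<dots> = (LINT z|slab T. (LINT y|torus. b z * F n z y))" by (simp add: inner)
    also have "\<dots> = (LINT p|slabt T. b (fst p) * F n (fst p) (snd p))"
      using st.integral_fst'[OF int_bF] by simp
    finally show ?thesis .
  qed
  have AE_t: "AE p :: (real \<times> (real ^ 'd)) \<times> (real ^ 'd) in slabt T. fst (fst p) \<in> {0<..<T}"
  proof -
    have "AE t in time_measure T. t \<in> {0<..<T}" by (simp add: AE_time_measure_iff)
    then have "AE z in (slab T :: (real \<times> (real ^ 'd)) measure). fst z \<in> {0<..<T}" by (rule AE_slab_I)
    then show ?thesis by (intro st.AE_pair_measure) auto
  qed
  have "(\<lambda>n. LINT p|slabt T. b (fst p) * F n (fst p) (snd p))
    \<longlonglongrightarrow> (LINT p|slabt T. b (fst p) * h (fst p) (fst (fst p), snd p))"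
  proof (rule integral_dominated_convergence)
    have "integrable (slabt T) (\<lambda>p. \<bar>b (fst p)\<bar>)"
      by (rule integrable_pair_fst[OF sigma_finite_slab torus.finite_measure_axioms integrable_abs[OF ib]])
    then show "integrable (slabt T) (\<lambda>p. C * M * \<bar>b (fst p)\<bar>)" by simp
    show "AE p in slabt T. norm (b (fst p) * F n (fst p) (snd p)) \<le> C * M * \<bar>b (fst p)\<bar>" for n
    proof (rule AE_I2)
      fix p :: "(real \<times> (real ^ 'd)) \<times> (real ^ 'd)"
      have "\<bar>b (fst p)\<bar> * \<bar>F n (fst p) (snd p)\<bar> \<le> \<bar>b (fst p)\<bar> * (C * M)"
        by (intro mult_left_mono F_bound) auto
      then show "norm (b (fst p) * F n (fst p) (snd p)) \<le> C * M * \<bar>b (fst p)\<bar>"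
        by (simp add: abs_mult mult.commute)
    qed
    show "AE p in slabt T. (\<lambda>n. b (fst p) * F n (fst p) (snd p)) \<longlonglongrightarrow> b (fst p) * h (fst p) (fst (fst p), snd p)"
      using AE_t
    proof eventually_elim
      case (elim p)
      from etan_approx[OF cont_hs elim h_bound]
      have "(\<lambda>n. F n (fst p) (snd p)) \<longlonglongrightarrow> h (fst p) (fst (fst p), snd p)" by (simp add: F_def)
      then show ?case by (intro tendsto_intros)
    qed
  qed measurable
  then show ?thesis unfolding J h_def by (simp add: mult.assoc)
qed

text \<open>Only the L^3 factor is approximated by a continuous one. The remainder is small in L^3
  and, by the two bounds, contributes at most \<open>e / 4\<close> to each side, uniformly in
  \<open>n\<close>.\<close>

lemma two_time_limit:
  fixes a b :: "real \<times> (real ^ 'd) \<Rightarrow> real"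
  assumes b: "Lp T (3/2) b" and a: "Lp T 3 a"
    and \<kappa>: "continuous_on UNIV \<kappa>" and M: "\<And>p. \<bar>\<kappa> p\<bar> \<le> M"
  shows "(\<lambda>n. LINT p|slab2 T. b (fst p) * a (snd p) * \<kappa> p * etan n (fst (fst p) - fst (snd p)))
    \<longlonglongrightarrow> (LINT p|slabt T. b (fst p) * a (fst (fst p), snd p) * \<kappa> (fst p, (fst (fst p), snd p)))"
proof (rule LIMSEQ_I)
  fix e :: real assume e: "0 < e"
  have [measurable]: "\<kappa> \<in> borel_measurable ((borel \<Otimes>\<^sub>M borel) \<Otimes>\<^sub>M (borel \<Otimes>\<^sub>M borel))"
    using borel_measurable_continuous_onI[OF \<kappa>] by (simp add: borel_prod)
  have \<kappa>_meas: "\<kappa> \<in> borel_measurable ((borel \<Otimes>\<^sub>M borel) \<Otimes>\<^sub>M (borel \<Otimes>\<^sub>M borel))" by measurable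
  define \<kappa>0 where "\<kappa>0 p = \<kappa> (fst p, (fst (fst p), snd p))" for p
  have \<kappa>0_meas: "\<kappa>0 \<in> borel_measurable ((borel \<Otimes>\<^sub>M borel) \<Otimes>\<^sub>M borel)" unfolding \<kappa>0_def by measurable
  have M_0: "\<bar>\<kappa>0 p\<bar> \<le> M" for p unfolding \<kappa>0_def by (rule M)
  have M0: "0 \<le> M" using M[of undefined] by linarith
  define B where "B = (LINT z|slab T. \<bar>b z\<bar> powr (3/2))"
  have B0: "0 \<le> B" unfolding B_def by simp
  \<comment> \<open>The exponent inverts \<open>3/2\<close>, so that the first term of the bound is
    at most \<open>e / 8\<close>; the added 1 keeps the denominator positive when
    \<open>M * B\<close> is 0.\<close>
  define \<delta> where "\<delta> = (e / (8 * (M * B + 1))) powr (2/3)"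
  have MB: "0 < M * B + 1" using M0 B0 by (simp add: add_nonneg_pos)
  have \<delta>: "0 < \<delta>" using e MB by (simp add: \<delta>_def)
  have \<delta>32: "\<delta> powr (3/2) = e / (8 * (M * B + 1))" using e MB by (simp add: \<delta>_def powr_powr)
  have small1: "M * (\<delta> powr (3/2) * B) \<le> e / 8"
  proof -
    have "M * (\<delta> powr (3/2) * B) = e / 8 * ((M * B) / (M * B + 1))" by (simp add: \<delta>32)
    also have "\<dots> \<le> e / 8 * 1" using e MB by (intro mult_left_mono) auto
    finally show ?thesis by simp
  qed
  \<comment> \<open>The L^3 error allowed once \<open>\<delta>\<close> is fixed: it makes the second
    term of the bound at most \<open>e / 8\<close>.\<close>
  define d where "d = e * \<delta> ^ 3 / (8 * (M + 1))"
  have d: "0 < d" using e \<delta> M0 by (simp add: d_def)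
  from continuous_approx_L3[OF a d] obtain g C where g: "continuous_on UNIV g" "\<And>z. \<bar>g z\<bar> \<le> C"
    and gd: "(LINT z|slab T. \<bar>a z - g z\<bar> ^ 3) < d" by blast
  have [measurable]: "g \<in> borel_measurable (borel \<Otimes>\<^sub>M borel)"
    using borel_measurable_continuous_onI[OF g(1)] by (simp add: borel_prod)
  have Lg: "Lp T 3 g"
  proof (rule Lp_dominated)
    show "\<bar>g z\<bar> powr 3 \<le> C powr 3" for z using g(2) by (intro powr_mono2) auto
  qed auto
  define r where "r z = a z - g z" for z
  have Lr: "Lp T 3 r" unfolding r_def by (rule Lp_diff[OF a Lg]) simp
  have small2: "M * ((LINT z|slab T. \<bar>r z\<bar> ^ 3) / \<delta> ^ 3) \<le> e / 8"
  proof -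
    have "M * ((LINT z|slab T. \<bar>r z\<bar> ^ 3) / \<delta> ^ 3) \<le> (M + 1) * (d / \<delta> ^ 3)"
      using gd \<delta> M0 by (intro mult_mono divide_right_mono) (auto simp: r_def)
    also have "d / \<delta> ^ 3 = (e / 8) / (M + 1)" using \<delta> by (simp add: d_def)
    also have "(M + 1) * ((e / 8) / (M + 1)) = e / 8"
      using M0 by (metis add_nonneg_pos less_numeral_extra(1,3) nonzero_mult_div_cancel_left times_divide_eq_right)
    finally show ?thesis .
  qed
  let ?J = "\<lambda>a n. LINT p|slab2 T. b (fst p) * a (snd p) * \<kappa> p * etan n (fst (fst p) - fst (snd p))"
  let ?L = "\<lambda>a. LINT p|slabt T. b (fst p) * a (fst (fst p), snd p) * \<kappa>0 p"
  note ib = Lp_imp_integrable[OF b, simplified]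
  have J_split: "?J a n = ?J g n + ?J r n" for n
  proof -
    have "?J a n = (LINT p|slab2 T. b (fst p) * g (snd p) * \<kappa> p * etan n (fst (fst p) - fst (snd p))
        + b (fst p) * r (snd p) * \<kappa> p * etan n (fst (fst p) - fst (snd p)))"
      by (rule arg_cong[where f = "integral\<^sup>L (slab2 T)"]) (auto simp: r_def algebra_simps)
    then show ?thesis
      using two_time_etan_integrable[OF ib Lp_imp_integrable[OF Lg, simplified] \<kappa>_meas M, of n]
        two_time_etan_integrable[OF ib Lp_imp_integrable[OF Lr, simplified] \<kappa>_meas M, of n]
      by simp
  qed
  have L_split: "?L a = ?L g + ?L r"
  proof -
    have "?L a = (LINT p|slabt T. b (fst p) * g (fst (fst p), snd p) * \<kappa>0 p + b (fst p) * r (fst (fst p), snd p) * \<kappa>0 p)"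
      by (rule arg_cong[where f = "integral\<^sup>L (slabt T)"]) (auto simp: r_def algebra_simps)
    then show ?thesis
      using diagonal_bound(1)[OF b Lg \<kappa>0_meas M_0 \<delta>] diagonal_bound(1)[OF b Lr \<kappa>0_meas M_0 \<delta>] by simp
  qed
  have small: "M * (\<delta> powr (3/2) * B + (LINT z|slab T. \<bar>r z\<bar> ^ 3) / \<delta> ^ 3) \<le> e / 4"
    unfolding distrib_left using small1 small2 by linarith
  have Jr: "\<bar>?J r n\<bar> \<le> e / 4" for n
    using two_time_bound[OF b Lr \<kappa>_meas M \<delta>, of n] small unfolding B_def by linarith
  have Lr': "\<bar>?L r\<bar> \<le> e / 4"
    using diagonal_bound(2)[OF b Lr \<kappa>0_meas M_0 \<delta>] small unfolding B_def by linarith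
  have "?J g \<longlonglongrightarrow> ?L g" using two_time_limit_continuous[OF b g \<kappa> M] unfolding \<kappa>0_def .
  from LIMSEQ_D[OF this, of "e / 4"] e obtain N where N: "\<And>n. N \<le> n \<Longrightarrow> \<bar>?J g n - ?L g\<bar> < e / 4" by auto
  have "\<bar>?J a n - ?L a\<bar> < e" if "N \<le> n" for n
    using N[OF that] Jr[of n] Lr' e unfolding J_split L_split by linarith
  then show "\<exists>N. \<forall>n\<ge>N. norm (?J a n - (LINT p|slabt T. b (fst p) * a (fst (fst p), snd p) * \<kappa> (fst p, (fst (fst p), snd p)))) < e"
    unfolding \<kappa>0_def real_norm_def by blast
qed

lemma time_bump_reversed: "time_bump (\<lambda>r. \<eta> (- r)) R"
proof
  show "smooth (\<lambda>r. \<eta> (- r))"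
    using smooth_affine[OF smooth_eta bounded_linear_minus[OF bounded_linear_ident], of 0] by simp
  show "integrable lborel (\<lambda>r. \<eta> (- r))" using integrable_lborel_reflect[of \<eta> 0] eta_integrable by simp
  show "(LINT r|lborel. \<eta> (- r)) = 1" using integral_lborel_reflect[of \<eta> 0] eta_integral by simp
qed (use eta_nonneg R_pos eta_supp in auto)

text \<open>Exchanging the two points gives the previous limit for the reversed bump and the
  transposed kernel. In the limit the times agree, and only the space points are left to
  exchange.\<close>

lemma two_time_limit_swapped:
  fixes a b :: "real \<times> (real ^ 'd) \<Rightarrow> real"
  assumes b: "Lp T (3/2) b" and a: "Lp T 3 a"
    and \<kappa>: "continuous_on UNIV \<kappa>" and M: "\<And>p. \<bar>\<kappa> p\<bar> \<le> M"
  shows "(\<lambda>n. LINT p|slab2 T. a (fst p) * b (snd p) * \<kappa> p * etan n (fst (fst p) - fst (snd p)))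
    \<longlonglongrightarrow> (LINT p|slabt T. a (fst p) * b (fst (fst p), snd p) * \<kappa> (fst p, (fst (fst p), snd p)))"
proof -
  interpret rev: time_bump "\<lambda>r. \<eta> (- r)" R by (rule time_bump_reversed)
  have [measurable]: "a \<in> borel_measurable (borel \<Otimes>\<^sub>M borel)" "b \<in> borel_measurable (borel \<Otimes>\<^sub>M borel)"
    using a b by measurable
  have [measurable]: "\<kappa> \<in> borel_measurable ((borel \<Otimes>\<^sub>M borel) \<Otimes>\<^sub>M (borel \<Otimes>\<^sub>M borel))"
    using borel_measurable_continuous_onI[OF \<kappa>] by (simp add: borel_prod)
  define \<kappa>' where "\<kappa>' p = \<kappa> (snd p, fst p)" for p
  have \<kappa>': "continuous_on UNIV \<kappa>'"
    unfolding \<kappa>'_def by (rule continuous_on_compose2[OF \<kappa>]) (auto intro!: continuous_intros)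
  have rev_etan: "rev.etan n r = etan n (- r)" for n r by (simp add: rev.etan_def etan_def)
  have "(\<lambda>n. LINT p|slab2 T. b (fst p) * a (snd p) * \<kappa>' p * rev.etan n (fst (fst p) - fst (snd p)))
    \<longlonglongrightarrow> (LINT p|slabt T. b (fst p) * a (fst (fst p), snd p) * \<kappa>' (fst p, (fst (fst p), snd p)))"
    by (rule rev.two_time_limit[OF b a \<kappa>', where M = M]) (simp add: \<kappa>'_def M)
  moreover have "(LINT p|slab2 T. b (fst p) * a (snd p) * \<kappa>' p * rev.etan n (fst (fst p) - fst (snd p)))
      = (LINT p|slab2 T. a (fst p) * b (snd p) * \<kappa> p * etan n (fst (fst p) - fst (snd p)))" for n
  proof -
    let ?f = "\<lambda>p. a (fst p) * b (snd p) * \<kappa> p * etan n (fst (fst p) - fst (snd p))"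
    have "(LINT p|slab2 T. ?f p) = (LINT (x, y)|slab2 T. ?f (y, x))"
      by (rule ss.integral_product_swap[symmetric]) measurable
    also have "\<dots> = (LINT p|slab2 T. b (fst p) * a (snd p) * \<kappa>' p * rev.etan n (fst (fst p) - fst (snd p)))"
      by (simp add: split_def \<kappa>'_def rev_etan mult_ac)
    finally show ?thesis by simp
  qed
  moreover have "(LINT p|slabt T. b (fst p) * a (fst (fst p), snd p) * \<kappa>' (fst p, (fst (fst p), snd p)))
      = (LINT p|slabt T. a (fst p) * b (fst (fst p), snd p) * \<kappa> (fst p, (fst (fst p), snd p)))"
  proof -
    let ?f = "\<lambda>p :: (real \<times> (real ^ 'd)) \<times> (real ^ 'd). a (fst p) * b (fst (fst p), snd p) * \<kappa> (fst p, (fst (fst p), snd p))"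
    have "(LINT p|slabt T. ?f p) = (LINT p|slabt T. ?f (swap_space p))"
      by (rule integral_swap_space[symmetric]) measurable
    also have "\<dots> = (LINT p|slabt T. b (fst p) * a (fst (fst p), snd p) * \<kappa>' (fst p, (fst (fst p), snd p)))"
      by (simp add: swap_space_def \<kappa>'_def mult_ac)
    finally show ?thesis by simp
  qed
  ultimately show ?thesis by simp
qed

end

subsection \<open>Two-point test functions\<close>

abbreviation dird :: "'a::real_normed_vector \<Rightarrow> ('a \<Rightarrow> real) \<Rightarrow> 'a \<Rightarrow> real" where
  "dird v f \<equiv> \<lambda>x. frechet_derivative f (at x) v"

text \<open>The kernel has two space points but one time, that of the first point. The second time
  enters only through \<open>etan\<close>, so the derivatives of the bump are the only terms common
  to both equations. The interval of support is explicit because it must leave room for the width of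
  the bump.\<close>

definition test2 :: "real \<Rightarrow> real \<Rightarrow> ((real \<times> (real ^ 'd)) \<times> (real ^ 'd) \<Rightarrow> real) \<Rightarrow> bool" where
  "test2 \<alpha> \<beta> K \<longleftrightarrow> smooth K \<and> (\<forall>t x y i. K ((t, x + axis i 1), y) = K ((t, x), y)) \<and>
    (\<forall>t x y i. K ((t, x), y + axis i 1) = K ((t, x), y)) \<and>
    (\<forall>t x y. t \<notin> {\<alpha>..\<beta>} \<longrightarrow> K ((t, x), y) = 0)"

lemma dird_translate:
  assumes "smooth f" shows "dird v (\<lambda>x. f (x + c)) x = dird v f (x + c)"
  using dird_affine[OF assms bounded_linear_ident, of c x v] by simp

text \<open>Differentiation commutes with translations, which preserves both periodicities; and
  \<open>K\<close> vanishes on the open set of times outside the interval, so its derivatives vanish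
  there too.\<close>

lemma test2_dird:
  fixes K :: "(real \<times> (real ^ 'd)) \<times> (real ^ 'd) \<Rightarrow> real"
  assumes "test2 \<alpha> \<beta> K" shows "test2 \<alpha> \<beta> (dird v K)"
proof -
  have K: "smooth K" using assms by (simp add: test2_def)
  have 1: "dird v K ((t, x + axis i 1), y) = dird v K ((t, x), y)" for t x y i
  proof -
    have "(\<lambda>p. K (p + ((0, axis i 1), 0))) = K"
      using assms by (auto simp: test2_def fun_eq_iff)
    then show ?thesis using dird_translate[OF K, where v = v and c = "((0, axis i 1), 0)" and x = "((t, x), y)"] by simp
  qed
  have 2: "dird v K ((t, x), y + axis i 1) = dird v K ((t, x), y)" for t x y i
  proof -
    have "(\<lambda>p. K (p + ((0, 0), axis i 1))) = K"
      using assms by (auto simp: test2_def fun_eq_iff)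
    then show ?thesis using dird_translate[OF K, where v = v and c = "((0, 0), axis i 1)" and x = "((t, x), y)"] by simp
  qed
  have 3: "dird v K ((t, x), y) = 0" if "t \<notin> {\<alpha>..\<beta>}" for t x y
  proof -
    define S where "S = ((- {\<alpha>..\<beta>}) \<times> (UNIV :: (real ^ 'd) set)) \<times> (UNIV :: (real ^ 'd) set)"
    have "open S" unfolding S_def by (intro open_Times open_UNIV) auto
    moreover have "((t, x), y) \<in> S" using that by (simp add: S_def)
    moreover have "((\<lambda>p. 0) has_derivative (\<lambda>p. 0)) (at ((t, x), y))" by simp
    ultimately have "(K has_derivative (\<lambda>p. 0)) (at ((t, x), y))"
      using assms by (intro has_derivative_transform_within_open[where f = "\<lambda>p. 0" and g = K and s = S])
        (auto simp: S_def test2_def)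
    from fun_cong[OF frechet_derivative_at[OF this], of v] show ?thesis by simp
  qed
  show ?thesis unfolding test2_def using smooth_dird[OF K] 1 2 3 by blast
qed

text \<open>Periodicity in both points and the support in time reduce the supremum to that over a
  compact set.\<close>

lemma test2_bounded:
  fixes K :: "(real \<times> (real ^ 'd)) \<times> (real ^ 'd) \<Rightarrow> real"
  assumes K: "test2 \<alpha> \<beta> K"
  obtains M where "\<And>p. \<bar>K p\<bar> \<le> M"
proof -
  define S :: "((real \<times> (real ^ 'd)) \<times> (real ^ 'd)) set" where "S = ({\<alpha>..\<beta>} \<times> cbox 0 1) \<times> cbox 0 1"
  have "continuous_on S K" using K smooth_continuous_on by (auto simp: test2_def)
  moreover have "compact S" unfolding S_def by (intro compact_Times compact_Icc compact_cbox)
  ultimately have "bounded (K ` S)" by (intro compact_imp_bounded compact_continuous_image)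
  then obtain M where M: "\<forall>p\<in>S. \<bar>K p\<bar> \<le> M" unfolding bounded_iff by auto
  have fl: "x - vec_floor x \<in> cbox 0 1" for x :: "real ^ 'd"
    using diff_vec_floor_half_cube[of x] by (auto simp: half_cube_def mem_box_cart less_imp_le)
  show ?thesis
  proof (rule that[of "max M 0"])
    fix p :: "(real \<times> (real ^ 'd)) \<times> (real ^ 'd)"
    obtain t x y where p: "p = ((t, x), y)" by (metis prod.collapse)
    show "\<bar>K p\<bar> \<le> max M 0"
    proof (cases "t \<in> {\<alpha>..\<beta>}")
      case True
      have "periodic (\<lambda>x. K ((t, x), y))" "periodic (\<lambda>y. K ((t, x - vec_floor x), y))"
        using K by (simp_all add: test2_def periodic_def)
      from periodic_int_vec[OF this(1) vec_floor_int_vec, of "x - vec_floor x" x]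
        periodic_int_vec[OF this(2) vec_floor_int_vec, of "y - vec_floor y" y]
      have "K p = K ((t, x - vec_floor x), y - vec_floor y)" by (simp add: p)
      moreover have "((t, x - vec_floor x), y - vec_floor y) \<in> S" using True fl by (simp add: S_def)
      ultimately show ?thesis using M by (simp add: le_max_iff_disj)
    next
      case False
      then have "K p = 0" using K by (simp add: test2_def p)
      then show ?thesis by simp
    qed
  qed
qed

lemma test2_continuous: "test2 \<alpha> \<beta> K \<Longrightarrow> continuous_on A K"
  by (simp add: test2_def smooth_continuous_on)

lemma test2_measurable:
  "test2 \<alpha> \<beta> K \<Longrightarrow> K \<in> borel_measurable ((borel \<Otimes>\<^sub>M borel) \<Otimes>\<^sub>M borel)"
  using borel_measurable_continuous_onI[OF test2_continuous[of \<alpha> \<beta> K UNIV]] by (simp add: borel_prod)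

lemma smooth_section1:
  fixes K :: "(real \<times> (real ^ 'd)) \<times> (real ^ 'd) \<Rightarrow> real"
  assumes "smooth K"
  shows "smooth (\<lambda>z. K (z, y))" and "dird v (\<lambda>z. K (z, y)) z = dird (v, 0) K (z, y)"
proof -
  have bl: "bounded_linear (\<lambda>z :: real \<times> (real ^ 'd). (z, 0 :: real ^ 'd))"
    by (intro bounded_linear_Pair bounded_linear_ident bounded_linear_zero)
  show "smooth (\<lambda>z. K (z, y))" "dird v (\<lambda>z. K (z, y)) z = dird (v, 0) K (z, y)"
    using smooth_affine[OF assms bl, of "(0, y)"] dird_affine[OF assms bl, of "(0, y)" z v] by simp_all
qed

lemma smooth_section2:
  fixes K :: "(real \<times> (real ^ 'd)) \<times> (real ^ 'd) \<Rightarrow> real"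
  assumes "smooth K"
  shows "smooth (\<lambda>w :: real \<times> (real ^ 'd). K (z, snd w))"
    and "dird v (\<lambda>w :: real \<times> (real ^ 'd). K (z, snd w)) w = dird (0, snd v) K (z, snd w)"
proof -
  have bl: "bounded_linear (\<lambda>w :: real \<times> (real ^ 'd). (0 :: real \<times> (real ^ 'd), snd w))"
    by (intro bounded_linear_Pair bounded_linear_snd bounded_linear_zero)
  show "smooth (\<lambda>w :: real \<times> (real ^ 'd). K (z, snd w))"
    "dird v (\<lambda>w :: real \<times> (real ^ 'd). K (z, snd w)) w = dird (0, snd v) K (z, snd w)"
    using smooth_affine[OF assms bl, of "(z, 0)"] dird_affine[OF assms bl, of "(z, 0)" w v] by simp_all
qed

text \<open>The bump depends on the difference of the two times: \<open>c\<close> is 1 for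
  differentiation at the first point and -1 at the second.\<close>

lemma smooth_time_factor:
  fixes h :: "real \<Rightarrow> real"
  assumes "smooth h"
  shows "smooth (\<lambda>w :: real \<times> (real ^ 'd). h (c * fst w + s))"
    and "dird v (\<lambda>w :: real \<times> (real ^ 'd). h (c * fst w + s)) w = c * fst v * dird 1 h (c * fst w + s)"
proof -
  have bl: "bounded_linear (\<lambda>w :: real \<times> (real ^ 'd). c * fst w)"
    by (intro bounded_linear_const_mult bounded_linear_fst)
  show "smooth (\<lambda>w :: real \<times> (real ^ 'd). h (c * fst w + s))" by (rule smooth_affine[OF assms bl])
  have "dird (c * fst v) h r = c * fst v * dird 1 h r" for r
    using linear_scale[OF linear_frechet_derivative_smooth[OF assms], of r "c * fst v" 1] by simp
  then show "dird v (\<lambda>w :: real \<times> (real ^ 'd). h (c * fst w + s)) w = c * fst v * dird 1 h (c * fst w + s)"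
    using dird_affine[OF assms bl, of s w v] by simp
qed

context time_bump
begin

abbreviation etan' :: "nat \<Rightarrow> real \<Rightarrow> real" where "etan' n \<equiv> dird 1 (etan n)"

lemma etan'_bounded: obtains C where "\<And>r. \<bar>etan' n r\<bar> \<le> C"
proof -
  have "etan' n r = 0" if "R / real (Suc n) < norm r" for r
  proof (rule frechet_derivative_zero_outside[OF _ that])
    fix r :: real assume "R / real (Suc n) < norm r"
    then show "etan n r = 0" by (intro etan_supp) (simp add: field_simps)
  qed
  with compact_support_bounded[OF smooth_continuous_on[OF smooth_dird[OF smooth_etan]], of "R / real (Suc n)" n 1]
  show ?thesis using that by blast
qed

lemma etan'_measurable [measurable]: "etan' n \<in> borel_measurable borel"
  by (rule smooth_borel_measurable[OF smooth_dird[OF smooth_etan]])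

lemma first_variable_test:
  fixes K :: "(real \<times> (real ^ 'd)) \<times> (real ^ 'd) \<Rightarrow> real" and n :: nat
  assumes K: "test2 \<alpha> \<beta> K" and ab: "0 < \<alpha>" "\<beta> < T"
  defines "\<psi> \<equiv> \<lambda>w z. etan n (fst z - fst w) * K (z, snd w)"
  shows "test_fun T (\<psi> w)"
    and "pd_t (\<psi> w) z = etan n (fst z - fst w) * dird ((1, 0), 0) K (z, snd w) + etan' n (fst z - fst w) * K (z, snd w)"
    and "pd_x k (\<psi> w) z = etan n (fst z - fst w) * dird ((0, axis k 1), 0) K (z, snd w)"
    and "pd_x k (pd_x k (\<psi> w)) z
      = etan n (fst z - fst w) * dird ((0, axis k 1), 0) (dird ((0, axis k 1), 0) K) (z, snd w)"
proof -
  have s1: "smooth (\<lambda>z :: real \<times> (real ^ 'd). etan n (fst z - fst w))"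
    and d1: "dird v (\<lambda>z :: real \<times> (real ^ 'd). etan n (fst z - fst w)) z = fst v * etan' n (fst z - fst w)" for v z
    using smooth_time_factor[OF smooth_etan, where n1 = n and c = 1 and s = "- fst w"] by simp_all
  have D: "dird v (\<lambda>z. etan n (fst z - fst w) * H (z, snd w)) z
      = etan n (fst z - fst w) * dird (v, 0) H (z, snd w) + fst v * etan' n (fst z - fst w) * H (z, snd w)"
    if "smooth H" for H :: "(real \<times> (real ^ 'd)) \<times> (real ^ 'd) \<Rightarrow> real" and v z
    using dird_mult[OF s1 smooth_section1(1)[OF that]] by (simp add: d1 smooth_section1(2)[OF that])
  have sK: "smooth K" using K by (simp add: test2_def)
  have "smooth (\<psi> w)" unfolding \<psi>_def by (rule smooth_mult[OF s1 smooth_section1(1)[OF sK]])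
  moreover have "space_periodic (\<psi> w)" using K by (simp add: \<psi>_def space_periodic_def test2_def)
  moreover have "\<forall>t x. t \<notin> {\<alpha>..\<beta>} \<longrightarrow> \<psi> w (t, x) = 0" using K by (simp add: \<psi>_def test2_def)
  ultimately show "test_fun T (\<psi> w)" unfolding test_fun_def using ab by blast
  show "pd_t (\<psi> w) z = etan n (fst z - fst w) * dird ((1, 0), 0) K (z, snd w) + etan' n (fst z - fst w) * K (z, snd w)"
    unfolding pd_t_def \<psi>_def D[OF sK] by simp
  have x1: "pd_x k (\<psi> w) = (\<lambda>z. etan n (fst z - fst w) * dird ((0, axis k 1), 0) K (z, snd w))"
    unfolding pd_x_def \<psi>_def D[OF sK] by simp
  then show "pd_x k (\<psi> w) z = etan n (fst z - fst w) * dird ((0, axis k 1), 0) K (z, snd w)" by simp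
  show "pd_x k (pd_x k (\<psi> w)) z
      = etan n (fst z - fst w) * dird ((0, axis k 1), 0) (dird ((0, axis k 1), 0) K) (z, snd w)"
    unfolding x1 unfolding pd_x_def D[OF smooth_dird[OF sK]] by simp
qed

text \<open>In the second time the support is not that of \<open>K\<close>: it spreads by the width
  of the bump. The hypotheses \<open>small\<close> keep it inside the time interval, which is why
  the two-point identity is first obtained for large \<open>n\<close> only.\<close>

lemma second_variable_test:
  fixes K :: "(real \<times> (real ^ 'd)) \<times> (real ^ 'd) \<Rightarrow> real" and n :: nat
  assumes K: "test2 \<alpha> \<beta> K" and ab: "0 < \<alpha>" "\<beta> < T"
    and small: "R < real (Suc n) * (\<alpha> / 2)" "R < real (Suc n) * ((T - \<beta>) / 2)"
  defines "\<psi> \<equiv> \<lambda>z w. etan n (fst z - fst w) * K (z, snd w)"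
  shows "test_fun T (\<psi> z)"
    and "pd_t (\<psi> z) w = - etan' n (fst z - fst w) * K (z, snd w)"
    and "pd_x k (\<psi> z) w = etan n (fst z - fst w) * dird (0, axis k 1) K (z, snd w)"
    and "pd_x k (pd_x k (\<psi> z)) w
      = etan n (fst z - fst w) * dird (0, axis k 1) (dird (0, axis k 1) K) (z, snd w)"
proof -
  have s1: "smooth (\<lambda>w :: real \<times> (real ^ 'd). etan n (fst z - fst w))"
    and d1: "dird v (\<lambda>w :: real \<times> (real ^ 'd). etan n (fst z - fst w)) w = - fst v * etan' n (fst z - fst w)" for v w
    using smooth_time_factor[OF smooth_etan, where n1 = n and c = "- 1" and s = "fst z"] by simp_all
  have D: "dird v (\<lambda>w. etan n (fst z - fst w) * H (z, snd w)) w
      = etan n (fst z - fst w) * dird (0, snd v) H (z, snd w) - fst v * etan' n (fst z - fst w) * H (z, snd w)"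
    if "smooth H" for H :: "(real \<times> (real ^ 'd)) \<times> (real ^ 'd) \<Rightarrow> real" and v w
    using dird_mult[OF s1 smooth_section2(1)[OF that]] by (simp add: d1 smooth_section2(2)[OF that])
  have sK: "smooth K" using K by (simp add: test2_def)
  have "smooth (\<psi> z)" unfolding \<psi>_def by (rule smooth_mult[OF s1 smooth_section2(1)[OF sK]])
  moreover have "space_periodic (\<psi> z)"
    using K by (cases z) (simp add: \<psi>_def space_periodic_def test2_def)
  \<comment> \<open>The interval from \<open>\<alpha>\<close> to \<open>\<beta>\<close> is widened
    by half of its distance to 0 and to \<open>T\<close>, whence these endpoints; the width of the
    bump is smaller than both.\<close>
  moreover have "\<psi> z (s, y) = 0" if "s \<notin> {\<alpha> / 2..(T + \<beta>) / 2}" for s y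
  proof (cases "fst z \<in> {\<alpha>..\<beta>}")
    case True
    have "R \<le> real (Suc n) * \<bar>fst z - s\<bar>"
    proof (cases "s < \<alpha> / 2")
      case True
      then have "\<alpha> / 2 \<le> \<bar>fst z - s\<bar>"
        using \<open>fst z \<in> _\<close> abs_ge_self[of "fst z - s"] unfolding atLeastAtMost_iff by linarith
      then have "real (Suc n) * (\<alpha> / 2) \<le> real (Suc n) * \<bar>fst z - s\<bar>" by (intro mult_left_mono) auto
      then show ?thesis using small(1) by linarith
    next
      case False
      then have "T + \<beta> < 2 * s" using that by auto
      moreover have "fst z \<le> \<beta>" using \<open>fst z \<in> _\<close> by simp
      moreover have "s - fst z \<le> \<bar>fst z - s\<bar>" by simp
      ultimately have "(T - \<beta>) / 2 \<le> \<bar>fst z - s\<bar>" by (simp add: field_simps)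
      then have "real (Suc n) * ((T - \<beta>) / 2) \<le> real (Suc n) * \<bar>fst z - s\<bar>" by (intro mult_left_mono) auto
      then show ?thesis using small(2) by linarith
    qed
    then show ?thesis by (simp add: \<psi>_def etan_supp)
  next
    case False
    then show ?thesis using K by (cases z) (auto simp: \<psi>_def test2_def)
  qed
  moreover have "0 < \<alpha> / 2" "(T + \<beta>) / 2 < T" using ab by auto
  ultimately show "test_fun T (\<psi> z)" unfolding test_fun_def by blast
  show "pd_t (\<psi> z) w = - etan' n (fst z - fst w) * K (z, snd w)"
    unfolding pd_t_def \<psi>_def D[OF sK]
    using linear_0[OF linear_frechet_derivative_smooth[OF sK], of "(z, snd w)"] by (simp add: zero_prod_def)
  have x1: "pd_x k (\<psi> z) = (\<lambda>w. etan n (fst z - fst w) * dird (0, axis k 1) K (z, snd w))"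
    unfolding pd_x_def \<psi>_def D[OF sK] by simp
  then show "pd_x k (\<psi> z) w = etan n (fst z - fst w) * dird (0, axis k 1) K (z, snd w)" by simp
  show "pd_x k (pd_x k (\<psi> z)) w
      = etan n (fst z - fst w) * dird (0, axis k 1) (dird (0, axis k 1) K) (z, snd w)"
    unfolding x1 unfolding pd_x_def D[OF smooth_dird[OF sK]] by simp
qed

text \<open>Stated for an arbitrary kernel because it has two uses: kernels depending on the
  difference of the points give the balance of \<open>a\<close> times its convolution, and kernels
  centred at a third point that of the squared convolution.\<close>

lemma two_point_identity:
  fixes a :: "real \<times> (real ^ 'd) \<Rightarrow> real" and f :: "'d \<Rightarrow> real \<times> (real ^ 'd) \<Rightarrow> real"
  assumes a: "Lp T 3 a" and f: "\<And>k. Lp T (3/2) (f k)"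
    and weak: "\<And>\<psi>. test_fun T \<psi> \<Longrightarrow>
      (LINT z|slab T. a z * pd_t \<psi> z + (\<Sum>k\<in>UNIV. f k z * pd_x k \<psi> z + \<nu> * (a z * pd_x k (pd_x k \<psi>) z))) = 0"
    and K: "test2 \<alpha> \<beta> K" and ab: "0 < \<alpha>" "\<beta> < T"
  defines "X k \<equiv> dird ((0, axis k 1), 0)" and "Y k \<equiv> dird (0, axis k 1)"
  shows "(LINT p|slabt T. a (fst p) * a (fst (fst p), snd p) * dird ((1, 0), 0) K p) +
    (\<Sum>k\<in>UNIV. (LINT p|slabt T. f k (fst p) * a (fst (fst p), snd p) * X k K p)
      + \<nu> * (LINT p|slabt T. a (fst p) * a (fst (fst p), snd p) * X k (X k K) p)
      + (LINT p|slabt T. a (fst p) * f k (fst (fst p), snd p) * Y k K p)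
      + \<nu> * (LINT p|slabt T. a (fst p) * a (fst (fst p), snd p) * Y k (Y k K) p)) = 0"
proof -
  have a32: "Lp T (3/2) a" by (rule Lp_3_imp[OF a])
  have ia: "integrable (slab T) a" by (rule Lp_imp_integrable[OF a]) simp
  have if_: "integrable (slab T) (f k)" for k by (rule Lp_imp_integrable[OF f]) simp
  define J where "J n b c H = (LINT p|slab2 T. b (fst p) * c (snd p) * H (fst p, snd (snd p)) * etan n (fst (fst p) - fst (snd p)))"
    for n and b c :: "real \<times> (real ^ 'd) \<Rightarrow> real" and H :: "(real \<times> (real ^ 'd)) \<times> (real ^ 'd) \<Rightarrow> real"
  define I where "I b c H = (LINT p|slabt T. b (fst p) * c (fst (fst p), snd p) * H p)"
    for b c :: "real \<times> (real ^ 'd) \<Rightarrow> real" and H :: "(real \<times> (real ^ 'd)) \<times> (real ^ 'd) \<Rightarrow> real"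
  \<comment> \<open>The case \<open>etan'\<close> is included because the two equations that contain
    it are integrated separately, before it cancels in their sum.\<close>
  have J_int: "integrable (slab2 T) (\<lambda>p. b (fst p) * c (snd p) * H (fst p, snd (snd p)) * e n (fst (fst p) - fst (snd p)))"
    if bc: "integrable (slab T) b" "integrable (slab T) c" and H: "test2 \<alpha> \<beta> H"
      and e: "e = etan \<or> e = etan'"
    for n b c H e
  proof -
    obtain M where M: "\<And>p. \<bar>H p\<bar> \<le> M" using test2_bounded[OF H] by blast
    have [measurable]: "H \<in> borel_measurable ((borel \<Otimes>\<^sub>M borel) \<Otimes>\<^sub>M borel)" by (rule test2_measurable[OF H])
    have em [measurable]: "e n \<in> borel_measurable borel" using e by auto
    obtain C where C: "\<And>r. \<bar>e n r\<bar> \<le> C"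
      using e etan_bounded[of n] etan'_bounded[of n] by blast
    have "integrable (slab2 T) (\<lambda>p. e n (fst (fst p) - fst (snd p)) * (b (fst p) * c (snd p) * H (fst p, snd (snd p))))"
      by (rule integrable_bounded_mult[OF two_time_integrable[OF bc, where \<kappa> = "\<lambda>p. H (fst p, snd (snd p))" and M = M] _ C])
        (measurable, rule M, measurable)
    then show ?thesis by (simp add: mult_ac)
  qed
  \<comment> \<open>The factor in L^(3/2) sits at the first point in \<open>lim1\<close> and at the
    second in \<open>lim2\<close>; fluxes occur at both.\<close>
  have lim1: "(\<lambda>n. J n b c H) \<longlonglongrightarrow> I b c H" and lim2: "(\<lambda>n. J n c b H) \<longlonglongrightarrow> I c b H"
    if b: "Lp T (3/2) b" and c: "Lp T 3 c" and H: "test2 \<alpha> \<beta> H" for b c H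
  proof -
    obtain M where M: "\<And>p. \<bar>H p\<bar> \<le> M" using test2_bounded[OF H] by blast
    have "continuous_on UNIV (\<lambda>p :: (real \<times> (real ^ 'd)) \<times> (real \<times> (real ^ 'd)). H (fst p, snd (snd p)))"
      by (rule continuous_on_compose2[OF test2_continuous[OF H, of UNIV]]) (auto intro!: continuous_intros)
    note l = two_time_limit[OF b c this M] two_time_limit_swapped[OF b c this M]
    show "(\<lambda>n. J n b c H) \<longlonglongrightarrow> I b c H" "(\<lambda>n. J n c b H) \<longlonglongrightarrow> I c b H"
      using l unfolding J_def I_def by simp_all
  qed
  have XK: "test2 \<alpha> \<beta> (X k K)" "test2 \<alpha> \<beta> (X k (X k K))" and YK: "test2 \<alpha> \<beta> (Y k K)" "test2 \<alpha> \<beta> (Y k (Y k K))"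
    and TK: "test2 \<alpha> \<beta> (dird ((1, 0), 0) K)" for k
    unfolding X_def Y_def by (intro test2_dird K)+
  define S where "S n = J n a a (dird ((1, 0), 0) K) + (\<Sum>k\<in>UNIV. J n (f k) a (X k K) + \<nu> * J n a a (X k (X k K))
      + J n a (f k) (Y k K) + \<nu> * J n a a (Y k (Y k K)))" for n
  have S_lim: "S \<longlonglongrightarrow> I a a (dird ((1, 0), 0) K) + (\<Sum>k\<in>UNIV. I (f k) a (X k K) + \<nu> * I a a (X k (X k K))
      + I a (f k) (Y k K) + \<nu> * I a a (Y k (Y k K)))"
    unfolding S_def by (intro tendsto_intros lim1 lim2 a32 a f XK YK TK)
  have S_zero: "S n = 0" if small: "R < real (Suc n) * (\<alpha> / 2)" "R < real (Suc n) * ((T - \<beta>) / 2)" for n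
  proof -
    define \<psi>1 where "\<psi>1 w z = etan n (fst z - fst w) * K (z, snd w)" for w z :: "real \<times> (real ^ 'd)"
    define \<psi>2 where "\<psi>2 z w = etan n (fst z - fst w) * K (z, snd w)" for w z :: "real \<times> (real ^ 'd)"
    note p1 = first_variable_test[OF K ab, where n = n, folded \<psi>1_def] and p2 = second_variable_test[OF K ab small, folded \<psi>2_def]
    let ?W = "\<lambda>\<psi> z. a z * pd_t \<psi> z + (\<Sum>k\<in>UNIV. f k z * pd_x k \<psi> z + \<nu> * (a z * pd_x k (pd_x k \<psi>) z))"
    let ?e = "\<lambda>p. etan n (fst (fst p) - fst (snd p))" and ?e' = "\<lambda>p. etan' n (fst (fst p) - fst (snd p))"
    let ?q = "\<lambda>p :: (real \<times> (real ^ 'd)) \<times> (real \<times> (real ^ 'd)). (fst p, snd (snd p))"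
    \<comment> \<open>The equation at the first point, weighted with \<open>a\<close> at the second,
      is \<open>U1\<close>; \<open>U2\<close> has the roles exchanged. Each is integrated over its
      own tested point first, with the other point frozen, and so vanishes.\<close>
    define U1 where "U1 p = a (fst p) * a (snd p) * dird ((1, 0), 0) K (?q p) * ?e p + a (fst p) * a (snd p) * K (?q p) * ?e' p
      + (\<Sum>k\<in>UNIV. f k (fst p) * a (snd p) * X k K (?q p) * ?e p + \<nu> * (a (fst p) * a (snd p) * X k (X k K) (?q p) * ?e p))" for p
    define U2 where "U2 p = - (a (fst p) * a (snd p) * K (?q p) * ?e' p)
      + (\<Sum>k\<in>UNIV. a (fst p) * f k (snd p) * Y k K (?q p) * ?e p + \<nu> * (a (fst p) * a (snd p) * Y k (Y k K) (?q p) * ?e p))" for p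
    have i1: "integrable (slab2 T) U1" unfolding U1_def
      by (intro Bochner_Integration.integrable_add Bochner_Integration.integrable_sum integrable_mult_right
          J_int ia if_ XK YK TK K) auto
    have i2: "integrable (slab2 T) U2" unfolding U2_def
      by (intro Bochner_Integration.integrable_add Bochner_Integration.integrable_sum integrable_mult_right
          Bochner_Integration.integrable_minus J_int ia if_ XK YK TK K) auto
    have eq1: "U1 (z, w) = a w * ?W (\<psi>1 w) z" for z w
      unfolding U1_def p1(2-4) X_def by (simp add: algebra_simps sum_distrib_left sum.distrib)
    have eq2: "U2 (z, w) = a z * ?W (\<psi>2 z) w" for z w
      unfolding U2_def p2(2-4) Y_def by (simp add: algebra_simps sum_distrib_left sum.distrib)
    have "integral\<^sup>L (slab2 T) U1 = (LINT w|slab T. (LINT z|slab T. U1 (z, w)))"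
      using ss.integral_snd[of T "\<lambda>z w. U1 (z, w)"] i1 by simp
    also have "\<dots> = 0" unfolding eq1 using weak[OF p1(1)] by simp
    finally have z1: "integral\<^sup>L (slab2 T) U1 = 0" .
    have "integral\<^sup>L (slab2 T) U2 = (LINT z|slab T. (LINT w|slab T. U2 (z, w)))"
      using ss.integral_fst'[OF i2] by simp
    also have "\<dots> = 0" unfolding eq2 using weak[OF p2(1)] by simp
    finally have z2: "integral\<^sup>L (slab2 T) U2 = 0" .
    have U: "U1 p + U2 p = a (fst p) * a (snd p) * dird ((1, 0), 0) K (?q p) * ?e p
      + (\<Sum>k\<in>UNIV. f k (fst p) * a (snd p) * X k K (?q p) * ?e p + \<nu> * (a (fst p) * a (snd p) * X k (X k K) (?q p) * ?e p)
        + a (fst p) * f k (snd p) * Y k K (?q p) * ?e p + \<nu> * (a (fst p) * a (snd p) * Y k (Y k K) (?q p) * ?e p))" for p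
      unfolding U1_def U2_def by (simp add: sum.distrib)
    have hJ: "has_bochner_integral (slab2 T) (\<lambda>p. b (fst p) * c (snd p) * H (?q p) * ?e p) (J n b c H)"
      if "integrable (slab T) b" "integrable (slab T) c" "test2 \<alpha> \<beta> H" for b c H
      unfolding J_def by (rule has_bochner_integral_integrable[OF J_int[OF that disjI1[OF refl]]])
    have "has_bochner_integral (slab2 T) (\<lambda>p. U1 p + U2 p) (S n)"
      unfolding S_def U
      by (intro has_bochner_integral_add has_bochner_integral_sum has_bochner_integral_mult_right
          hJ ia if_ XK YK TK)
    then have "(LINT p|slab2 T. U1 p + U2 p) = S n" by (rule has_bochner_integral_integral_eq)
    then show ?thesis using z1 z2 i1 i2 by simp
  qed
  have "eventually (\<lambda>n. S n = 0) sequentially"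
  proof -
    have ev: "eventually (\<lambda>n. R < real (Suc n) * \<gamma>) sequentially" if "0 < \<gamma>" for \<gamma>
    proof -
      obtain N where "R / \<gamma> < real N" using reals_Archimedean2 by blast
      then have N: "R < real N * \<gamma>" using that by (simp add: field_simps)
      have "R < real (Suc n) * \<gamma>" if "N \<le> n" for n
      proof -
        have "real N * \<gamma> \<le> real (Suc n) * \<gamma>" using that \<open>0 < \<gamma>\<close> by (intro mult_right_mono) auto
        with N show ?thesis by linarith
      qed
      then show ?thesis by (auto simp: eventually_sequentially)
    qed
    have "eventually (\<lambda>n. R < real (Suc n) * (\<alpha> / 2)) sequentially"
      "eventually (\<lambda>n. R < real (Suc n) * ((T - \<beta>) / 2)) sequentially"
      using ab by (intro ev; simp)+
    then show ?thesis by eventually_elim (rule S_zero)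
  qed
  then have "S \<longlonglongrightarrow> 0" by (rule tendsto_eventually)
  from LIMSEQ_unique[OF S_lim this] show ?thesis unfolding I_def .
qed

end

subsection \<open>Test functions on the slab\<close>

text \<open>A test function is a two-point kernel that is constant in the second point; boundedness
  and stability under differentiation are inherited in this way.\<close>

lemma test_fun_iff_test2:
  fixes \<phi> :: "real \<times> (real ^ 'd) \<Rightarrow> real"
  shows "test_fun T \<phi> \<longleftrightarrow> smooth \<phi> \<and>
    (\<exists>\<alpha> \<beta>. 0 < \<alpha> \<and> \<beta> < T \<and> test2 \<alpha> \<beta> (\<lambda>p :: (real \<times> (real ^ 'd)) \<times> (real ^ 'd). \<phi> (fst p)))"
  (is "_ \<longleftrightarrow> ?R")
proof
  assume \<phi>: "test_fun T \<phi>"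
  then have "smooth \<phi>" by (simp add: test_fun_def)
  from smooth_affine[OF this bounded_linear_fst, of 0]
  have "smooth (\<lambda>p :: (real \<times> (real ^ 'd)) \<times> (real ^ 'd). \<phi> (fst p))" by simp
  with \<phi> show ?R unfolding test_fun_def test2_def space_periodic_def by auto
next
  assume ?R
  then show "test_fun T \<phi>" unfolding test_fun_def test2_def space_periodic_def by auto
qed

lemma test_fun_smooth: "test_fun T \<phi> \<Longrightarrow> smooth \<phi>"
  by (simp add: test_fun_def)

lemma test_fun_dird:
  fixes \<phi> :: "real \<times> (real ^ 'd) \<Rightarrow> real"
  assumes "test_fun T \<phi>" shows "test_fun T (dird v \<phi>)"
proof -
  have s: "smooth \<phi>" using assms by (rule test_fun_smooth)
  obtain \<alpha> \<beta> where ab: "0 < \<alpha>" "\<beta> < T"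
    and t: "test2 \<alpha> \<beta> (\<lambda>p :: (real \<times> (real ^ 'd)) \<times> (real ^ 'd). \<phi> (fst p))"
    using assms unfolding test_fun_iff_test2 by blast
  have "dird (v, 0) (\<lambda>p :: (real \<times> (real ^ 'd)) \<times> (real ^ 'd). \<phi> (fst p)) = (\<lambda>p. dird v \<phi> (fst p))"
  proof
    fix p :: "(real \<times> (real ^ 'd)) \<times> (real ^ 'd)"
    show "dird (v, 0) (\<lambda>p :: (real \<times> (real ^ 'd)) \<times> (real ^ 'd). \<phi> (fst p)) p = dird v \<phi> (fst p)"
      using dird_affine[OF s bounded_linear_fst, of 0 p "(v, 0)"] by simp
  qed
  with test2_dird[OF t, of "(v, 0)"] ab smooth_dird[OF s] show ?thesis
    unfolding test_fun_iff_test2 by metis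
qed

lemma test_fun_pd_t: "test_fun T \<phi> \<Longrightarrow> test_fun T (pd_t \<phi>)"
  and test_fun_pd_x: "test_fun T \<phi> \<Longrightarrow> test_fun T (pd_x i \<phi>)"
  using test_fun_dird[of T \<phi>] unfolding pd_t_def[abs_def] pd_x_def[abs_def] by blast+

lemma test_fun_bounded:
  assumes "test_fun T \<phi>" obtains M where "\<And>z. \<bar>\<phi> z\<bar> \<le> M"
proof -
  obtain \<alpha> \<beta> where t: "test2 \<alpha> \<beta> (\<lambda>p :: (real \<times> (real ^ 'a)) \<times> (real ^ 'a). \<phi> (fst p))"
    using assms unfolding test_fun_iff_test2 by blast
  obtain M where M: "\<And>p :: (real \<times> (real ^ 'a)) \<times> (real ^ 'a). \<bar>\<phi> (fst p)\<bar> \<le> M"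
    using test2_bounded[OF t] by blast
  have "\<bar>\<phi> z\<bar> \<le> M" for z using M[of "(z, 0)"] by simp
  then show ?thesis by (rule that)
qed

lemma test_fun_borel: "test_fun T \<phi> \<Longrightarrow> \<phi> \<in> borel_measurable borel"
  by (rule smooth_borel_measurable[OF test_fun_smooth])

lemma test_fun_measurable [measurable_dest]:
  "test_fun T \<phi> \<Longrightarrow> \<phi> \<in> borel_measurable (borel \<Otimes>\<^sub>M borel)"
  using test_fun_borel[of T \<phi>] by (simp add: borel_prod)

lemma Lp_mult_test:
  assumes "Lp T p f" "test_fun T' \<phi>" "0 \<le> p" shows "Lp T p (\<lambda>z. f z * \<phi> z)"
proof -
  obtain M where M: "\<And>z. \<bar>\<phi> z\<bar> \<le> M" using test_fun_bounded[OF assms(2)] by blast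
  have "Lp T p (\<lambda>z. \<phi> z * f z)"
    by (rule Lp_mult_bounded[OF assms(1) test_fun_measurable[OF assms(2)] M assms(3)])
  then show ?thesis by (simp add: mult.commute)
qed

subsection \<open>Two-point integrals as convolutions\<close>

text \<open>What the kernels require of the two factors, abstracted from the exponents because the
  factor in L^(3/2) may stand at either point.\<close>

definition pairable :: "real \<Rightarrow> (real \<times> (real ^ 'd) \<Rightarrow> real) \<Rightarrow> (real \<times> (real ^ 'd) \<Rightarrow> real) \<Rightarrow> bool" where
  "pairable T b c \<longleftrightarrow> b \<in> borel_measurable (borel \<Otimes>\<^sub>M borel) \<and> c \<in> borel_measurable (borel \<Otimes>\<^sub>M borel) \<and>
    integrable (slabt T) (\<lambda>p. b (fst p) * c (fst (fst p), snd p))"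

lemma pairable_32_3: "Lp T (3/2) b \<Longrightarrow> Lp T 3 c \<Longrightarrow> pairable T b c"
  unfolding pairable_def using integrable_two_point[of T b c] by (auto simp: split_def)

lemma pairable_3_32:
  fixes b c :: "real \<times> (real ^ 'd) \<Rightarrow> real"
  assumes "Lp T 3 b" "Lp T (3/2) c" shows "pairable T b c"
proof -
  have "integrable (slabt T) (\<lambda>p. c (fst p) * b (fst (fst p), snd p))"
    using pairable_32_3[OF assms(2,1)] by (simp add: pairable_def)
  from integrable_swap_space[OF this]
  have "integrable (slabt T) (\<lambda>p. c (fst (fst p), snd p) * b (fst p))" by (simp only: swap_space_def fst_conv snd_conv prod.collapse)
  then show ?thesis unfolding pairable_def using assms by (auto simp: mult.commute)
qed

lemma pairable_3_3: "Lp T 3 b \<Longrightarrow> Lp T 3 c \<Longrightarrow> pairable T b c"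
  by (intro pairable_32_3 Lp_3_imp)

text \<open>Integrating a function of the second point against it produces the convolution with
  \<open>k\<close> at the first point, times \<open>g\<close> there.\<close>

definition diff_kernel :: "(real ^ 'd \<Rightarrow> real) \<Rightarrow> (real \<times> (real ^ 'd) \<Rightarrow> real) \<Rightarrow> (real \<times> (real ^ 'd)) \<times> (real ^ 'd) \<Rightarrow> real" where
  "diff_kernel k g p = k (snd (fst p) - snd p) * g (fst p)"

lemma pairable_bounded:
  assumes bc: "pairable T b c" and [measurable]: "h \<in> borel_measurable ((borel \<Otimes>\<^sub>M borel) \<Otimes>\<^sub>M borel)"
    and M: "\<And>p. \<bar>h p\<bar> \<le> M"
  shows "integrable (slabt T) (\<lambda>p. b (fst p) * c (fst (fst p), snd p) * h p)"
proof -
  have "integrable (slabt T) (\<lambda>p. h p * (b (fst p) * c (fst (fst p), snd p)))"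
    by (rule integrable_bounded_mult[OF _ _ M]) (use bc in \<open>simp add: pairable_def\<close>, measurable)
  then show ?thesis by (simp add: mult.commute)
qed

lemma integral_diff_kernel:
  fixes b c :: "real \<times> (real ^ 'd) \<Rightarrow> real"
  assumes bc: "pairable T b c" and k: "smooth_periodic k" and g: "test_fun T' g"
  shows "has_bochner_integral (slab T) (\<lambda>z. b z * conv k c z * g z)
    (LINT p|slabt T. b (fst p) * c (fst (fst p), snd p) * diff_kernel k g p)"
    and "integrable (slabt T) (\<lambda>p. b (fst p) * c (fst (fst p), snd p) * diff_kernel k g p)"
proof -
  obtain C where C: "\<And>x. \<bar>k x\<bar> \<le> C" using smooth_periodic_bounded[OF k] by blast
  obtain M where M: "\<And>z. \<bar>g z\<bar> \<le> M" using test_fun_bounded[OF g] by blast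
  have [measurable]: "k \<in> borel_measurable borel" "g \<in> borel_measurable (borel \<Otimes>\<^sub>M borel)"
    using k g by measurable
  have C0: "0 \<le> C" using C[of 0] by linarith
  have int: "integrable (slabt T) (\<lambda>p. b (fst p) * c (fst (fst p), snd p) * diff_kernel k g p)"
  proof (rule pairable_bounded[OF bc, where M = "C * M"])
    show "diff_kernel k g \<in> borel_measurable ((borel \<Otimes>\<^sub>M borel) \<Otimes>\<^sub>M borel)"
      unfolding diff_kernel_def by measurable
    show "\<bar>diff_kernel k g p\<bar> \<le> C * M" for p
      unfolding diff_kernel_def abs_mult using C M C0 by (intro mult_mono) auto
  qed
  then show "integrable (slabt T) (\<lambda>p. b (fst p) * c (fst (fst p), snd p) * diff_kernel k g p)" .
  have eq: "(LINT y|torus. b z * c (fst z, y) * diff_kernel k g (z, y)) = b z * conv k c z * g z" for z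
  proof -
    have "(LINT y|torus. b z * c (fst z, y) * diff_kernel k g (z, y))
        = (LINT y|torus. (b z * g z) * (k (snd z - y) * c (fst z, y)))"
      by (rule arg_cong[where f = "integral\<^sup>L torus"]) (auto simp: diff_kernel_def)
    then show ?thesis by (simp add: conv_def)
  qed
  have "integrable (slab T) (\<lambda>z. b z * conv k c z * g z)"
    using st.integrable_fst'[OF int] by (simp add: eq)
  moreover have "integral\<^sup>L (slab T) (\<lambda>z. b z * conv k c z * g z)
      = (LINT p|slabt T. b (fst p) * c (fst (fst p), snd p) * diff_kernel k g p)"
    using st.integral_fst'[OF int] by (simp add: eq)
  ultimately show "has_bochner_integral (slab T) (\<lambda>z. b z * conv k c z * g z)
    (LINT p|slabt T. b (fst p) * c (fst (fst p), snd p) * diff_kernel k g p)"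
    by (simp add: has_bochner_integral_iff)
qed

lemma smooth_diff_kernel:
  fixes k :: "real ^ 'd \<Rightarrow> real"
  assumes k: "smooth k" and g: "smooth g"
  shows "smooth (diff_kernel k g)"
    and "dird v (diff_kernel k g) p = diff_kernel k (dird (fst v) g) p + diff_kernel (dird (snd (fst v) - snd v) k) g p"
proof -
  have bl: "bounded_linear (\<lambda>p :: (real \<times> (real ^ 'd)) \<times> (real ^ 'd). snd (fst p) - snd p)"
    by (intro bounded_linear_sub bounded_linear_snd bounded_linear_compose[OF bounded_linear_snd bounded_linear_fst])
  have s1: "smooth (\<lambda>p :: (real \<times> (real ^ 'd)) \<times> (real ^ 'd). k (snd (fst p) - snd p))"
    using smooth_affine[OF k bl, of 0] by simp
  have s2: "smooth (\<lambda>p :: (real \<times> (real ^ 'd)) \<times> (real ^ 'd). g (fst p))"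
    using smooth_affine[OF g bounded_linear_fst, of 0] by simp
  show "smooth (diff_kernel k g)" unfolding diff_kernel_def[abs_def] by (rule smooth_mult[OF s1 s2])
  show "dird v (diff_kernel k g) p = diff_kernel k (dird (fst v) g) p + diff_kernel (dird (snd (fst v) - snd v) k) g p"
    unfolding diff_kernel_def[abs_def] dird_mult[OF s1 s2]
    using dird_affine[OF k bl, of 0 p v] dird_affine[OF g bounded_linear_fst, of 0 p v] by simp
qed

lemma test2_diff_kernel:
  fixes k :: "real ^ 'd \<Rightarrow> real"
  assumes k: "smooth_periodic k" and g: "test_fun T g"
  obtains \<alpha> \<beta> where "0 < \<alpha>" "\<beta> < T" "test2 \<alpha> \<beta> (diff_kernel k g)"
proof -
  obtain \<alpha> \<beta> where ab: "0 < \<alpha>" "\<beta> < T" and supp: "\<And>t x. t \<notin> {\<alpha>..\<beta>} \<Longrightarrow> g (t, x) = 0"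
    using g unfolding test_fun_def by blast
  have per: "k (x + m) = k x" if "m \<in> int_vec" for x m
    using periodic_int_vec[OF _ that, of k x] k by (simp add: smooth_periodic_def)
  have "k (x + axis i 1 - y) = k (x - y)" "k (x - (y + axis i 1)) = k (x - y)" for x y i
    using per[OF axis_int_vec, of "x - y" i] per[OF int_vec_uminus[OF axis_int_vec], of "x - y" i]
    by (simp_all add: algebra_simps)
  moreover have "smooth (diff_kernel k g)"
    by (rule smooth_diff_kernel(1)[OF _ test_fun_smooth[OF g]]) (use k in \<open>simp add: smooth_periodic_def\<close>)
  moreover have "g (t, x + axis i 1) = g (t, x)" for t x i
    using g by (simp add: test_fun_def space_periodic_def)
  ultimately have "test2 \<alpha> \<beta> (diff_kernel k g)"
    unfolding test2_def using supp by (simp add: diff_kernel_def)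
  with ab show ?thesis by (rule that)
qed

lemma dird_zero: "smooth f \<Longrightarrow> dird 0 f x = 0"
  using linear_0[OF linear_frechet_derivative_smooth, of f x] by simp

lemma dird_uminus: "smooth f \<Longrightarrow> dird (- v) f x = - dird v f x"
  using linear_neg[OF linear_frechet_derivative_smooth, of f x v] by simp

lemma dird_uminus_fun:
  assumes "smooth f" shows "smooth (\<lambda>x. - f x)" "dird v (\<lambda>x. - f x) x = - dird v f x"
proof -
  have "smooth (\<lambda>x. - 1 * f x)" by (rule smooth_mult[OF smooth_const assms])
  then show "smooth (\<lambda>x. - f x)" by simp
  show "dird v (\<lambda>x. - f x) x = - dird v f x"
    using dird_mult[OF smooth_const assms, of "- 1" x v] by simp
qed

lemma dird_add: "smooth f \<Longrightarrow> smooth g \<Longrightarrow> dird v (\<lambda>x. f x + g x) x = dird v f x + dird v g x"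
  by (rule frechet_derivative_add_apply) (simp_all add: smooth_differentiable)

text \<open>The second derivatives are stated for the right sides of the first ones, so that
  rewriting evaluates an iterated derivative from the inside.\<close>

lemma diff_kernel_derivatives:
  fixes k :: "real ^ 'd \<Rightarrow> real"
  assumes k: "smooth k" and g: "smooth g"
  shows "dird ((1, 0), 0) (diff_kernel k g) p = diff_kernel k (pd_t g) p"
    and "dird ((0, axis j 1), 0) (diff_kernel k g) p = diff_kernel k (pd_x j g) p + diff_kernel (partial j k) g p"
    and "dird (0, axis j 1) (diff_kernel k g) p = - diff_kernel (partial j k) g p"
    and "dird ((0, axis j 1), 0) (\<lambda>p. diff_kernel k (pd_x j g) p + diff_kernel (partial j k) g p) p
      = diff_kernel k (pd_x j (pd_x j g)) p + 2 * diff_kernel (partial j k) (pd_x j g) p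
          + diff_kernel (partial j (partial j k)) g p"
    and "dird (0, axis j 1) (\<lambda>p. - diff_kernel (partial j k) g p) p = diff_kernel (partial j (partial j k)) g p"
proof -
  have kj: "smooth (partial j k)" and gj: "smooth (pd_x j g)"
    using smooth_dird[OF k] smooth_dird[OF g] by (auto simp: pd_x_def[abs_def])
  show "dird ((1, 0), 0) (diff_kernel k g) p = diff_kernel k (pd_t g) p"
    by (simp add: smooth_diff_kernel(2)[OF k g] dird_zero[OF k] pd_t_def diff_kernel_def)
  have x: "dird ((0, axis j 1), 0) (diff_kernel h f) p = diff_kernel h (pd_x j f) p + diff_kernel (partial j h) f p"
    if "smooth h" "smooth f" for h and f :: "real \<times> (real ^ 'd) \<Rightarrow> real"
    by (simp add: smooth_diff_kernel(2)[OF that] pd_x_def[abs_def])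
  have y: "dird (0, axis j 1) (diff_kernel h f) p = - diff_kernel (partial j h) f p"
    if "smooth h" "smooth f" for h and f :: "real \<times> (real ^ 'd) \<Rightarrow> real"
    by (simp add: smooth_diff_kernel(2)[OF that] dird_uminus[OF that(1)] dird_zero[OF that(2)] diff_kernel_def)
  show "dird ((0, axis j 1), 0) (diff_kernel k g) p = diff_kernel k (pd_x j g) p + diff_kernel (partial j k) g p"
    by (rule x[OF k g])
  show "dird (0, axis j 1) (diff_kernel k g) p = - diff_kernel (partial j k) g p" by (rule y[OF k g])
  show "dird ((0, axis j 1), 0) (\<lambda>p. diff_kernel k (pd_x j g) p + diff_kernel (partial j k) g p) p
      = diff_kernel k (pd_x j (pd_x j g)) p + 2 * diff_kernel (partial j k) (pd_x j g) p
          + diff_kernel (partial j (partial j k)) g p"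
    by (simp add: dird_add[OF smooth_diff_kernel(1)[OF k gj] smooth_diff_kernel(1)[OF kj g]] x[OF k gj] x[OF kj g])
  show "dird (0, axis j 1) (\<lambda>p. - diff_kernel (partial j k) g p) p = diff_kernel (partial j (partial j k)) g p"
    by (simp add: dird_uminus_fun(2)[OF smooth_diff_kernel(1)[OF kj g]] y[OF kj g])
qed

lemma smooth_periodic_partial: "smooth_periodic k \<Longrightarrow> smooth_periodic (partial j k)"
  by (rule smooth_periodic_dird)

context time_bump
begin

text \<open>The equation tested with \<open>\<phi> (k * a)\<close>, a function that need not be smooth in time.\<close>

lemma weak_tested_with_conv:
  fixes a :: "real \<times> (real ^ 'd) \<Rightarrow> real" and f :: "'d \<Rightarrow> real \<times> (real ^ 'd) \<Rightarrow> real"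
  assumes a: "Lp T 3 a" and f: "\<And>j. Lp T (3/2) (f j)"
    and weak: "\<And>\<psi>. test_fun T \<psi> \<Longrightarrow>
      (LINT z|slab T. a z * pd_t \<psi> z + (\<Sum>j\<in>UNIV. f j z * pd_x j \<psi> z + \<nu> * (a z * pd_x j (pd_x j \<psi>) z))) = 0"
    and k: "smooth_periodic k" and \<phi>: "test_fun T \<phi>"
  shows "has_bochner_integral (slab T) (\<lambda>z. a z * conv k a z * pd_t \<phi> z +
    (\<Sum>j\<in>UNIV. (f j z * conv k a z * pd_x j \<phi> z + f j z * conv (partial j k) a z * \<phi> z)
      + \<nu> * (a z * conv k a z * pd_x j (pd_x j \<phi>) z + 2 * (a z * conv (partial j k) a z * pd_x j \<phi> z)
          + a z * conv (partial j (partial j k)) a z * \<phi> z)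
      + - (a z * conv (partial j k) (f j) z * \<phi> z)
      + \<nu> * (a z * conv (partial j (partial j k)) a z * \<phi> z))) 0"
proof -
  have sk: "smooth k" using k by (simp add: smooth_periodic_def)
  have s\<phi>: "smooth \<phi>" by (rule test_fun_smooth[OF \<phi>])
  note kj = smooth_periodic_partial[OF k] and kjj = smooth_periodic_partial[OF smooth_periodic_partial[OF k]]
  note \<phi>t = test_fun_pd_t[OF \<phi>] and \<phi>j = test_fun_pd_x[OF \<phi>] and \<phi>jj = test_fun_pd_x[OF test_fun_pd_x[OF \<phi>]]
  obtain \<alpha> \<beta> where ab: "0 < \<alpha>" "\<beta> < T" and K: "test2 \<alpha> \<beta> (diff_kernel k \<phi>)"
    using test2_diff_kernel[OF k \<phi>] by blast
  note aa = pairable_3_3[OF a a] and fa = pairable_32_3[OF f a] and af = pairable_3_32[OF a f]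
  note D = integral_diff_kernel[where T' = T]
  have lin: "(LINT p|slabt T. b (fst p) * c (fst (fst p), snd p) * (diff_kernel k1 g1 p + diff_kernel k2 g2 p))
      = (LINT p|slabt T. b (fst p) * c (fst (fst p), snd p) * diff_kernel k1 g1 p)
        + (LINT p|slabt T. b (fst p) * c (fst (fst p), snd p) * diff_kernel k2 g2 p)"
    if "pairable T b c" "smooth_periodic k1" "smooth_periodic k2" "test_fun T g1" "test_fun T g2"
    for b c :: "real \<times> (real ^ 'd) \<Rightarrow> real" and k1 k2 g1 g2
    using D(2)[OF that(1,2,4)] D(2)[OF that(1,3,5)] by (simp add: distrib_left)
  have lin3: "(LINT p|slabt T. b (fst p) * c (fst (fst p), snd p) * (diff_kernel k1 g1 p + 2 * diff_kernel k2 g2 p + diff_kernel k3 g3 p))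
      = (LINT p|slabt T. b (fst p) * c (fst (fst p), snd p) * diff_kernel k1 g1 p)
        + 2 * (LINT p|slabt T. b (fst p) * c (fst (fst p), snd p) * diff_kernel k2 g2 p)
        + (LINT p|slabt T. b (fst p) * c (fst (fst p), snd p) * diff_kernel k3 g3 p)"
    if "pairable T b c" "smooth_periodic k1" "smooth_periodic k2" "smooth_periodic k3"
      "test_fun T g1" "test_fun T g2" "test_fun T g3"
    for b c :: "real \<times> (real ^ 'd) \<Rightarrow> real" and k1 k2 k3 g1 g2 g3
    using D(2)[OF that(1,2,5)] D(2)[OF that(1,3,6)] D(2)[OF that(1,4,7)]
    by (simp add: distrib_left mult.left_commute[of _ 2])
  have zero: "(LINT p|slabt T. a (fst p) * a (fst (fst p), snd p) * diff_kernel k (pd_t \<phi>) p) +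
    (\<Sum>j\<in>UNIV. ((LINT p|slabt T. f j (fst p) * a (fst (fst p), snd p) * diff_kernel k (pd_x j \<phi>) p)
        + (LINT p|slabt T. f j (fst p) * a (fst (fst p), snd p) * diff_kernel (partial j k) \<phi> p))
      + \<nu> * ((LINT p|slabt T. a (fst p) * a (fst (fst p), snd p) * diff_kernel k (pd_x j (pd_x j \<phi>)) p)
        + 2 * (LINT p|slabt T. a (fst p) * a (fst (fst p), snd p) * diff_kernel (partial j k) (pd_x j \<phi>) p)
        + (LINT p|slabt T. a (fst p) * a (fst (fst p), snd p) * diff_kernel (partial j (partial j k)) \<phi> p))
      + - (LINT p|slabt T. a (fst p) * f j (fst (fst p), snd p) * diff_kernel (partial j k) \<phi> p)
      + \<nu> * (LINT p|slabt T. a (fst p) * a (fst (fst p), snd p) * diff_kernel (partial j (partial j k)) \<phi> p)) = 0"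
    using two_point_identity[OF a f weak K ab]
    unfolding diff_kernel_derivatives[OF sk s\<phi>] lin[OF fa k kj \<phi>j \<phi>] lin3[OF aa k kj kjj \<phi>jj \<phi>j \<phi>]
    by simp
  show ?thesis
    by (subst zero[symmetric],
      intro has_bochner_integral_add has_bochner_integral_sum has_bochner_integral_mult_right
        has_bochner_integral_minus D(1) aa fa af k kj kjj \<phi> \<phi>t \<phi>j \<phi>jj)
qed

end

text \<open>Both points are compared with a centre \<open>\<zeta>\<close> at which \<open>g\<close>
  is evaluated too, so derivatives in the two points fall on the kernels alone.\<close>

definition point_kernel :: "(real ^ 'd \<Rightarrow> real) \<Rightarrow> (real ^ 'd \<Rightarrow> real) \<Rightarrow> (real \<times> (real ^ 'd) \<Rightarrow> real) \<Rightarrow> real ^ 'd \<Rightarrow>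
    (real \<times> (real ^ 'd)) \<times> (real ^ 'd) \<Rightarrow> real" where
  "point_kernel k1 k2 g \<zeta> p = k1 (\<zeta> - snd (fst p)) * k2 (\<zeta> - snd p) * g (fst (fst p), \<zeta>)"

lemma smooth_point_kernel:
  fixes k1 k2 :: "real ^ 'd \<Rightarrow> real"
  assumes k1: "smooth k1" and k2: "smooth k2" and g: "smooth g"
  shows "smooth (point_kernel k1 k2 g \<zeta>)"
    and "dird v (point_kernel k1 k2 g \<zeta>) p = point_kernel (dird (- snd (fst v)) k1) k2 g \<zeta> p
      + point_kernel k1 (dird (- snd v) k2) g \<zeta> p + point_kernel k1 k2 (dird (fst (fst v), 0) g) \<zeta> p"
proof -
  have bl1: "bounded_linear (\<lambda>p :: (real \<times> (real ^ 'd)) \<times> (real ^ 'd). - snd (fst p))"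
    by (intro bounded_linear_minus bounded_linear_compose[OF bounded_linear_snd bounded_linear_fst])
  have bl2: "bounded_linear (\<lambda>p :: (real \<times> (real ^ 'd)) \<times> (real ^ 'd). - snd p)"
    by (intro bounded_linear_minus bounded_linear_snd)
  have bl3: "bounded_linear (\<lambda>p :: (real \<times> (real ^ 'd)) \<times> (real ^ 'd). (fst (fst p), 0 :: real ^ 'd))"
    by (intro bounded_linear_Pair bounded_linear_zero bounded_linear_compose[OF bounded_linear_fst bounded_linear_fst])
  have s1: "smooth (\<lambda>p :: (real \<times> (real ^ 'd)) \<times> (real ^ 'd). k1 (\<zeta> - snd (fst p)))"
    and s2: "smooth (\<lambda>p :: (real \<times> (real ^ 'd)) \<times> (real ^ 'd). k2 (\<zeta> - snd p))"
    and s3: "smooth (\<lambda>p :: (real \<times> (real ^ 'd)) \<times> (real ^ 'd). g (fst (fst p), \<zeta>))"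
    using smooth_affine[OF k1 bl1, of \<zeta>] smooth_affine[OF k2 bl2, of \<zeta>] smooth_affine[OF g bl3, of "(0, \<zeta>)"]
    by simp_all
  show "smooth (point_kernel k1 k2 g \<zeta>)" unfolding point_kernel_def[abs_def]
    by (rule smooth_mult[OF smooth_mult[OF s1 s2] s3])
  show "dird v (point_kernel k1 k2 g \<zeta>) p = point_kernel (dird (- snd (fst v)) k1) k2 g \<zeta> p
      + point_kernel k1 (dird (- snd v) k2) g \<zeta> p + point_kernel k1 k2 (dird (fst (fst v), 0) g) \<zeta> p"
    unfolding point_kernel_def[abs_def] dird_mult[OF smooth_mult[OF s1 s2] s3] dird_mult[OF s1 s2]
    using dird_affine[OF k1 bl1, of \<zeta> p v] dird_affine[OF k2 bl2, of \<zeta> p v] dird_affine[OF g bl3, of "(0, \<zeta>)" p v]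
    by (simp add: algebra_simps)
qed

lemma point_kernel_derivatives:
  fixes k1 k2 :: "real ^ 'd \<Rightarrow> real"
  assumes k1: "smooth k1" and k2: "smooth k2" and g: "smooth g"
  shows "dird ((1, 0), 0) (point_kernel k1 k2 g \<zeta>) p = point_kernel k1 k2 (pd_t g) \<zeta> p"
    and "dird ((0, axis j 1), 0) (point_kernel k1 k2 g \<zeta>) p = - point_kernel (partial j k1) k2 g \<zeta> p"
    and "dird (0, axis j 1) (point_kernel k1 k2 g \<zeta>) p = - point_kernel k1 (partial j k2) g \<zeta> p"
    and "dird ((0, axis j 1), 0) (\<lambda>p. - point_kernel (partial j k1) k2 g \<zeta> p) p
      = point_kernel (partial j (partial j k1)) k2 g \<zeta> p"
    and "dird (0, axis j 1) (\<lambda>p. - point_kernel k1 (partial j k2) g \<zeta> p) p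
      = point_kernel k1 (partial j (partial j k2)) g \<zeta> p"
proof -
  have g0: "dird (0, 0) g z = 0" for z using dird_zero[OF g, of z] by (simp add: zero_prod_def)
  show "dird ((1, 0), 0) (point_kernel k1 k2 g \<zeta>) p = point_kernel k1 k2 (pd_t g) \<zeta> p"
    by (simp add: smooth_point_kernel(2)[OF k1 k2 g] point_kernel_def dird_zero[OF k1] dird_zero[OF k2] pd_t_def)
  have x: "dird ((0, axis j 1), 0) (point_kernel h1 h2 g \<zeta>) p = - point_kernel (partial j h1) h2 g \<zeta> p"
    if "smooth h1" "smooth h2" for h1 h2
    by (simp add: smooth_point_kernel(2)[OF that g] point_kernel_def dird_zero[OF that(2)] dird_uminus[OF that(1)] g0)
  have y: "dird (0, axis j 1) (point_kernel h1 h2 g \<zeta>) p = - point_kernel h1 (partial j h2) g \<zeta> p"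
    if "smooth h1" "smooth h2" for h1 h2
    by (simp add: smooth_point_kernel(2)[OF that g] point_kernel_def dird_zero[OF that(1)] dird_uminus[OF that(2)] g0)
  note d1 = smooth_dird[OF k1] and d2 = smooth_dird[OF k2]
  show "dird ((0, axis j 1), 0) (point_kernel k1 k2 g \<zeta>) p = - point_kernel (partial j k1) k2 g \<zeta> p"
    by (rule x[OF k1 k2])
  show "dird (0, axis j 1) (point_kernel k1 k2 g \<zeta>) p = - point_kernel k1 (partial j k2) g \<zeta> p"
    by (rule y[OF k1 k2])
  show "dird ((0, axis j 1), 0) (\<lambda>p. - point_kernel (partial j k1) k2 g \<zeta> p) p
      = point_kernel (partial j (partial j k1)) k2 g \<zeta> p"
    by (simp add: dird_uminus_fun(2)[OF smooth_point_kernel(1)[OF d1 k2 g]] x[OF d1 k2])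
  show "dird (0, axis j 1) (\<lambda>p. - point_kernel k1 (partial j k2) g \<zeta> p) p
      = point_kernel k1 (partial j (partial j k2)) g \<zeta> p"
    by (simp add: dird_uminus_fun(2)[OF smooth_point_kernel(1)[OF k1 d2 g]] y[OF k1 d2])
qed

lemma test2_point_kernel:
  fixes k1 k2 :: "real ^ 'd \<Rightarrow> real"
  assumes k1: "smooth_periodic k1" and k2: "smooth_periodic k2" and g: "test_fun T g"
  obtains \<alpha> \<beta> where "0 < \<alpha>" "\<beta> < T" "test2 \<alpha> \<beta> (point_kernel k1 k2 g \<zeta>)"
proof -
  obtain \<alpha> \<beta> where ab: "0 < \<alpha>" "\<beta> < T" and supp: "\<And>t x. t \<notin> {\<alpha>..\<beta>} \<Longrightarrow> g (t, x) = 0"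
    using g unfolding test_fun_def by blast
  have per: "k (x - (y + axis i 1)) = k (x - y)" if "smooth_periodic k" for k :: "real ^ 'd \<Rightarrow> real" and x y i
    using periodic_int_vec[OF _ int_vec_uminus[OF axis_int_vec], of k "x - y" i] that
    by (simp add: smooth_periodic_def algebra_simps)
  have "smooth (point_kernel k1 k2 g \<zeta>)"
    by (rule smooth_point_kernel(1)[OF _ _ test_fun_smooth[OF g]])
      (use k1 k2 in \<open>simp_all add: smooth_periodic_def\<close>)
  then have "test2 \<alpha> \<beta> (point_kernel k1 k2 g \<zeta>)"
    unfolding test2_def using supp per[OF k1] per[OF k2] by (simp add: point_kernel_def)
  with ab show ?thesis by (rule that)
qed

text \<open>At a fixed centre the variables separate: each point is integrated against its own
  kernel, and an integral over time alone remains.\<close>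

lemma integral_point_kernel:
  fixes b c :: "real \<times> (real ^ 'd) \<Rightarrow> real"
  assumes bc: "pairable T b c" and k1: "smooth_periodic k1" and k2: "smooth_periodic k2" and g: "test_fun T' g"
  shows "has_bochner_integral (time_measure T) (\<lambda>t. conv k1 b (t, \<zeta>) * conv k2 c (t, \<zeta>) * g (t, \<zeta>))
    (LINT p|slabt T. b (fst p) * c (fst (fst p), snd p) * point_kernel k1 k2 g \<zeta> p)"
proof -
  obtain C1 where C1: "\<And>x. \<bar>k1 x\<bar> \<le> C1" using smooth_periodic_bounded[OF k1] by blast
  obtain C2 where C2: "\<And>x. \<bar>k2 x\<bar> \<le> C2" using smooth_periodic_bounded[OF k2] by blast
  obtain M where M: "\<And>z. \<bar>g z\<bar> \<le> M" using test_fun_bounded[OF g] by blast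
  have [measurable]: "k1 \<in> borel_measurable borel" "k2 \<in> borel_measurable borel"
    "g \<in> borel_measurable (borel \<Otimes>\<^sub>M borel)" using k1 k2 g by measurable
  have C0: "0 \<le> C1" "0 \<le> C2" using C1[of 0] C2[of 0] by linarith+
  have int: "integrable (slabt T) (\<lambda>p. b (fst p) * c (fst (fst p), snd p) * point_kernel k1 k2 g \<zeta> p)"
  proof (rule pairable_bounded[OF bc, where M = "C1 * C2 * M"])
    show "point_kernel k1 k2 g \<zeta> \<in> borel_measurable ((borel \<Otimes>\<^sub>M borel) \<Otimes>\<^sub>M borel)"
      unfolding point_kernel_def[abs_def] by measurable
    show "\<bar>point_kernel k1 k2 g \<zeta> p\<bar> \<le> C1 * C2 * M" for p
      unfolding point_kernel_def abs_mult using C1 C2 M C0 by (intro mult_mono mult_nonneg_nonneg) auto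
  qed
  have eq: "(LINT y|torus. b z * c (fst z, y) * point_kernel k1 k2 g \<zeta> (z, y))
      = b z * k1 (\<zeta> - snd z) * g (fst z, \<zeta>) * conv k2 c (fst z, \<zeta>)" for z
  proof -
    have "(LINT y|torus. b z * c (fst z, y) * point_kernel k1 k2 g \<zeta> (z, y))
        = (LINT y|torus. (b z * k1 (\<zeta> - snd z) * g (fst z, \<zeta>)) * (k2 (\<zeta> - y) * c (fst z, y)))"
      by (rule arg_cong[where f = "integral\<^sup>L torus"]) (auto simp: point_kernel_def)
    then show ?thesis by (simp add: conv_def)
  qed
  have int2: "integrable (time_measure T \<Otimes>\<^sub>M torus) (\<lambda>z. b z * k1 (\<zeta> - snd z) * g (fst z, \<zeta>) * conv k2 c (fst z, \<zeta>))"
    using st.integrable_fst'[OF int] by (simp add: eq slab_def)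
  have eq2: "(LINT x|torus. b (t, x) * k1 (\<zeta> - x) * g (t, \<zeta>) * conv k2 c (t, \<zeta>))
      = conv k1 b (t, \<zeta>) * conv k2 c (t, \<zeta>) * g (t, \<zeta>)" for t
  proof -
    have "(LINT x|torus. b (t, x) * k1 (\<zeta> - x) * g (t, \<zeta>) * conv k2 c (t, \<zeta>))
        = (LINT x|torus. (g (t, \<zeta>) * conv k2 c (t, \<zeta>)) * (k1 (\<zeta> - x) * b (t, x)))"
      by (rule arg_cong[where f = "integral\<^sup>L torus"]) auto
    then show ?thesis by (simp add: conv_def)
  qed
  have "integrable (time_measure T) (\<lambda>t. conv k1 b (t, \<zeta>) * conv k2 c (t, \<zeta>) * g (t, \<zeta>))"
    using tt.integrable_fst'[OF int2] by (simp only: fst_conv snd_conv eq2)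
  moreover have "(LINT t|time_measure T. conv k1 b (t, \<zeta>) * conv k2 c (t, \<zeta>) * g (t, \<zeta>))
      = (LINT p|slabt T. b (fst p) * c (fst (fst p), snd p) * point_kernel k1 k2 g \<zeta> p)"
    using tt.integral_fst'[OF int2] st.integral_fst'[OF int]
    by (simp only: fst_conv snd_conv eq eq2 slab_def)
  ultimately show ?thesis by (simp add: has_bochner_integral_iff)
qed

lemma has_bochner_integral_slab_slices:
  fixes W :: "real \<times> (real ^ 'd) \<Rightarrow> real"
  assumes "integrable (slab T) W" and "\<And>\<zeta>. (LINT t|time_measure T. W (t, \<zeta>)) = 0"
  shows "has_bochner_integral (slab T) W 0"
proof -
  have "integrable (time_measure T \<Otimes>\<^sub>M torus) (\<lambda>(t, x). W (t, x))" using assms(1) by (simp add: slab_def)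
  from tt.integral_snd[OF this] assms(2) have "integral\<^sup>L (slab T) W = 0" by (simp add: slab_def)
  with assms(1) show ?thesis by (simp add: has_bochner_integral_iff)
qed

context time_bump
begin

text \<open>No space derivative of \<open>\<phi>\<close> appears, since \<open>\<phi>\<close> is
  evaluated at the centre of the kernels. The identity holds for every centre; integrability over
  the slab is shown first, so that the centres may be integrated.\<close>

lemma weak_squared_conv:
  fixes a :: "real \<times> (real ^ 'd) \<Rightarrow> real" and f :: "'d \<Rightarrow> real \<times> (real ^ 'd) \<Rightarrow> real"
  assumes a: "Lp T 3 a" and f: "\<And>j. Lp T (3/2) (f j)"
    and weak: "\<And>\<psi>. test_fun T \<psi> \<Longrightarrow>
      (LINT z|slab T. a z * pd_t \<psi> z + (\<Sum>j\<in>UNIV. f j z * pd_x j \<psi> z + \<nu> * (a z * pd_x j (pd_x j \<psi>) z))) = 0"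
    and k: "smooth_periodic k" and \<phi>: "test_fun T \<phi>"
  shows "has_bochner_integral (slab T) (\<lambda>z. conv k a z * conv k a z * pd_t \<phi> z +
    (\<Sum>j\<in>UNIV. - (conv (partial j k) (f j) z * conv k a z * \<phi> z)
      + \<nu> * (conv (partial j (partial j k)) a z * conv k a z * \<phi> z)
      + - (conv k a z * conv (partial j k) (f j) z * \<phi> z)
      + \<nu> * (conv k a z * conv (partial j (partial j k)) a z * \<phi> z))) 0"
proof (rule has_bochner_integral_slab_slices)
  have sk: "smooth k" using k by (simp add: smooth_periodic_def)
  have s\<phi>: "smooth \<phi>" by (rule test_fun_smooth[OF \<phi>])
  note kj = smooth_periodic_partial[OF k] and kjj = smooth_periodic_partial[OF smooth_periodic_partial[OF k]]
  note \<phi>t = test_fun_pd_t[OF \<phi>]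
  have c3: "Lp T 3 (conv h a)" if "smooth_periodic h" for h by (rule Lp_conv[OF that a]) simp
  have c32: "Lp T (3/2) (conv h (f j))" if "smooth_periodic h" for h j by (rule Lp_conv[OF that f]) simp
  have i1: "integrable (slab T) (\<lambda>z. g z * h z * \<theta> z)" if "Lp T (3/2) g" "Lp T 3 h" "test_fun T \<theta>" for g h \<theta>
    using integrable_Lp_32_3[OF that(1) Lp_mult_test[OF that(2,3)]] by (simp add: mult.assoc)
  have i2: "integrable (slab T) (\<lambda>z. h z * g z * \<theta> z)" if "Lp T (3/2) g" "Lp T 3 h" "test_fun T \<theta>" for g h \<theta>
    using i1[OF that] by (simp add: mult_ac)
  show "integrable (slab T) (\<lambda>z. conv k a z * conv k a z * pd_t \<phi> z +
    (\<Sum>j\<in>UNIV. - (conv (partial j k) (f j) z * conv k a z * \<phi> z)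
      + \<nu> * (conv (partial j (partial j k)) a z * conv k a z * \<phi> z)
      + - (conv k a z * conv (partial j k) (f j) z * \<phi> z)
      + \<nu> * (conv k a z * conv (partial j (partial j k)) a z * \<phi> z)))"
    by (intro Bochner_Integration.integrable_add Bochner_Integration.integrable_sum
        Bochner_Integration.integrable_minus integrable_mult_right i1[OF Lp_3_imp[OF c3] c3] i1[OF c32 c3] i2[OF c32 c3]
        k kj kjj \<phi> \<phi>t)
  fix \<zeta> :: "real ^ 'd"
  obtain \<alpha> \<beta> where ab: "0 < \<alpha>" "\<beta> < T" and K: "test2 \<alpha> \<beta> (point_kernel k k \<phi> \<zeta>)"
    using test2_point_kernel[OF k k \<phi>] by blast
  note aa = pairable_3_3[OF a a] and fa = pairable_32_3[OF f a] and af = pairable_3_32[OF a f]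
  note D = integral_point_kernel[where T' = T and \<zeta> = \<zeta>]
  have zero: "(LINT p|slabt T. a (fst p) * a (fst (fst p), snd p) * point_kernel k k (pd_t \<phi>) \<zeta> p) +
    (\<Sum>j\<in>UNIV. - (LINT p|slabt T. f j (fst p) * a (fst (fst p), snd p) * point_kernel (partial j k) k \<phi> \<zeta> p)
      + \<nu> * (LINT p|slabt T. a (fst p) * a (fst (fst p), snd p) * point_kernel (partial j (partial j k)) k \<phi> \<zeta> p)
      + - (LINT p|slabt T. a (fst p) * f j (fst (fst p), snd p) * point_kernel k (partial j k) \<phi> \<zeta> p)
      + \<nu> * (LINT p|slabt T. a (fst p) * a (fst (fst p), snd p) * point_kernel k (partial j (partial j k)) \<phi> \<zeta> p)) = 0"
    using two_point_identity[OF a f weak K ab] unfolding point_kernel_derivatives[OF sk sk s\<phi>] by simp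
  have "has_bochner_integral (time_measure T) (\<lambda>t. conv k a (t, \<zeta>) * conv k a (t, \<zeta>) * pd_t \<phi> (t, \<zeta>) +
    (\<Sum>j\<in>UNIV. - (conv (partial j k) (f j) (t, \<zeta>) * conv k a (t, \<zeta>) * \<phi> (t, \<zeta>))
      + \<nu> * (conv (partial j (partial j k)) a (t, \<zeta>) * conv k a (t, \<zeta>) * \<phi> (t, \<zeta>))
      + - (conv k a (t, \<zeta>) * conv (partial j k) (f j) (t, \<zeta>) * \<phi> (t, \<zeta>))
      + \<nu> * (conv k a (t, \<zeta>) * conv (partial j (partial j k)) a (t, \<zeta>) * \<phi> (t, \<zeta>)))) 0"
    by (subst zero[symmetric],
      intro has_bochner_integral_add has_bochner_integral_sum has_bochner_integral_mult_right
        has_bochner_integral_minus D aa fa af k kj kjj \<phi> \<phi>t)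
  then show "(LINT t|time_measure T. conv k a (t, \<zeta>) * conv k a (t, \<zeta>) * pd_t \<phi> (t, \<zeta>) +
    (\<Sum>j\<in>UNIV. - (conv (partial j k) (f j) (t, \<zeta>) * conv k a (t, \<zeta>) * \<phi> (t, \<zeta>))
      + \<nu> * (conv (partial j (partial j k)) a (t, \<zeta>) * conv k a (t, \<zeta>) * \<phi> (t, \<zeta>))
      + - (conv k a (t, \<zeta>) * conv (partial j k) (f j) (t, \<zeta>) * \<phi> (t, \<zeta>))
      + \<nu> * (conv k a (t, \<zeta>) * conv (partial j (partial j k)) a (t, \<zeta>) * \<phi> (t, \<zeta>)))) = 0"
    by (rule has_bochner_integral_integral_eq)
qed

text \<open>Smoothing a bounded continuous function in time extends the hypothesis to it. Bounded
  continuous functions that converge almost everywhere to the sign of \<open>h\<close> then show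
  that the modulus of \<open>h\<close> has integral zero. The functions \<open>\<theta>\<close>
  carry no support condition, because they will multiply a test function that already vanishes near
  the ends of the interval.\<close>

lemma time_fundamental_lemma:
  fixes h :: "real \<Rightarrow> real"
  assumes h: "integrable (time_measure T) h"
    and zero: "\<And>\<theta>. smooth \<theta> \<Longrightarrow> (LINT t|time_measure T. h t * \<theta> t) = 0"
  shows "AE t in time_measure T. h t = 0"
proof -
  have [measurable]: "h \<in> borel_measurable borel"
    using borel_measurable_integrable[OF h] by (simp add: measurable_cong_sets[OF sets_time_measure refl])
  have AE_I: "AE t in time_measure T. t \<in> {0<..<T}" by (simp add: AE_time_measure_iff)
  have cont: "(LINT t|time_measure T. h t * g t) = 0" if g: "continuous_on UNIV g" "\<And>t. \<bar>g t\<bar> \<le> 1" for g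
  proof -
    have [measurable]: "g \<in> borel_measurable borel" by (rule borel_measurable_continuous_onI[OF g(1)])
    interpret pair_sigma_finite "time_measure T" "time_measure T" ..
    have "(\<lambda>n. LINT t|time_measure T. h t * (LINT s|time_measure T. g s * etan n (t - s)))
      \<longlonglongrightarrow> (LINT t|time_measure T. h t * g t)"
    proof (rule integral_dominated_convergence)
      show "integrable (time_measure T) (\<lambda>t. \<bar>h t\<bar>)" using h by simp
      show "AE t in time_measure T. (\<lambda>n. h t * (LINT s|time_measure T. g s * etan n (t - s))) \<longlonglongrightarrow> h t * g t"
        using AE_I by eventually_elim (intro tendsto_intros etan_approx[OF g(1) _ g(2)])
      show "AE t in time_measure T. norm (h t * (LINT s|time_measure T. g s * etan n (t - s))) \<le> \<bar>h t\<bar>" for n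
      proof (rule AE_I2)
        fix t
        have i: "integrable (time_measure T) (\<lambda>s. g s * etan n (t - s))"
          by (rule integrable_bounded_mult[OF integrable_time_etan(1) _ g(2)]) measurable
        have "\<bar>LINT s|time_measure T. g s * etan n (t - s)\<bar> \<le> (LINT s|time_measure T. \<bar>g s * etan n (t - s)\<bar>)"
          by (rule integral_abs_bound)
        also have "\<dots> \<le> (LINT s|time_measure T. etan n (t - s))"
        proof (rule integral_mono[OF _ integrable_time_etan(1)])
          show "integrable (time_measure T) (\<lambda>s. \<bar>g s * etan n (t - s)\<bar>)" using i by simp
          show "\<bar>g s * etan n (t - s)\<bar> \<le> etan n (t - s)" for s
            using mult_right_mono[OF g(2)[of s] etan_nonneg[of n "t - s"]] etan_nonneg[of n "t - s"]
            by (simp add: abs_mult)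
        qed
        also have "\<dots> \<le> 1" by (rule etan_time_le)
        finally show "norm (h t * (LINT s|time_measure T. g s * etan n (t - s))) \<le> \<bar>h t\<bar>"
          by (simp add: abs_mult mult_left_le)
      qed
    qed measurable
    \<comment> \<open>By Fubini's theorem \<open>h\<close> is tested with the smooth function
      \<open>\<lambda>t. etan n (t - s)\<close> for each fixed \<open>s\<close>.\<close>
    moreover have "(LINT t|time_measure T. h t * (LINT s|time_measure T. g s * etan n (t - s))) = 0" for n
    proof -
      obtain C where C: "\<And>r. \<bar>etan n r\<bar> \<le> C" using etan_bounded by blast
      have ig: "integrable (time_measure T) g"
        by (rule time.integrable_const_bound[where B = 1]) (use g(2) in auto)
      have "integrable (time_measure T \<Otimes>\<^sub>M time_measure T) (\<lambda>p. etan n (fst p - snd p) * (h (fst p) * g (snd p)))"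
        by (rule integrable_bounded_mult[OF integrable_pair_mult[OF time.sigma_finite_measure_axioms time.sigma_finite_measure_axioms h ig] _ C])
          measurable
      then have int: "integrable (time_measure T \<Otimes>\<^sub>M time_measure T) (\<lambda>(t, s). h t * (g s * etan n (t - s)))"
        by (simp add: split_def mult_ac)
      have "(LINT t|time_measure T. h t * (LINT s|time_measure T. g s * etan n (t - s)))
          = (LINT s|time_measure T. (LINT t|time_measure T. h t * (g s * etan n (t - s))))"
        using Fubini_integral[OF int] by simp
      also have "\<dots> = (LINT s|time_measure T. g s * (LINT t|time_measure T. h t * etan n (t - s)))"
        by (simp add: mult.left_commute)
      also have "\<dots> = 0"
      proof -
        have "smooth (\<lambda>t. etan n (t - s))" for s
          using smooth_affine[OF smooth_etan bounded_linear_ident, of n "- s"] by simp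
        from zero[OF this] show ?thesis by simp
      qed
      finally show ?thesis .
    qed
    ultimately show ?thesis by (simp add: LIMSEQ_const_iff)
  qed
  have "(\<lambda>t. sgn (h t)) \<in> borel_measurable (lebesgue_on UNIV)"
    by (simp add: lebesgue_on_UNIV_eq measurable_completion)
  then have "(\<lambda>t. sgn (h t)) measurable_on UNIV" by (simp add: measurable_on_iff_borel_measurable)
  then obtain N g where N: "negligible N" and g: "\<And>n. continuous_on UNIV (g n)"
    and lim: "\<And>t. t \<notin> N \<Longrightarrow> (\<lambda>n. g n t) \<longlonglongrightarrow> sgn (h t)"
    unfolding measurable_on_def by auto
  define G where "G n t = clamp_at 1 (g n t)" for n t
  have cG: "continuous_on UNIV (G n)" for n unfolding G_def by (rule continuous_on_clamp_at[OF g])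
  have bG: "\<bar>G n t\<bar> \<le> 1" for n t unfolding G_def by (rule abs_clamp_at) simp
  have [measurable]: "G n \<in> borel_measurable borel" for n by (rule borel_measurable_continuous_onI[OF cG])
  have "AE t in lebesgue. t \<notin> N" using N by (intro AE_not_in) (simp add: negligible_iff_null_sets)
  then have "AE t in lborel. t \<notin> N" by (simp add: AE_completion_iff)
  then have AE_N: "AE t in time_measure T. t \<notin> N" unfolding AE_time_measure_iff by (auto elim: AE_mp)
  have "(\<lambda>n. LINT t|time_measure T. h t * G n t) \<longlonglongrightarrow> (LINT t|time_measure T. h t * sgn (h t))"
  proof (rule integral_dominated_convergence)
    show "integrable (time_measure T) (\<lambda>t. \<bar>h t\<bar>)" using h by simp
    show "AE t in time_measure T. (\<lambda>n. h t * G n t) \<longlonglongrightarrow> h t * sgn (h t)"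
      using AE_N
    proof eventually_elim
      case (elim t)
      have "(\<lambda>n. clamp_at 1 (g n t)) \<longlonglongrightarrow> clamp_at 1 (sgn (h t))"
        unfolding clamp_at_def by (intro tendsto_intros lim elim)
      then have "(\<lambda>n. G n t) \<longlonglongrightarrow> sgn (h t)" by (simp add: G_def clamp_at_eq abs_sgn_eq)
      then show ?case by (intro tendsto_intros)
    qed
    show "AE t in time_measure T. norm (h t * G n t) \<le> \<bar>h t\<bar>" for n
      using bG by (intro AE_I2) (simp add: abs_mult mult_left_le)
  qed measurable
  then have "(LINT t|time_measure T. \<bar>h t\<bar>) = 0"
    using cont[OF cG bG] by (simp add: LIMSEQ_const_iff mult_sgn_abs abs_sgn mult.commute)
  then have "AE t in time_measure T. \<bar>h t\<bar> = 0"
    using integral_nonneg_eq_0_iff_AE[of "time_measure T" "\<lambda>t. \<bar>h t\<bar>"] h by simp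
  then show ?thesis by simp
qed

end

subsection \<open>Integration by parts in space\<close>

lemma has_bochner_integral_slab_AE:
  fixes W :: "real \<times> (real ^ 'd) \<Rightarrow> real"
  assumes "integrable (slab T) W" and "AE t in time_measure T. (LINT x|torus. W (t, x)) = 0"
  shows "has_bochner_integral (slab T) W 0"
proof -
  have "integrable (time_measure T \<Otimes>\<^sub>M torus) W" using assms(1) by (simp add: slab_def)
  from tt.integral_fst'[OF this] have "integral\<^sup>L (slab T) W = (LINT t|time_measure T. (LINT x|torus. W (t, x)))"
    by (simp add: slab_def)
  also have "\<dots> = 0" by (rule integral_eq_zero_AE[OF assms(2)])
  finally show ?thesis using assms(1) by (simp add: has_bochner_integral_iff)
qed

lemma has_real_derivative_along_axis:
  fixes f :: "real ^ 'd \<Rightarrow> real"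
  assumes "(f has_derivative D) (at x)"
  shows "((\<lambda>r. f (x + r *\<^sub>R v)) has_real_derivative D v) (at 0)"
proof -
  have "((\<lambda>r. x + r *\<^sub>R v) has_derivative (\<lambda>r. r *\<^sub>R v)) (at 0)"
    by (auto intro!: derivative_eq_intros)
  moreover have "(f has_derivative D) (at (x + 0 *\<^sub>R v))" using assms by simp
  ultimately have "((\<lambda>r. f (x + r *\<^sub>R v)) has_derivative (\<lambda>r. D (r *\<^sub>R v))) (at 0)"
    by (rule has_derivative_compose)
  moreover have "D (r *\<^sub>R v) = D v * r" for r
    using linear_scale[OF has_derivative_linear[OF assms], of r v] by simp
  ultimately show ?thesis by (simp add: has_field_derivative_def)
qed

lemma smooth_space_section:
  fixes \<phi> :: "real \<times> (real ^ 'd) \<Rightarrow> real"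
  assumes "smooth \<phi>"
  shows "smooth (\<lambda>x. \<phi> (t, x))" and "dird v (\<lambda>x. \<phi> (t, x)) x = dird (0, v) \<phi> (t, x)"
proof -
  have bl: "bounded_linear (\<lambda>x :: real ^ 'd. (0 :: real, x))"
    by (intro bounded_linear_Pair bounded_linear_zero bounded_linear_ident)
  show "smooth (\<lambda>x. \<phi> (t, x))" "dird v (\<lambda>x. \<phi> (t, x)) x = dird (0, v) \<phi> (t, x)"
    using smooth_affine[OF assms bl, of "(t, 0)"] dird_affine[OF assms bl, of "(t, 0)" x v] by simp_all
qed

lemma test_fun_section:
  assumes "test_fun T \<phi>"
  shows "smooth_periodic (\<lambda>x. \<phi> (t, x))" and "partial j (\<lambda>x. \<phi> (t, x)) x = pd_x j \<phi> (t, x)"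
  using smooth_space_section[OF test_fun_smooth[OF assms]] assms
  by (simp_all add: smooth_periodic_def periodic_def test_fun_def space_periodic_def pd_x_def)

lemma periodic_conv:
  assumes "smooth_periodic k" shows "periodic (\<lambda>x. conv k f (t, x))"
  unfolding periodic_def
proof (intro allI)
  fix x i
  have "k (x + axis i 1 - y) = k (x - y)" for y
    using periodic_int_vec[OF _ axis_int_vec, of k "x - y" i] assms
    by (simp add: smooth_periodic_def algebra_simps)
  then show "conv k f (t, x + axis i 1) = conv k f (t, x)" by (simp add: conv_def)
qed

lemma continuous_on_conv:
  assumes "smooth_periodic k" "integrable torus (\<lambda>y. f (t, y))"
  shows "continuous_on UNIV (\<lambda>x. conv k f (t, x))"
  using has_derivative_continuous[OF has_derivative_conv[OF assms]]
  by (auto intro: continuous_at_imp_continuous_on)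

text \<open>The integrand is the \<open>j\<close>-th partial derivative of a continuously
  differentiable periodic function, the product of the two convolutions and
  \<open>\<phi>\<close>.\<close>

lemma conv_conv_by_parts_slice:
  assumes k1: "smooth_periodic k1" and k2: "smooth_periodic k2" and \<phi>: "test_fun T \<phi>"
    and f: "integrable torus (\<lambda>y. f (t, y))" and g: "integrable torus (\<lambda>y. g (t, y))"
  shows "(LINT x|torus. conv (partial j k1) f (t, x) * conv k2 g (t, x) * \<phi> (t, x)
    + conv k1 f (t, x) * conv (partial j k2) g (t, x) * \<phi> (t, x)
    + conv k1 f (t, x) * conv k2 g (t, x) * pd_x j \<phi> (t, x)) = 0"
proof (rule torus_integral_partial_zero)
  note s = test_fun_section[OF \<phi>, of t] and s' = test_fun_section(1)[OF test_fun_pd_x[OF \<phi>], of j t]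
  have cs: "continuous_on UNIV h" if "smooth_periodic h" for h
    using that by (simp add: smooth_periodic_def smooth_continuous_on)
  note kj1 = smooth_periodic_partial[OF k1] and kj2 = smooth_periodic_partial[OF k2]
  show "periodic (\<lambda>x. conv k1 f (t, x) * conv k2 g (t, x) * \<phi> (t, x))"
    using periodic_conv[OF k1, of f t] periodic_conv[OF k2, of g t] s(1)
    by (simp add: periodic_def smooth_periodic_def)
  show "continuous_on UNIV (\<lambda>x. conv k1 f (t, x) * conv k2 g (t, x) * \<phi> (t, x))"
    by (intro continuous_on_mult continuous_on_conv k1 k2 f g cs s(1))
  show "continuous_on UNIV (\<lambda>x. conv (partial j k1) f (t, x) * conv k2 g (t, x) * \<phi> (t, x)
    + conv k1 f (t, x) * conv (partial j k2) g (t, x) * \<phi> (t, x)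
    + conv k1 f (t, x) * conv k2 g (t, x) * pd_x j \<phi> (t, x))"
    by (intro continuous_on_add continuous_on_mult continuous_on_conv k1 k2 kj1 kj2 f g cs s(1) s')
  fix x
  have sm: "smooth (\<lambda>x. \<phi> (t, x))" using s(1) by (simp add: smooth_periodic_def)
  have "((\<lambda>x. conv k1 f (t, x) * conv k2 g (t, x) * \<phi> (t, x)) has_derivative
    (\<lambda>v. conv k1 f (t, x) * conv k2 g (t, x) * dird v (\<lambda>x. \<phi> (t, x)) x
      + (conv k1 f (t, x) * conv (dird v k2) g (t, x) + conv (dird v k1) f (t, x) * conv k2 g (t, x)) * \<phi> (t, x))) (at x)"
    by (intro has_derivative_mult has_derivative_conv k1 k2 f g smooth_has_derivative[OF sm])
  from has_real_derivative_along_axis[OF this, of "axis j 1"]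
  show "((\<lambda>r. conv k1 f (t, x + r *\<^sub>R axis j 1) * conv k2 g (t, x + r *\<^sub>R axis j 1) * \<phi> (t, x + r *\<^sub>R axis j 1))
    has_real_derivative (conv (partial j k1) f (t, x) * conv k2 g (t, x) * \<phi> (t, x)
    + conv k1 f (t, x) * conv (partial j k2) g (t, x) * \<phi> (t, x)
    + conv k1 f (t, x) * conv k2 g (t, x) * pd_x j \<phi> (t, x))) (at 0)"
    by (simp add: s(2) algebra_simps)
qed

lemma conv_conv_by_parts:
  assumes k: "smooth_periodic k1" "smooth_periodic k2" and \<phi>: "test_fun T \<phi>"
    and f: "Lp T p f" "1 \<le> p" and g: "Lp T p' g" "1 \<le> p'"
    and int: "integrable (slab T) (\<lambda>z. conv (partial j k1) f z * conv k2 g z * \<phi> z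
      + conv k1 f z * conv (partial j k2) g z * \<phi> z + conv k1 f z * conv k2 g z * pd_x j \<phi> z)"
  shows "has_bochner_integral (slab T) (\<lambda>z. conv (partial j k1) f z * conv k2 g z * \<phi> z
    + conv k1 f z * conv (partial j k2) g z * \<phi> z + conv k1 f z * conv k2 g z * pd_x j \<phi> z) 0"
proof (rule has_bochner_integral_slab_AE[OF int])
  show "AE t in time_measure T. (LINT x|torus. conv (partial j k1) f (t, x) * conv k2 g (t, x) * \<phi> (t, x)
    + conv k1 f (t, x) * conv (partial j k2) g (t, x) * \<phi> (t, x)
    + conv k1 f (t, x) * conv k2 g (t, x) * pd_x j \<phi> (t, x)) = 0"
    using Lp_slice_integrable[OF f] Lp_slice_integrable[OF g]
    by eventually_elim (rule conv_conv_by_parts_slice[OF k \<phi>])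
qed

subsection \<open>The weak divergence constraint\<close>

lemma test_fun_time_mult:
  fixes \<psi> :: "real \<times> (real ^ 'd) \<Rightarrow> real"
  assumes \<psi>: "test_fun T \<psi>" and h: "smooth h"
  shows "test_fun T (\<lambda>z. h (fst z) * \<psi> z)" and "pd_x j (\<lambda>z. h (fst z) * \<psi> z) z = h (fst z) * pd_x j \<psi> z"
proof -
  have s: "smooth \<psi>" by (rule test_fun_smooth[OF \<psi>])
  have sh: "smooth (\<lambda>z :: real \<times> (real ^ 'd). h (fst z))" using smooth_affine[OF h bounded_linear_fst, of 0] by simp
  have d: "dird v (\<lambda>z :: real \<times> (real ^ 'd). h (fst z)) z = dird (fst v) h (fst z)" for v z
    using dird_affine[OF h bounded_linear_fst, of 0 z v] by simp
  show "test_fun T (\<lambda>z. h (fst z) * \<psi> z)"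
    using \<psi> smooth_mult[OF sh s] by (fastforce simp: test_fun_def space_periodic_def)
  show "pd_x j (\<lambda>z. h (fst z) * \<psi> z) z = h (fst z) * pd_x j \<psi> z"
    by (simp add: pd_x_def dird_mult[OF sh s] d dird_zero[OF h])
qed

lemma test_fun_mult_space:
  fixes \<psi> :: "real \<times> (real ^ 'd) \<Rightarrow> real"
  assumes \<psi>: "test_fun T \<psi>" and k: "smooth_periodic k"
  shows "test_fun T (\<lambda>z. k (snd z - y) * \<psi> z)"
    and "pd_x j (\<lambda>z. k (snd z - y) * \<psi> z) z = partial j k (snd z - y) * \<psi> z + k (snd z - y) * pd_x j \<psi> z"
proof -
  have s: "smooth \<psi>" by (rule test_fun_smooth[OF \<psi>])
  have sk: "smooth k" using k by (simp add: smooth_periodic_def)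
  have sh: "smooth (\<lambda>z :: real \<times> (real ^ 'd). k (snd z - y))"
    using smooth_affine[OF sk bounded_linear_snd, of "- y"] by simp
  have d: "dird v (\<lambda>z :: real \<times> (real ^ 'd). k (snd z - y)) z = dird (snd v) k (snd z - y)" for v z
    using dird_affine[OF sk bounded_linear_snd, of "- y" z v] by simp
  have per: "k (x + axis i 1 - y) = k (x - y)" for x i
    using periodic_int_vec[OF _ axis_int_vec, of k "x - y" i] k
    by (simp add: smooth_periodic_def algebra_simps)
  show "test_fun T (\<lambda>z. k (snd z - y) * \<psi> z)"
    using \<psi> smooth_mult[OF sh s] per by (fastforce simp: test_fun_def space_periodic_def)
  show "pd_x j (\<lambda>z. k (snd z - y) * \<psi> z) z = partial j k (snd z - y) * \<psi> z + k (snd z - y) * pd_x j \<psi> z"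
    by (simp add: pd_x_def dird_mult[OF sh s] d)
qed

text \<open>With \<open>x\<close> frozen, the kernel becomes a test function of the convolution
  variable. Testing the constraint with it yields \<open>\<phi>\<close> times the divergence of the
  mollified field at \<open>x\<close>.\<close>

lemma frozen_space_test:
  fixes \<phi> :: "real \<times> (real ^ 'd) \<Rightarrow> real"
  assumes \<phi>: "test_fun T \<phi>" and k: "smooth_periodic k"
  shows "test_fun T (\<lambda>z. k (x - snd z) * \<phi> (fst z, x))"
    and "pd_x j (\<lambda>z. k (x - snd z) * \<phi> (fst z, x)) z = - partial j k (x - snd z) * \<phi> (fst z, x)"
proof -
  have s: "smooth \<phi>" by (rule test_fun_smooth[OF \<phi>])
  have sk: "smooth k" using k by (simp add: smooth_periodic_def)
  have bl1: "bounded_linear (\<lambda>z :: real \<times> (real ^ 'd). - snd z)"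
    by (intro bounded_linear_minus bounded_linear_snd)
  have bl2: "bounded_linear (\<lambda>z :: real \<times> (real ^ 'd). (fst z, 0 :: real ^ 'd))"
    by (intro bounded_linear_Pair bounded_linear_zero bounded_linear_fst)
  have s1: "smooth (\<lambda>z :: real \<times> (real ^ 'd). k (x - snd z))"
    and s2: "smooth (\<lambda>z :: real \<times> (real ^ 'd). \<phi> (fst z, x))"
    using smooth_affine[OF sk bl1, of x] smooth_affine[OF s bl2, of "(0, x)"] by simp_all
  have d1: "dird v (\<lambda>z :: real \<times> (real ^ 'd). k (x - snd z)) z = dird (- snd v) k (x - snd z)"
    and d2: "dird v (\<lambda>z :: real \<times> (real ^ 'd). \<phi> (fst z, x)) z = dird (fst v, 0) \<phi> (fst z, x)" for v z
    using dird_affine[OF sk bl1, of x z v] dird_affine[OF s bl2, of "(0, x)" z v] by simp_all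
  have per: "k (x - (y + axis i 1)) = k (x - y)" for y i
    using periodic_int_vec[OF _ int_vec_uminus[OF axis_int_vec], of k "x - y" i] k
    by (simp add: smooth_periodic_def algebra_simps)
  show "test_fun T (\<lambda>z. k (x - snd z) * \<phi> (fst z, x))"
    using \<phi> smooth_mult[OF s1 s2] per by (fastforce simp: test_fun_def space_periodic_def)
  have "dird (0, 0) \<phi> z = 0" for z using dird_zero[OF s, of z] by (simp add: zero_prod_def)
  then show "pd_x j (\<lambda>z. k (x - snd z) * \<phi> (fst z, x)) z = - partial j k (x - snd z) * \<phi> (fst z, x)"
    by (simp add: pd_x_def dird_mult[OF s1 s2] d1 d2 dird_uminus[OF sk])
qed

abbreviation torus2 :: "((real ^ 'd) \<times> (real ^ 'd)) measure" where
  "torus2 \<equiv> torus \<Otimes>\<^sub>M torus"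

text \<open>Built on \<open>time_bump\<close> because localising the constraint to single times
  rests on the approximate identity in time.\<close>

locale weakly_solenoidal = time_bump +
  fixes T :: real and u :: "'d \<Rightarrow> real \<times> (real ^ 'd) \<Rightarrow> real"
  assumes u3: "Lp T 3 (u j)"
    and weak_div: "test_fun T \<psi> \<Longrightarrow> (LINT z|slab T. (\<Sum>j\<in>UNIV. u j z * pd_x j \<psi> z)) = 0"
begin

lemma u_measurable [measurable]: "u j \<in> borel_measurable (borel \<Otimes>\<^sub>M borel)"
  using u3[of j] by measurable

lemma integrable_u_pd:
  assumes "test_fun T \<psi>" shows "integrable (slab T) (\<lambda>z. \<Sum>j\<in>UNIV. u j z * pd_x j \<psi> z)"
proof (intro Bochner_Integration.integrable_sum)
  fix j show "integrable (slab T) (\<lambda>z. u j z * pd_x j \<psi> z)"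
    by (rule Lp_imp_integrable[OF Lp_mult_test[OF u3 test_fun_pd_x[OF assms]]]) auto
qed

text \<open>Multiplying the test function by an arbitrary smooth function of time localises the
  constraint. The exceptional set of times depends on \<open>\<psi>\<close>, which is the source of
  the exchanges of null sets that follow.\<close>

lemma weak_div_slices:
  assumes \<psi>: "test_fun T \<psi>"
  shows "AE t in time_measure T. (LINT x|torus. (\<Sum>j\<in>UNIV. u j (t, x) * pd_x j \<psi> (t, x))) = 0"
proof (rule time_fundamental_lemma)
  show "integrable (time_measure T) (\<lambda>t. LINT x|torus. (\<Sum>j\<in>UNIV. u j (t, x) * pd_x j \<psi> (t, x)))"
    using tt.integrable_fst'[OF integrable_u_pd[OF \<psi>, unfolded slab_def]] .
  fix h :: "real \<Rightarrow> real" assume h: "smooth h"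
  note t = test_fun_time_mult[OF \<psi> h]
  have eq: "(\<Sum>j\<in>UNIV. u j z * pd_x j (\<lambda>z. h (fst z) * \<psi> z) z) = (\<Sum>j\<in>UNIV. u j z * pd_x j \<psi> z) * h (fst z)" for z
    unfolding t(2) sum_distrib_right by (rule sum.cong) (simp_all add: mult_ac)
  have int: "integrable (slab T) (\<lambda>z. (\<Sum>j\<in>UNIV. u j z * pd_x j \<psi> z) * h (fst z))"
    using integrable_u_pd[OF t(1)] unfolding eq .
  have "(LINT t|time_measure T. (LINT x|torus. (\<Sum>j\<in>UNIV. u j (t, x) * pd_x j \<psi> (t, x))) * h t)
      = (LINT z|slab T. (\<Sum>j\<in>UNIV. u j z * pd_x j \<psi> z) * h (fst z))"
    using tt.integral_fst'[OF int[unfolded slab_def]] by (simp add: slab_def)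
  also have "\<dots> = 0" using weak_div[OF t(1)] unfolding eq .
  finally show "(LINT t|time_measure T. (LINT x|torus. (\<Sum>j\<in>UNIV. u j (t, x) * pd_x j \<psi> (t, x))) * h t) = 0" .
qed

lemma conv_divergence_free:
  assumes k: "smooth_periodic k" and \<phi>: "test_fun T \<phi>"
  shows "AE z in slab T. \<phi> z * (\<Sum>j\<in>UNIV. conv (partial j k) (u j) z) = 0"
proof -
  note kj = smooth_periodic_partial[OF k]
  have [measurable]: "\<phi> \<in> borel_measurable (borel \<Otimes>\<^sub>M borel)" using \<phi> by measurable
  have [measurable]: "conv (partial j k) (u j) \<in> borel_measurable (borel \<Otimes>\<^sub>M borel)" for j
    by (rule Lp_measurable[OF Lp_conv[OF kj u3]]) simp
  have slices: "AE t in time_measure T. \<forall>j. integrable torus (\<lambda>y. u j (t, y))"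
    using Lp_slice_integrable[OF u3] by (simp add: AE_all_countable eventually_all_finite)
  have "AE t in time_measure T. \<phi> (t, x) * (\<Sum>j\<in>UNIV. conv (partial j k) (u j) (t, x)) = 0" for x
    using slices weak_div_slices[OF frozen_space_test(1)[OF \<phi> k, of x]]
  proof eventually_elim
    case (elim t)
    have i: "integrable torus (\<lambda>y. partial j k (x - y) * u j (t, y))" for j
      by (rule integrable_conv_integrand[OF kj]) (use elim(1) in blast)
    have "0 = (LINT y|torus. (\<Sum>j\<in>UNIV. - \<phi> (t, x) * (partial j k (x - y) * u j (t, y))))"
      using elim(2) unfolding frozen_space_test(2)[OF \<phi> k] by (simp add: mult_ac sum_negf)
    also have "\<dots> = - \<phi> (t, x) * (\<Sum>j\<in>UNIV. conv (partial j k) (u j) (t, x))"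
      using i by (simp add: conv_def sum_distrib_left)
    finally show ?case by simp
  qed
  then have "AE x in torus. AE t in time_measure T. \<phi> (t, x) * (\<Sum>j\<in>UNIV. conv (partial j k) (u j) (t, x)) = 0"
    by simp
  then have "AE t in time_measure T. AE x in torus. \<phi> (t, x) * (\<Sum>j\<in>UNIV. conv (partial j k) (u j) (t, x)) = 0"
    by (subst tt.AE_commute) measurable
  moreover have "(\<lambda>z. \<phi> z * (\<Sum>j\<in>UNIV. conv (partial j k) (u j) z)) \<in> borel_measurable (time_measure T \<Otimes>\<^sub>M torus)"
    by measurable
  from measurable_sets[OF this, of "{0}"]
  have "{z \<in> space (time_measure T \<Otimes>\<^sub>M torus). \<phi> z * (\<Sum>j\<in>UNIV. conv (partial j k) (u j) z) = 0}
      \<in> sets (time_measure T \<Otimes>\<^sub>M torus)"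
    by (auto simp: vimage_def Int_def conj_commute)
  ultimately have "AE z in time_measure T \<Otimes>\<^sub>M torus. \<phi> z * (\<Sum>j\<in>UNIV. conv (partial j k) (u j) z) = 0"
    by (intro tt.AE_pair_measure)
  then show ?thesis unfolding slab_def .
qed

text \<open>Testing the constraint with \<open>\<phi> (k1 * f) (k2 * g)\<close>, a function that is not smooth in time: the
  constraint holds at almost every time for almost all of the kernels \<open>k1 (x - y) k2 (x - y')\<close>, which
  are then averaged with the weight \<open>f (t, y) g (t, y')\<close>.\<close>

lemma weak_div_conv_conv:
  assumes k1: "smooth_periodic k1" and k2: "smooth_periodic k2" and \<phi>: "test_fun T \<phi>"
    and f: "Lp T p f" "1 \<le> p" and g: "Lp T p' g" "1 \<le> p'"
    and int: "integrable (slab T) (\<lambda>z. \<Sum>j\<in>UNIV. u j z * (conv (partial j k1) f z * conv k2 g z * \<phi> z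
      + conv k1 f z * conv (partial j k2) g z * \<phi> z + conv k1 f z * conv k2 g z * pd_x j \<phi> z))"
  shows "has_bochner_integral (slab T) (\<lambda>z. \<Sum>j\<in>UNIV. u j z * (conv (partial j k1) f z * conv k2 g z * \<phi> z
      + conv k1 f z * conv (partial j k2) g z * \<phi> z + conv k1 f z * conv k2 g z * pd_x j \<phi> z)) 0"
proof (rule has_bochner_integral_slab_AE[OF int])
  note kj1 = smooth_periodic_partial[OF k1] and kj2 = smooth_periodic_partial[OF k2]
  note \<phi>j = test_fun_pd_x[OF \<phi>]
  define \<psi> where "\<psi> y z = k1 (snd z - fst y) * (k2 (snd z - snd y) * \<phi> z)"
    for y :: "(real ^ 'd) \<times> (real ^ 'd)" and z
  \<comment> \<open>The pair \<open>y\<close> holds the centres of the two kernels, and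
    \<open>D j y\<close> is the \<open>j\<close>-th space derivative of
    \<open>\<psi> y\<close>.\<close>
  define D where "D j y z = partial j k1 (snd z - fst y) * (k2 (snd z - snd y) * \<phi> z)
      + k1 (snd z - fst y) * (partial j k2 (snd z - snd y) * \<phi> z + k2 (snd z - snd y) * pd_x j \<phi> z)"
    for j and y :: "(real ^ 'd) \<times> (real ^ 'd)" and z
  have \<psi>: "test_fun T (\<psi> y)" and \<psi>j: "pd_x j (\<psi> y) z = D j y z" for j y z
  proof -
    have t: "test_fun T (\<lambda>z. k2 (snd z - snd y) * \<phi> z)" by (rule test_fun_mult_space(1)[OF \<phi> k2])
    show "test_fun T (\<psi> y)" unfolding \<psi>_def by (rule test_fun_mult_space(1)[OF t k1])
    show "pd_x j (\<psi> y) z = D j y z"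
      unfolding \<psi>_def D_def test_fun_mult_space(2)[OF t k1] test_fun_mult_space(2)[OF \<phi> k2] ..
  qed
  have [measurable]: "k1 \<in> borel_measurable borel" "k2 \<in> borel_measurable borel"
    "partial j k1 \<in> borel_measurable borel" "partial j k2 \<in> borel_measurable borel"
    "\<phi> \<in> borel_measurable (borel \<Otimes>\<^sub>M borel)" "pd_x j \<phi> \<in> borel_measurable (borel \<Otimes>\<^sub>M borel)" for j
    using k1 k2 kj1[of j] kj2[of j] \<phi> \<phi>j[of j] by measurable
  obtain C1 where C1: "\<And>x. \<bar>k1 x\<bar> \<le> C1" using smooth_periodic_bounded[OF k1] by blast
  obtain C2 where C2: "\<And>x. \<bar>k2 x\<bar> \<le> C2" using smooth_periodic_bounded[OF k2] by blast
  obtain M where M: "\<And>z. \<bar>\<phi> z\<bar> \<le> M" using test_fun_bounded[OF \<phi>] by blast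
  have C0: "0 \<le> C1" "0 \<le> C2" "0 \<le> M" using C1[of 0] C2[of 0] M[of 0] by linarith+
  have D_bounded: "\<exists>B. \<forall>y z. \<bar>D j y z\<bar> \<le> B" for j
  proof -
    obtain C1' where C1': "\<And>x. \<bar>partial j k1 x\<bar> \<le> C1'" using smooth_periodic_bounded[OF kj1] by blast
    obtain C2' where C2': "\<And>x. \<bar>partial j k2 x\<bar> \<le> C2'" using smooth_periodic_bounded[OF kj2] by blast
    obtain M' where M': "\<And>z. \<bar>pd_x j \<phi> z\<bar> \<le> M'" using test_fun_bounded[OF \<phi>j] by blast
    have C0': "0 \<le> C1'" "0 \<le> C2'" "0 \<le> M'" using C1'[of 0] C2'[of 0] M'[of 0] by linarith+
    have "\<bar>D j y z\<bar> \<le> C1' * (C2 * M) + C1 * (C2' * M + C2 * M')" for y z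
      unfolding D_def
      by (intro order_trans[OF abs_triangle_ineq] add_mono)
        (unfold abs_mult, (intro mult_mono order_trans[OF abs_triangle_ineq] add_mono mult_nonneg_nonneg add_nonneg_nonneg
          C1 C2 C1' C2' M M' C0 C0' abs_ge_zero | unfold abs_mult)+)
    then show ?thesis by blast
  qed
  have u_slices: "AE t in time_measure T. \<forall>j. integrable torus (\<lambda>y. u j (t, y))"
    using Lp_slice_integrable[OF u3] by (simp add: AE_all_countable eventually_all_finite)
  define H where "H t y = (LINT x|torus. (\<Sum>j\<in>UNIV. u j (t, x) * D j y (t, x)))" for t y
  have D_meas [measurable]: "(\<lambda>p. D j (fst p) (snd p)) \<in> borel_measurable ((borel \<Otimes>\<^sub>M borel) \<Otimes>\<^sub>M (borel \<Otimes>\<^sub>M borel))" for j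
    unfolding D_def by measurable
  have H_meas [measurable]: "(\<lambda>p. H (fst p) (snd p)) \<in> borel_measurable (borel \<Otimes>\<^sub>M (borel \<Otimes>\<^sub>M borel))"
    unfolding H_def D_def by measurable
  interpret ty: pair_sigma_finite "time_measure T" "torus \<Otimes>\<^sub>M torus :: ((real ^ 'd) \<times> (real ^ 'd)) measure" ..
  interpret xy: pair_sigma_finite "torus :: (real ^ 'd) measure" "torus \<Otimes>\<^sub>M torus :: ((real ^ 'd) \<times> (real ^ 'd)) measure" ..
  have "AE y in torus \<Otimes>\<^sub>M torus. AE t in time_measure T. H t y = 0"
    using weak_div_slices[OF \<psi>] unfolding \<psi>j H_def by simp
  \<comment> \<open>A null set of times for each pair of centres is exchanged for one null set of
    times, outside of which almost every pair of centres is admissible.\<close>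
  then have H0: "AE t in time_measure T. AE y in torus \<Otimes>\<^sub>M torus. H t y = 0"
  proof (subst ty.AE_commute)
    have "(\<lambda>p. H (fst p) (snd p)) \<in> borel_measurable (time_measure T \<Otimes>\<^sub>M (torus \<Otimes>\<^sub>M torus))" by measurable
    from measurable_sets[OF this, of "{0}"]
    show "{x \<in> space (time_measure T \<Otimes>\<^sub>M (torus \<Otimes>\<^sub>M torus)). H (fst x) (snd x) = 0}
      \<in> sets (time_measure T \<Otimes>\<^sub>M (torus \<Otimes>\<^sub>M torus))"
      by (auto simp: vimage_def Int_def conj_commute)
  qed
  show "AE t in time_measure T. (LINT x|torus. (\<Sum>j\<in>UNIV. u j (t, x) *
      (conv (partial j k1) f (t, x) * conv k2 g (t, x) * \<phi> (t, x)
      + conv k1 f (t, x) * conv (partial j k2) g (t, x) * \<phi> (t, x)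
      + conv k1 f (t, x) * conv k2 g (t, x) * pd_x j \<phi> (t, x)))) = 0"
    using u_slices Lp_slice_integrable[OF f] Lp_slice_integrable[OF g] H0
  proof eventually_elim
    case (elim t)
    have fg: "integrable (torus \<Otimes>\<^sub>M torus) (\<lambda>y. f (t, fst y) * g (t, snd y))"
      by (rule integrable_pair_mult[OF torus.sigma_finite_measure_axioms torus.sigma_finite_measure_axioms elim(2,3)])
    have prod: "has_bochner_integral (torus \<Otimes>\<^sub>M torus) (\<lambda>y. (h1 (x - fst y) * f (t, fst y)) * (h2 (x - snd y) * g (t, snd y)))
        (conv h1 f (t, x) * conv h2 g (t, x))" if h: "smooth_periodic h1" "smooth_periodic h2" for h1 h2 x
    proof -
      note i = integrable_conv_integrand[OF h(1) elim(2), of x] integrable_conv_integrand[OF h(2) elim(3), of x]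
      have int: "integrable (torus \<Otimes>\<^sub>M torus) (\<lambda>y. (h1 (x - fst y) * f (t, fst y)) * (h2 (x - snd y) * g (t, snd y)))"
        by (rule integrable_pair_mult[OF torus.sigma_finite_measure_axioms torus.sigma_finite_measure_axioms i])
      from tor2.integral_fst'[OF int] int show ?thesis by (simp add: has_bochner_integral_iff conv_def)
    qed
    have inner: "has_bochner_integral (torus \<Otimes>\<^sub>M torus) (\<lambda>y. f (t, fst y) * g (t, snd y) * D j y (t, x))
      (conv (partial j k1) f (t, x) * conv k2 g (t, x) * \<phi> (t, x)
      + conv k1 f (t, x) * conv (partial j k2) g (t, x) * \<phi> (t, x)
      + conv k1 f (t, x) * conv k2 g (t, x) * pd_x j \<phi> (t, x))" for j x
    proof -
      have "(\<lambda>y. f (t, fst y) * g (t, snd y) * D j y (t, x)) =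
        (\<lambda>y. (partial j k1 (x - fst y) * f (t, fst y)) * (k2 (x - snd y) * g (t, snd y)) * \<phi> (t, x)
          + (k1 (x - fst y) * f (t, fst y)) * (partial j k2 (x - snd y) * g (t, snd y)) * \<phi> (t, x)
          + (k1 (x - fst y) * f (t, fst y)) * (k2 (x - snd y) * g (t, snd y)) * pd_x j \<phi> (t, x))"
        by (rule ext) (simp add: D_def algebra_simps)
      then show ?thesis
        by (simp only:) (intro has_bochner_integral_add has_bochner_integral_mult_left prod k1 k2 kj1 kj2)
    qed
    have int_xy: "integrable (torus \<Otimes>\<^sub>M (torus \<Otimes>\<^sub>M torus))
        (\<lambda>(x, y). \<Sum>j\<in>UNIV. u j (t, x) * (f (t, fst y) * g (t, snd y) * D j y (t, x)))"
    proof -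
      have "integrable (torus \<Otimes>\<^sub>M (torus \<Otimes>\<^sub>M torus))
        (\<lambda>p. u j (t, fst p) * (f (t, fst (snd p)) * g (t, snd (snd p)) * D j (snd p) (t, fst p)))" for j
      proof -
        obtain B where B: "\<And>y z. \<bar>D j y z\<bar> \<le> B" using D_bounded by blast
        have [measurable]: "(\<lambda>p. D j (snd p) (t, fst p)) \<in> borel_measurable (borel \<Otimes>\<^sub>M (borel \<Otimes>\<^sub>M borel))"
          unfolding D_def snd_conv by measurable
        have "integrable (torus \<Otimes>\<^sub>M (torus \<Otimes>\<^sub>M torus)) (\<lambda>p. D j (snd p) (t, fst p) * (u j (t, fst p) * (f (t, fst (snd p)) * g (t, snd (snd p)))))"
          by (rule integrable_bounded_mult[OF integrable_pair_mult[OF torus.sigma_finite_measure_axioms tor2.sigma_finite_measure_axioms _ fg] _ B])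
            (use elim(1) in blast, measurable)
        then show ?thesis by (simp add: mult_ac)
      qed
      then show ?thesis unfolding split_def by (intro Bochner_Integration.integrable_sum)
    qed
    have iu: "(LINT y|torus2. (\<Sum>j\<in>UNIV. u j (t, x) * (f (t, fst y) * g (t, snd y) * D j y (t, x))))
      = (\<Sum>j\<in>UNIV. u j (t, x) * (conv (partial j k1) f (t, x) * conv k2 g (t, x) * \<phi> (t, x)
        + conv k1 f (t, x) * conv (partial j k2) g (t, x) * \<phi> (t, x)
        + conv k1 f (t, x) * conv k2 g (t, x) * pd_x j \<phi> (t, x)))" for x
      by (rule has_bochner_integral_integral_eq,
          intro has_bochner_integral_sum has_bochner_integral_mult_right inner)
    have "(LINT x|torus. (\<Sum>j\<in>UNIV. u j (t, x) *
      (conv (partial j k1) f (t, x) * conv k2 g (t, x) * \<phi> (t, x)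
      + conv k1 f (t, x) * conv (partial j k2) g (t, x) * \<phi> (t, x)
      + conv k1 f (t, x) * conv k2 g (t, x) * pd_x j \<phi> (t, x))))
      = (LINT x|torus. (LINT y|torus2. (\<Sum>j\<in>UNIV. u j (t, x) * (f (t, fst y) * g (t, snd y) * D j y (t, x)))))"
      unfolding iu ..
    also have "\<dots> = (LINT y|torus2. (LINT x|torus. (\<Sum>j\<in>UNIV. u j (t, x) * (f (t, fst y) * g (t, snd y) * D j y (t, x)))))"
      by (rule xy.Fubini_integral[OF int_xy, symmetric])
    also have "\<dots> = (LINT y|torus2. (f (t, fst y) * g (t, snd y)) * H t y)"
    proof -
      have "(\<Sum>j\<in>UNIV. u j (t, x) * (f (t, fst y) * g (t, snd y) * D j y (t, x)))
        = (f (t, fst y) * g (t, snd y)) * (\<Sum>j\<in>UNIV. u j (t, x) * D j y (t, x))" for x y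
        unfolding sum_distrib_left by (rule sum.cong) (simp_all add: mult_ac)
      then show ?thesis by (simp add: H_def)
    qed
    also have "\<dots> = 0"
      by (rule integral_eq_zero_AE) (use elim(4) in eventually_elim, simp)
    finally show ?case .
  qed
qed

end

subsection \<open>The weak gradient\<close>

lemma set_integral_unit_cube:
  fixes f :: "real ^ 'd \<Rightarrow> real"
  assumes "f \<in> borel_measurable borel"
  shows "(LINT x:unit_cube|lborel. f x) = integral\<^sup>L torus f"
  using integral_density[of f lborel "indicator unit_cube"] assms
  unfolding torus_def set_lebesgue_integral_def by (simp add: ennreal_indicator)

text \<open>On the finite slab L^3 is contained in L^2, and the product of two square-integrable
  functions is integrable.\<close>

lemma integrable_Lp_2_3:
  assumes g: "Lp T 2 g" and h: "Lp T 3 h"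
  shows "integrable (slab T) (\<lambda>z. g z * h z)"
proof (rule Bochner_Integration.integrable_bound)
  have h2: "Lp T 2 h" by (rule Lp_mono[OF h]) auto
  have "integrable (slab T) (\<lambda>z. \<bar>g z\<bar> powr 2)" "integrable (slab T) (\<lambda>z. \<bar>h z\<bar> powr 2)"
    using g h2 by (simp_all only: Lp_integrable_powr)
  then show "integrable (slab T) (\<lambda>z. \<bar>g z\<bar> ^ 2 + \<bar>h z\<bar> ^ 2)" by simp
  show "AE z in slab T. norm (g z * h z) \<le> norm (\<bar>g z\<bar> ^ 2 + \<bar>h z\<bar> ^ 2)"
  proof (rule AE_I2)
    fix z
    have "0 \<le> (\<bar>g z\<bar> - \<bar>h z\<bar>) ^ 2" by simp
    then have "2 * (\<bar>g z\<bar> * \<bar>h z\<bar>) \<le> \<bar>g z\<bar> ^ 2 + \<bar>h z\<bar> ^ 2" by (simp add: power2_diff)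
    moreover have "0 \<le> \<bar>g z\<bar> * \<bar>h z\<bar>" by simp
    ultimately have "\<bar>g z\<bar> * \<bar>h z\<bar> \<le> \<bar>g z\<bar> ^ 2 + \<bar>h z\<bar> ^ 2" by linarith
    then show "norm (g z * h z) \<le> norm (\<bar>g z\<bar> ^ 2 + \<bar>h z\<bar> ^ 2)" by (simp add: abs_mult)
  qed
  show "(\<lambda>z. g z * h z) \<in> borel_measurable (slab T)" using g h by measurable
qed

text \<open>At a fixed time the definition of the weak gradient is tested with
  \<open>k (x - y) * \<phi> (t, x)\<close> as a function of \<open>x\<close>, and the result is
  averaged over \<open>y\<close> with weight \<open>u (t, y) $ i\<close>. One null set of times
  serves all test functions here, so the argument runs slice by slice.\<close>

lemma weak_gradient_tested_with_conv:
  fixes u :: "real \<times> (real ^ 'd) \<Rightarrow> real ^ 'd"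
  assumes G: "in_L2_H1 T u G" and u: "in_Lp T 3 u"
    and k: "smooth_periodic k" and \<phi>: "test_fun T \<phi>"
  shows "Lp T 2 (\<lambda>z. G z $ i $ j)"
    and "has_bochner_integral (slab T) (\<lambda>z. G z $ i $ j * conv k (\<lambda>z. u z $ i) z * \<phi> z
      + (u z $ i * conv (partial j k) (\<lambda>z. u z $ i) z * \<phi> z
        + u z $ i * conv k (\<lambda>z. u z $ i) z * pd_x j \<phi> z)) 0"
proof -
  define U where "U z = u z $ i" for z
  define g where "g z = G z $ i $ j" for z
  have U3: "Lp T 3 U" unfolding U_def by (rule Lp_component[OF u]) simp
  have G2: "in_Lp T 2 G" using G by (simp add: in_L2_H1_def)
  have g2: "Lp T 2 g" unfolding g_def
  proof (rule in_Lp_imp_Lp[OF G2])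
    show "(\<lambda>A :: real ^ 'd ^ 'd. A $ i $ j) \<in> borel_measurable borel"
      by (intro borel_measurable_continuous_onI continuous_on_component continuous_on_id)
    show "\<bar>A $ i $ j\<bar> \<le> norm A" for A :: "real ^ 'd ^ 'd"
      by (rule order_trans[OF component_le_norm_cart Finite_Cartesian_Product.norm_nth_le])
  qed simp
  then show "Lp T 2 (\<lambda>z. G z $ i $ j)" unfolding g_def .
  note kj = smooth_periodic_partial[OF k] and \<phi>j = test_fun_pd_x[OF \<phi>]
  have [measurable]: "U \<in> borel_measurable (borel \<Otimes>\<^sub>M borel)" "g \<in> borel_measurable (borel \<Otimes>\<^sub>M borel)"
    using U3 g2 by measurable
  have [measurable]: "k \<in> borel_measurable borel" "partial j k \<in> borel_measurable borel"
    "\<phi> \<in> borel_measurable (borel \<Otimes>\<^sub>M borel)" "pd_x j \<phi> \<in> borel_measurable (borel \<Otimes>\<^sub>M borel)"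
    using k kj[of j] \<phi> \<phi>j[of j] by measurable
  have c3: "Lp T 3 (conv h U)" if "smooth_periodic h" for h by (rule Lp_conv[OF that U3]) simp
  have "has_bochner_integral (slab T) (\<lambda>z. g z * conv k U z * \<phi> z
      + (U z * conv (partial j k) U z * \<phi> z + U z * conv k U z * pd_x j \<phi> z)) 0"
  proof (rule has_bochner_integral_slab_AE)
    have "integrable (slab T) (\<lambda>z. g z * (conv k U z * \<phi> z))"
      by (rule integrable_Lp_2_3[OF g2 Lp_mult_test[OF c3[OF k] \<phi>]]) simp
    moreover have "integrable (slab T) (\<lambda>z. U z * (conv (partial j k) U z * \<phi> z))"
      by (rule integrable_Lp_32_3[OF Lp_3_imp[OF U3] Lp_mult_test[OF c3[OF kj] \<phi>]]) simp
    moreover have "integrable (slab T) (\<lambda>z. U z * (conv k U z * pd_x j \<phi> z))"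
      by (rule integrable_Lp_32_3[OF Lp_3_imp[OF U3] Lp_mult_test[OF c3[OF k] \<phi>j]]) simp
    ultimately show "integrable (slab T) (\<lambda>z. g z * conv k U z * \<phi> z
      + (U z * conv (partial j k) U z * \<phi> z + U z * conv k U z * pd_x j \<phi> z))"
      by (simp add: mult.assoc)
    have "AE t in time_measure T. \<forall>\<psi>::real ^ 'd \<Rightarrow> real. smooth_periodic \<psi> \<longrightarrow>
        (LINT x:unit_cube|lborel. U (t, x) * partial j \<psi> x) = - (LINT x:unit_cube|lborel. g (t, x) * \<psi> x)"
      using G unfolding in_L2_H1_def AE_time_measure_iff smooth_periodic_def periodic_def U_def g_def
      by (auto elim!: AE_mp)
    then show "AE t in time_measure T. (LINT x|torus. g (t, x) * conv k U (t, x) * \<phi> (t, x)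
      + (U (t, x) * conv (partial j k) U (t, x) * \<phi> (t, x) + U (t, x) * conv k U (t, x) * pd_x j \<phi> (t, x))) = 0"
      using Lp_slice_integrable[OF U3, simplified] Lp_slice_integrable[OF g2, simplified]
    proof eventually_elim
      case (elim t)
      \<comment> \<open>For fixed \<open>y\<close> the test function is \<open>N\<close>, and
        \<open>E\<close> is its \<open>j\<close>-th partial derivative in \<open>x\<close>.\<close>
      define E where "E x y = partial j k (x - y) * \<phi> (t, x) + k (x - y) * pd_x j \<phi> (t, x)" for x y
      define N where "N x y = k (x - y) * \<phi> (t, x)" for x y
      have [measurable]: "(\<lambda>x. U (t, x)) \<in> borel_measurable borel" "(\<lambda>x. g (t, x)) \<in> borel_measurable borel"
        "(\<lambda>x. \<phi> (t, x)) \<in> borel_measurable borel" "(\<lambda>x. pd_x j \<phi> (t, x)) \<in> borel_measurable borel"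
        by (auto intro: measurable_compose[OF measurable_Pair1'])
      have E_meas: "(\<lambda>p. E (fst p) (snd p)) \<in> borel_measurable (borel \<Otimes>\<^sub>M borel)"
        and N_meas: "(\<lambda>p. N (fst p) (snd p)) \<in> borel_measurable (borel \<Otimes>\<^sub>M borel)"
        unfolding E_def N_def by measurable
      obtain C where C: "\<And>x. \<bar>k x\<bar> \<le> C" using smooth_periodic_bounded[OF k] by blast
      obtain C' where C': "\<And>x. \<bar>partial j k x\<bar> \<le> C'" using smooth_periodic_bounded[OF kj] by blast
      obtain M where M: "\<And>z. \<bar>\<phi> z\<bar> \<le> M" using test_fun_bounded[OF \<phi>] by blast
      obtain M' where M': "\<And>z. \<bar>pd_x j \<phi> z\<bar> \<le> M'" using test_fun_bounded[OF \<phi>j] by blast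
      have C0: "0 \<le> C" "0 \<le> C'" "0 \<le> M" "0 \<le> M'" using C[of 0] C'[of 0] M[of 0] M'[of 0] by linarith+
      have Nb: "\<bar>N (fst p) (snd p)\<bar> \<le> C * M" for p
        unfolding N_def abs_mult by (intro mult_mono C M C0 abs_ge_zero)
      have Eb: "\<bar>E (fst p) (snd p)\<bar> \<le> C' * M + C * M'" for p
        unfolding E_def by (rule order_trans[OF abs_triangle_ineq], rule add_mono; unfold abs_mult)
          (intro mult_mono C C' M M' C0 abs_ge_zero)+
      have i: "integrable torus2 (\<lambda>p. w (fst p) * U (t, snd p))" if "integrable torus w" for w :: "real ^ 'd \<Rightarrow> real"
        by (rule integrable_pair_mult[OF torus.sigma_finite_measure_axioms torus.sigma_finite_measure_axioms that elim(2)])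
      have "integrable torus2 (\<lambda>p. E (fst p) (snd p) * (U (t, fst p) * U (t, snd p)))"
        by (rule integrable_bounded_mult[OF i[OF elim(2)] _ Eb]) (use E_meas in measurable)
      moreover have "integrable torus2 (\<lambda>p. N (fst p) (snd p) * (g (t, fst p) * U (t, snd p)))"
        by (rule integrable_bounded_mult[OF i[OF elim(3)] _ Nb]) (use N_meas in measurable)
      ultimately have "integrable torus2 (\<lambda>p. E (fst p) (snd p) * (U (t, fst p) * U (t, snd p))
          + N (fst p) (snd p) * (g (t, fst p) * U (t, snd p)))"
        by (rule Bochner_Integration.integrable_add)
      then have int: "integrable torus2 (\<lambda>(x, y). E x y * (U (t, x) * U (t, y)) + N x y * (g (t, x) * U (t, y)))"
        by (simp add: split_def)
      \<comment> \<open>The double integral is evaluated in both orders: over \<open>y\<close> first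
        it gives the claimed integrand, over \<open>x\<close> first it vanishes by the definition of
        the weak gradient.\<close>
      have inner_y: "(LINT y|torus. E x y * (U (t, x) * U (t, y)) + N x y * (g (t, x) * U (t, y)))
        = g (t, x) * conv k U (t, x) * \<phi> (t, x)
          + (U (t, x) * conv (partial j k) U (t, x) * \<phi> (t, x) + U (t, x) * conv k U (t, x) * pd_x j \<phi> (t, x))" for x
      proof (rule has_bochner_integral_integral_eq)
        have h: "has_bochner_integral torus (\<lambda>y. h (x - y) * U (t, y)) (conv h U (t, x))" if "smooth_periodic h" for h
          using integrable_conv_integrand[OF that elim(2), of x] by (simp add: has_bochner_integral_iff conv_def)
        have "has_bochner_integral torus (\<lambda>y. g (t, x) * (k (x - y) * U (t, y)) * \<phi> (t, x)
          + (U (t, x) * (partial j k (x - y) * U (t, y)) * \<phi> (t, x) + U (t, x) * (k (x - y) * U (t, y)) * pd_x j \<phi> (t, x)))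
          (g (t, x) * conv k U (t, x) * \<phi> (t, x)
          + (U (t, x) * conv (partial j k) U (t, x) * \<phi> (t, x) + U (t, x) * conv k U (t, x) * pd_x j \<phi> (t, x)))"
          by (intro has_bochner_integral_add has_bochner_integral_mult_left has_bochner_integral_mult_right h k kj)
        moreover have "(\<lambda>y. g (t, x) * (k (x - y) * U (t, y)) * \<phi> (t, x)
          + (U (t, x) * (partial j k (x - y) * U (t, y)) * \<phi> (t, x) + U (t, x) * (k (x - y) * U (t, y)) * pd_x j \<phi> (t, x)))
          = (\<lambda>y. E x y * (U (t, x) * U (t, y)) + N x y * (g (t, x) * U (t, y)))"
          by (rule ext) (simp add: E_def N_def algebra_simps)
        ultimately show "has_bochner_integral torus (\<lambda>y. E x y * (U (t, x) * U (t, y)) + N x y * (g (t, x) * U (t, y)))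
          (g (t, x) * conv k U (t, x) * \<phi> (t, x)
          + (U (t, x) * conv (partial j k) U (t, x) * \<phi> (t, x) + U (t, x) * conv k U (t, x) * pd_x j \<phi> (t, x)))"
          by (simp only:)
      qed
      have inner_x: "(LINT x|torus. E x y * (U (t, x) * U (t, y)) + N x y * (g (t, x) * U (t, y))) = 0" for y
      proof -
        note tm = test_fun_mult_space[OF \<phi> k, where y = y]
        have Nsec: "smooth_periodic (\<lambda>x. N x y)" and Esec: "partial j (\<lambda>x. N x y) x = E x y" for x
          using test_fun_section(1)[OF tm(1), where t = t] test_fun_section(2)[OF tm(1), where t = t and j = j]
          tm(2)[where j = j] by (simp_all add: N_def E_def)
        have [measurable]: "(\<lambda>x. E x y) \<in> borel_measurable borel" "(\<lambda>x. N x y) \<in> borel_measurable borel"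
          unfolding E_def N_def by measurable
        have "(LINT x|torus. U (t, x) * E x y) = - (LINT x|torus. g (t, x) * N x y)"
          using elim(1)[rule_format, OF Nsec] unfolding Esec by (simp add: set_integral_unit_cube)
        moreover have "integrable torus (\<lambda>x. E x y * U (t, x))"
          by (rule integrable_bounded_mult[OF elim(2), where C = "C' * M + C * M'"]) (measurable, use Eb in fastforce)
        moreover have "integrable torus (\<lambda>x. N x y * g (t, x))"
          by (rule integrable_bounded_mult[OF elim(3), where C = "C * M"]) (measurable, use Nb in fastforce)
        ultimately have "(LINT x|torus. U (t, y) * (E x y * U (t, x) + N x y * g (t, x))) = 0"
          by (simp add: mult.commute)
        then show ?thesis by (simp add: algebra_simps)
      qed
      have "(LINT x|torus. (LINT y|torus. E x y * (U (t, x) * U (t, y)) + N x y * (g (t, x) * U (t, y)))) = 0"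
        using tor2.Fubini_integral[OF int] by (simp add: inner_x)
      then show ?case by (simp only: inner_y)
    qed
  qed
  then show "has_bochner_integral (slab T) (\<lambda>z. G z $ i $ j * conv k (\<lambda>z. u z $ i) z * \<phi> z
      + (u z $ i * conv (partial j k) (\<lambda>z. u z $ i) z * \<phi> z
        + u z $ i * conv k (\<lambda>z. u z $ i) z * pd_x j \<phi> z)) 0"
    unfolding U_def[abs_def] g_def .
qed

subsection \<open>Algebra of the integrands\<close>

lemma sum_diagonal: "(\<Sum>i\<in>UNIV. \<Sum>j\<in>UNIV. (if i = j then q else 0) * x i j) = q * (\<Sum>i\<in>(UNIV::'d::finite set). x i i)"
  for q :: real
proof -
  have "(\<Sum>j\<in>UNIV. (if i = j then q else 0) * x i j) = q * x i i" for i :: 'd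
    by (simp add: if_distrib[of "\<lambda>c. c * _"] cong: if_cong)
  then show ?thesis by (simp add: sum_distrib_left)
qed

lemma sum2_cmult: "(\<Sum>i\<in>A. \<Sum>j\<in>B. c * x i j) = c * (\<Sum>i\<in>A. \<Sum>j\<in>B. x i j)" for c :: real
  by (simp only: sum_distrib_left)

lemma sum2_product: "(\<Sum>i\<in>A. \<Sum>j\<in>B. a i * b j) = (\<Sum>i\<in>A. a i) * (\<Sum>j\<in>B. b j)" for a b :: "_ \<Rightarrow> real"
  by (rule sum_product[symmetric])

text \<open>Algebra at a single point, with numbers in place of functions: \<open>U\<close> and
  \<open>V\<close> stand for \<open>u\<close> and its mollification, \<open>V1\<close> and
  \<open>V2\<close> for first and pure second derivatives of the latter, \<open>S\<close> and
  \<open>SF\<close> for derivatives of the mollified fluxes without and with the pressure,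
  \<open>\<phi>1\<close> and \<open>\<phi>2\<close> for space derivatives of the test
  function.\<close>

context
  fixes U V P1 \<phi>1 \<phi>2 :: "'d::finite \<Rightarrow> real" and V1 V2 S SF F :: "'d \<Rightarrow> 'd \<Rightarrow> real" and q P \<phi> \<phi>t \<nu> :: real
begin

text \<open>The pressure sits on the diagonal of the flux, so each double sum containing it
  collapses: one becomes \<open>q\<close> times the derivative of \<open>\<phi>\<close> along
  \<open>V\<close>, the other \<open>q\<close> times the divergence of \<open>V\<close>.\<close>

lemma sum_tested:
  assumes F: "\<And>i j. F i j = U i * U j + (if i = j then q else 0)"
  shows "(\<Sum>i\<in>UNIV. U i * V i * \<phi>t + (\<Sum>j\<in>UNIV. (F i j * V i * \<phi>1 j + F i j * V1 i j * \<phi>)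
      + \<nu> * (U i * V i * \<phi>2 j + 2 * (U i * V1 i j * \<phi>1 j) + U i * V2 i j * \<phi>)
      + - (U i * SF i j * \<phi>) + \<nu> * (U i * V2 i j * \<phi>)))
    = (\<Sum>i\<in>UNIV. U i * V i) * \<phi>t
      + (\<Sum>i\<in>UNIV. U i * V i) * (\<Sum>j\<in>UNIV. U j * \<phi>1 j) + q * (\<Sum>j\<in>UNIV. V j * \<phi>1 j)
      + (\<Sum>i\<in>UNIV. \<Sum>j\<in>UNIV. U i * U j * V1 i j) * \<phi> + q * (\<Sum>j\<in>UNIV. V1 j j) * \<phi>
      + \<nu> * ((\<Sum>i\<in>UNIV. U i * V i) * (\<Sum>j\<in>UNIV. \<phi>2 j) + 2 * (\<Sum>i\<in>UNIV. \<Sum>j\<in>UNIV. U i * V1 i j * \<phi>1 j)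
          + (\<Sum>i\<in>UNIV. \<Sum>j\<in>UNIV. U i * V2 i j) * \<phi>)
      - (\<Sum>i\<in>UNIV. \<Sum>j\<in>UNIV. U i * SF i j) * \<phi> + \<nu> * ((\<Sum>i\<in>UNIV. \<Sum>j\<in>UNIV. U i * V2 i j) * \<phi>)"
proof -
  have "(F i j * V i * \<phi>1 j + F i j * V1 i j * \<phi>)
      + \<nu> * (U i * V i * \<phi>2 j + 2 * (U i * V1 i j * \<phi>1 j) + U i * V2 i j * \<phi>)
      + - (U i * SF i j * \<phi>) + \<nu> * (U i * V2 i j * \<phi>)
    = (U i * V i) * (U j * \<phi>1 j) + (if i = j then q else 0) * (V i * \<phi>1 j)
      + \<phi> * (U i * U j * V1 i j) + \<phi> * ((if i = j then q else 0) * V1 i j)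
      + \<nu> * ((U i * V i) * \<phi>2 j) + (2 * \<nu>) * (U i * V1 i j * \<phi>1 j) + (2 * \<nu> * \<phi>) * (U i * V2 i j)
      + (- \<phi>) * (U i * SF i j)" for i j
    by (simp add: F algebra_simps)
  then have "(\<Sum>i\<in>UNIV. U i * V i * \<phi>t + (\<Sum>j\<in>UNIV. (F i j * V i * \<phi>1 j + F i j * V1 i j * \<phi>)
      + \<nu> * (U i * V i * \<phi>2 j + 2 * (U i * V1 i j * \<phi>1 j) + U i * V2 i j * \<phi>)
      + - (U i * SF i j * \<phi>) + \<nu> * (U i * V2 i j * \<phi>)))
    = (\<Sum>i\<in>UNIV. U i * V i) * \<phi>t
      + ((\<Sum>i\<in>UNIV. U i * V i) * (\<Sum>j\<in>UNIV. U j * \<phi>1 j) + q * (\<Sum>i\<in>UNIV. V i * \<phi>1 i)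
      + \<phi> * (\<Sum>i\<in>UNIV. \<Sum>j\<in>UNIV. U i * U j * V1 i j) + \<phi> * (q * (\<Sum>i\<in>UNIV. V1 i i))
      + \<nu> * ((\<Sum>i\<in>UNIV. U i * V i) * (\<Sum>j\<in>UNIV. \<phi>2 j)) + (2 * \<nu>) * (\<Sum>i\<in>UNIV. \<Sum>j\<in>UNIV. U i * V1 i j * \<phi>1 j)
      + (2 * \<nu> * \<phi>) * (\<Sum>i\<in>UNIV. \<Sum>j\<in>UNIV. U i * V2 i j) + (- \<phi>) * (\<Sum>i\<in>UNIV. \<Sum>j\<in>UNIV. U i * SF i j))"
    by (simp only: sum.distrib sum_diagonal sum2_cmult sum2_product sum_distrib_right[symmetric])
  then show ?thesis by (simp only: algebra_simps)
qed

lemma sum_squared: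
  "(\<Sum>i\<in>UNIV. V i * V i * \<phi>t + (\<Sum>j\<in>UNIV. - (SF i j * V i * \<phi>) + \<nu> * (V2 i j * V i * \<phi>)
      + - (V i * SF i j * \<phi>) + \<nu> * (V i * V2 i j * \<phi>)))
    = (\<Sum>i\<in>UNIV. V i * V i) * \<phi>t - 2 * (\<Sum>i\<in>UNIV. \<Sum>j\<in>UNIV. V i * SF i j) * \<phi>
      + 2 * \<nu> * (\<Sum>i\<in>UNIV. \<Sum>j\<in>UNIV. V i * V2 i j) * \<phi>"
proof -
  have "(\<Sum>i\<in>UNIV. V i * V i * \<phi>t + (\<Sum>j\<in>UNIV. - (SF i j * V i * \<phi>) + \<nu> * (V2 i j * V i * \<phi>)
      + - (V i * SF i j * \<phi>) + \<nu> * (V i * V2 i j * \<phi>)))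
    = (\<Sum>i\<in>UNIV. V i * V i * \<phi>t + (\<Sum>j\<in>UNIV. - (2 * \<phi>) * (V i * SF i j) + (2 * \<nu> * \<phi>) * (V i * V2 i j)))"
  proof -
    have "- (SF i j * V i * \<phi>) + \<nu> * (V2 i j * V i * \<phi>) + - (V i * SF i j * \<phi>) + \<nu> * (V i * V2 i j * \<phi>)
      = - (2 * \<phi>) * (V i * SF i j) + (2 * \<nu> * \<phi>) * (V i * V2 i j)" for i j
      by (simp add: algebra_simps)
    then show ?thesis by (simp only:)
  qed
  also have "\<dots> = (\<Sum>i\<in>UNIV. V i * V i) * \<phi>t - (2 * \<phi>) * (\<Sum>i\<in>UNIV. \<Sum>j\<in>UNIV. V i * SF i j)
      + (2 * \<nu> * \<phi>) * (\<Sum>i\<in>UNIV. \<Sum>j\<in>UNIV. V i * V2 i j)"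
    by (simp add: sum.distrib sum_subtractf flip: sum_distrib_left sum_distrib_right)
  finally show ?thesis by (simp add: algebra_simps)
qed

text \<open>The left side is the derivative along \<open>U\<close> of the squared norm of
  \<open>V\<close> times \<open>\<phi>\<close>, expanded by the product rule.\<close>

lemma sum_solenoidal:
  "(\<Sum>i\<in>UNIV. \<Sum>j\<in>UNIV. U j * (V1 i j * V i * \<phi> + V i * V1 i j * \<phi> + V i * V i * \<phi>1 j))
    = 2 * (\<Sum>i\<in>UNIV. \<Sum>j\<in>UNIV. V i * U j * V1 i j) * \<phi> + (\<Sum>i\<in>UNIV. V i * V i) * (\<Sum>j\<in>UNIV. U j * \<phi>1 j)"
proof -
  have "(\<Sum>i\<in>UNIV. \<Sum>j\<in>UNIV. U j * (V1 i j * V i * \<phi> + V i * V1 i j * \<phi> + V i * V i * \<phi>1 j))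
    = (\<Sum>i\<in>UNIV. \<Sum>j\<in>UNIV. (2 * \<phi>) * (V i * U j * V1 i j) + (V i * V i) * (U j * \<phi>1 j))"
    by (intro sum.cong refl) (simp add: algebra_simps)
  also have "\<dots> = (2 * \<phi>) * (\<Sum>i\<in>UNIV. \<Sum>j\<in>UNIV. V i * U j * V1 i j)
      + (\<Sum>i\<in>UNIV. V i * V i) * (\<Sum>j\<in>UNIV. U j * \<phi>1 j)"
    by (simp only: sum.distrib sum2_cmult sum2_product)
  finally show ?thesis by (simp add: mult_ac)
qed

text \<open>All terms with the factor \<open>V j * V1 i j\<close> cancel between the two parts of
  \<open>C_comm\<close>. What survives is transport by \<open>U\<close>, the form in which the
  tested equations deliver it.\<close>

lemma sum_commutator:
  "(\<Sum>i\<in>UNIV. (U i - V i) * (\<Sum>j\<in>UNIV. V i * V1 j j + V1 i j * V j - S i j))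
    + (\<Sum>i\<in>UNIV. \<Sum>j\<in>UNIV. (U i - V i) * (U j - V j) * V1 i j)
    = ((\<Sum>i\<in>UNIV. U i * V i) - (\<Sum>i\<in>UNIV. V i * V i)) * (\<Sum>j\<in>UNIV. V1 j j)
      - (\<Sum>i\<in>UNIV. \<Sum>j\<in>UNIV. U i * S i j) + (\<Sum>i\<in>UNIV. \<Sum>j\<in>UNIV. V i * S i j)
      + (\<Sum>i\<in>UNIV. \<Sum>j\<in>UNIV. U i * U j * V1 i j) - (\<Sum>i\<in>UNIV. \<Sum>j\<in>UNIV. V i * U j * V1 i j)"
proof -
  have "(\<Sum>i\<in>UNIV. (U i - V i) * (\<Sum>j\<in>UNIV. V i * V1 j j + V1 i j * V j - S i j))
    + (\<Sum>i\<in>UNIV. \<Sum>j\<in>UNIV. (U i - V i) * (U j - V j) * V1 i j)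
    = (\<Sum>i\<in>UNIV. \<Sum>j\<in>UNIV. (U i * V i - V i * V i) * V1 j j - U i * S i j + V i * S i j
        + U i * U j * V1 i j - V i * U j * V1 i j)"
    unfolding sum_distrib_left sum.distrib[symmetric]
    by (intro sum.cong refl) (simp add: algebra_simps)
  also have "\<dots> = (\<Sum>i\<in>UNIV. U i * V i - V i * V i) * (\<Sum>j\<in>UNIV. V1 j j)
      - (\<Sum>i\<in>UNIV. \<Sum>j\<in>UNIV. U i * S i j) + (\<Sum>i\<in>UNIV. \<Sum>j\<in>UNIV. V i * S i j)
      + (\<Sum>i\<in>UNIV. \<Sum>j\<in>UNIV. U i * U j * V1 i j) - (\<Sum>i\<in>UNIV. \<Sum>j\<in>UNIV. V i * U j * V1 i j)"
    unfolding sum_product by (simp only: sum.distrib sum_subtractf)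
  finally show ?thesis by (simp only: sum_subtractf)
qed

end

subsection \<open>Distributional terms as integrals\<close>

lemma Lp_1_iff: "Lp T 1 f \<longleftrightarrow> f \<in> borel_measurable (borel \<Otimes>\<^sub>M borel) \<and> integrable (slab T) f"
proof -
  have "f \<in> borel_measurable (slab T) \<Longrightarrow> integrable (slab T) (\<lambda>z. \<bar>f z\<bar>) \<longleftrightarrow> integrable (slab T) f"
    using integrable_norm_iff[of f "slab T"] by simp
  then show ?thesis unfolding Lp_def by (auto simp: measurable_cong_sets[OF sets_slab refl])
qed

lemma Lp_32_3_mult: "Lp T (3/2) f \<Longrightarrow> Lp T 3 g \<Longrightarrow> Lp T 1 (\<lambda>z. f z * g z)"
  unfolding Lp_1_iff using integrable_Lp_32_3[of T f g] Lp_measurable[of T "3/2" f] Lp_measurable[of T 3 g]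
  by (auto intro: borel_measurable_times)

lemma Lp_3_32_mult: "Lp T 3 g \<Longrightarrow> Lp T (3/2) f \<Longrightarrow> Lp T 1 (\<lambda>z. g z * f z)"
  using Lp_32_3_mult[of T f g] by (simp add: mult.commute)

lemma Lp_2_3_mult: "Lp T 2 f \<Longrightarrow> Lp T 3 g \<Longrightarrow> Lp T 1 (\<lambda>z. f z * g z)"
  unfolding Lp_1_iff using integrable_Lp_2_3[of T f g] Lp_measurable[of T 2 f] Lp_measurable[of T 3 g]
  by (auto intro: borel_measurable_times)

text \<open>Integrability and value are carried together, so that long linear combinations are built
  by introduction rules with no separate integrability conditions.\<close>

lemma has_bochner_integral_reg:
  assumes "AE z in slab T. f z = g z" and g: "Lp T 1 g" and \<psi>: "test_fun T \<psi>"
  shows "has_bochner_integral (slab T) (\<lambda>z. g z * \<psi> z) (reg T f \<psi>)"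
proof -
  have "integrable (slab T) (\<lambda>z. g z * \<psi> z)"
    by (rule Lp_imp_integrable[OF Lp_mult_test[OF g \<psi>]]) auto
  moreover have "g \<in> borel_measurable (borel \<Otimes>\<^sub>M borel)" using g by measurable
  ultimately show ?thesis
    using reg_eq[OF assms(1) _ test_fun_borel[OF \<psi>]] by (simp add: has_bochner_integral_iff)
qed

lemma has_bochner_integral_D_t:
  assumes "AE z in slab T. f z = g z" "Lp T 1 g" "test_fun T \<phi>"
  shows "has_bochner_integral (slab T) (\<lambda>z. - (g z * pd_t \<phi> z)) (D_t (reg T f) \<phi>)"
  unfolding D_t_def
  by (intro has_bochner_integral_minus has_bochner_integral_reg[OF assms(1,2)] test_fun_pd_t assms(3))

lemma has_bochner_integral_D_x:
  assumes "AE z in slab T. f z = g z" "Lp T 1 g" "test_fun T \<phi>"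
  shows "has_bochner_integral (slab T) (\<lambda>z. - (g z * pd_x j \<phi> z)) (D_x j (reg T f) \<phi>)"
  unfolding D_x_def
  by (intro has_bochner_integral_minus has_bochner_integral_reg[OF assms(1,2)] test_fun_pd_x assms(3))

lemma has_bochner_integral_D_laplace:
  assumes "AE z in slab T. f z = g z" "Lp T 1 g" "test_fun T \<phi>"
  shows "has_bochner_integral (slab T) (\<lambda>z. \<Sum>j\<in>UNIV. g z * pd_x j (pd_x j \<phi>) z) (D_laplace (reg T f) \<phi>)"
  unfolding D_laplace_def D_x_def minus_minus
  by (intro has_bochner_integral_sum has_bochner_integral_reg[OF assms(1,2)] test_fun_pd_x assms(3))

lemma has_bochner_integral_D_div:
  assumes "AE z in slab T. \<forall>j. h z $ j = g j z" "\<And>j. Lp T 1 (g j)" "test_fun T \<phi>"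
  shows "has_bochner_integral (slab T) (\<lambda>z. \<Sum>j\<in>UNIV. - (g j z * pd_x j \<phi> z)) (D_div T h \<phi>)"
  unfolding D_div_def
proof (intro has_bochner_integral_sum has_bochner_integral_D_x assms(2,3))
  show "AE z in slab T. h z $ j = g j z" for j using assms(1) by eventually_elim blast
qed

text \<open>Only almost everywhere: at a time whose slice is not integrable the integral is 0 by
  default, and additivity may fail.\<close>

lemma AE_conv_add:
  assumes "smooth_periodic k" "Lp T p f" "1 \<le> p" "Lp T p' g" "1 \<le> p'"
  shows "AE z in slab T. conv k (\<lambda>z. f z + g z) z = conv k f z + conv k g z"
proof -
  have "AE t in time_measure T. \<forall>x. conv k (\<lambda>z. f z + g z) (t, x) = conv k f (t, x) + conv k g (t, x)"
    using Lp_slice_integrable[OF assms(2,3)] Lp_slice_integrable[OF assms(4,5)]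
  proof eventually_elim
    case (elim t)
    show ?case
    proof
      fix x
      have "integrable torus (\<lambda>y. k (x - y) * f (t, y))" "integrable torus (\<lambda>y. k (x - y) * g (t, y))"
        using elim by (simp_all only: integrable_conv_integrand[OF assms(1)])
      then show "conv k (\<lambda>z. f z + g z) (t, x) = conv k f (t, x) + conv k g (t, x)"
        unfolding conv_def by (simp add: distrib_left)
    qed
  qed
  from AE_slab_I[OF this] show ?thesis
  proof eventually_elim
    case (elim z)
    then show ?case by (cases z) simp
  qed
qed

lemma time_bump_ex:
  assumes "mollifier \<rho>" shows "\<exists>\<eta> R. time_bump \<eta> R"
proof (rule smooth_bump_ex[OF assms])
  fix \<eta> :: "real \<Rightarrow> real" and R :: real
  assume *: "smooth \<eta>" "\<And>r. 0 \<le> \<eta> r" "0 < R" "\<And>r. R \<le> \<bar>r\<bar> \<Longrightarrow> \<eta> r = 0"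
    "integrable lborel \<eta>" "(LINT r|lborel. \<eta> r) = 1"
  have "time_bump \<eta> R" by (rule time_bump.intro) (fact *)+
  then show ?thesis by blast
qed

lemma smooth_periodic_one: "smooth_periodic (\<lambda>x. 1)"
  by (simp add: smooth_periodic_def periodic_def smooth_const)

text \<open>With kernel 1 and function 1 the second convolution in \<open>weak_div_conv_conv\<close>
  is the constant 1, so a single convolution is covered as well. The value is 1 because the torus
  has measure 1.\<close>

lemma conv_one: "conv (\<lambda>x. 1) (\<lambda>z. 1) z = 1" "conv (partial j (\<lambda>x. 1)) f z = 0"
  by (simp_all add: conv_def)

lemma norm_power2_eq_sum: "(norm x)\<^sup>2 = (\<Sum>i\<in>UNIV. x $ i * x $ i)" for x :: "real ^ 'd"
  by (simp add: power2_norm_eq_inner inner_vec_def)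

lemma inner_matrix_eq_sum: "A \<bullet> B = (\<Sum>i\<in>UNIV. \<Sum>j\<in>UNIV. A $ i $ j * B $ i $ j)" for A B :: "real ^ 'd ^ 'd"
  by (simp add: inner_vec_def)

theorem proposition3p1:
  fixes u :: "real \<times> (real ^ 'd) \<Rightarrow> real ^ 'd"
    and q :: "real \<times> (real ^ 'd) \<Rightarrow> real"
    and G :: "real \<times> (real ^ 'd) \<Rightarrow> real ^ 'd ^ 'd"
    and \<rho> :: "real ^ 'd \<Rightarrow> real"
    and T \<nu> l :: real
  assumes "0 < T" and "0 \<le> \<nu>"
    and "in_Lp T 3 u"
    and "pressure T u q"
    and "weak_solution T \<nu> u q"
    and "0 < \<nu> \<Longrightarrow> in_L2_H1 T u G"
    and "mollifier \<rho>"
    and "0 < l"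
  shows "\<forall>\<phi>. test_fun T \<phi> \<longrightarrow>
    - total_dissipation T \<nu> u q G \<phi> =
      D_t (reg T (E_fluct \<rho> l u)) \<phi>
      + D_div T (\<lambda>z. E_fluct \<rho> l u z *\<^sub>R mollify \<rho> l u z) \<phi>
      - \<nu> * D_laplace (reg T (E_fluct \<rho> l u)) \<phi>
      + D_div T (Q_flux \<rho> l u q) \<phi>
      + reg T (C_comm \<rho> l u) \<phi>
      + \<nu> * reg T (\<lambda>z. (norm (grad_x (mollify \<rho> l u) z))\<^sup>2) \<phi>
      - 2 * \<nu> * reg T (\<lambda>z. G z \<bullet> grad_x (mollify \<rho> l u) z) \<phi>"
proof (intro allI impI)
  fix \<phi> :: "real \<times> (real ^ 'd) \<Rightarrow> real"
  assume \<phi>: "test_fun T \<phi>"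
  note u = \<open>in_Lp T 3 u\<close> and \<rho> = \<open>mollifier \<rho>\<close> \<open>0 < l\<close>
  obtain \<eta> R where bump: "time_bump \<eta> R" using time_bump_ex[OF \<rho>(1)] by blast
  interpret time_bump \<eta> R by (rule bump)

  \<comment> \<open>Components, mollified components and their integrability classes\<close>
  define k where "k = kernel \<rho> l"
  define U where "U i z = u z $ i" for i z
  define V where "V i = conv k (U i)" for i
  define V1 where "V1 i j = conv (partial j k) (U i)" for i j
  define V2 where "V2 i j = conv (partial j (partial j k)) (U i)" for i j
  define S where "S i j = conv (partial j k) (\<lambda>z. U i z * U j z)" for i j
  define F where "F i j z = U i z * U j z + (if i = j then q z else 0)" for i j z
  define SF where "SF i j = conv (partial j k) (F i j)" for i j
  define P where "P = conv k q"
  define P1 where "P1 j = conv (partial j k) q" for j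
  note defs = V_def V1_def V2_def S_def SF_def P_def P1_def
  have k: "smooth_periodic k" unfolding k_def by (rule smooth_periodic_kernel[OF \<rho>])
  note kj = smooth_periodic_partial[OF k] and kjj = smooth_periodic_partial[OF smooth_periodic_partial[OF k]]
  note \<phi>t = test_fun_pd_t[OF \<phi>] and \<phi>j = test_fun_pd_x[OF \<phi>] and \<phi>jj = test_fun_pd_x[OF test_fun_pd_x[OF \<phi>]]
  have U3: "Lp T 3 (U i)" for i unfolding U_def by (rule Lp_component[OF u]) simp
  have V3: "Lp T 3 (V i)" and V13: "Lp T 3 (V1 i j)" and V23: "Lp T 3 (V2 i j)" for i j
    unfolding defs by (rule Lp_conv[OF _ U3]; simp add: k kj kjj)+
  have q_in: "in_Lp T (3/2) q" using \<open>pressure T u q\<close> by (simp add: pressure_def)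
  have q32: "Lp T (3/2) q" by (rule in_Lp_imp_Lp[OF q_in, of "\<lambda>x. x"]) auto
  have UU32: "Lp T (3/2) (\<lambda>z. U i z * U j z)" for i j by (rule Lp_3_mult[OF U3 U3])
  have F32: "Lp T (3/2) (F i j)" for i j
    unfolding F_def by (cases "i = j") (simp_all add: Lp_add UU32 q32)
  have S32: "Lp T (3/2) (S i j)" and SF32: "Lp T (3/2) (SF i j)" for i j
    unfolding defs by (rule Lp_conv[OF kj UU32], simp, rule Lp_conv[OF kj F32], simp)
  have P32: "Lp T (3/2) P" and P132: "Lp T (3/2) (P1 j)" for j
    unfolding defs by (rule Lp_conv[OF k q32], simp, rule Lp_conv[OF kj q32], simp)
  have L1: "Lp T (3/2) f \<Longrightarrow> Lp T 1 f" for f :: "real \<times> (real ^ 'd) \<Rightarrow> real" by (erule Lp_mono) auto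

  \<comment> \<open>The weak equations as integrals over the slab\<close>
  have weak: "(LINT z|slab T. U i z * pd_t \<psi> z + (\<Sum>j\<in>UNIV. F i j z * pd_x j \<psi> z
      + \<nu> * (U i z * pd_x j (pd_x j \<psi>) z))) = 0" if \<psi>: "test_fun T \<psi>" for i \<psi>
  proof -
    have eq: "D_t (reg T (\<lambda>z. u z $ i)) \<psi> + D_div T (\<lambda>z. (u z \<otimes>\<^sub>v u z) $ i) \<psi> + D_x i (reg T q) \<psi>
          - \<nu> * D_laplace (reg T (\<lambda>z. u z $ i)) \<psi> = 0"
      using \<open>weak_solution T \<nu> u q\<close> \<psi> by (simp add: weak_solution_def)
    have "has_bochner_integral (slab T) (\<lambda>z. - (U i z * pd_t \<psi> z) + (\<Sum>j\<in>UNIV. - (U i z * U j z * pd_x j \<psi> z))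
        + - (q z * pd_x i \<psi> z) - \<nu> * (\<Sum>j\<in>UNIV. U i z * pd_x j (pd_x j \<psi>) z)) 0"
      unfolding eq[symmetric]
      by (intro has_bochner_integral_add has_bochner_integral_diff has_bochner_integral_mult_right
          has_bochner_integral_D_t has_bochner_integral_D_div has_bochner_integral_D_x has_bochner_integral_D_laplace
          AE_I2 allI \<psi> L1 UU32 Lp_3_imp U3 q32) (simp_all add: U_def tensor_component)
    \<comment> \<open>Each first-order distributional derivative carries a minus sign, whereas the
      two-point identity expects derivatives on the test function with a plus sign.\<close>
    from has_bochner_integral_minus[OF this]
    have neg: "has_bochner_integral (slab T) (\<lambda>z. - (- (U i z * pd_t \<psi> z) + (\<Sum>j\<in>UNIV. - (U i z * U j z * pd_x j \<psi> z))
        + - (q z * pd_x i \<psi> z) - \<nu> * (\<Sum>j\<in>UNIV. U i z * pd_x j (pd_x j \<psi>) z))) 0" by simp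
    have F_sum: "(\<Sum>j\<in>UNIV. F i j z * pd_x j \<psi> z) = (\<Sum>j\<in>UNIV. U i z * U j z * pd_x j \<psi> z) + q z * pd_x i \<psi> z" for z
      by (simp add: F_def distrib_right sum.distrib if_distrib[of "\<lambda>c. c * _"] cong: if_cong)
    have "- (- (U i z * pd_t \<psi> z) + (\<Sum>j\<in>UNIV. - (U i z * U j z * pd_x j \<psi> z))
        + - (q z * pd_x i \<psi> z) - \<nu> * (\<Sum>j\<in>UNIV. U i z * pd_x j (pd_x j \<psi>) z))
      = U i z * pd_t \<psi> z + (\<Sum>j\<in>UNIV. F i j z * pd_x j \<psi> z + \<nu> * (U i z * pd_x j (pd_x j \<psi>) z))" for z
      unfolding sum.distrib F_sum by (simp add: sum_negf sum_distrib_left)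
    with neg show ?thesis
      by (intro has_bochner_integral_integral_eq) (simp only:)
  qed
  interpret weakly_solenoidal \<eta> R T U
  proof
    fix \<psi> :: "real \<times> (real ^ 'd) \<Rightarrow> real" assume \<psi>: "test_fun T \<psi>"
    have "D_div T u \<psi> = 0" using \<open>weak_solution T \<nu> u q\<close> \<psi> by (simp add: weak_solution_def)
    moreover have "has_bochner_integral (slab T) (\<lambda>z. \<Sum>j\<in>UNIV. - (U j z * pd_x j \<psi> z)) (D_div T u \<psi>)"
      by (intro has_bochner_integral_D_div AE_I2 allI \<psi> L1 Lp_3_imp U3) (simp add: U_def)
    ultimately show "(LINT z|slab T. (\<Sum>j\<in>UNIV. U j z * pd_x j \<psi> z)) = 0"
      using has_bochner_integral_integral_eq by (fastforce simp: sum_negf)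
  qed (rule U3)

  \<comment> \<open>Scalar sums in which all balances are expressed\<close>
  define uu where "uu z = (\<Sum>i\<in>UNIV. U i z * U i z)" for z
  define uv where "uv z = (\<Sum>i\<in>UNIV. U i z * V i z)" for z
  define vv where "vv z = (\<Sum>i\<in>UNIV. V i z * V i z)" for z
  define u\<phi> where "u\<phi> z = (\<Sum>j\<in>UNIV. U j z * pd_x j \<phi> z)" for z
  define v\<phi> where "v\<phi> z = (\<Sum>j\<in>UNIV. V j z * pd_x j \<phi> z)" for z
  define uP where "uP z = (\<Sum>j\<in>UNIV. U j z * P1 j z)" for z
  define vP where "vP z = (\<Sum>j\<in>UNIV. V j z * P1 j z)" for z
  define dv where "dv z = (\<Sum>j\<in>UNIV. V1 j j z)" for z
  define \<phi>L where "\<phi>L z = (\<Sum>j\<in>UNIV. pd_x j (pd_x j \<phi>) z)" for z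
  define a1 where "a1 z = (\<Sum>i\<in>UNIV. \<Sum>j\<in>UNIV. U i z * U j z * V1 i j z)" for z
  define a2 where "a2 z = (\<Sum>i\<in>UNIV. \<Sum>j\<in>UNIV. V i z * U j z * V1 i j z)" for z
  define s1 where "s1 z = (\<Sum>i\<in>UNIV. \<Sum>j\<in>UNIV. U i z * S i j z)" for z
  define s2 where "s2 z = (\<Sum>i\<in>UNIV. \<Sum>j\<in>UNIV. V i z * S i j z)" for z
  define r1 where "r1 z = (\<Sum>i\<in>UNIV. \<Sum>j\<in>UNIV. U i z * SF i j z)" for z
  define r2 where "r2 z = (\<Sum>i\<in>UNIV. \<Sum>j\<in>UNIV. V i z * SF i j z)" for z
  define w1 where "w1 z = (\<Sum>i\<in>UNIV. \<Sum>j\<in>UNIV. U i z * V1 i j z * pd_x j \<phi> z)" for z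
  define w2 where "w2 z = (\<Sum>i\<in>UNIV. \<Sum>j\<in>UNIV. V i z * V1 i j z * pd_x j \<phi> z)" for z
  define w3 where "w3 z = (\<Sum>i\<in>UNIV. \<Sum>j\<in>UNIV. U i z * V2 i j z)" for z
  define w4 where "w4 z = (\<Sum>i\<in>UNIV. \<Sum>j\<in>UNIV. V i z * V2 i j z)" for z
  define w5 where "w5 z = (\<Sum>i\<in>UNIV. \<Sum>j\<in>UNIV. V1 i j z * V1 i j z)" for z
  define w6 where "w6 z = (\<Sum>i\<in>UNIV. \<Sum>j\<in>UNIV. G z $ i $ j * V1 i j z)" for z

  \<comment> \<open>Balances of the product with the mollified field and of its square\<close>
  have HA: "has_bochner_integral (slab T) (\<lambda>z. uv z * pd_t \<phi> z + uv z * u\<phi> z + q z * v\<phi> z + a1 z * \<phi> z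
      + q z * dv z * \<phi> z + \<nu> * (uv z * \<phi>L z + 2 * w1 z + w3 z * \<phi> z) - r1 z * \<phi> z + \<nu> * (w3 z * \<phi> z)) 0"
  proof -
    have "has_bochner_integral (slab T) (\<lambda>z. \<Sum>i\<in>UNIV. U i z * V i z * pd_t \<phi> z +
      (\<Sum>j\<in>UNIV. (F i j z * V i z * pd_x j \<phi> z + F i j z * V1 i j z * \<phi> z)
        + \<nu> * (U i z * V i z * pd_x j (pd_x j \<phi>) z + 2 * (U i z * V1 i j z * pd_x j \<phi> z) + U i z * V2 i j z * \<phi> z)
        + - (U i z * SF i j z * \<phi> z) + \<nu> * (U i z * V2 i j z * \<phi> z))) (\<Sum>i\<in>(UNIV :: 'd set). 0)"
      unfolding defs by (intro has_bochner_integral_sum weak_tested_with_conv U3 F32 weak k \<phi>)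
    then show ?thesis
      unfolding sum_tested[where U = "\<lambda>i. U i _" and F = "\<lambda>i j. F i j _", OF F_def]
      by (simp only: uv_def u\<phi>_def v\<phi>_def a1_def dv_def \<phi>L_def w1_def w3_def r1_def sum.neutral_const)
  qed
  have HB: "has_bochner_integral (slab T) (\<lambda>z. vv z * pd_t \<phi> z - 2 * r2 z * \<phi> z + 2 * \<nu> * w4 z * \<phi> z) 0"
  proof -
    have "has_bochner_integral (slab T) (\<lambda>z. \<Sum>i\<in>UNIV. V i z * V i z * pd_t \<phi> z +
      (\<Sum>j\<in>UNIV. - (SF i j z * V i z * \<phi> z) + \<nu> * (V2 i j z * V i z * \<phi> z)
        + - (V i z * SF i j z * \<phi> z) + \<nu> * (V i z * V2 i j z * \<phi> z))) (\<Sum>i\<in>(UNIV :: 'd set). 0)"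
      unfolding defs by (intro has_bochner_integral_sum weak_squared_conv U3 F32 weak k \<phi>)
    then show ?thesis
      unfolding sum_squared by (simp only: vv_def r2_def w4_def sum.neutral_const)
  qed

  \<comment> \<open>The tested constraint and the integrations by parts\<close>
  have i_test: "integrable (slab T) (\<lambda>z. f z * \<psi> z)" if "Lp T 1 f" "test_fun T \<psi>" for f \<psi>
    by (rule Lp_imp_integrable[OF Lp_mult_test[OF that]]) auto
  \<comment> \<open>The constraint tested with \<open>\<phi>\<close> times the squared norm of the
    mollified field. With coefficient -1/2 it supplies the term \<open>a2\<close> of the commutator
    and the transport of \<open>vv\<close> by \<open>u\<close>.\<close>
  have HD4: "has_bochner_integral (slab T) (\<lambda>z. 2 * a2 z * \<phi> z + vv z * u\<phi> z) 0"
  proof -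
    have "has_bochner_integral (slab T) (\<lambda>z. \<Sum>i\<in>UNIV. \<Sum>j\<in>UNIV. U j z *
        (V1 i j z * V i z * \<phi> z + V i z * V1 i j z * \<phi> z + V i z * V i z * pd_x j \<phi> z)) (\<Sum>i\<in>(UNIV :: 'd set). 0)"
    proof (intro has_bochner_integral_sum)
      fix i
      have "integrable (slab T) (\<lambda>z. \<Sum>j\<in>UNIV. U j z * (V1 i j z * V i z) * \<phi> z + U j z * (V i z * V1 i j z) * \<phi> z
          + U j z * (V i z * V i z) * pd_x j \<phi> z)"
        by (intro Bochner_Integration.integrable_sum Bochner_Integration.integrable_add i_test Lp_3_32_mult Lp_3_mult
            U3 V3 V13 \<phi> \<phi>j)
      then have "integrable (slab T) (\<lambda>z. \<Sum>j\<in>UNIV. U j z *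
        (V1 i j z * V i z * \<phi> z + V i z * V1 i j z * \<phi> z + V i z * V i z * pd_x j \<phi> z))"
        by (simp add: algebra_simps)
      then show "has_bochner_integral (slab T) (\<lambda>z. \<Sum>j\<in>UNIV. U j z *
        (V1 i j z * V i z * \<phi> z + V i z * V1 i j z * \<phi> z + V i z * V i z * pd_x j \<phi> z)) 0"
        unfolding defs by (intro weak_div_conv_conv[OF k k \<phi> U3 _ U3]) simp_all
    qed
    then show ?thesis
      unfolding sum_solenoidal by (simp only: a2_def vv_def u\<phi>_def sum.neutral_const)
  qed
  \<comment> \<open>The constraint tested with \<open>\<phi>\<close> times the mollified pressure,
    the second convolution being the constant 1. It cancels the term \<open>uP\<close> that the
    mollified flux leaves in \<open>HA\<close>.\<close>
  have HD5: "has_bochner_integral (slab T) (\<lambda>z. uP z * \<phi> z + P z * u\<phi> z) 0"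
  proof -
    have one: "Lp T 3 (\<lambda>z. 1 :: real)" unfolding Lp_def by simp
    have eq: "(\<Sum>j\<in>UNIV. U j z * (conv (partial j k) q z * conv (\<lambda>x. 1) (\<lambda>z. 1) z * \<phi> z
        + conv k q z * conv (partial j (\<lambda>x. 1)) (\<lambda>z. 1) z * \<phi> z + conv k q z * conv (\<lambda>x. 1) (\<lambda>z. 1) z * pd_x j \<phi> z))
      = (\<Sum>j\<in>UNIV. U j z * P1 j z * \<phi> z + U j z * P z * pd_x j \<phi> z)" for z
      unfolding conv_one P_def P1_def by (simp add: algebra_simps)
    have "has_bochner_integral (slab T) (\<lambda>z. \<Sum>j\<in>UNIV. U j z * P1 j z * \<phi> z + U j z * P z * pd_x j \<phi> z) 0"
    proof (rule weak_div_conv_conv[OF k smooth_periodic_one \<phi> q32 _ one, unfolded eq])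
      show "integrable (slab T) (\<lambda>z. \<Sum>j\<in>UNIV. U j z * P1 j z * \<phi> z + U j z * P z * pd_x j \<phi> z)"
        by (intro Bochner_Integration.integrable_sum Bochner_Integration.integrable_add i_test Lp_3_32_mult
            U3 P32 P132 \<phi> \<phi>j)
    qed simp_all
    then show ?thesis
      by (simp add: uP_def u\<phi>_def sum.distrib sum_distrib_left sum_distrib_right mult_ac)
  qed
  \<comment> \<open>Integral of the divergence of the mollified pressure times the mollified field
    times \<open>\<phi>\<close>. It cancels the term \<open>vP\<close> left by
    \<open>HB\<close>.\<close>
  have HD6: "has_bochner_integral (slab T) (\<lambda>z. dv z * P z * \<phi> z + vP z * \<phi> z + P z * v\<phi> z) 0"
  proof -
    have "has_bochner_integral (slab T) (\<lambda>z. \<Sum>j\<in>UNIV. V1 j j z * P z * \<phi> z + V j z * P1 j z * \<phi> z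
        + V j z * P z * pd_x j \<phi> z) (\<Sum>j\<in>(UNIV :: 'd set). 0)"
    proof (intro has_bochner_integral_sum)
      fix j
      have "integrable (slab T) (\<lambda>z. V1 j j z * P z * \<phi> z + V j z * P1 j z * \<phi> z + V j z * P z * pd_x j \<phi> z)"
        by (intro Bochner_Integration.integrable_add i_test Lp_3_32_mult V3 V13 P32 P132 \<phi> \<phi>j)
      then show "has_bochner_integral (slab T) (\<lambda>z. V1 j j z * P z * \<phi> z + V j z * P1 j z * \<phi> z
        + V j z * P z * pd_x j \<phi> z) 0"
        unfolding defs by (intro conv_conv_by_parts[OF k k \<phi> U3 _ q32]) simp_all
    qed
    then show ?thesis
      by (simp add: dv_def vP_def v\<phi>_def sum.distrib sum_distrib_left sum_distrib_right mult_ac)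
  qed
  \<comment> \<open>Integral of the divergence of \<open>vv\<close> times the gradient of
    \<open>\<phi>\<close>: it trades \<open>w2\<close> for the Laplacian of the test
    function.\<close>
  have HD8a: "has_bochner_integral (slab T) (\<lambda>z. 2 * w2 z + vv z * \<phi>L z) 0"
  proof -
    have "has_bochner_integral (slab T) (\<lambda>z. \<Sum>i\<in>UNIV. \<Sum>j\<in>UNIV. V1 i j z * V i z * pd_x j \<phi> z
        + V i z * V1 i j z * pd_x j \<phi> z + V i z * V i z * pd_x j (pd_x j \<phi>) z) (\<Sum>i\<in>(UNIV :: 'd set). \<Sum>j\<in>(UNIV :: 'd set). 0)"
    proof (intro has_bochner_integral_sum)
      fix i j
      have "integrable (slab T) (\<lambda>z. V1 i j z * V i z * pd_x j \<phi> z
        + V i z * V1 i j z * pd_x j \<phi> z + V i z * V i z * pd_x j (pd_x j \<phi>) z)"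
        by (intro Bochner_Integration.integrable_add i_test L1 Lp_3_mult V3 V13 \<phi>jj \<phi>j)
      then show "has_bochner_integral (slab T) (\<lambda>z. V1 i j z * V i z * pd_x j \<phi> z
        + V i z * V1 i j z * pd_x j \<phi> z + V i z * V i z * pd_x j (pd_x j \<phi>) z) 0"
        unfolding defs by (intro conv_conv_by_parts[OF k k \<phi>j U3 _ U3]) simp_all
    qed
    moreover have "(\<Sum>i\<in>UNIV. \<Sum>j\<in>UNIV. V1 i j z * V i z * pd_x j \<phi> z
        + V i z * V1 i j z * pd_x j \<phi> z + V i z * V i z * pd_x j (pd_x j \<phi>) z) = 2 * w2 z + vv z * \<phi>L z" for z
    proof -
      have "V1 i j z * V i z * pd_x j \<phi> z + V i z * V1 i j z * pd_x j \<phi> z + V i z * V i z * pd_x j (pd_x j \<phi>) z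
        = 2 * (V i z * V1 i j z * pd_x j \<phi> z) + (V i z * V i z) * pd_x j (pd_x j \<phi>) z" for i j by simp
      then show ?thesis by (simp only: sum.distrib sum2_cmult sum2_product w2_def vv_def \<phi>L_def)
    qed
    ultimately show ?thesis by simp
  qed
  \<comment> \<open>Integral of the derivatives of \<open>V1 i j * V i * \<phi>\<close>: it trades
    the second derivatives in \<open>HB\<close> for the squared gradient \<open>w5\<close>.\<close>
  have HD8b: "has_bochner_integral (slab T) (\<lambda>z. w4 z * \<phi> z + w5 z * \<phi> z + w2 z) 0"
  proof -
    have "has_bochner_integral (slab T) (\<lambda>z. \<Sum>i\<in>UNIV. \<Sum>j\<in>UNIV. V2 i j z * V i z * \<phi> z
        + V1 i j z * V1 i j z * \<phi> z + V1 i j z * V i z * pd_x j \<phi> z) (\<Sum>i\<in>(UNIV :: 'd set). \<Sum>j\<in>(UNIV :: 'd set). 0)"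
    proof (intro has_bochner_integral_sum)
      fix i j
      have "integrable (slab T) (\<lambda>z. V2 i j z * V i z * \<phi> z
        + V1 i j z * V1 i j z * \<phi> z + V1 i j z * V i z * pd_x j \<phi> z)"
        by (intro Bochner_Integration.integrable_add i_test L1 Lp_3_mult V3 V13 V23 \<phi> \<phi>j)
      then show "has_bochner_integral (slab T) (\<lambda>z. V2 i j z * V i z * \<phi> z
        + V1 i j z * V1 i j z * \<phi> z + V1 i j z * V i z * pd_x j \<phi> z) 0"
        unfolding defs by (intro conv_conv_by_parts[OF kj k \<phi> U3 _ U3]) simp_all
    qed
    moreover have "(\<Sum>i\<in>UNIV. \<Sum>j\<in>UNIV. V2 i j z * V i z * \<phi> z + V1 i j z * V1 i j z * \<phi> z
        + V1 i j z * V i z * pd_x j \<phi> z) = w4 z * \<phi> z + w5 z * \<phi> z + w2 z" for z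
    proof -
      have "V2 i j z * V i z * \<phi> z + V1 i j z * V1 i j z * \<phi> z + V1 i j z * V i z * pd_x j \<phi> z
        = \<phi> z * (V i z * V2 i j z) + \<phi> z * (V1 i j z * V1 i j z) + V i z * V1 i j z * pd_x j \<phi> z" for i j by simp
      then show ?thesis by (simp only: sum.distrib sum2_cmult w2_def w4_def w5_def mult.commute[of _ "\<phi> z"])
    qed
    ultimately show ?thesis by simp
  qed
  \<comment> \<open>Testing the weak gradient with \<open>\<phi>\<close> times the gradient of the
    mollified field removes \<open>w1\<close> and \<open>w3\<close> from \<open>HA\<close> and
    leaves the cross term \<open>w6\<close>. The factor \<open>\<nu>\<close> stays inside because
    for \<open>\<nu> = 0\<close> nothing is known about \<open>G\<close>.\<close>
  have HD7: "has_bochner_integral (slab T) (\<lambda>z. \<nu> * (w6 z * \<phi> z + w3 z * \<phi> z + w1 z)) 0"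
  proof (cases "\<nu> = 0")
    case False
    then have G: "in_L2_H1 T u G" using assms(2,6) by simp
    have "has_bochner_integral (slab T) (\<lambda>z. \<Sum>i\<in>UNIV. \<Sum>j\<in>UNIV. G z $ i $ j * V1 i j z * \<phi> z
        + (U i z * V2 i j z * \<phi> z + U i z * V1 i j z * pd_x j \<phi> z)) (\<Sum>i\<in>(UNIV :: 'd set). \<Sum>j\<in>(UNIV :: 'd set). 0)"
      unfolding defs U_def
      by (intro has_bochner_integral_sum weak_gradient_tested_with_conv(2)[OF G u kj \<phi>])
    moreover have "(\<Sum>i\<in>UNIV. \<Sum>j\<in>UNIV. G z $ i $ j * V1 i j z * \<phi> z
        + (U i z * V2 i j z * \<phi> z + U i z * V1 i j z * pd_x j \<phi> z)) = w6 z * \<phi> z + w3 z * \<phi> z + w1 z" for z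
    proof -
      have "G z $ i $ j * V1 i j z * \<phi> z + (U i z * V2 i j z * \<phi> z + U i z * V1 i j z * pd_x j \<phi> z)
        = \<phi> z * (G z $ i $ j * V1 i j z) + \<phi> z * (U i z * V2 i j z) + U i z * V1 i j z * pd_x j \<phi> z" for i j by simp
      then show ?thesis by (simp only: sum.distrib sum2_cmult w6_def w3_def w1_def mult.commute[of _ "\<phi> z"])
    qed
    ultimately have "has_bochner_integral (slab T) (\<lambda>z. w6 z * \<phi> z + w3 z * \<phi> z + w1 z) 0" by simp
    from has_bochner_integral_mult_right[OF this, of \<nu>] show ?thesis by simp
  qed (simp add: has_bochner_integral_zero)

  \<comment> \<open>Identities that hold almost everywhere\<close>
  have AE_dv: "AE z in slab T. \<phi> z * dv z = 0"
    using conv_divergence_free[OF k \<phi>] unfolding dv_def V1_def .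
  \<comment> \<open>Mollifying the flux splits off the mollified pressure, whose derivative
    contributes only on the diagonal.\<close>
  have AE_r: "AE z in slab T. r1 z = s1 z + uP z \<and> r2 z = s2 z + vP z"
  proof -
    have "AE z in slab T. SF i i z = S i i z + P1 i z" for i
      using AE_conv_add[OF kj UU32 _ q32, of i i i] unfolding SF_def S_def P1_def F_def by simp
    then have "AE z in slab T. \<forall>i. SF i i z = S i i z + P1 i z" by (simp add: eventually_all_finite)
    then show ?thesis
    proof eventually_elim
      case (elim z)
      have "SF i j z = S i j z + (if i = j then P1 j z else 0)" for i j
      proof (cases "i = j")
        case False
        then have "F i j = (\<lambda>z. U i z * U j z)" by (intro ext) (simp add: F_def)
        with False show ?thesis by (simp add: SF_def S_def)
      qed (use elim in simp)
      then have "x i * SF i j z = x i * S i j z + (if i = j then 1 else 0) * (x i * P1 j z)" for x i j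
        by (simp add: distrib_left)
      then have "(\<Sum>i\<in>UNIV. \<Sum>j\<in>UNIV. x i * SF i j z) = (\<Sum>i\<in>UNIV. \<Sum>j\<in>UNIV. x i * S i j z) + (\<Sum>j\<in>UNIV. x j * P1 j z)" for x
        by (simp only: sum.distrib sum_diagonal mult_1)
      then show ?case by (simp only: r1_def r2_def s1_def s2_def uP_def vP_def)
    qed
  qed
  have AE_m: "AE z in slab T. (\<forall>i. mollify \<rho> l u z $ i = V i z) \<and>
    (\<forall>i j. grad_x (mollify \<rho> l u) z $ i $ j = V1 i j z) \<and>
    (\<forall>i. div_x (R_stress \<rho> l u) z $ i = (\<Sum>j\<in>UNIV. V i z * V1 j j z + V1 i j z * V j z - S i j z))"
    using AE_mollify_vector[OF \<rho> u] unfolding defs U_def k_def .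
  have AE_q: "AE z in slab T. mollify \<rho> l q z = P z"
    using AE_mollify_scalar[OF \<rho> q_in] unfolding P_def k_def by simp

  have uu32: "Lp T (3/2) uu" and uv32: "Lp T (3/2) uv" and vv32: "Lp T (3/2) vv" and w532: "Lp T (3/2) w5"
    unfolding uu_def uv_def vv_def w5_def by (intro Lp_sum Lp_3_mult U3 V3 V13; simp)+
  define e where "e z = (1/2) * (uu z - 2 * uv z + vv z)" for z
  have e32: "Lp T (3/2) e" unfolding e_def by (intro Lp_cmult Lp_add Lp_diff uu32 uv32 vv32) simp_all
  \<comment> \<open>The commutator in the expanded form of \<open>sum_commutator\<close>. The
    divergence \<open>dv\<close> is retained, since it vanishes only after multiplication by
    \<open>\<phi>\<close>.\<close>
  define c where "c z = (uv z - vv z) * dv z - s1 z + s2 z + a1 z - a2 z" for z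
  have dv3: "Lp T 3 dv" unfolding dv_def by (intro Lp_sum V13) simp
  have c1: "Lp T 1 c"
    unfolding c_def s1_def s2_def a1_def a2_def
    by (intro Lp_add Lp_diff Lp_sum Lp_32_3_mult Lp_3_32_mult Lp_3_mult uv32 vv32 dv3 U3 V3 V13 S32) simp_all
  have norm_diff: "(norm (u z - mollify \<rho> l u z))\<^sup>2 / 2 = e z" if "\<forall>i. mollify \<rho> l u z $ i = V i z" for z
  proof -
    have "(x - y) * (x - y) = x * x - 2 * (x * y) + y * y" for x y :: real by (simp add: algebra_simps)
    then show ?thesis
      using that by (simp add: norm_power2_eq_sum e_def uu_def uv_def vv_def U_def sum.distrib sum_subtractf
          sum_distrib_left[symmetric])
  qed
  have AE_E: "AE z in slab T. E_fluct \<rho> l u z = e z"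
    using AE_m by eventually_elim (simp add: E_fluct_def norm_diff)
  have AE_EV: "AE z in slab T. \<forall>j. (E_fluct \<rho> l u z *\<^sub>R mollify \<rho> l u z) $ j = e z * V j z"
    using AE_m AE_E by eventually_elim simp
  have AE_Q: "AE z in slab T. \<forall>j. Q_flux \<rho> l u q z $ j = (e z + (q z - P z)) * (U j z - V j z)"
    using AE_m AE_q by eventually_elim (simp add: Q_flux_def norm_diff U_def)
  have AE_C: "AE z in slab T. C_comm \<rho> l u z = c z"
    using AE_m
  proof eventually_elim
    case (elim z)
    have "C_comm \<rho> l u z = (\<Sum>i\<in>UNIV. (U i z - V i z) * (\<Sum>j\<in>UNIV. V i z * V1 j j z + V1 i j z * V j z - S i j z))
      + (\<Sum>i\<in>UNIV. \<Sum>j\<in>UNIV. (U i z - V i z) * (U j z - V j z) * V1 i j z)"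
      using elim by (simp add: C_comm_def inner_vec_def tensor_component U_def)
    then show ?case
      by (simp only: c_def uv_def vv_def dv_def s1_def s2_def a1_def a2_def
          sum_commutator[where U = "\<lambda>i. U i z" and V = "\<lambda>i. V i z" and ?V1.0 = "\<lambda>i j. V1 i j z" and S = "\<lambda>i j. S i j z"])
  qed
  have AE_w5: "AE z in slab T. (norm (grad_x (mollify \<rho> l u) z))\<^sup>2 = w5 z"
    using AE_m by eventually_elim (simp add: power2_norm_eq_inner inner_matrix_eq_sum w5_def)
  have AE_w6: "AE z in slab T. G z \<bullet> grad_x (mollify \<rho> l u) z = w6 z"
    using AE_m by eventually_elim (simp add: inner_matrix_eq_sum w6_def)
  have Lq: "Lp T (3/2) (\<lambda>z. e z + (q z - P z))" by (intro Lp_add Lp_diff e32 q32 P32) simp_all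
  have UV3: "Lp T 3 (\<lambda>z. U j z - V j z)" for j by (intro Lp_diff U3 V3) simp

  \<comment> \<open>Both sides as integrals, and their comparison\<close>
  define rhs where "rhs = D_t (reg T (E_fluct \<rho> l u)) \<phi>
      + D_div T (\<lambda>z. E_fluct \<rho> l u z *\<^sub>R mollify \<rho> l u z) \<phi>
      - \<nu> * D_laplace (reg T (E_fluct \<rho> l u)) \<phi>
      + D_div T (Q_flux \<rho> l u q) \<phi>
      + reg T (C_comm \<rho> l u) \<phi>
      + \<nu> * reg T (\<lambda>z. (norm (grad_x (mollify \<rho> l u) z))\<^sup>2) \<phi>
      - 2 * (\<nu> * reg T (\<lambda>z. G z \<bullet> grad_x (mollify \<rho> l u) z) \<phi>)"
  \<comment> \<open>For \<open>\<nu> = 0\<close> the function \<open>w6\<close> need not be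
    integrable, but then both the integrand and the claimed value are 0.\<close>
  have R7: "has_bochner_integral (slab T) (\<lambda>z. \<nu> * (w6 z * \<phi> z)) (\<nu> * reg T (\<lambda>z. G z \<bullet> grad_x (mollify \<rho> l u) z) \<phi>)"
  proof (cases "\<nu> = 0")
    case False
    then have G: "in_L2_H1 T u G" using assms(2,6) by simp
    have "Lp T 1 w6"
      unfolding w6_def by (intro Lp_sum Lp_2_3_mult V13 weak_gradient_tested_with_conv(1)[OF G u k \<phi>]) simp_all
    then show ?thesis by (intro has_bochner_integral_mult_right has_bochner_integral_reg AE_w6 \<phi>)
  qed (simp add: has_bochner_integral_zero)
  have RHS: "has_bochner_integral (slab T) (\<lambda>z. - (e z * pd_t \<phi> z) + (\<Sum>j\<in>UNIV. - (e z * V j z * pd_x j \<phi> z))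
      - \<nu> * (\<Sum>j\<in>UNIV. e z * pd_x j (pd_x j \<phi>) z)
      + (\<Sum>j\<in>UNIV. - ((e z + (q z - P z)) * (U j z - V j z) * pd_x j \<phi> z))
      + c z * \<phi> z + \<nu> * (w5 z * \<phi> z) - 2 * (\<nu> * (w6 z * \<phi> z))) rhs"
    unfolding rhs_def
    by (intro has_bochner_integral_add has_bochner_integral_diff has_bochner_integral_mult_right R7
        has_bochner_integral_D_t has_bochner_integral_D_div has_bochner_integral_D_laplace has_bochner_integral_reg
        AE_E AE_EV AE_Q AE_C AE_w5 \<phi> L1 e32 w532 c1 Lp_32_3_mult V3 Lq UV3)
  have LHS: "has_bochner_integral (slab T) (\<lambda>z. - ((1/2) * uu z * pd_t \<phi> z)
      - \<nu> * (\<Sum>j\<in>UNIV. (1/2) * uu z * pd_x j (pd_x j \<phi>) z)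
      + (\<Sum>j\<in>UNIV. - (((1/2) * uu z + q z) * U j z * pd_x j \<phi> z)))
      (- total_dissipation T \<nu> u q G \<phi>)"
  proof -
    have nu: "(norm (u z))\<^sup>2 / 2 = (1/2) * uu z" for z by (simp add: norm_power2_eq_sum uu_def U_def)
    \<comment> \<open>The two terms with the squared norm of \<open>G\<close> cancel: one comes from
      the definition of the Duchon-Robert distribution, the other from adding the viscous
      dissipation.\<close>
    have "- total_dissipation T \<nu> u q G \<phi> = D_t (reg T (\<lambda>z. (norm (u z))\<^sup>2 / 2)) \<phi>
        - \<nu> * D_laplace (reg T (\<lambda>z. (norm (u z))\<^sup>2 / 2)) \<phi>
        + D_div T (\<lambda>z. ((norm (u z))\<^sup>2 / 2 + q z) *\<^sub>R u z) \<phi>"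
      by (simp add: total_dissipation_def duchon_robert_def)
    then show ?thesis
      by (simp only:) (intro has_bochner_integral_add has_bochner_integral_diff has_bochner_integral_mult_right
        has_bochner_integral_D_t has_bochner_integral_D_div has_bochner_integral_D_laplace AE_I2 allI \<phi> L1 Lp_cmult uu32
        Lp_32_3_mult Lp_add q32 U3; simp add: nu U_def)
  qed
  text \<open>The first two coefficients come from \<open>- |u - u\<^sub>l|\<^sup>2 / 2 = - |u|\<^sup>2 / 2 + u \<cdot> u\<^sub>l - |u\<^sub>l|\<^sup>2 / 2\<close>; the
    others cancel what these balances leave over.\<close>
  have comb: "has_bochner_integral (slab T) (\<lambda>z.
      (uv z * pd_t \<phi> z + uv z * u\<phi> z + q z * v\<phi> z + a1 z * \<phi> z
      + q z * dv z * \<phi> z + \<nu> * (uv z * \<phi>L z + 2 * w1 z + w3 z * \<phi> z) - r1 z * \<phi> z + \<nu> * (w3 z * \<phi> z))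
      - (1/2) * (vv z * pd_t \<phi> z - 2 * r2 z * \<phi> z + 2 * \<nu> * w4 z * \<phi> z)
      - (1/2) * (2 * a2 z * \<phi> z + vv z * u\<phi> z) + (uP z * \<phi> z + P z * u\<phi> z)
      - (dv z * P z * \<phi> z + vP z * \<phi> z + P z * v\<phi> z)
      - 2 * (\<nu> * (w6 z * \<phi> z + w3 z * \<phi> z + w1 z))
      - (\<nu> / 2) * (2 * w2 z + vv z * \<phi>L z) + \<nu> * (w4 z * \<phi> z + w5 z * \<phi> z + w2 z))
      (0 - (1/2) * 0 - (1/2) * 0 + 0 - 0 - 2 * 0 - (\<nu> / 2) * 0 + \<nu> * 0)"
    by (intro has_bochner_integral_add has_bochner_integral_diff has_bochner_integral_mult_right
        HA HB HD4 HD5 HD6 HD7 HD8a HD8b)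
  note d = has_bochner_integral_diff[OF has_bochner_integral_diff[OF RHS LHS] comb]
  \<comment> \<open>Transport of \<open>e\<close> by the mollified field and the flux of
    \<open>e\<close> along \<open>u\<close> minus that field add up to transport of \<open>e\<close>
    by \<open>u\<close>, which is what the balances contain. Terms with \<open>dv\<close> carry the
    factor \<open>\<phi>\<close> and vanish; \<open>r1\<close> and \<open>r2\<close> split as in
    \<open>AE_r\<close>; the rest is arithmetic.\<close>
  have "AE z in slab T. (- (e z * pd_t \<phi> z) + (\<Sum>j\<in>UNIV. - (e z * V j z * pd_x j \<phi> z))
      - \<nu> * (\<Sum>j\<in>UNIV. e z * pd_x j (pd_x j \<phi>) z)
      + (\<Sum>j\<in>UNIV. - ((e z + (q z - P z)) * (U j z - V j z) * pd_x j \<phi> z))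
      + c z * \<phi> z + \<nu> * (w5 z * \<phi> z) - 2 * (\<nu> * (w6 z * \<phi> z)))
      - (- ((1/2) * uu z * pd_t \<phi> z)
      - \<nu> * (\<Sum>j\<in>UNIV. (1/2) * uu z * pd_x j (pd_x j \<phi>) z)
      + (\<Sum>j\<in>UNIV. - (((1/2) * uu z + q z) * U j z * pd_x j \<phi> z)))
      - ((uv z * pd_t \<phi> z + uv z * u\<phi> z + q z * v\<phi> z + a1 z * \<phi> z
      + q z * dv z * \<phi> z + \<nu> * (uv z * \<phi>L z + 2 * w1 z + w3 z * \<phi> z) - r1 z * \<phi> z + \<nu> * (w3 z * \<phi> z))
      - (1/2) * (vv z * pd_t \<phi> z - 2 * r2 z * \<phi> z + 2 * \<nu> * w4 z * \<phi> z)
      - (1/2) * (2 * a2 z * \<phi> z + vv z * u\<phi> z) + (uP z * \<phi> z + P z * u\<phi> z)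
      - (dv z * P z * \<phi> z + vP z * \<phi> z + P z * v\<phi> z)
      - 2 * (\<nu> * (w6 z * \<phi> z + w3 z * \<phi> z + w1 z))
      - (\<nu> / 2) * (2 * w2 z + vv z * \<phi>L z) + \<nu> * (w4 z * \<phi> z + w5 z * \<phi> z + w2 z)) = 0"
    using AE_dv AE_r
  proof eventually_elim
    case (elim z)
    have 1: "(\<Sum>j\<in>UNIV. - (e z * V j z * pd_x j \<phi> z)) = - (e z * v\<phi> z)"
      by (simp add: v\<phi>_def sum_negf sum_distrib_left mult_ac)
    have 2: "(\<Sum>j\<in>UNIV. b * pd_x j (pd_x j \<phi>) z) = b * \<phi>L z" for b
      by (simp add: \<phi>L_def sum_distrib_left)
    have 3: "(\<Sum>j\<in>UNIV. - (b * (U j z - V j z) * pd_x j \<phi> z)) = - (b * (u\<phi> z - v\<phi> z))" for b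
      by (simp add: u\<phi>_def v\<phi>_def sum_negf sum_distrib_left sum_subtractf algebra_simps)
    have 4: "(\<Sum>j\<in>UNIV. - (b * U j z * pd_x j \<phi> z)) = - (b * u\<phi> z)" for b
      by (simp add: u\<phi>_def sum_negf sum_distrib_left mult_ac)
    have x: "x * dv z * \<phi> z = 0" for x using elim(1) by auto
    have y: "dv z * P z * \<phi> z = 0" using elim(1) by auto
    have c: "c z * \<phi> z = (- s1 z + s2 z + a1 z - a2 z) * \<phi> z"
      using x[of "uv z - vv z"] by (simp add: c_def algebra_simps)
    show ?case
      unfolding 1 2 3 4 x y c using elim(2) unfolding e_def by (simp add: field_simps)
  qed
  from integral_eq_zero_AE[OF this] has_bochner_integral_integral_eq[OF d]
  have "rhs = - total_dissipation T \<nu> u q G \<phi>" by simp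
  then show "- total_dissipation T \<nu> u q G \<phi> =
      D_t (reg T (E_fluct \<rho> l u)) \<phi>
      + D_div T (\<lambda>z. E_fluct \<rho> l u z *\<^sub>R mollify \<rho> l u z) \<phi>
      - \<nu> * D_laplace (reg T (E_fluct \<rho> l u)) \<phi>
      + D_div T (Q_flux \<rho> l u q) \<phi>
      + reg T (C_comm \<rho> l u) \<phi>
      + \<nu> * reg T (\<lambda>z. (norm (grad_x (mollify \<rho> l u) z))\<^sup>2) \<phi>
      - 2 * \<nu> * reg T (\<lambda>z. G z \<bullet> grad_x (mollify \<rho> l u) z) \<phi>"
    unfolding rhs_def by (simp only: mult.assoc)
qed

end
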